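(* Let $S=Z(f)$ be an irreducible semi-stable $(2,2)$-type surface of $\mathbb{P}^1\times\mathbb{P}^2$. Then $S$ is strictly semi-stable if and only if $S$ satisfies at least one of the following conditions: (i) There is some section $\sigma:\mathbb{P}^1\to S$ of $p_1$ with $p_2(\sigma(\mathbb{P}^1))=P_2$ a point of $\mathbb{P}^2$, such that $\phi_\sigma:\mathbb{P}^1\to\mathbb{P}(T_{\mathbb{P}^2,P_2})$ is a constant map. (ii) The map $p_2$ is not finite at some $P\in S_{\text{sing}}$, where $P$ is not an $A_1$-type singularity. (iii) There is a point $P=P_1\times P_2\in S_{\text{sing}}$ which is not of $A_1$-type and such that the fibre of $p_1$ over $P_1$ is non-reduced.
   Context: Work over $\mathbb{C}$. A $(2,2)$-type surface is an effective divisor $S=Z(f)$ of $\mathbb{P}^1\times\mathbb{P}^2$, where $0\neq f\in V=\mathbb{C}[x_0,x_1]_2\otimes\mathbb{C}[y_0,y_1,y_2]_2$; it is irreducible if $f$ is irreducible. $p_1:S\to\mathbb{P}^1$, $p_2:S\to\mathbb{P}^2$ are the restrictions of the projections; the fibres of $p_1$ are regarded as conics in $\mathbb{P}^2$. $S_{\text{sing}}$ is the singular locus of $S$. Stability: $G=\mathrm{SL}(2,\mathbb{C})\times\mathrm{SL}(3,\mathbb{C})$ acts linearly on $V$. $S=Z(f)$ is semi-stable if $0\notin\overline{G\cdot f}$; stable (properly stable) if $G\cdot f$ is closed in $V$ and the stabilizer of $f$ is finite; strictly semi-stable if it is semi-stable but not stable. Equivalently (Hilbert–Mumford), $S$ is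 not semi-stable (resp. not stable) iff for some non-trivial one-parameter subgroup $\lambda$ of $G$ one has $\lim_{t\to0}\lambda(t)\cdot f=0$ (resp. $\lim_{t\to0}\lambda(t)\cdot f$ exists). A point $P\in S$ is an $A_n$-type singularity if $\widehat{\mathcal{O}}_{S,P}\cong\mathbb{C}[[x,y,z]]/(x^2+y^2+z^{n+1})$. The map $\phi_\sigma$: $p_2$ is not finite at $P=P_1\times P_2\in S$ exactly when $\mathbb{P}^1\times P_2\subset S$; then $\sigma:\mathbb{P}^1\to\mathbb{P}^1\times P_2\subset S$ is a section of $p_1$ contracted by $p_2$ to $P_2$, and every conic $p_2(p_1^{-1}(Q))$, $Q\in\mathbb{P}^1$, passes through $P_2$. If $\sigma(\mathbb{P}^1)\not\subseteq S_{\text{sing}}$ (which is automatic when $S$ is semi-stable), the generic such conic is smooth at $P_2$, and $\phi_\sigma:\mathbb{P}^1\to\mathbb{P}(T_{\mathbb{P}^2,P_2})\simeq\mathbb{P}^1$ is the morphism extending the map which sends a general $Q$ to the tangent line at $P_2$ of the conic $p_2(p_1^{-1}(Q))$. *)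

theory Defs
  imports
    "HOL-Analysis.Analysis"
    "HOL-Library.Poly_Mapping"
    "HOL-Computational_Algebra.Formal_Power_Series"
    "HOL-Computational_Algebra.Fraction_Field"
    "HOL-Algebra.QuotRing"
    "HOL-Algebra.Ideal_Product"
begin

section \<open>Polynomials\<close>

type_synonym 'v mpol = "('v \<Rightarrow>\<^sub>0 nat) \<Rightarrow>\<^sub>0 complex"

definition Const :: "complex \<Rightarrow> 'v mpol" where
  "Const c = Poly_Mapping.single 0 c"

definition Var :: "'v \<Rightarrow> 'v mpol" where
  "Var v = Poly_Mapping.single (Poly_Mapping.single v 1) 1"

definition peval :: "(complex \<Rightarrow> 'r::comm_ring_1) \<Rightarrow> ('v \<Rightarrow> 'r) \<Rightarrow> 'v mpol \<Rightarrow> 'r" where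
  "peval \<iota> s f =
     (\<Sum>m\<in>Poly_Mapping.keys f. \<iota> (Poly_Mapping.lookup f m) *
        (\<Prod>v\<in>Poly_Mapping.keys m. s v ^ Poly_Mapping.lookup m v))"

definition partial :: "'v \<Rightarrow> 'v mpol \<Rightarrow> 'v mpol" where
  "partial v f =
     (\<Sum>m\<in>Poly_Mapping.keys f.
        Poly_Mapping.single (m - Poly_Mapping.single v 1)
          (of_nat (Poly_Mapping.lookup m v) * Poly_Mapping.lookup f m))"

definition homogeneous :: "nat \<Rightarrow> ('v::finite) mpol \<Rightarrow> bool" where
  "homogeneous d f \<longleftrightarrow>
     (\<forall>m\<in>Poly_Mapping.keys f. (\<Sum>v\<in>UNIV. Poly_Mapping.lookup m v) = d)"

text \<open>Coordinates on \<open>\<complex>\<^sup>2 \<times> \<complex>\<^sup>3\<close>: the indices of type \<^typ>\<open>2\<close> and \<^typ>\<open>3\<close> are those of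
  \<^typ>\<open>complex^2\<close> and \<^typ>\<open>complex^3\<close>. The linear order carries no meaning; it is what the library
  asks for in order to know that the polynomial ring is a domain.\<close>

datatype coord = X 2 | Y 3

instantiation coord :: linorder
begin

fun less_eq_coord :: "coord \<Rightarrow> coord \<Rightarrow> bool" where
  "less_eq_coord (X i) (X j) \<longleftrightarrow> i \<le> j"
| "less_eq_coord (X i) (Y j) \<longleftrightarrow> True"
| "less_eq_coord (Y i) (X j) \<longleftrightarrow> False"
| "less_eq_coord (Y i) (Y j) \<longleftrightarrow> i \<le> j"

definition less_coord :: "coord \<Rightarrow> coord \<Rightarrow> bool" where
  "less_coord a b \<longleftrightarrow> a \<le> b \<and> \<not> b \<le> a"

instance
proof
  fix a b c :: coord
  show "a < b \<longleftrightarrow> a \<le> b \<and> \<not> b \<le> a" by (simp add: less_coord_def)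
  show "a \<le> a" by (cases a) auto
  show "a \<le> b \<Longrightarrow> b \<le> c \<Longrightarrow> a \<le> c" by (cases a; cases b; cases c) auto
  show "a \<le> b \<Longrightarrow> b \<le> a \<Longrightarrow> a = b" by (cases a; cases b) auto
  show "a \<le> b \<or> b \<le> a" by (cases a; cases b) auto
qed

end

definition bihomogeneous :: "nat \<Rightarrow> nat \<Rightarrow> coord mpol \<Rightarrow> bool" where
  "bihomogeneous d e f \<longleftrightarrow>
     (\<forall>m\<in>Poly_Mapping.keys f. (\<Sum>i\<in>UNIV. Poly_Mapping.lookup m (X i)) = d \<and>
                 (\<Sum>j\<in>UNIV. Poly_Mapping.lookup m (Y j)) = e)"

definition forms22 :: "coord mpol set" where
  "forms22 = {f. bihomogeneous 2 2 f}"

definition ev :: "coord mpol \<Rightarrow> complex^2 \<Rightarrow> complex^3 \<Rightarrow> complex" where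
  "ev f p q = peval (\<lambda>c. c) (case_coord (($) p) (($) q)) f"


section \<open>Projective spaces\<close>

typedef (overloaded) 'n proj = "{range (\<lambda>c. c *s v) | v :: complex^'n. v \<noteq> 0}"
  by (auto intro!: exI[of _ "axis undefined 1"] simp: axis_eq_0_iff)

definition hcoords :: "'n::finite proj \<Rightarrow> (complex^'n) set" where
  "hcoords P = Rep_proj P - {0}"

text \<open>Every morphism between projective spaces is given by forms of one degree without a common
  zero.\<close>

definition proj_morphism :: "('n::finite proj \<Rightarrow> 'm::finite proj) \<Rightarrow> bool" where
  "proj_morphism \<phi> \<longleftrightarrow>
     (\<exists>d F. (\<forall>i. homogeneous d (F i)) \<and>
        (\<forall>P. \<forall>v\<in>hcoords P. (\<chi> i. peval (\<lambda>c. c) (($) v) (F i)) \<in> hcoords (\<phi> P)))"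


section \<open>The surface, its singular locus and its fibres\<close>

definition surface :: "coord mpol \<Rightarrow> (2 proj \<times> 3 proj) set" where
  "surface f = {(P, Q). \<forall>p\<in>hcoords P. \<forall>q\<in>hcoords Q. ev f p q = 0}"

definition sing :: "coord mpol \<Rightarrow> (2 proj \<times> 3 proj) set" where
  "sing f = {(P, Q) \<in> surface f.
     \<forall>p\<in>hcoords P. \<forall>q\<in>hcoords Q. \<forall>v. ev (partial v f) p q = 0}"

definition fibre_form :: "coord mpol \<Rightarrow> complex^2 \<Rightarrow> 3 mpol" where
  "fibre_form f p = peval Const (case_coord (\<lambda>i. Const (p $ i)) Var) f"

text \<open>The fibre of \<open>p\<^sub>1\<close> over \<open>P\<close> is the plane curve with homogeneous coordinate ring
  \<open>\<complex>[y\<^sub>0,y\<^sub>1,y\<^sub>2]/(f(P,y))\<close>; the condition says that this ring has a nonzero nilpotent.\<close>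

definition fibre_nonreduced :: "coord mpol \<Rightarrow> 2 proj \<Rightarrow> bool" where
  "fibre_nonreduced f P \<longleftrightarrow>
     (\<forall>p\<in>hcoords P. \<exists>g n. fibre_form f p dvd g ^ n \<and> \<not> fibre_form f p dvd g)"

text \<open>The locus where the projection \<open>p\<^sub>2\<close> to the plane is not finite.\<close>

definition p2_nonfinite :: "coord mpol \<Rightarrow> (2 proj \<times> 3 proj) set" where
  "p2_nonfinite f = {P \<in> surface f. UNIV \<times> {snd P} \<subseteq> surface f}"


section \<open>Stability\<close>

definition SL :: "(complex^'n^'n) set" where
  "SL = {A. det A = 1}"

text \<open>The group acts on linear forms by \<open>x\<^sub>j \<mapsto> \<Sum>\<^sub>i g\<^sub>i\<^sub>j x\<^sub>i\<close>, the standard representation with basis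
  the variables. This is a left action; replacing \<open>g\<close> by its inverse transpose turns it into
  \<open>f \<mapsto> f \<circ> g\<^sup>-\<^sup>1\<close>, with the same orbits.\<close>

definition act :: "(complex^2^2) \<times> (complex^3^3) \<Rightarrow> coord mpol \<Rightarrow> coord mpol" where
  "act \<gamma> f = peval Const
     (case_coord (\<lambda>j. \<Sum>i\<in>UNIV. Const (fst \<gamma> $ i $ j) * Var (X i))
                 (\<lambda>j. \<Sum>i\<in>UNIV. Const (snd \<gamma> $ i $ j) * Var (Y i))) f"

text \<open>Orbits are viewed through the coefficients, in the product topology. On the finite-dimensional
  \<^const>\<open>forms22\<close>, which is closed there, this is the usual complex topology.\<close>

definition orbit_coeffs :: "coord mpol \<Rightarrow> ((coord \<Rightarrow>\<^sub>0 nat) \<Rightarrow> complex) set" where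
  "orbit_coeffs f = (\<lambda>\<gamma>. Poly_Mapping.lookup (act \<gamma> f)) ` (SL \<times> SL)"

definition semistable :: "coord mpol \<Rightarrow> bool" where
  "semistable f \<longleftrightarrow> Poly_Mapping.lookup 0 \<notin> closure (orbit_coeffs f)"

definition stable :: "coord mpol \<Rightarrow> bool" where
  "stable f \<longleftrightarrow> closed (orbit_coeffs f) \<and> finite {\<gamma> \<in> SL \<times> SL. act \<gamma> f = f}"

definition strictly_semistable :: "coord mpol \<Rightarrow> bool" where
  "strictly_semistable f \<longleftrightarrow> semistable f \<and> \<not> stable f"


section \<open>Sections of the first projection and the map \<open>\<phi>\<^sub>\<sigma>\<close>\<close>

definition is_section :: "coord mpol \<Rightarrow> (2 proj \<Rightarrow> 2 proj \<times> 3 proj) \<Rightarrow> bool" where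
  "is_section f \<sigma> \<longleftrightarrow> proj_morphism (fst \<circ> \<sigma>) \<and> proj_morphism (snd \<circ> \<sigma>) \<and>
     range \<sigma> \<subseteq> surface f \<and> fst \<circ> \<sigma> = id"

text \<open>Lines of the plane are points of the dual plane, given by the coefficients of an equation.
  A conic through \<open>P\<close> is smooth at \<open>P\<close> iff the gradient of its equation at \<open>P\<close> is nonzero, and
  the gradient is then the tangent line; \<open>tangent_line f Q P L\<close> includes this smoothness.\<close>

definition gradY :: "coord mpol \<Rightarrow> complex^2 \<Rightarrow> complex^3 \<Rightarrow> complex^3" where
  "gradY f p q = (\<chi> j. ev (partial (Y j) f) p q)"

definition tangent_line :: "coord mpol \<Rightarrow> 2 proj \<Rightarrow> 3 proj \<Rightarrow> 3 proj \<Rightarrow> bool" where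
  "tangent_line f Q P L \<longleftrightarrow> (Q, P) \<in> surface f \<and>
     (\<forall>p\<in>hcoords Q. \<forall>q\<in>hcoords P. gradY f p q \<in> hcoords L)"

text \<open>\<open>\<P>(T\<^sub>P)\<close> is the pencil of lines through \<open>P\<close>.\<close>

definition pencil :: "3 proj \<Rightarrow> 3 proj set" where
  "pencil P = {L. \<forall>l\<in>hcoords L. \<forall>q\<in>hcoords P. (\<Sum>i\<in>UNIV. l $ i * q $ i) = 0}"

text \<open>A morphism on the projective line is determined by its values at all but finitely many
  points, so at most one \<open>\<phi>\<close> satisfies this.\<close>

definition is_phi :: "coord mpol \<Rightarrow> 3 proj \<Rightarrow> (2 proj \<Rightarrow> 3 proj) \<Rightarrow> bool" where
  "is_phi f P \<phi> \<longleftrightarrow> proj_morphism \<phi> \<and> range \<phi> \<subseteq> pencil P \<and>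
     finite {Q. \<not> tangent_line f Q P (\<phi> Q)}"


section \<open>Completed local rings and singularities of type \<open>A\<^sub>n\<close>\<close>

definition ring_on :: "'a::comm_ring_1 set \<Rightarrow> 'a ring" where
  "ring_on A = \<lparr>carrier = A, monoid.mult = (*), one = 1, ring.zero = 0, add = (+)\<rparr>"

definition ambient_local_ring :: "2 proj \<times> 3 proj \<Rightarrow> coord mpol fract ring" where
  "ambient_local_ring P = ring_on {Fract g h | g h.
     (\<exists>d e. bihomogeneous d e g \<and> bihomogeneous d e h) \<and>
     (\<forall>p\<in>hcoords (fst P). \<forall>q\<in>hcoords (snd P). ev h p q \<noteq> 0)}"

definition local_ideal :: "coord mpol \<Rightarrow> 2 proj \<times> 3 proj \<Rightarrow> coord mpol fract set" where
  "local_ideal f P = {Fract g h | g h.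
     (\<exists>d e. bihomogeneous d e g \<and> bihomogeneous d e h) \<and>
     (\<forall>p\<in>hcoords (fst P). \<forall>q\<in>hcoords (snd P). ev h p q \<noteq> 0) \<and> f dvd g}"

definition local_ring :: "coord mpol \<Rightarrow> 2 proj \<times> 3 proj \<Rightarrow> coord mpol fract set ring" where
  "local_ring f P = ambient_local_ring P Quot local_ideal f P"

definition local_const ::
    "coord mpol \<Rightarrow> 2 proj \<times> 3 proj \<Rightarrow> complex \<Rightarrow> coord mpol fract set" where
  "local_const f P c = local_ideal f P +>\<^bsub>ambient_local_ring P\<^esub> Fract (Const c) 1"

text \<open>For a local ring \<open>R\<close>, the powers of the maximal ideal (the set of nonunits), and
  the inverse limit of the rings \<open>R/\<mm>\<^sup>n\<close>. A coset of \<open>\<mm>\<^sup>n\<^sup>+\<^sup>1\<close> is mapped to the coset of \<open>\<mm>\<^sup>n\<close> that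
  contains it, whence the condition \<open>s (Suc n) \<subseteq> s n\<close>.\<close>

fun max_power :: "'a ring \<Rightarrow> nat \<Rightarrow> 'a set" where
  "max_power R 0 = carrier R"
| "max_power R (Suc n) = ideal_prod R (max_power R n) (carrier R - Units R)"

definition completion :: "'a ring \<Rightarrow> (nat \<Rightarrow> 'a set) ring" where
  "completion R =
     \<lparr>carrier = {s. \<forall>n. s n \<in> carrier (R Quot max_power R n) \<and> s (Suc n) \<subseteq> s n},
      monoid.mult = (\<lambda>s t n. s n \<otimes>\<^bsub>R Quot max_power R n\<^esub> t n),
      one = (\<lambda>n. \<one>\<^bsub>R Quot max_power R n\<^esub>),
      ring.zero = (\<lambda>n. \<zero>\<^bsub>R Quot max_power R n\<^esub>),
      add = (\<lambda>s t n. s n \<oplus>\<^bsub>R Quot max_power R n\<^esub> t n)\<rparr>"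

definition completion_map :: "'a ring \<Rightarrow> 'a \<Rightarrow> nat \<Rightarrow> 'a set" where
  "completion_map R a = (\<lambda>n. max_power R n +>\<^bsub>R\<^esub> a)"

text \<open>\<open>\<complex>[[x,y,z]]\<close> as the iterated power series ring \<open>\<complex>[[x]][[y]][[z]]\<close>.\<close>

type_synonym fps3 = "complex fps fps fps"

definition An_equation :: "nat \<Rightarrow> fps3" where
  "An_equation n =
     fps_const (fps_const fps_X) ^ 2 + fps_const fps_X ^ 2 + fps_X ^ (n + 1)"

definition An_ring :: "nat \<Rightarrow> fps3 set ring" where
  "An_ring n = ring_on UNIV Quot (PIdl\<^bsub>ring_on UNIV\<^esub> An_equation n)"

definition An_const :: "nat \<Rightarrow> complex \<Rightarrow> fps3 set" where
  "An_const n c = PIdl\<^bsub>ring_on UNIV\<^esub> An_equation n +>\<^bsub>ring_on UNIV\<^esub>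
     fps_const (fps_const (fps_const c))"

definition An_type :: "nat \<Rightarrow> coord mpol \<Rightarrow> 2 proj \<times> 3 proj \<Rightarrow> bool" where
  "An_type n f P \<longleftrightarrow> P \<in> surface f \<and>
     (\<exists>h \<in> ring_iso (completion (local_ring f P)) (An_ring n).
        \<forall>c. h (completion_map (local_ring f P) (local_const f P c)) = An_const n c)"

end

theory Submission
  imports Defs "HOL-Computational_Algebra.Fundamental_Theorem_Algebra"
begin

text \<open>By the Hilbert--Mumford criterion \<open>f\<close> is not stable iff, in suitable bases of \<open>\<complex>\<^sup>2\<close> and \<open>\<complex>\<^sup>3\<close> with real
  weights that sum to zero and do not all vanish, all coefficients of \<open>f\<close> of positive total weight are
  zero. After sorting the weights there are three patterns of vanishing coefficients. In the first, all
  conics pass through one point with one common tangent line; in the other two the Hessian of \<open>f\<close> in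
  local coordinates degenerates at the point given by the first basis vectors, and this means that
  the point is singular but not of type \<open>A\<^sub>1\<close>, by a formal Morse lemma. Conversely, each of the conditions
  produces bases in which explicit integral weights destabilise \<open>f\<close>.

  The criterion itself is obtained as follows. If the orbit map is not proper, complete pivoting turns an unbounded
  sequence in the group into unbounded diagonal matrices up to bounded factors, and the growth rates
  of the pivots are weights. If it is proper, the orbit is closed and the stabiliser compact; if the
  stabiliser is infinite, it has elements arbitrarily close to the identity, these are power-bounded and so
  diagonalisable, and the logarithms of their eigenvalues are weights.\<close>

section \<open>Evaluation of polynomials\<close>

text \<open>The obstacle is that type \<open>A\<^sub>1\<close> speaks of completed local rings,
  stability of orbit closures and non-reducedness of nilpotents. All three are translated into the
  vanishing of entries of one array \<open>tact (A, B) c\<close>, the values of the polarized form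
  \<open>Phi\<close> on the rows of two bases. For weights \<alpha>, -\<alpha> and x \<ge> y \<ge> z
  with sum zero, the three patterns are: \<alpha> = 0 or x + y > 2\<alpha>; else x \<le> \<alpha>,
  where the conic over the point is a double line; else x > \<alpha>, where the surface contains the
  whole line contracted to the point. In the last two, after a suitable choice of the second basis
  vector of the plane, the determinant of the quadratic part is a single monomial in the entries.
  Its vanishing therefore yields one more zero entry, and this is what the converse needs to find
  weights. Semi-stability excludes a common point at which every conic is singular; irreducibility
  excludes a fibre that is the whole plane.\<close>

definition ring_morph :: "('a::comm_ring_1 \<Rightarrow> 'b::comm_ring_1) \<Rightarrow> bool" where
  "ring_morph h \<longleftrightarrow> h 1 = 1 \<and> (\<forall>a b. h (a + b) = h a + h b) \<and> (\<forall>a b. h (a * b) = h a * h b)"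

lemma ring_morphD:
  assumes "ring_morph h"
  shows "h 1 = 1" "h (a + b) = h a + h b" "h (a * b) = h a * h b" "h 0 = 0" "h (- a) = - h a"
    "h (a - b) = h a - h b" "h (a ^ n) = h a ^ n"
proof -
  show 1: "h 1 = 1" and add: "h (a + b) = h a + h b" and mult: "h (a * b) = h a * h b" for a b
    using assms by (auto simp: ring_morph_def)
  have "h 0 + h 0 = h 0" using add[of 0 0] by simp
  then show 0: "h 0 = 0" by simp
  have "h (- a) + h a = 0" for a using add[of "- a" a] 0 by simp
  then show neg: "h (- a) = - h a" for a by (simp add: eq_neg_iff_add_eq_0)
  show "h (a - b) = h a - h b" using add[of a "- b"] neg[of b] by simp
  show "h (a ^ n) = h a ^ n" by (induct n) (simp_all add: 1 mult)
qed

lemma ring_morph_sum: "ring_morph h \<Longrightarrow> h (sum g A) = (\<Sum>a\<in>A. h (g a))"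
  by (induct A rule: infinite_finite_induct) (simp_all add: ring_morphD)

lemma ring_morph_prod: "ring_morph h \<Longrightarrow> h (prod g A) = (\<Prod>a\<in>A. h (g a))"
  by (induct A rule: infinite_finite_induct) (simp_all add: ring_morphD)

lemma ring_morph_comp: "ring_morph g \<Longrightarrow> ring_morph h \<Longrightarrow> ring_morph (\<lambda>x. g (h x))"
  by (simp add: ring_morph_def)

definition mval :: "('v \<Rightarrow> 'r::comm_ring_1) \<Rightarrow> ('v \<Rightarrow>\<^sub>0 nat) \<Rightarrow> 'r" where
  "mval s m = (\<Prod>v\<in>Poly_Mapping.keys m. s v ^ Poly_Mapping.lookup m v)"

lemma mval_superset:
  assumes "finite A" "Poly_Mapping.keys m \<subseteq> A"
  shows "mval s m = (\<Prod>v\<in>A. s v ^ Poly_Mapping.lookup m v)"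
  unfolding mval_def
  by (rule prod.mono_neutral_left) (use assms in \<open>auto simp: in_keys_iff\<close>)

lemma mval_add: "mval s (m + n) = mval s m * mval s n"
proof -
  define A where "A = Poly_Mapping.keys m \<union> Poly_Mapping.keys n"
  have A: "finite A" "Poly_Mapping.keys m \<subseteq> A" "Poly_Mapping.keys n \<subseteq> A" "Poly_Mapping.keys (m + n) \<subseteq> A"
    using Poly_Mapping.keys_add[of m n] by (auto simp: A_def)
  show ?thesis
    unfolding mval_superset[OF A(1,2)] mval_superset[OF A(1,3)] mval_superset[OF A(1,4)]
    by (simp add: lookup_add power_add prod.distrib)
qed

lemma mval_0 [simp]: "mval s 0 = 1"
  by (simp add: mval_def)

lemma mval_single [simp]: "mval s (Poly_Mapping.single v n) = s v ^ n"
  by (cases "n = 0") (simp_all add: mval_def)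

lemma poly_mapping_decomp:
  fixes f :: "'a \<Rightarrow>\<^sub>0 'b::comm_monoid_add"
  shows "f = (\<Sum>m\<in>Poly_Mapping.keys f. Poly_Mapping.single m (Poly_Mapping.lookup f m))"
proof (rule poly_mapping_eqI)
  fix k
  show "Poly_Mapping.lookup f k = Poly_Mapping.lookup (\<Sum>m\<in>Poly_Mapping.keys f. Poly_Mapping.single m (Poly_Mapping.lookup f m)) k"
    by (cases "k \<in> Poly_Mapping.keys f")
       (auto simp: lookup_sum lookup_single when_def in_keys_iff cong: if_cong)
qed

lemma poly_mapping_additive_induct [case_names zero single add]:
  fixes f :: "'a \<Rightarrow>\<^sub>0 'b::comm_monoid_add"
  assumes "P 0" "\<And>m a. P (Poly_Mapping.single m a)" "\<And>f g. P f \<Longrightarrow> P g \<Longrightarrow> P (f + g)"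
  shows "P f"
proof -
  have "P (\<Sum>m\<in>A. Poly_Mapping.single m (Poly_Mapping.lookup f m))" if "finite A" for A
    using that by induct (simp_all add: assms)
  then show ?thesis using poly_mapping_decomp[of f] by (metis finite_keys)
qed

text \<open>Coefficients pass through a ring map \<iota>, since polynomials are evaluated in complex
  numbers, polynomials, power series and fractions alike; that \<open>peval\<close> is a
  homomorphism is proved once for all of them.\<close>

locale coeff_morph =
  fixes \<iota> :: "complex \<Rightarrow> 'r::comm_ring_1"
  assumes morph: "ring_morph \<iota>"
begin

lemmas morphD = ring_morphD[OF morph]

lemma peval_superset:
  assumes "finite A" "Poly_Mapping.keys f \<subseteq> A"
  shows "peval \<iota> s f = (\<Sum>m\<in>A. \<iota> (Poly_Mapping.lookup f m) * mval s m)"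
  unfolding peval_def mval_def[symmetric]
  by (rule sum.mono_neutral_left) (use assms in \<open>auto simp: in_keys_iff morphD\<close>)

lemma peval_single: "peval \<iota> s (Poly_Mapping.single m a) = \<iota> a * mval s m"
  by (subst peval_superset[of "{m}"]) auto

lemma peval_0 [simp]: "peval \<iota> s 0 = 0"
  by (simp add: peval_def)

lemma peval_add: "peval \<iota> s (f + g) = peval \<iota> s f + peval \<iota> s g"
proof -
  define A where "A = Poly_Mapping.keys f \<union> Poly_Mapping.keys g"
  have A: "finite A" "Poly_Mapping.keys f \<subseteq> A" "Poly_Mapping.keys g \<subseteq> A" "Poly_Mapping.keys (f + g) \<subseteq> A"
    using Poly_Mapping.keys_add[of f g] by (auto simp: A_def)
  show ?thesis
    unfolding peval_superset[OF A(1,2)] peval_superset[OF A(1,3)] peval_superset[OF A(1,4)]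
    by (simp add: lookup_add morphD sum.distrib distrib_right)
qed

lemma peval_mult: "peval \<iota> s (f * g) = peval \<iota> s f * peval \<iota> s g"
proof (induct f rule: poly_mapping_additive_induct)
  case (single m a)
  show ?case
    by (induct g rule: poly_mapping_additive_induct)
       (simp_all add: mult_single peval_single morphD mval_add peval_add algebra_simps)
qed (simp_all add: distrib_right peval_add)

lemma peval_morph: "ring_morph (peval \<iota> s)"
  using peval_single[of s 0 1]
  by (simp add: ring_morph_def peval_add peval_mult morphD)

lemmas peval_simps = ring_morphD[OF peval_morph] ring_morph_sum[OF peval_morph]
  ring_morph_prod[OF peval_morph]

lemma peval_Const [simp]: "peval \<iota> s (Const c) = \<iota> c"
  by (simp add: Const_def peval_single)

lemma peval_Var [simp]: "peval \<iota> s (Var v) = s v"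
  by (simp add: Var_def peval_single morphD)

end

lemma ring_morph_Const: "ring_morph (Const :: complex \<Rightarrow> 'v mpol)"
  by (simp add: ring_morph_def Const_def single_add mult_single)

lemmas Const_simps = ring_morphD[OF ring_morph_Const] ring_morph_sum[OF ring_morph_Const]

interpretation ev: coeff_morph "\<lambda>c. c"
  by standard (simp add: ring_morph_def)

interpretation cst: coeff_morph "Const :: complex \<Rightarrow> 'v mpol"
  by standard (rule ring_morph_Const)

lemma single_eq_Const_mval: "Poly_Mapping.single m a = Const a * mval Var m"
proof -
  have "mval Var m = Poly_Mapping.single m (1::complex)" for m :: "'a \<Rightarrow>\<^sub>0 nat"
  proof (induct m rule: poly_mapping_additive_induct)
    case (single v n)
    have "Var v ^ n = Poly_Mapping.single (Poly_Mapping.single v n) 1" for n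
      by (induct n) (simp_all add: Var_def mult_single single_add[symmetric])
    then show ?case by simp
  next
    case (add f g)
    then show ?case by (simp add: mval_add mult_single)
  qed simp
  then show ?thesis by (simp add: Const_def mult_single)
qed

text \<open>Constants and variables generate the polynomial ring, so a property stable under sums
  and products spreads from them.\<close>

lemma mpol_induct [case_names Const Var add mult]:
  fixes f :: "'v mpol"
  assumes "\<And>c. P (Const c)" "\<And>v. P (Var v)" "\<And>f g. P f \<Longrightarrow> P g \<Longrightarrow> P (f + g)"
    "\<And>f g. P f \<Longrightarrow> P g \<Longrightarrow> P (f * g)"
  shows "P f"
proof (induct f rule: poly_mapping_additive_induct)
  case zero
  show ?case using assms(1)[of 0] by (simp add: Const_def)
next
  case (single m a)
  have one: "P 1" using assms(1)[of 1] by (simp add: Const_def)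
  have pow: "P (f ^ n)" if "P f" for f n
    by (induct n) (simp_all add: one assms(4) that)
  have "P (\<Prod>v\<in>A. Var v ^ Poly_Mapping.lookup m v)" if "finite A" for A
    using that by induct (simp_all add: assms pow one)
  then have "P (mval Var m)" by (simp add: mval_def)
  then show ?case by (simp add: single_eq_Const_mval assms)
qed (simp add: assms)

text \<open>Evaluation is natural: a ring map may be moved inside. This later gives the constant
  term of an expansion, the values of a fibre form and the passage to fractions.\<close>

lemma morph_peval:
  assumes "ring_morph h" "coeff_morph \<iota>"
  shows "h (peval \<iota> s f) = peval (\<lambda>c. h (\<iota> c)) (\<lambda>v. h (s v)) f"
proof -
  interpret coeff_morph \<iota> by fact
  interpret h: coeff_morph "\<lambda>c. h (\<iota> c)"
    by standard (rule ring_morph_comp[OF assms(1) morph])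
  show ?thesis
    by (induct f rule: mpol_induct)
       (simp_all add: ring_morphD[OF assms(1)] peval_simps h.peval_simps)
qed

lemma peval_cong: "(\<And>v. s v = t v) \<Longrightarrow> peval \<iota> s f = peval \<iota> t f"
  by (simp add: peval_def)

lemma peval_self: "peval Const Var f = f"
  by (induct f rule: mpol_induct) (simp_all add: cst.peval_simps)

section \<open>Partial derivatives\<close>

lemma partial_superset:
  assumes "finite A" "Poly_Mapping.keys f \<subseteq> A"
  shows "partial v f = (\<Sum>m\<in>A. Poly_Mapping.single (m - Poly_Mapping.single v 1)
          (of_nat (Poly_Mapping.lookup m v) * Poly_Mapping.lookup f m))"
  unfolding partial_def
  by (rule sum.mono_neutral_left) (use assms in \<open>auto simp: in_keys_iff\<close>)

lemma partial_single: "partial v (Poly_Mapping.single m a) =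
    Poly_Mapping.single (m - Poly_Mapping.single v 1) (of_nat (Poly_Mapping.lookup m v) * a)"
  by (subst partial_superset[of "{m}"]) auto

lemma partial_0 [simp]: "partial v 0 = 0"
  by (simp add: partial_def)

lemma partial_add: "partial v (f + g) = partial v f + partial v g"
proof -
  define A where "A = Poly_Mapping.keys f \<union> Poly_Mapping.keys g"
  have A: "finite A" "Poly_Mapping.keys f \<subseteq> A" "Poly_Mapping.keys g \<subseteq> A" "Poly_Mapping.keys (f + g) \<subseteq> A"
    using Poly_Mapping.keys_add[of f g] by (auto simp: A_def)
  show ?thesis
    unfolding partial_superset[OF A(1,2)] partial_superset[OF A(1,3)] partial_superset[OF A(1,4)]
    by (simp add: lookup_add sum.distrib[symmetric] distrib_left single_add)
qed

lemma partial_mult: "partial v (f * g) = partial v f * g + f * partial v g"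
proof (induct f rule: poly_mapping_additive_induct)
  case (single m a)
  show ?case
  proof (induct g rule: poly_mapping_additive_induct)
    case (single n b)
    let ?e = "Poly_Mapping.single v (1::nat)"
    \<comment> \<open>Subtraction of exponents is truncated at zero. It commutes with the addition
      of exponents only if \<open>v\<close> occurs; otherwise the coefficient in front is
      zero.\<close>
    have shift: "m' - ?e + n' = m' + n' - ?e" if "Poly_Mapping.lookup m' v \<noteq> 0" for m' n' :: "'a \<Rightarrow>\<^sub>0 nat"
      by (rule poly_mapping_eqI) (use that in \<open>auto simp: lookup_add lookup_minus lookup_single when_def\<close>)
    have 1: "Poly_Mapping.single (m - ?e + n) (of_nat (Poly_Mapping.lookup m v) * a * b)
        = Poly_Mapping.single (m + n - ?e) (of_nat (Poly_Mapping.lookup m v) * a * b)"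
      using shift[of m n] by (cases "Poly_Mapping.lookup m v = 0") auto
    have 2: "Poly_Mapping.single (m + (n - ?e)) (a * (of_nat (Poly_Mapping.lookup n v) * b))
        = Poly_Mapping.single (m + n - ?e) (a * (of_nat (Poly_Mapping.lookup n v) * b))"
      using shift[of n m] by (cases "Poly_Mapping.lookup n v = 0") (auto simp: add.commute)
    show ?case
      unfolding mult_single partial_single 1 2 single_add[symmetric]
      by (simp add: lookup_add algebra_simps)
  qed (simp_all add: distrib_left partial_add algebra_simps)
qed (simp_all add: distrib_right partial_add algebra_simps)

lemma partial_Const [simp]: "partial v (Const c) = 0"
  by (simp add: Const_def partial_single)

lemma partial_Var: "partial v (Var w) = (if v = w then 1 else 0)"
  by (auto simp: Var_def partial_single lookup_single)

lemma partial_sum: "partial v (sum g A) = (\<Sum>a\<in>A. partial v (g a))"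
  by (induct A rule: infinite_finite_induct) (simp_all add: partial_add)

section \<open>Bihomogeneous forms\<close>

lemma UNIV_coord: "(UNIV :: coord set) = range X \<union> range Y"
  by (metis UNIV_eq_I UnCI coord.exhaust rangeI)

instance coord :: finite
  by standard (simp add: UNIV_coord)

lemma prod_coord: "(\<Prod>v\<in>UNIV. g (v::coord)) = (\<Prod>i\<in>UNIV. g (X i)) * (\<Prod>j\<in>UNIV. g (Y j))"
  unfolding UNIV_coord
  by (subst prod.union_disjoint) (auto simp: prod.reindex inj_def)

lemma mval_coord: "mval s m = (\<Prod>i\<in>UNIV. s (X i) ^ Poly_Mapping.lookup m (X i)) *
    (\<Prod>j\<in>UNIV. s (Y j) ^ Poly_Mapping.lookup m (Y j))"
  by (subst mval_superset[of UNIV]) (simp_all add: prod_coord)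

lemma bihomogeneous_0 [simp]: "bihomogeneous d e 0"
  by (simp add: bihomogeneous_def)

lemma bihomogeneous_add: "bihomogeneous d e f \<Longrightarrow> bihomogeneous d e g \<Longrightarrow> bihomogeneous d e (f + g)"
  using Poly_Mapping.keys_add[of f g] by (auto simp: bihomogeneous_def)

lemma bihomogeneous_mult:
  assumes "bihomogeneous d e f" "bihomogeneous d' e' g"
  shows "bihomogeneous (d + d') (e + e') (f * g)"
  unfolding bihomogeneous_def
proof
  fix m assume "m \<in> Poly_Mapping.keys (f * g)"
  then obtain a b where ab: "a \<in> Poly_Mapping.keys f" "b \<in> Poly_Mapping.keys g" "m = a + b"
    using Poly_Mapping.keys_mult[of f g] by blast
  then show "(\<Sum>i\<in>UNIV. Poly_Mapping.lookup m (X i)) = d + d' \<and> (\<Sum>j\<in>UNIV. Poly_Mapping.lookup m (Y j)) = e + e'"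
    using assms by (simp add: bihomogeneous_def lookup_add sum.distrib)
qed

lemma bihomogeneous_Const: "bihomogeneous 0 0 (Const c)"
  by (simp add: bihomogeneous_def Const_def)

lemma bihomogeneous_1: "bihomogeneous 0 0 1"
  by (simp add: bihomogeneous_def)

lemma bihomogeneous_VarX: "bihomogeneous 1 0 (Var (X i))"
  by (simp add: bihomogeneous_def Var_def lookup_single when_def if_distrib cong: if_cong)

lemma bihomogeneous_VarY: "bihomogeneous 0 1 (Var (Y j))"
  by (simp add: bihomogeneous_def Var_def lookup_single when_def if_distrib cong: if_cong)

lemma bihomogeneous_sum: "(\<And>a. a \<in> A \<Longrightarrow> bihomogeneous d e (g a)) \<Longrightarrow> bihomogeneous d e (sum g A)"
  by (induct A rule: infinite_finite_induct) (simp_all add: bihomogeneous_add)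

lemma bihomogeneous_power: "bihomogeneous d e f \<Longrightarrow> bihomogeneous (n * d) (n * e) (f ^ n)"
  by (induct n) (simp_all add: bihomogeneous_1 bihomogeneous_mult)

lemma bihomogeneous_uminus: "bihomogeneous d e f \<Longrightarrow> bihomogeneous d e (- f)"
  by (simp add: bihomogeneous_def in_keys_iff)

lemma (in coeff_morph) peval_bihomogeneous:
  assumes "bihomogeneous d e g"
  shows "peval \<iota> (case_coord (\<lambda>i. s * x i) (\<lambda>j. t * y j)) g = s ^ d * t ^ e * peval \<iota> (case_coord x y) g"
proof -
  have "mval (case_coord (\<lambda>i. s * x i) (\<lambda>j. t * y j)) m = s ^ d * t ^ e * mval (case_coord x y) m"
    if "m \<in> Poly_Mapping.keys g" for m
  proof -
    have "(\<Sum>i\<in>UNIV. Poly_Mapping.lookup m (X i)) = d" "(\<Sum>j\<in>UNIV. Poly_Mapping.lookup m (Y j)) = e"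
      using assms that by (auto simp: bihomogeneous_def)
    then show ?thesis
      by (simp add: mval_coord power_mult_distrib prod.distrib power_sum[symmetric] ac_simps)
  qed
  then show ?thesis
    by (simp add: peval_def mval_def[symmetric] sum_distrib_left ac_simps)
qed

lemma ev_scale:
  assumes "bihomogeneous d e g"
  shows "ev g (s *s p) (t *s q) = s ^ d * t ^ e * ev g p q"
proof -
  have "ev g (s *s p) (t *s q) = peval (\<lambda>c. c) (case_coord (\<lambda>i. s * p $ i) (\<lambda>j. t * q $ j)) g"
    unfolding ev_def by (rule peval_cong) (simp split: coord.split)
  then show ?thesis using ev.peval_bihomogeneous[OF assms] by (simp add: ev_def)
qed

section \<open>Forms of bidegree \<open>(2,2)\<close> as symmetric tensors\<close>

type_synonym tensor = "2 \<Rightarrow> 2 \<Rightarrow> 3 \<Rightarrow> 3 \<Rightarrow> complex"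

text \<open>The sum runs over ordered indices: for symmetric \<open>c\<close> the entries are
  coefficients divided by the number of orderings, that is, the polarization of the form.\<close>

definition tens :: "tensor \<Rightarrow> coord mpol" where
  "tens c = (\<Sum>i\<in>UNIV. \<Sum>j\<in>UNIV. \<Sum>k\<in>UNIV. \<Sum>l\<in>UNIV.
     Const (c i j k l) * (Var (X i) * Var (X j) * (Var (Y k) * Var (Y l))))"

definition tsym :: "tensor \<Rightarrow> bool" where
  "tsym c \<longleftrightarrow> (\<forall>i j k l. c i j k l = c j i k l \<and> c i j k l = c i j l k)"

text \<open>Generic in the ring of values: complex numbers give \<open>Phi\<close>, polynomials the
  group action, power series the expansion at a point.\<close>

definition tform :: "(complex \<Rightarrow> 'r::comm_ring_1) \<Rightarrow> tensor \<Rightarrow> (2 \<Rightarrow> 'r) \<Rightarrow> (2 \<Rightarrow> 'r) \<Rightarrow>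
    (3 \<Rightarrow> 'r) \<Rightarrow> (3 \<Rightarrow> 'r) \<Rightarrow> 'r" where
  "tform \<iota> c x x' y y' = (\<Sum>i\<in>UNIV. \<Sum>j\<in>UNIV. \<Sum>k\<in>UNIV. \<Sum>l\<in>UNIV.
     \<iota> (c i j k l) * (x i * x' j * (y k * y' l)))"

text \<open>The polarized form. On the diagonal it is the value of the form; with one argument
  replaced by a basis vector it is, for symmetric \<open>c\<close>, half a partial
  derivative.\<close>

definition Phi :: "tensor \<Rightarrow> complex^2 \<Rightarrow> complex^2 \<Rightarrow> complex^3 \<Rightarrow> complex^3 \<Rightarrow> complex" where
  "Phi c p p' q q' = tform (\<lambda>a. a) c (($) p) (($) p') (($) q) (($) q')"

text \<open>The coefficients in the bases formed by the rows of the two matrices. Conditions on the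
  surface become conditions on these entries once single rows are chosen suitably.\<close>

definition tact :: "(complex^2^2) \<times> (complex^3^3) \<Rightarrow> tensor \<Rightarrow> tensor" where
  "tact \<gamma> c = (\<lambda>i j k l. Phi c (fst \<gamma> $ i) (fst \<gamma> $ j) (snd \<gamma> $ k) (snd \<gamma> $ l))"

lemma (in coeff_morph) peval_tens:
  "peval \<iota> s (tens c) = tform \<iota> c (\<lambda>i. s (X i)) (\<lambda>i. s (X i)) (\<lambda>k. s (Y k)) (\<lambda>k. s (Y k))"
  by (simp add: tens_def tform_def peval_simps)

lemma ev_tens: "ev (tens c) p q = Phi c p p q q"
  by (simp add: ev_def ev.peval_tens Phi_def)

lemma Phi_linear:
  "Phi c (p + p1) p' q q' = Phi c p p' q q' + Phi c p1 p' q q'"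
  "Phi c p (p' + p1) q q' = Phi c p p' q q' + Phi c p p1 q q'"
  "Phi c p p' (q + q1) q' = Phi c p p' q q' + Phi c p p' q1 q'"
  "Phi c p p' q (q' + q1) = Phi c p p' q q' + Phi c p p' q q1"
  "Phi c (s *s p) p' q q' = s * Phi c p p' q q'"
  "Phi c p (s *s p') q q' = s * Phi c p p' q q'"
  "Phi c p p' (s *s q) q' = s * Phi c p p' q q'"
  "Phi c p p' q (s *s q') = s * Phi c p p' q q'"
  by (simp_all add: Phi_def tform_def distrib_left distrib_right sum.distrib sum_distrib_left ac_simps)

lemma Phi_zero [simp]:
  "Phi c 0 p' q q' = 0" "Phi c p 0 q q' = 0" "Phi c p p' 0 q' = 0" "Phi c p p' q 0 = 0"
  using Phi_linear(5-8)[where s = 0 and c = c] by (simp_all add: vector_smult_lzero)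

lemma Phi_sum:
  "Phi c (\<Sum>a\<in>A. f a) p' q q' = (\<Sum>a\<in>A. Phi c (f a) p' q q')"
  "Phi c p (\<Sum>a\<in>A. f a) q q' = (\<Sum>a\<in>A. Phi c p (f a) q q')"
  "Phi c p p' (\<Sum>a\<in>A. g a) q' = (\<Sum>a\<in>A. Phi c p p' (g a) q')"
  "Phi c p p' q (\<Sum>a\<in>A. g a) = (\<Sum>a\<in>A. Phi c p p' q (g a))"
  by (induct A rule: infinite_finite_induct) (simp_all add: Phi_linear)

lemma Phi_sum4: "Phi c (\<Sum>a\<in>A. f a) (\<Sum>a\<in>A'. f' a) (\<Sum>a\<in>B. g a) (\<Sum>a\<in>B'. g' a) =
    (\<Sum>a\<in>A. \<Sum>a'\<in>A'. \<Sum>b\<in>B. \<Sum>b'\<in>B'. Phi c (f a) (f' a') (g b) (g' b'))"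
  unfolding Phi_sum(1) unfolding Phi_sum(2) unfolding Phi_sum(3) unfolding Phi_sum(4) ..

lemma Phi_swap:
  assumes "tsym c"
  shows "Phi c p p' q q' = Phi c p' p q q'" "Phi c p p' q q' = Phi c p p' q' q"
proof -
  have "Phi c p p' q q' = (\<Sum>i\<in>UNIV. \<Sum>j\<in>UNIV. \<Sum>k\<in>UNIV. \<Sum>l\<in>UNIV. c j i k l * (p $ i * p' $ j * (q $ k * q' $ l)))"
    using assms by (simp add: Phi_def tform_def tsym_def)
  also have "\<dots> = Phi c p' p q q'"
    unfolding Phi_def tform_def by (subst sum.swap) (simp add: ac_simps)
  finally show "Phi c p p' q q' = Phi c p' p q q'" .
  have inner: "(\<Sum>k\<in>UNIV. \<Sum>l\<in>UNIV. c i j l k * (p $ i * p' $ j * (q $ k * q' $ l))) =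
      (\<Sum>k\<in>UNIV. \<Sum>l\<in>UNIV. c i j k l * (p $ i * p' $ j * (q' $ k * q $ l)))" for i j
    by (subst sum.swap) (simp add: ac_simps)
  have "Phi c p p' q q' = (\<Sum>i\<in>UNIV. \<Sum>j\<in>UNIV. \<Sum>k\<in>UNIV. \<Sum>l\<in>UNIV. c i j l k * (p $ i * p' $ j * (q $ k * q' $ l)))"
    using assms by (simp add: Phi_def tform_def tsym_def)
  also have "\<dots> = Phi c p p' q' q"
    unfolding Phi_def tform_def by (simp only: inner)
  finally show "Phi c p p' q q' = Phi c p p' q' q" .
qed

text \<open>Multilinear expansion, with the sums over old and new indices exchanged. As the values
  lie in any ring, it covers the group action, the local expansion and the equation of a
  fibre.\<close>

lemma (in coeff_morph) tform_basis:
  assumes x: "\<And>j. x j = (\<Sum>a\<in>UNIV. \<iota> (fst \<gamma> $ a $ j) * s a)" and y: "\<And>k. y k = (\<Sum>b\<in>UNIV. \<iota> (snd \<gamma> $ b $ k) * t b)"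
  shows "tform \<iota> c x x y y = tform \<iota> (tact \<gamma> c) s s t t"
proof -
  let ?P = "\<lambda>a j. \<iota> (fst \<gamma> $ a $ j)" and ?Q = "\<lambda>a j. \<iota> (snd \<gamma> $ a $ j)"
  have "tform \<iota> c x x y y = (\<Sum>i\<in>UNIV. \<Sum>j\<in>UNIV. \<Sum>k\<in>UNIV. \<Sum>l\<in>UNIV. \<Sum>a\<in>UNIV. \<Sum>b\<in>UNIV. \<Sum>m\<in>UNIV. \<Sum>n\<in>UNIV.
      \<iota> (c i j k l) * (?P a i * ?P b j * (?Q m k * ?Q n l)) * (s a * s b * (t m * t n)))"
    (is "_ = ?R")
  proof -
    have "\<iota> (c i j k l) * (x i * x j * (y k * y l)) = (\<Sum>a\<in>UNIV. \<Sum>b\<in>UNIV. \<Sum>m\<in>UNIV. \<Sum>n\<in>UNIV.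
      \<iota> (c i j k l) * (?P a i * ?P b j * (?Q m k * ?Q n l)) * (s a * s b * (t m * t n)))" for i j k l
    proof -
      have "\<iota> (c i j k l) * (x i * x j * (y k * y l)) = \<iota> (c i j k l) *
        ((\<Sum>a\<in>UNIV. \<Sum>b\<in>UNIV. (?P a i * s a) * (?P b j * s b)) * (\<Sum>m\<in>UNIV. \<Sum>n\<in>UNIV. (?Q m k * t m) * (?Q n l * t n)))"
        unfolding x y sum_product ..
      also have "\<dots> = (\<Sum>a\<in>UNIV. \<Sum>b\<in>UNIV. \<Sum>m\<in>UNIV. \<Sum>n\<in>UNIV.
         \<iota> (c i j k l) * (((?P a i * s a) * (?P b j * s b)) * ((?Q m k * t m) * (?Q n l * t n))))"
        unfolding sum_distrib_right unfolding sum_distrib_left ..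
      also have "\<dots> = (\<Sum>a\<in>UNIV. \<Sum>b\<in>UNIV. \<Sum>m\<in>UNIV. \<Sum>n\<in>UNIV.
         \<iota> (c i j k l) * (?P a i * ?P b j * (?Q m k * ?Q n l)) * (s a * s b * (t m * t n)))"
        by (intro sum.cong refl) (simp add: ac_simps)
      finally show ?thesis .
    qed
    then show ?thesis by (simp only: tform_def)
  qed
  also have "\<dots> = (\<Sum>(i,j,k,l)\<in>UNIV. \<Sum>(a,b,m,n)\<in>UNIV.
      \<iota> (c i j k l) * (?P a i * ?P b j * (?Q m k * ?Q n l)) * (s a * s b * (t m * t n)))"
    unfolding UNIV_Times_UNIV[symmetric] sum.cartesian_product[symmetric] by simp
  also have "\<dots> = (\<Sum>(a,b,m,n)\<in>UNIV. \<Sum>(i,j,k,l)\<in>UNIV.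
      \<iota> (c i j k l) * (?P a i * ?P b j * (?Q m k * ?Q n l)) * (s a * s b * (t m * t n)))"
    unfolding case_prod_unfold by (rule sum.swap)
  also have "\<dots> = tform \<iota> (tact \<gamma> c) s s t t"
    unfolding UNIV_Times_UNIV[symmetric] sum.cartesian_product[symmetric]
    by (simp add: tform_def tact_def Phi_def morphD ring_morph_sum[OF morph] sum_distrib_right)
  finally show ?thesis .
qed

lemma act_tens: "act \<gamma> (tens c) = tens (tact \<gamma> c)"
proof -
  have "act \<gamma> (tens c) = tform Const (tact \<gamma> c) (\<lambda>i. Var (X i)) (\<lambda>i. Var (X i)) (\<lambda>i. Var (Y i)) (\<lambda>i. Var (Y i))"
    unfolding act_def cst.peval_tens by (rule cst.tform_basis) simp_all
  also have "\<dots> = tens (tact \<gamma> c)"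
    by (simp add: tform_def tens_def)
  finally show ?thesis .
qed

lemma matrix_mult_row: "(A ** B) $ i = (\<Sum>k\<in>UNIV. A $ i $ k *s B $ k)"
  by (simp add: matrix_matrix_mult_def vec_eq_iff)

lemma tact_mult: "tact \<gamma> (tact \<gamma>' c) = tact (fst \<gamma> ** fst \<gamma>', snd \<gamma> ** snd \<gamma>') c"
proof (intro ext)
  fix i j k l
  show "tact \<gamma> (tact \<gamma>' c) i j k l = tact (fst \<gamma> ** fst \<gamma>', snd \<gamma> ** snd \<gamma>') c i j k l"
    by (simp add: tact_def matrix_mult_row Phi_sum4 Phi_linear)
       (simp add: Phi_def[of "\<lambda>i j k l. Phi c (fst \<gamma>' $ i) (fst \<gamma>' $ j) (snd \<gamma>' $ k) (snd \<gamma>' $ l)"] tform_def ac_simps)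
qed

lemma sum_axis: "(\<Sum>j\<in>UNIV. f j * axis i 1 $ j) = (f i :: 'a::comm_semiring_1)"
  by (simp add: axis_def if_distrib cong: if_cong)

lemma mat_row: "mat 1 $ i = axis i 1"
  by (simp add: mat_def axis_def vec_eq_iff)

lemma vector_matrix_mult_rows: "v v* A = (\<Sum>k\<in>UNIV. v $ k *s A $ k)"
  by (simp add: vector_matrix_mult_def vec_eq_iff ac_simps)

lemma Phi_axis: "Phi c (axis i 1) (axis j 1) (axis k 1) (axis l 1) = c i j k l"
proof -
  have "Phi c (axis i 1) (axis j 1) (axis k 1) (axis l 1) =
      (\<Sum>i'\<in>UNIV. (\<Sum>j'\<in>UNIV. (\<Sum>k'\<in>UNIV. (\<Sum>l'\<in>UNIV. c i' j' k' l' * axis l 1 $ l')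
       * axis k 1 $ k') * axis j 1 $ j') * axis i 1 $ i')"
    unfolding Phi_def tform_def sum_distrib_right by (simp add: ac_simps)
  then show ?thesis by (simp only: sum_axis)
qed

lemma tact_one: "tact (mat 1, mat 1) c = c"
  by (intro ext) (simp add: tact_def mat_row Phi_axis)

lemma tsym_tact: "tsym c \<Longrightarrow> tsym (tact \<gamma> c)"
  unfolding tsym_def tact_def by (meson Phi_swap tsym_def)

lemma Phi_tact: "Phi (tact \<gamma> c) p p' q q' = Phi c (p v* fst \<gamma>) (p' v* fst \<gamma>) (q v* snd \<gamma>) (q' v* snd \<gamma>)"
  by (simp add: vector_matrix_mult_rows Phi_sum4 Phi_linear Phi_def[of "tact \<gamma> c"] tform_def)
     (simp add: tact_def ac_simps)

subsection \<open>Coefficients\<close>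

definition mon :: "2 \<Rightarrow> 2 \<Rightarrow> 3 \<Rightarrow> 3 \<Rightarrow> coord \<Rightarrow>\<^sub>0 nat" where
  "mon i j k l = Poly_Mapping.single (X i) 1 + Poly_Mapping.single (X j) 1 +
     (Poly_Mapping.single (Y k) 1 + Poly_Mapping.single (Y l) 1)"

lemma mon_swap: "mon j i k l = mon i j k l" "mon i j l k = mon i j k l"
  by (simp_all add: mon_def ac_simps)

text \<open>An unordered pair is determined by its counting function; so a monomial determines its
  indices up to order.\<close>

lemma indicator_pair_eq:
  assumes "\<And>v. of_bool (i = v) + of_bool (j = v) = (of_bool (i' = v) + of_bool (j' = v) :: nat)"
  shows "i = i' \<and> j = j' \<or> i = j' \<and> j = i'"
proof (cases "i = i'")
  case True
  then show ?thesis using assms[of j] by (cases "j = j'") auto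
next
  case False
  then have "i = j'" using assms[of i] by (cases "i = j'") auto
  then show ?thesis using assms[of j] by (cases "j = i'") auto
qed

lemma mon_eq:
  assumes "mon i j k l = mon i' j' k' l'"
  shows "(i = i' \<and> j = j' \<or> i = j' \<and> j = i') \<and> (k = k' \<and> l = l' \<or> k = l' \<and> l = k')"
proof -
  have *: "Poly_Mapping.lookup (mon i j k l) v = Poly_Mapping.lookup (mon i' j' k' l') v" for v
    using assms by simp
  have 1: "i = i' \<and> j = j' \<or> i = j' \<and> j = i'"
  proof (rule indicator_pair_eq)
    fix v show "of_bool (i = v) + of_bool (j = v) = (of_bool (i' = v) + of_bool (j' = v) :: nat)"
      using *[of "X v"] by (simp add: mon_def lookup_add lookup_single when_def of_bool_def del: One_nat_def)
  qed
  have 2: "k = k' \<and> l = l' \<or> k = l' \<and> l = k'"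
  proof (rule indicator_pair_eq)
    fix v show "of_bool (k = v) + of_bool (l = v) = (of_bool (k' = v) + of_bool (l' = v) :: nat)"
      using *[of "Y v"] by (simp add: mon_def lookup_add lookup_single when_def of_bool_def del: One_nat_def)
  qed
  show ?thesis using 1 2 ..
qed

lemma tsym_mon_eq:
  assumes "tsym c" "mon i j k l = mon i' j' k' l'"
  shows "c i' j' k' l' = c i j k l"
proof -
  have "c i j k l = c j i k l" "c i j k l = c i j l k" "c j i k l = c j i l k"
    using assms(1) unfolding tsym_def by blast+
  moreover have "c i' j' k' l' \<in> {c i j k l, c j i k l, c i j l k, c j i l k}"
    using mon_eq[OF assms(2)] by (elim conjE disjE) simp_all
  ultimately show ?thesis by auto
qed

lemma tens_single: "tens c = (\<Sum>i\<in>UNIV. \<Sum>j\<in>UNIV. \<Sum>k\<in>UNIV. \<Sum>l\<in>UNIV. Poly_Mapping.single (mon i j k l) (c i j k l))"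
  by (simp add: tens_def Const_def Var_def mult_single mon_def)

lemma lookup_tens: "Poly_Mapping.lookup (tens c) m =
    (\<Sum>(i,j,k,l)\<in>UNIV. if mon i j k l = m then c i j k l else 0)"
  unfolding UNIV_Times_UNIV[symmetric] sum.cartesian_product[symmetric]
  by (simp add: tens_single lookup_sum lookup_single when_def)

text \<open>The number of orderings of the indices, which is 1, 2 or 4 on the monomials
  \<open>mon i j k l\<close>; dividing by it turns coefficients into tensor entries.\<close>

definition mon_mult :: "(coord \<Rightarrow>\<^sub>0 nat) \<Rightarrow> nat" where
  "mon_mult m = card {(i,j,k,l). mon i j k l = m}"

lemma mon_mult_pos: "mon_mult (mon i j k l) > 0"
  unfolding mon_mult_def by (subst card_gt_0_iff) auto

lemma lookup_tens_mon:
  assumes "tsym c"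
  shows "Poly_Mapping.lookup (tens c) (mon i j k l) = of_nat (mon_mult (mon i j k l)) * c i j k l"
proof -
  have "Poly_Mapping.lookup (tens c) (mon i j k l) =
      (\<Sum>t\<in>UNIV. if t \<in> {(i',j',k',l'). mon i' j' k' l' = mon i j k l} then c i j k l else 0)"
    unfolding lookup_tens
  proof (rule sum.cong[OF refl], goal_cases)
    case (1 t)
    obtain i' j' k' l' where t: "t = (i', j', k', l')" by (cases t)
    show ?case
      using tsym_mon_eq[OF assms, of i j k l i' j' k' l'] unfolding t by (cases "mon i j k l = mon i' j' k' l'") auto
  qed
  also have "\<dots> = of_nat (mon_mult (mon i j k l)) * c i j k l"
    by (subst sum.inter_restrict[symmetric]) (auto simp: mon_mult_def)
  finally show ?thesis .
qed

lemma tens_inject: "tsym c \<Longrightarrow> tsym c' \<Longrightarrow> tens c = tens c' \<longleftrightarrow> c = c'"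
proof
  assume *: "tsym c" "tsym c'" "tens c = tens c'"
  show "c = c'"
  proof (intro ext)
    fix i j k l
    show "c i j k l = c' i j k l"
      using lookup_tens_mon[OF *(1), of i j k l] lookup_tens_mon[OF *(2), of i j k l] *(3)
        mon_mult_pos[of i j k l] by simp
  qed
qed simp

lemma lookup_tens_other:
  assumes "\<And>i j k l. m \<noteq> mon i j k l"
  shows "Poly_Mapping.lookup (tens c) m = 0"
  unfolding lookup_tens using assms by (intro sum.neutral) (auto dest: sym)

lemma tens_add: "tens (\<lambda>i j k l. c i j k l + c' i j k l) = tens c + tens c'"
  by (simp add: tens_single single_add sum.distrib)

lemma prod_UNIV_2: "(\<Prod>i\<in>UNIV. s i) = s (1::2) * s 2"
  unfolding UNIV_2 by simp

lemma prod_UNIV_3: "(\<Prod>i\<in>UNIV. s i) = s (1::3) * s 2 * s 3"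
  unfolding UNIV_3 by (simp add: ac_simps)

text \<open>Each monomial of bidegree (2,2) comes from a tensor with one nonzero entry; averaging
  over the two swaps of indices then makes the tensor symmetric without changing the form.\<close>

lemma forms22_tens:
  assumes "f \<in> forms22"
  obtains c where "tsym c" "f = tens c"
proof -
  have two: "\<exists>i j. (\<Prod>i\<in>UNIV. s i ^ n i) = s i * s j" if "(\<Sum>i\<in>UNIV. n i) = 2" for n :: "2 \<Rightarrow> nat" and s :: "2 \<Rightarrow> coord mpol"
  proof -
    have "n 1 = 0 \<and> n 2 = 2 \<or> n 1 = 1 \<and> n 2 = 1 \<or> n 1 = 2 \<and> n 2 = 0"
      using that by (auto simp: sum_2)
    then have "(\<Prod>i\<in>UNIV. s i ^ n i) \<in> {s 2 * s 2, s 1 * s 2, s 1 * s 1}"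
      by (auto simp: prod_UNIV_2 power2_eq_square)
    then show ?thesis by auto
  qed
  have three: "\<exists>i j. (\<Prod>i\<in>UNIV. s i ^ n i) = s i * s j" if "(\<Sum>i\<in>UNIV. n i) = 2" for n :: "3 \<Rightarrow> nat" and s :: "3 \<Rightarrow> coord mpol"
  proof -
    have "n 1 + n 2 + n 3 = 2" using that by (simp add: sum_3)
    moreover from this have "n 1 \<in> {0, 1, 2}" "n 2 \<in> {0, 1, 2}" by auto
    ultimately have "(\<Prod>i\<in>UNIV. s i ^ n i) \<in> {s 2 * s 2, s 1 * s 2, s 1 * s 1, s 2 * s 3, s 1 * s 3, s 3 * s 3}"
      by (auto simp: prod_UNIV_3 power2_eq_square)
    then show ?thesis by auto
  qed
  have mono: "\<exists>c. Poly_Mapping.single m a = tens c" if "m \<in> Poly_Mapping.keys f" for m a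
  proof -
    have m: "(\<Sum>i\<in>UNIV. Poly_Mapping.lookup m (X i)) = 2" "(\<Sum>j\<in>UNIV. Poly_Mapping.lookup m (Y j)) = 2"
      using assms that by (auto simp: forms22_def bihomogeneous_def)
    obtain i j k l where eq: "mval Var m = Var (X i) * Var (X j) * (Var (Y k) * Var (Y l) :: coord mpol)"
      unfolding mval_coord using two[OF m(1)] three[OF m(2)] by metis
    then have "Poly_Mapping.single m a = Poly_Mapping.single (mon i j k l) a"
      unfolding single_eq_Const_mval[of m a] by (simp add: mon_def Var_def Const_def mult_single)
    also have "\<dots> = tens (\<lambda>i' j' k' l'. if (i',j',k',l') = (i,j,k,l) then a else 0)"
    proof (rule poly_mapping_eqI)
      fix m'
      show "Poly_Mapping.lookup (Poly_Mapping.single (mon i j k l) a) m' =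
        Poly_Mapping.lookup (tens (\<lambda>i' j' k' l'. if (i',j',k',l') = (i,j,k,l) then a else 0)) m'"
        unfolding lookup_tens
        by (subst sum.mono_neutral_right[of _ "{(i,j,k,l)}"]) (auto simp: lookup_single when_def split: if_splits)
    qed
    finally show ?thesis by blast
  qed
  have "\<exists>c. (\<Sum>m\<in>A. Poly_Mapping.single m (Poly_Mapping.lookup f m)) = tens c"
    if "finite A" "A \<subseteq> Poly_Mapping.keys f" for A
    using that
  proof induct
    case empty
    have "tens (\<lambda>i j k l. 0) = 0" by (simp add: tens_single)
    then show ?case by (metis sum.empty)
  next
    case (insert m A)
    then obtain c where c: "(\<Sum>m\<in>A. Poly_Mapping.single m (Poly_Mapping.lookup f m)) = tens c"
      by auto
    obtain c' where c': "Poly_Mapping.single m (Poly_Mapping.lookup f m) = tens c'"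
      using mono[of m] insert by auto
    have "(\<Sum>m\<in>insert m A. Poly_Mapping.single m (Poly_Mapping.lookup f m)) = tens (\<lambda>i j k l. c' i j k l + c i j k l)"
      unfolding tens_add using insert(1,2) c c' by simp
    then show ?case by blast
  qed
  from this[of "Poly_Mapping.keys f"] obtain c
    where "(\<Sum>m\<in>Poly_Mapping.keys f. Poly_Mapping.single m (Poly_Mapping.lookup f m)) = tens c" by auto
  then have c: "f = tens c" by (rule trans[OF poly_mapping_decomp])
  define d where "d = (\<lambda>i j k l. (c i j k l + c j i k l + c i j l k + c j i l k) / 4)"
  have "f = tens d"
  proof (rule poly_mapping_eqI)
    fix m
    define T where "T = {(i,j,k,l). mon i j k l = m}"
    have L: "Poly_Mapping.lookup (tens c) m = (\<Sum>(i,j,k,l)\<in>T. c i j k l)" for c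
      unfolding lookup_tens by (rule sum.mono_neutral_cong_right) (auto simp: T_def split: if_splits)
    have 1: "(\<Sum>(i,j,k,l)\<in>T. c j i k l) = (\<Sum>(i,j,k,l)\<in>T. c i j k l)" for c :: tensor
      by (rule sum.reindex_bij_witness[of _ "\<lambda>(i,j,k,l). (j,i,k,l)" "\<lambda>(i,j,k,l). (j,i,k,l)"])
         (auto simp: T_def mon_swap(1))
    have 2: "(\<Sum>(i,j,k,l)\<in>T. c i j l k) = (\<Sum>(i,j,k,l)\<in>T. c i j k l)" for c :: tensor
      by (rule sum.reindex_bij_witness[of _ "\<lambda>(i,j,k,l). (i,j,l,k)" "\<lambda>(i,j,k,l). (i,j,l,k)"])
         (auto simp: T_def mon_swap(2))
    have 3: "(\<Sum>(i,j,k,l)\<in>T. c j i l k) = (\<Sum>(i,j,k,l)\<in>T. c i j k l)"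
      using 1[of "\<lambda>i j k l. c i j l k"] 2[of c] by simp
    have "Poly_Mapping.lookup (tens d) m = ((\<Sum>(i,j,k,l)\<in>T. c i j k l) + (\<Sum>(i,j,k,l)\<in>T. c j i k l)
        + (\<Sum>(i,j,k,l)\<in>T. c i j l k) + (\<Sum>(i,j,k,l)\<in>T. c j i l k)) / 4"
      unfolding L d_def by (simp add: case_prod_unfold sum.distrib sum_divide_distrib[symmetric])
    then show "Poly_Mapping.lookup f m = Poly_Mapping.lookup (tens d) m"
      unfolding 1[of c] 2[of c] 3 c by (simp add: L)
  qed
  moreover have "tsym d" by (simp add: tsym_def d_def ac_simps)
  ultimately show thesis using that by blast
qed

lemma tens_forms22: "tens c \<in> forms22"
proof -
  have "bihomogeneous (0 + (1 + 1 + (0 + 0))) (0 + (0 + 0 + (1 + 1))) (Const (c i j k l) * (Var (X i) * Var (X j) * (Var (Y k) * Var (Y l))))" for i j k l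
    by (intro bihomogeneous_mult bihomogeneous_Const bihomogeneous_VarX bihomogeneous_VarY)
  then show ?thesis
    unfolding forms22_def tens_def by (auto intro!: bihomogeneous_sum simp: numeral_2_eq_2)
qed

subsection \<open>Derivatives\<close>

lemma ev_simps: "ev (f + g) p q = ev f p q + ev g p q" "ev (f * g) p q = ev f p q * ev g p q"
  "ev (Const c) p q = c" "ev (Var (X i)) p q = p $ i" "ev (Var (Y k)) p q = q $ k" "ev 0 p q = 0" "ev 1 p q = 1"
  "ev (sum h A) p q = (\<Sum>a\<in>A. ev (h a) p q)"
  by (simp_all add: ev_def ev.peval_simps)

lemma ev_partialX:
  assumes "tsym c"
  shows "ev (partial (X i) (tens c)) p q = 2 * Phi c (axis i 1) p q q"
proof -
  have d: "ev (partial (X i) (Var (X j))) p q = axis i 1 $ j" "ev (partial (X i) (Var (Y k))) p q = 0" for j k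
    by (auto simp: axis_def partial_Var ev_simps)
  have "ev (partial (X i) (tens c)) p q = Phi c (axis i 1) p q q + Phi c p (axis i 1) q q"
    by (simp add: tens_def partial_sum partial_mult ev_simps d Phi_def tform_def sum.distrib distrib_left distrib_right)
  then show ?thesis using Phi_swap(1)[OF assms, of p "axis i 1" q q] by simp
qed

lemma ev_partialY:
  assumes "tsym c"
  shows "ev (partial (Y i) (tens c)) p q = 2 * Phi c p p (axis i 1) q"
proof -
  have d: "ev (partial (Y i) (Var (Y k))) p q = axis i 1 $ k" "ev (partial (Y i) (Var (X j))) p q = 0" for j k
    by (auto simp: axis_def partial_Var ev_simps)
  have "ev (partial (Y i) (tens c)) p q = Phi c p p (axis i 1) q + Phi c p p q (axis i 1)"
    by (simp add: tens_def partial_sum partial_mult ev_simps d Phi_def tform_def sum.distrib distrib_left distrib_right)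
  then show ?thesis using Phi_swap(2)[OF assms, of p p q "axis i 1"] by simp
qed

lemma Phi_expand_axis:
  "Phi c p' p q q = (\<Sum>i\<in>UNIV. p' $ i * Phi c (axis i 1) p q q)"
  "Phi c p p q' q = (\<Sum>i\<in>UNIV. q' $ i * Phi c p p (axis i 1) q)"
proof -
  have "Phi c p' p q q = Phi c (\<Sum>i\<in>UNIV. p' $ i *s axis i 1) p q q"
    by (simp only: basis_expansion)
  also have "\<dots> = (\<Sum>i\<in>UNIV. p' $ i * Phi c (axis i 1) p q q)"
    unfolding Phi_sum Phi_linear ..
  finally show "Phi c p' p q q = (\<Sum>i\<in>UNIV. p' $ i * Phi c (axis i 1) p q q)" .
  have "Phi c p p q' q = Phi c p p (\<Sum>i\<in>UNIV. q' $ i *s axis i 1) q"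
    by (simp only: basis_expansion)
  also have "\<dots> = (\<Sum>i\<in>UNIV. q' $ i * Phi c p p (axis i 1) q)"
    unfolding Phi_sum Phi_linear ..
  finally show "Phi c p p q' q = (\<Sum>i\<in>UNIV. q' $ i * Phi c p p (axis i 1) q)" .
qed

section \<open>Points of projective spaces\<close>

definition pt :: "complex^'n \<Rightarrow> 'n::finite proj" where
  "pt v = Abs_proj (range (\<lambda>c. c *s v))"

lemma hcoords_pt: "v \<noteq> 0 \<Longrightarrow> hcoords (pt v) = {c *s v | c. c \<noteq> 0}"
proof -
  assume v: "v \<noteq> 0"
  then have "Rep_proj (pt v) = range (\<lambda>c. c *s v)"
    unfolding pt_def by (subst Abs_proj_inverse) auto
  then show ?thesis using v by (auto simp: hcoords_def)
qed

lemma proj_cases: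
  fixes P :: "'n::finite proj"
  obtains v where "v \<noteq> 0" "P = pt v"
proof -
  from Rep_proj[of P] obtain v where v: "v \<noteq> 0" "Rep_proj P = range (\<lambda>c. c *s v)" by auto
  then have "P = pt v" by (metis Rep_proj_inverse pt_def)
  with v that show thesis by blast
qed

lemma pt_mem: "v \<noteq> 0 \<Longrightarrow> v \<in> hcoords (pt v)"
  by (auto simp: hcoords_pt intro: exI[of _ 1])

lemma pt_scale: "c \<noteq> 0 \<Longrightarrow> pt (c *s v) = pt v"
proof -
  assume c: "c \<noteq> 0"
  have "range (\<lambda>a. a *s (c *s v)) = range (\<lambda>a. a *s v)"
  proof safe
    fix a show "a *s (c *s v) \<in> range (\<lambda>a. a *s v)" by (auto simp: vector_smult_assoc)
    have "a *s v = (a / c) *s (c *s v)" using c by (simp add: vector_smult_assoc)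
    then show "a *s v \<in> range (\<lambda>a. a *s (c *s v))" by (rule range_eqI)
  qed
  then show ?thesis by (simp add: pt_def)
qed

lemma hcoords_iff: "v \<in> hcoords P \<longleftrightarrow> v \<noteq> 0 \<and> P = pt v"
proof
  assume v: "v \<in> hcoords P"
  obtain w where w: "w \<noteq> 0" "P = pt w" by (rule proj_cases[of P])
  with v obtain c where "c \<noteq> 0" "v = c *s w" by (auto simp: hcoords_pt)
  then show "v \<noteq> 0 \<and> P = pt v" using w by (simp add: pt_scale)
qed (simp add: pt_mem)

lemma surface_tens: "p \<noteq> 0 \<Longrightarrow> q \<noteq> 0 \<Longrightarrow> (pt p, pt q) \<in> surface (tens c) \<longleftrightarrow> Phi c p p q q = 0"
proof -
  assume "p \<noteq> 0" "q \<noteq> 0"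
  from pt_mem[OF this(1)] pt_mem[OF this(2)]
  have "(pt p, pt q) \<in> surface (tens c) \<Longrightarrow> Phi c p p q q = 0"
    by (auto simp: surface_def ev_tens)
  moreover have "Phi c p p q q = 0 \<Longrightarrow> (pt p, pt q) \<in> surface (tens c)"
    using \<open>p \<noteq> 0\<close> \<open>q \<noteq> 0\<close> by (auto simp: surface_def ev_tens hcoords_pt Phi_linear)
  ultimately show ?thesis by blast
qed

text \<open>The partial derivatives are twice the values of \<open>Phi\<close> with a basis vector
  in one place; by linearity their vanishing extends to all vectors.\<close>

lemma sing_tens:
  assumes "tsym c" "p \<noteq> 0" "q \<noteq> 0"
  shows "(pt p, pt q) \<in> sing (tens c) \<longleftrightarrow> (\<forall>p'. Phi c p' p q q = 0) \<and> (\<forall>q'. Phi c p p q' q = 0)"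
proof
  assume "(pt p, pt q) \<in> sing (tens c)"
  then have "ev (partial v (tens c)) p q = 0" for v
    using pt_mem[OF assms(2)] pt_mem[OF assms(3)] by (auto simp: sing_def)
  then have "Phi c (axis i 1) p q q = 0" "Phi c p p (axis k 1) q = 0" for i k
    using ev_partialX[OF assms(1), of i p q] ev_partialY[OF assms(1), of k p q] by auto
  note van = this
  show "(\<forall>p'. Phi c p' p q q = 0) \<and> (\<forall>q'. Phi c p p q' q = 0)"
  proof (intro conjI allI)
    show "Phi c p' p q q = 0" for p'
      unfolding Phi_expand_axis(1)[of c p' p q] using van by simp
    show "Phi c p p q' q = 0" for q'
      unfolding Phi_expand_axis(2)[of c p q' q] using van by simp
  qed
next
  assume *: "(\<forall>p'. Phi c p' p q q = 0) \<and> (\<forall>q'. Phi c p p q' q = 0)"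
  then have "ev (partial v (tens c)) (s *s p) (t *s q) = 0" for v s t
    using ev_partialX[OF assms(1)] ev_partialY[OF assms(1)] by (cases v) (auto simp: Phi_linear)
  then show "(pt p, pt q) \<in> sing (tens c)"
    using * assms(2,3) by (auto simp: sing_def surface_tens hcoords_pt)
qed

text \<open>A quadratic form vanishes identically iff its polarization does, so the condition
  becomes linear in each argument and can be tested on a basis.\<close>

lemma nonfinite_tens:
  assumes "tsym c" "p \<noteq> 0" "q \<noteq> 0"
  shows "(pt p, pt q) \<in> p2_nonfinite (tens c) \<longleftrightarrow> (\<forall>p p'. Phi c p p' q q = 0)"
proof
  assume "(pt p, pt q) \<in> p2_nonfinite (tens c)"
  then have "(pt p', pt q) \<in> surface (tens c)" for p'
    by (auto simp: p2_nonfinite_def)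
  then have *: "Phi c p' p' q q = 0" for p'
    using surface_tens[of p' q c] assms(3) by (cases "p' = 0") auto
  show "\<forall>p p'. Phi c p p' q q = 0"
  proof (intro allI)
    fix p p'
    show "Phi c p p' q q = 0"
      using *[of "p + p'"] *[of p] *[of p'] Phi_swap(1)[OF assms(1), of p' p q q]
      by (simp add: Phi_linear)
  qed
next
  assume "\<forall>p p'. Phi c p p' q q = 0"
  then have "(Q, pt q) \<in> surface (tens c)" for Q
    using assms(3) by (cases Q rule: proj_cases) (simp add: surface_tens)
  then show "(pt p, pt q) \<in> p2_nonfinite (tens c)"
    by (auto simp: p2_nonfinite_def)
qed

section \<open>Complete pivoting\<close>

definition diagm :: "('n \<Rightarrow> complex) \<Rightarrow> complex^'n^'n" where
  "diagm d = (\<chi> i j. if i = j then d i else 0)"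

text \<open>The factors of a pivoting are recorded together with their inverses: both have to stay
  in a fixed compact set, so that limits of the factors are again invertible.\<close>

definition bounded_inverses :: "real \<Rightarrow> complex^'n^'n \<Rightarrow> complex^'n^'n \<Rightarrow> bool" where
  "bounded_inverses M B B' \<longleftrightarrow> B ** B' = mat 1 \<and> B' ** B = mat 1 \<and>
     (\<forall>i j. norm (B $ i $ j) \<le> M \<and> norm (B' $ i $ j) \<le> M)"

definition shear_col :: "'n \<Rightarrow> ('n \<Rightarrow> complex) \<Rightarrow> complex^'n^'n" where
  "shear_col i0 r = (\<chi> i j. (if i = j then 1 else 0) + (if j = i0 then r i else 0))"

definition shear_row :: "'n \<Rightarrow> ('n \<Rightarrow> complex) \<Rightarrow> complex^'n^'n" where
  "shear_row j0 u = (\<chi> i j. (if i = j then 1 else 0) + (if i = j0 then u j else 0))"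

lemma shear_col_mult: "(shear_col i0 r ** Z) $ i $ j = Z $ i $ j + r i * Z $ i0 $ j"
  by (simp add: shear_col_def matrix_matrix_mult_def distrib_right sum.distrib if_distrib[where f = "\<lambda>a. a * _"] cong: if_cong)

lemma shear_row_mult: "(Z ** shear_row j0 u) $ i $ j = Z $ i $ j + Z $ i $ j0 * u j"
  by (simp add: shear_row_def matrix_matrix_mult_def distrib_left sum.distrib if_distrib[where f = "\<lambda>a. _ * a"] cong: if_cong)

lemma shear_col_inverse:
  assumes "r i0 = 0"
  shows "shear_col i0 r ** shear_col i0 (\<lambda>i. - r i) = mat 1"
  unfolding vec_eq_iff shear_col_mult using assms by (auto simp: shear_col_def mat_def)

lemma shear_row_inverse:
  assumes "u j0 = 0"
  shows "shear_row j0 (\<lambda>i. - u i) ** shear_row j0 u = mat 1"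
  unfolding vec_eq_iff shear_row_mult using assms by (auto simp: shear_row_def mat_def)

lemma bounded_inverses_mult:
  fixes B C :: "complex^'n^'n" and M K :: real
  assumes "bounded_inverses M B B'" "bounded_inverses K C C'" "0 \<le> M" "0 \<le> K"
  shows "bounded_inverses (CARD('n) * (M * K)) (B ** C) (C' ** B')"
proof -
  have entry: "norm ((Z ** W) $ i $ j) \<le> CARD('n) * (a * b)"
    if "\<And>i j. norm (Z $ i $ j) \<le> a" "\<And>i j. norm (W $ i $ j) \<le> b" "0 \<le> a" for Z W :: "complex^'n^'n" and i j and a b :: real
  proof -
    have "norm (Z $ i $ k * W $ k $ j) \<le> a * b" for k
      unfolding norm_mult using that by (intro mult_mono) auto
    then show ?thesis
      unfolding matrix_matrix_mult_def using sum_norm_bound[of UNIV "\<lambda>k. Z $ i $ k * W $ k $ j" "a * b"] by simp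
  qed
  have "B ** C ** (C' ** B') = B ** (C ** C') ** B'" "C' ** B' ** (B ** C) = C' ** (B' ** B) ** C"
    by (simp_all only: matrix_mul_assoc)
  then show ?thesis
    using assms entry[of B M C K] entry[of C' K B' M] unfolding bounded_inverses_def by (auto simp: mult.commute)
qed

lemma bounded_inverses_shear:
  assumes "r i0 = 0" "\<And>i. norm (r i) \<le> 1"
  shows "bounded_inverses 2 (shear_col i0 r) (shear_col i0 (\<lambda>i. - r i))"
    "bounded_inverses 2 (shear_row i0 r) (shear_row i0 (\<lambda>i. - r i))"
proof -
  have b: "norm (shear_col i0 s $ i $ j) \<le> 2" "norm (shear_row i0 s $ i $ j) \<le> 2" if "\<And>i. norm (s i) \<le> 1" for s i j
    using that[of i] that[of j] norm_triangle_ineq[of 1 "s i"] norm_triangle_ineq[of 1 "s j"]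
    by (auto simp: shear_col_def shear_row_def)
  show "bounded_inverses 2 (shear_col i0 r) (shear_col i0 (\<lambda>i. - r i))"
    using b[of r] b[of "\<lambda>i. - r i"] assms(2) shear_col_inverse[of r i0, OF assms(1)] shear_col_inverse[of "\<lambda>i. - r i"] assms(1)
    by (simp add: bounded_inverses_def)
  show "bounded_inverses 2 (shear_row i0 r) (shear_row i0 (\<lambda>i. - r i))"
    using b[of r] b[of "\<lambda>i. - r i"] assms(2) shear_row_inverse[of r] shear_row_inverse[of "\<lambda>i. - r i"] assms(1)
    by (simp add: bounded_inverses_def)
qed

text \<open>After \<open>k\<close> elimination steps \<open>N\<close> consists of \<open>k\<close>
  isolated pivots, in the rows \<open>I\<close> and their images under \<pi>, and a remaining block.
  Pivots of largest modulus keep all multipliers within 1, so the bound \<open>M\<close> depends on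
  \<open>k\<close> and the size but not on the matrix.\<close>

lemma partial_pivoting:
  assumes "k \<le> CARD('n::finite)"
  shows "\<exists>M\<ge>0. \<forall>A :: complex^'n^'n. \<exists>B B' N E E' I \<pi>. A = B ** N ** E \<and> bounded_inverses M B B' \<and>
    bounded_inverses M E E' \<and> card I = k \<and> inj_on \<pi> I \<and>
    (\<forall>i j. N $ i $ j \<noteq> 0 \<longrightarrow> i \<in> I \<and> j = \<pi> i \<or> i \<notin> I \<and> j \<notin> \<pi> ` I)"
  using assms
proof (induct k)
  case 0
  have "bounded_inverses 1 (mat 1) (mat 1 :: complex^'n^'n)"
    by (simp add: bounded_inverses_def) (simp add: mat_def)
  then have "A = mat 1 ** A ** mat 1 \<and> bounded_inverses 1 (mat 1 :: complex^'n^'n) (mat 1) \<and>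
    bounded_inverses 1 (mat 1 :: complex^'n^'n) (mat 1) \<and> card ({} :: 'n set) = 0 \<and> inj_on (id :: 'n \<Rightarrow> 'n) {} \<and>
    (\<forall>i j. A $ i $ j \<noteq> 0 \<longrightarrow> i \<in> {} \<and> j = id i \<or> i \<notin> {} \<and> j \<notin> id ` {})" for A :: "complex^'n^'n"
    by simp
  then show ?case using zero_le_one[where 'a = real] by blast
next
  case (Suc k)
  then obtain M where "M \<ge> 0" and M: "\<And>A :: complex^'n^'n. \<exists>B B' N E E' I \<pi>. A = B ** N ** E \<and> bounded_inverses M B B' \<and>
    bounded_inverses M E E' \<and> card I = k \<and> inj_on \<pi> I \<and>
    (\<forall>i j. N $ i $ j \<noteq> 0 \<longrightarrow> i \<in> I \<and> j = \<pi> i \<or> i \<notin> I \<and> j \<notin> \<pi> ` I)" by auto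
  have "\<exists>B B' N E E' I \<pi>. A = B ** N ** E \<and> bounded_inverses (CARD('n) * (M * 2)) B B' \<and>
    bounded_inverses (CARD('n) * (M * 2)) E E' \<and> card I = Suc k \<and> inj_on \<pi> I \<and>
    (\<forall>i j. N $ i $ j \<noteq> 0 \<longrightarrow> i \<in> I \<and> j = \<pi> i \<or> i \<notin> I \<and> j \<notin> \<pi> ` I)" for A :: "complex^'n^'n"
  proof -
    from M[of A] obtain B B' N E E' I \<pi> where A: "A = B ** N ** E" and B: "bounded_inverses M B B'"
      and E: "bounded_inverses M E E'" and I: "card I = k" "inj_on \<pi> I"
      and N: "\<And>i j. N $ i $ j \<noteq> 0 \<Longrightarrow> i \<in> I \<and> j = \<pi> i \<or> i \<notin> I \<and> j \<notin> \<pi> ` I" by blast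
    have k: "k < CARD('n)" using Suc by simp
    have "I \<noteq> UNIV" "\<pi> ` I \<noteq> UNIV"
      using I k card_image[OF I(2)] by auto
    then have ne: "(- I) \<times> (- (\<pi> ` I)) \<noteq> {}" by blast
    define m where "m = Max ((\<lambda>(i,j). norm (N $ i $ j)) ` ((- I) \<times> (- (\<pi> ` I))))"
    have "m \<in> (\<lambda>(i,j). norm (N $ i $ j)) ` ((- I) \<times> (- (\<pi> ` I)))"
      unfolding m_def using ne by (intro Max_in) auto
    then obtain i0 j0 where ij0: "i0 \<notin> I" "j0 \<notin> \<pi> ` I" "m = norm (N $ i0 $ j0)" by auto
    have max: "norm (N $ i $ j) \<le> norm (N $ i0 $ j0)" if "i \<notin> I" "j \<notin> \<pi> ` I" for i j
      unfolding ij0(3)[symmetric] m_def using that by (intro Max_ge) auto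
    define r where "r = (\<lambda>i. if i \<notin> I \<and> i \<noteq> i0 then N $ i $ j0 / N $ i0 $ j0 else 0)"
    define u where "u = (\<lambda>j. if j \<notin> \<pi> ` I \<and> j \<noteq> j0 then N $ i0 $ j / N $ i0 $ j0 else 0)"
    have r: "r i0 = 0" "norm (r i) \<le> 1" and u: "u j0 = 0" "norm (u i) \<le> 1" for i
      using max[of i j0] max[of i0 i] ij0 by (auto simp: r_def u_def norm_divide divide_le_eq_1)
    \<comment> \<open>If the pivot is 0, the whole remaining block is 0 by maximality, and the
      convention x / 0 = 0 keeps the identity true.\<close>
    have rN: "r i * N $ i0 $ j0 = N $ i $ j0" if "i \<notin> I" "i \<noteq> i0" for i
      using max[of i j0] that ij0 by (auto simp: r_def)
    have uN: "N $ i0 $ j0 * u j = N $ i0 $ j" if "j \<notin> \<pi> ` I" "j \<noteq> j0" for j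
      using max[of i0 j] that ij0 by (auto simp: u_def)
    \<comment> \<open>Row and column of the pivot are cleared and the rest of the block becomes its
      Schur complement; finished rows are kept.\<close>
    define N' where "N' = (\<chi> i j. if i \<in> I then N $ i $ j else if i = i0 then (if j = j0 then N $ i0 $ j0 else 0)
       else if j = j0 then 0 else N $ i $ j - r i * N $ i0 $ j)"
    have r0: "r i = 0" if "i \<in> I" for i using that by (simp add: r_def)
    have u0: "u j = 0" if "j \<in> \<pi> ` I" for j using that by (auto simp: u_def)
    have N0: "N $ i $ j = 0" if "i \<notin> I" "j \<in> \<pi> ` I" for i j using N[of i j] that by auto
    have N0': "N $ i $ j = 0" if "i \<in> I" "j \<notin> \<pi> ` I" for i j using N[of i j] that by auto
    have "N = shear_col i0 r ** N' ** shear_row j0 u"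
      unfolding vec_eq_iff
    proof (intro allI)
      fix i j
      have "(shear_col i0 r ** N' ** shear_row j0 u) $ i $ j =
        N' $ i $ j + r i * N' $ i0 $ j + (N' $ i $ j0 + r i * N' $ i0 $ j0) * u j"
        unfolding shear_row_mult shear_col_mult ..
      also have "\<dots> = N $ i $ j"
      proof (cases "i \<in> I")
        case True
        then show ?thesis using ij0 N0'[OF True ij0(2)] by (simp add: N'_def r0)
      next
        case iI: False
        show ?thesis
        proof (cases "i = i0")
          case True
          show ?thesis
          proof (cases "j = j0")
            case False
            then show ?thesis
              using True iI ij0 uN[of j] N0[OF iI, of j] u0[of j] r by (cases "j \<in> \<pi> ` I") (auto simp: N'_def)
          qed (use True iI ij0 r u in \<open>auto simp: N'_def\<close>)
        next
          case ne: False
          show ?thesis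
          proof (cases "j = j0")
            case False
            have "r i * N $ i0 $ j0 * u j = r i * N $ i0 $ j"
              using uN[of j] u0[of j] N0[OF ij0(1), of j] False by (cases "j \<in> \<pi> ` I") (auto simp: mult.assoc)
            then show ?thesis using False ne iI ij0 by (auto simp: N'_def)
          qed (use ne iI ij0 rN[OF iI ne] u in \<open>auto simp: N'_def\<close>)
        qed
      qed
      finally show "N $ i $ j = (shear_col i0 r ** N' ** shear_row j0 u) $ i $ j" ..
    qed
    then have "A = (B ** shear_col i0 r) ** N' ** (shear_row j0 u ** E)"
      unfolding A by (simp only: matrix_mul_assoc)
    moreover have "bounded_inverses (CARD('n) * (M * 2)) (B ** shear_col i0 r) (shear_col i0 (\<lambda>i. - r i) ** B')"
      using bounded_inverses_mult[OF B bounded_inverses_shear(1)[of r i0]] r \<open>M \<ge> 0\<close> by simp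
    moreover have "bounded_inverses (CARD('n) * (M * 2)) (shear_row j0 u ** E) (E' ** shear_row j0 (\<lambda>i. - u i))"
      using bounded_inverses_mult[OF bounded_inverses_shear(2)[of u j0] E] u \<open>M \<ge> 0\<close> by (simp add: ac_simps)
    moreover have "card (insert i0 I) = Suc k" using I ij0 by simp
    moreover have im: "(\<pi>(i0 := j0)) ` insert i0 I = insert j0 (\<pi> ` I)" using ij0 by auto
    moreover have "inj_on (\<pi>(i0 := j0)) (insert i0 I)"
      using I ij0 by (auto simp: inj_on_def)
    moreover have "i \<in> insert i0 I \<and> j = (\<pi>(i0 := j0)) i \<or> i \<notin> insert i0 I \<and> j \<notin> (\<pi>(i0 := j0)) ` insert i0 I"
      if "N' $ i $ j \<noteq> 0" for i j
      unfolding im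
      using that N[of i j] N0[of i j] N0[OF ij0(1), of j] ij0 by (auto simp: N'_def split: if_splits)
    ultimately show ?thesis by blast
  qed
  moreover have "0 \<le> CARD('n) * (M * 2)" using \<open>M \<ge> 0\<close> by simp
  ultimately show ?case by blast
qed

text \<open>When every row carries a pivot, \<open>N\<close> is a diagonal matrix times a
  permutation matrix, and the permutation is absorbed into the right factor.\<close>

lemma complete_pivoting:
  "\<exists>M\<ge>0. \<forall>A :: complex^'n^'n. \<exists>B B' d E E'. A = B ** diagm d ** E \<and> bounded_inverses M B B' \<and> bounded_inverses M E E'"
proof -
  obtain M where "M \<ge> 0" and M: "\<And>A :: complex^'n^'n. \<exists>B B' N E E' I \<pi>. A = B ** N ** E \<and> bounded_inverses M B B' \<and>
    bounded_inverses M E E' \<and> card I = CARD('n) \<and> inj_on \<pi> I \<and>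
    (\<forall>i j. N $ i $ j \<noteq> 0 \<longrightarrow> i \<in> I \<and> j = \<pi> i \<or> i \<notin> I \<and> j \<notin> \<pi> ` I)"
    using partial_pivoting[of "CARD('n)", where 'n = 'n] by auto
  have "\<exists>B B' d E E'. A = B ** diagm d ** E \<and> bounded_inverses M B B' \<and> bounded_inverses M E E'" for A :: "complex^'n^'n"
  proof -
    from M[of A] obtain B B' N E E' I \<pi> where A: "A = B ** N ** E" and B: "bounded_inverses M B B'"
      and E: "bounded_inverses M E E'" and I: "card I = CARD('n)" "inj_on \<pi> I"
      and N: "\<And>i j. N $ i $ j \<noteq> 0 \<Longrightarrow> i \<in> I \<and> j = \<pi> i \<or> i \<notin> I \<and> j \<notin> \<pi> ` I" by blast
    have "I = UNIV" using I(1) by (metis card_eq_UNIV_imp_eq_UNIV finite)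
    then have bij: "bij \<pi>" using I(2) by (simp add: finite_UNIV_inj_surj bij_def)
    define F where "F = (\<chi> i. E $ \<pi> i)"
    define F' where "F' = (\<chi> i j. E' $ i $ \<pi> j)"
    have N0: "N $ i $ j = (if j = \<pi> i then N $ i $ \<pi> i else 0)" for i j
      using N[of i j] \<open>I = UNIV\<close> by auto
    have "N ** E = diagm (\<lambda>i. N $ i $ \<pi> i) ** F"
      unfolding matrix_matrix_mult_def vec_eq_iff diagm_def F_def
      by (subst N0) (simp add: if_distrib[where f = "\<lambda>a. a * _"] cong: if_cong)
    moreover have "F ** F' = mat 1"
    proof -
      have "(E ** E') $ \<pi> i $ \<pi> j = (if i = j then 1 else 0)" for i j
        using E bij by (auto simp: bounded_inverses_def mat_def bij_def inj_eq)
      then show ?thesis by (simp add: vec_eq_iff matrix_matrix_mult_def F_def F'_def mat_def)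
    qed
    moreover have "F' ** F = mat 1"
    proof -
      have "(\<Sum>k\<in>UNIV. E' $ i $ \<pi> k * E $ \<pi> k $ j) = (E' ** E) $ i $ j" for i j
        unfolding matrix_matrix_mult_def by (simp add: sum.reindex_bij_betw[OF bij, of "\<lambda>k. E' $ i $ k * E $ k $ j"])
      then show ?thesis using E by (simp add: vec_eq_iff matrix_matrix_mult_def F_def F'_def mat_def bounded_inverses_def)
    qed
    ultimately show ?thesis using A B E
      by (intro exI[of _ B] exI[of _ B'] exI[of _ "\<lambda>i. N $ i $ \<pi> i"] exI[of _ F] exI[of _ F'])
         (auto simp: bounded_inverses_def F_def F'_def matrix_mul_assoc[symmetric])
  qed
  then show ?thesis using \<open>M \<ge> 0\<close> by blast
qed

section \<open>Diagonalization\<close>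

lemma vec_norm_le_sum: "norm (v :: complex^'n) \<le> (\<Sum>i\<in>UNIV. norm (v $ i))"
  unfolding norm_vec_def by (rule L2_set_le_sum) simp

lemma norm_vector_matrix_mult_le: "norm (v v* A) \<le> CARD('n) * CARD('m) * (norm v * norm (A :: complex^'m^'n))"
proof -
  have "norm ((v v* A) $ j) \<le> CARD('n) * (norm v * norm A)" for j
  proof -
    have "norm (A $ i $ j) \<le> norm A" for i
      using Finite_Cartesian_Product.norm_nth_le[of "A $ i" j] Finite_Cartesian_Product.norm_nth_le[of A i] by linarith
    then have "norm (v $ i * A $ i $ j) \<le> norm v * norm A" for i
      unfolding norm_mult by (intro mult_mono) (auto simp: Finite_Cartesian_Product.norm_nth_le)
    then show ?thesis
      unfolding vector_matrix_mult_def using sum_norm_bound[of UNIV "\<lambda>i. v $ i * A $ i $ j" "norm v * norm A"]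
      by (simp add: mult.commute)
  qed
  then have "(\<Sum>j\<in>UNIV. norm ((v v* A) $ j)) \<le> (\<Sum>j\<in>(UNIV :: 'm set). CARD('n) * (norm v * norm A))"
    by (intro sum_mono)
  then show ?thesis using vec_norm_le_sum[of "v v* A"] by (simp add: ac_simps)
qed

text \<open>The polynomial \<open>p\<close> in the operator v \<mapsto> v A. Row vectors are used
  because basis vectors are stored as rows.\<close>

definition poly_act :: "complex poly \<Rightarrow> complex^'n^'n \<Rightarrow> complex^'n \<Rightarrow> complex^'n" where
  "poly_act p A v = (\<Sum>i\<le>degree p. coeff p i *s ((\<lambda>w. w v* A) ^^ i) v)"

lemma poly_act_superset: "degree p \<le> n \<Longrightarrow> poly_act p A v = (\<Sum>i\<le>n. coeff p i *s ((\<lambda>w. w v* A) ^^ i) v)"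
  unfolding poly_act_def by (rule sum.mono_neutral_left) (auto simp: coeff_eq_0 not_le)

lemma vector_matrix_linear: "(a *s v + w) v* A = a *s (v v* A) + w v* (A :: complex^'m^'n)"
  by (simp add: vec_eq_iff vector_matrix_mult_def sum.distrib distrib_left distrib_right sum_distrib_left ac_simps)

lemma vector_matrix_simps: "(a *s v) v* A = a *s (v v* (A :: complex^'m^'n))" "(0 :: complex^'n) v* A = 0"
  "(v + w) v* A = v v* A + w v* A" "(v - w) v* A = v v* A - w v* A"
  "(\<Sum>i\<in>S. f i) v* A = (\<Sum>i\<in>S. f i v* A)"
proof -
  show *: "(0 :: complex^'n) v* A = 0" by (simp add: vec_eq_iff vector_matrix_mult_def)
  show "(a *s v) v* A = a *s (v v* A)" using vector_matrix_linear[of a v 0 A] * by simp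
  show add: "(v + w) v* A = v v* A + w v* A" for v w using vector_matrix_linear[of 1 v w A] by simp
  show "(v - w) v* A = v v* A - w v* A" using vector_matrix_linear[of "-1" w v A] by simp
  show "(\<Sum>i\<in>S. f i) v* A = (\<Sum>i\<in>S. f i v* A)"
    by (induct S rule: infinite_finite_induct) (simp_all add: * add)
qed

lemma poly_act_pCons: "poly_act (pCons a p) A v = a *s v + poly_act p A v v* A"
proof -
  have "poly_act (pCons a p) A v = (\<Sum>i\<le>Suc (degree p). coeff (pCons a p) i *s ((\<lambda>w. w v* A) ^^ i) v)"
    by (rule poly_act_superset) (simp add: degree_pCons_le)
  also have "\<dots> = a *s v + poly_act p A v v* A"
    unfolding sum.atMost_Suc_shift poly_act_def by (simp add: vector_matrix_simps)
  finally show ?thesis .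
qed

lemma poly_act_add: "poly_act (p + q) A v = poly_act p A v + poly_act q A v"
  using poly_act_superset[of p "max (degree p) (degree q)" A v] poly_act_superset[of q "max (degree p) (degree q)" A v]
    poly_act_superset[OF degree_add_le_max[of p q], of A v]
  by (simp add: sum.distrib[symmetric] vector_sadd_rdistrib)

lemma poly_act_smult: "poly_act (smult a p) A v = a *s poly_act p A v"
  by (cases "a = 0") (simp_all add: poly_act_def vec.scale_sum_right vector_smult_assoc)

text \<open>Strip linear factors X - a from \<open>p\<close> one at a time. As soon as the cofactor
  \<open>q\<close> no longer takes \<open>v\<close> into \<open>S\<close>, the vector
  \<open>poly_act q A v\<close> is an eigenvector modulo \<open>S\<close>.\<close>

lemma eigenvector_modulo_subspace:
  fixes A :: "complex^'n^'n"
  assumes "vec.subspace S" "v \<notin> S" "p \<noteq> 0" "poly_act p A v \<in> S"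
  shows "\<exists>w a. w \<notin> S \<and> w v* A - a *s w \<in> S"
  using assms(3,4)
proof (induct "degree p" arbitrary: p)
  case 0
  then obtain c where c: "p = [:c:]" "c \<noteq> 0" by (metis degree_0_id pCons_0_0)
  then have "c *s v \<in> S" using 0 by (simp add: poly_act_def)
  then have "inverse c *s (c *s v) \<in> S" using assms(1) by (rule vec.subspace_scale[rotated])
  then show ?case using assms(2) c by (simp add: vector_smult_assoc)
next
  case (Suc n)
  then have "\<not> constant (poly p)" by (simp add: constant_degree)
  then obtain a where "poly p a = 0" using fundamental_theorem_of_algebra by blast
  then obtain q where q: "p = [:- a, 1:] * q" by (auto simp: poly_eq_0_iff_dvd elim: dvdE)
  then have "q \<noteq> 0" using Suc by auto
  then have "degree q = n" using Suc(2) unfolding q by (subst (asm) degree_mult_eq) auto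
  have act: "poly_act p A v = poly_act q A v v* A - a *s poly_act q A v"
  proof -
    have p: "p = pCons 0 q + smult (- a) q" unfolding q by simp
    show ?thesis unfolding p poly_act_add poly_act_smult poly_act_pCons by (simp add: vector_smult_lneg)
  qed
  show ?case
  proof (cases "poly_act q A v \<in> S")
    case True
    then show ?thesis using Suc(1)[of q] \<open>degree q = n\<close> \<open>q \<noteq> 0\<close> by simp
  next
    case False
    then show ?thesis using Suc(4) unfolding act by blast
  qed
qed

text \<open>In dimension n, the n + 1 vectors v, v A, ..., v A^n are dependent. Equal iterates are
  treated separately, because linear dependence is a property of sets and does not see
  repetitions.\<close>

lemma annihilating_polynomial:
  fixes A :: "complex^'n^'n"
  shows "\<exists>p. p \<noteq> 0 \<and> poly_act p A v = 0"
proof (cases "inj_on (\<lambda>i. ((\<lambda>w. w v* A) ^^ i) v) {..CARD('n)}")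
  case False
  then obtain i j where ij: "i \<noteq> j" "((\<lambda>w. w v* A) ^^ i) v = ((\<lambda>w. w v* A) ^^ j) v" by (auto simp: inj_on_def)
  have m: "poly_act (monom 1 i) A v = ((\<lambda>w. w v* A) ^^ i) v" for i
    using poly_act_superset[of "monom 1 i" i A v]
    by (simp add: degree_monom_eq if_distrib[where f = "\<lambda>a. a *s _"] cong: if_cong)
  have "poly_act (monom 1 i + smult (-1) (monom 1 j)) A v = 0"
    unfolding poly_act_add poly_act_smult m using ij by simp
  moreover have "coeff (monom 1 i + smult (-1) (monom 1 j)) i \<noteq> (0::complex)" using ij by simp
  ultimately show ?thesis by (metis coeff_0)
next
  case True
  define P where "P = (\<lambda>i. ((\<lambda>w. w v* A) ^^ i) v)"
  have "card (P ` {..CARD('n)}) = Suc (CARD('n))" using True by (simp add: card_image P_def)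
  then have "vec.dependent (P ` {..CARD('n)})"
    using dim_subset_UNIV_cart_gen[of "P ` {..CARD('n)}"] by (intro vec.dependent_biggerset_general) simp
  then obtain u x where u: "x \<in> P ` {..CARD('n)}" "u x \<noteq> 0" "(\<Sum>x\<in>P ` {..CARD('n)}. u x *s x) = 0"
    by (subst (asm) vec.dependent_finite) auto
  define p where "p = Poly (map (\<lambda>i. u (P i)) [0..<Suc (CARD('n))])"
  have coeff: "coeff p i = (if i \<le> CARD('n) then u (P i) else 0)" for i
    by (auto simp: p_def coeff_Poly_eq nth_default_def simp del: upt_Suc)
  then have "degree p \<le> CARD('n)" by (intro degree_le) auto
  then have "poly_act p A v = (\<Sum>i\<le>CARD('n). u (P i) *s P i)"
    by (simp add: poly_act_superset coeff P_def)
  also have "\<dots> = 0" using u(3) True by (subst (asm) sum.reindex) (simp_all add: P_def)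
  finally show ?thesis using u(1,2) coeff by (metis (no_types, lifting) coeff_0 imageE atMost_iff)
qed

text \<open>The hypothesis forbids Jordan chains of length two. If the eigenvectors did not span,
  there would be an eigenvector modulo their span; subtracting a suitable element of the span leaves
  either an honest eigenvector or such a chain.\<close>

lemma diagonalization:
  fixes A :: "complex^'n^'n"
  assumes semisimple: "\<And>a v w. w = v v* A - a *s v \<Longrightarrow> w v* A = a *s w \<Longrightarrow> w = 0"
  obtains K \<mu> where "det K \<noteq> 0" "\<And>i. K $ i v* A = \<mu> i *s K $ i"
proof -
  define E where "E = {v. \<exists>a. v v* A = a *s v}"
  \<comment> \<open>On the span, A - a is invertible on eigenvectors for eigenvalues other than
    \<open>a\<close>; the components for \<open>a\<close> itself are collected in
    \<open>k\<close>.\<close>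
  have split: "\<exists>u\<in>vec.span E. \<exists>k. k v* A = a *s k \<and> s = (u v* A - a *s u) + k" if "s \<in> vec.span E" for s a
    using that
  proof (induct rule: vec.span_induct_alt)
    case base
    show ?case by (intro bexI[of _ 0] exI[of _ 0]) (simp_all add: vector_matrix_simps vec.span_zero)
  next
    case (step c x y)
    then obtain u k where u: "u \<in> vec.span E" "k v* A = a *s k" "y = (u v* A - a *s u) + k" by blast
    obtain b where b: "x v* A = b *s x" using step(1) by (auto simp: E_def)
    show ?case
    proof (cases "b = a")
      case True
      then show ?thesis using u b
        by (intro bexI[of _ u] exI[of _ "k + c *s x"])
           (simp_all add: vector_matrix_simps vec.scale_right_distrib vector_smult_assoc mult.commute)
    next
      case False
      have "(c / (b - a)) *s x \<in> vec.span E" using step(1) by (intro vec.span_scale vec.span_base)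
      moreover have "(c / (b - a) * b) *s x - (a * (c / (b - a))) *s x = c *s x"
      proof -
        have "t * b - a * t = t * (b - a)" for t by (simp add: algebra_simps)
        from this[of "c / (b - a)"] show ?thesis
          unfolding vec.scale_left_diff_distrib[symmetric] using False by simp
      qed
      ultimately show ?thesis using u b
        by (intro bexI[of _ "u + (c / (b - a)) *s x"] exI[of _ k])
           (simp_all add: vector_matrix_simps vec.span_add vec.scale_right_distrib vector_smult_assoc algebra_simps)
    qed
  qed
  have "vec.span E = UNIV"
  proof (rule ccontr)
    assume "vec.span E \<noteq> UNIV"
    then obtain v where v: "v \<notin> vec.span E" by blast
    obtain p where p: "p \<noteq> 0" "poly_act p A v = 0" using annihilating_polynomial by blast
    have "\<exists>w a. w \<notin> vec.span E \<and> w v* A - a *s w \<in> vec.span E"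
      by (rule eigenvector_modulo_subspace[OF vec.subspace_span v p(1)]) (simp add: p vec.span_zero)
    then obtain w a where w: "w \<notin> vec.span E" "w v* A - a *s w \<in> vec.span E" by blast
    from split[OF w(2), of a] obtain u k where u: "u \<in> vec.span E" "k v* A = a *s k"
      "w v* A - a *s w = (u v* A - a *s u) + k" by blast
    have k: "k = (w - u) v* A - a *s (w - u)"
      using u(3) by (simp add: vector_matrix_simps vec.scale_right_diff_distrib algebra_simps)
    have "k = 0" using semisimple[OF k] u(2) by simp
    then have "(w - u) v* A = a *s (w - u)" using k by simp
    then have "w - u \<in> vec.span E" by (intro vec.span_base) (auto simp: E_def)
    then have "w - u + u \<in> vec.span E" using u(1) by (rule vec.span_add)
    then show False using w(1) by simp
  qed
  obtain B where B: "B \<subseteq> E" "vec.independent B" "E \<subseteq> vec.span B" "card B = vec.dim E" by (rule vec.basis_exists)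
  have "vec.dim E = vec.dim (vec.span E)" by (rule vec.dim_span[symmetric])
  then have "card B = CARD('n)"
    using vec_dim_card[where 'a = complex and 'n = 'n] unfolding B(4) \<open>vec.span E = UNIV\<close> by (rule trans)
  moreover have "finite B" using vec.independent_bound_general[OF B(2)] by blast
  ultimately obtain b where b: "bij_betw b (UNIV :: 'n set) B"
    by (metis finite finite_same_card_bij)
  define K where "K = (\<chi> i. b i)"
  have rows: "row i K = b i" for i by (simp add: row_def K_def vec_eq_iff)
  have inj: "inj b" and im: "range b = B" using b by (auto simp: bij_betw_def)
  have "c i = 0" if 0: "(\<Sum>i\<in>UNIV. c i *s row i K) = 0" for c i
  proof -
    have s0: "(\<Sum>x\<in>B. c (inv_into UNIV b x) *s x) = 0"
      using 0 unfolding rows im[symmetric] by (subst sum.reindex[OF inj]) (simp add: inv_f_f[OF inj])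
    have dep: "\<forall>u. (\<Sum>x\<in>B. u x *s x) = 0 \<longrightarrow> (\<forall>x\<in>B. u x = 0)"
      using B(2) vec.dependent_finite[OF \<open>finite B\<close>] by blast
    then have "c (inv_into UNIV b (b i)) = 0"
      using dep[THEN spec, of "\<lambda>x. c (inv_into UNIV b x)", THEN mp, OF s0] im by blast
    then show ?thesis by (simp add: inv_f_f[OF inj])
  qed
  then have "\<exists>B. K ** B = mat 1" unfolding matrix_right_invertible_independent_rows by blast
  then have "det K \<noteq> 0" by (simp add: invertible_det_nz[symmetric] invertible_right_inverse)
  moreover have "\<exists>a. K $ i v* A = a *s K $ i" for i
    using B(1) im by (auto simp: K_def E_def)
  then obtain \<mu> where "\<And>i. K $ i v* A = \<mu> i *s K $ i" by metis
  ultimately show thesis by (rule that)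
qed

section \<open>The Hilbert--Mumford criterion\<close>

text \<open>The weights are real because they arise as limits of logarithms and as logarithms of
  eigenvalues. The sign is such that \<open>one_ps a b s\<close> keeps all coefficients bounded as
  \<open>s\<close> tends to infinity.\<close>

definition weights :: "tensor \<Rightarrow> (complex^2^2) \<times> (complex^3^3) \<Rightarrow> (2 \<Rightarrow> real) \<Rightarrow> (3 \<Rightarrow> real) \<Rightarrow> bool" where
  "weights c \<gamma> a b \<longleftrightarrow> (\<Sum>i\<in>UNIV. a i) = 0 \<and> (\<Sum>k\<in>UNIV. b k) = 0 \<and>
     (\<forall>i j k l. tact \<gamma> c i j k l \<noteq> 0 \<longrightarrow> a i + a j + b k + b l \<le> 0)"

section \<open>Limits of group elements and closures of orbits\<close>

lemma tendsto_tact':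
  assumes "(g \<longlongrightarrow> \<gamma>) F"
  shows "((\<lambda>x. tact (g x) c i j k l) \<longlongrightarrow> tact \<gamma> c i j k l) F"
  unfolding tact_def Phi_def tform_def by (intro tendsto_intros assms)

lemma tendsto_det:
  assumes "(g \<longlongrightarrow> (A :: complex^'n^'n)) F"
  shows "((\<lambda>x. det (g x)) \<longlongrightarrow> det A) F"
  unfolding det_def by (intro tendsto_intros assms)

lemma tendsto_matrix_mult:
  assumes "(g \<longlongrightarrow> (A :: complex^'n^'m)) F" "(h \<longlongrightarrow> (B :: complex^'k^'n)) F"
  shows "((\<lambda>x. g x ** h x) \<longlongrightarrow> A ** B) F"
  by (intro vec_tendstoI, simp only: matrix_matrix_mult_def vec_lambda_beta) (intro tendsto_intros assms)

lemma closed_SL: "closed (SL :: (complex^'n^'n) set)"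
  unfolding closed_sequential_limits
proof (intro allI impI, elim conjE)
  fix x :: "nat \<Rightarrow> complex^'n^'n" and l
  assume x: "\<forall>n. x n \<in> SL" "x \<longlonglongrightarrow> l"
  then have "(\<lambda>n. 1) \<longlonglongrightarrow> det l" using tendsto_det[OF x(2)] by (simp add: SL_def)
  then show "l \<in> SL" by (simp add: SL_def LIMSEQ_const_iff)
qed

lemma SL_mult: "A \<in> SL \<Longrightarrow> B \<in> SL \<Longrightarrow> A ** B \<in> SL"
  by (simp add: SL_def det_mul)

lemma SL_one: "mat 1 \<in> SL"
  by (simp add: SL_def)

lemma SL_inverse:
  assumes "A \<in> (SL :: (complex^'n^'n) set)"
  obtains A' where "A' \<in> SL" "A ** A' = mat 1" "A' ** A = mat 1"
proof -
  have "invertible A" using assms by (simp add: SL_def invertible_det_nz)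
  then obtain A' where A': "A ** A' = mat 1" "A' ** A = mat 1" by (auto simp: invertible_def)
  then have "det A * det A' = 1" by (metis det_I det_mul)
  then have "A' \<in> SL" using assms by (simp add: SL_def)
  then show thesis using A' that by blast
qed

text \<open>Tensors form the finite-dimensional space \<open>complex^3^3^2^2\<close>, on which the
  coefficient function is continuous for the product topology; so convergence of the entries
  suffices.\<close>

lemma closure_orbitI:
  fixes g :: tensor
  assumes "\<And>n::nat. \<gamma> n \<in> SL \<times> SL" "\<And>i j k l. (\<lambda>n. tact (\<gamma> n) c i j k l) \<longlonglongrightarrow> g i j k l"
  shows "Poly_Mapping.lookup (tens g) \<in> closure (orbit_coeffs (tens c))"
proof -
  define \<Lambda> where "\<Lambda> = (\<lambda>w :: complex^3^3^2^2. Poly_Mapping.lookup (tens (\<lambda>i j k l. w $ i $ j $ k $ l)))"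
  define x where "x = (\<lambda>n. (\<chi> i j k l. tact (\<gamma> n) c i j k l) :: complex^3^3^2^2)"
  have "continuous_on UNIV \<Lambda>"
    unfolding \<Lambda>_def
  proof (rule continuous_on_coordinatewise_then_product)
    fix m
    have "continuous_on UNIV (\<lambda>w :: complex^3^3^2^2. if P then w $ i $ j $ k $ l else 0)" for P i j k l
      by (cases P) (auto intro!: continuous_intros)
    then show "continuous_on UNIV (\<lambda>w :: complex^3^3^2^2. Poly_Mapping.lookup (tens (\<lambda>i j k l. w $ i $ j $ k $ l)) m)"
      unfolding lookup_tens case_prod_unfold by (intro continuous_on_sum)
  qed
  moreover have "x \<longlonglongrightarrow> (\<chi> i j k l. g i j k l)"
    unfolding x_def by (intro vec_tendstoI) (simp add: assms(2))
  ultimately have L: "(\<lambda>n. \<Lambda> (x n)) \<longlonglongrightarrow> \<Lambda> (\<chi> i j k l. g i j k l)"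
    by (metis UNIV_I continuous_on_tendsto_compose eventually_sequentially)
  have "\<Lambda> (x n) \<in> orbit_coeffs (tens c)" for n
  proof -
    have "(\<lambda>i j k l. x n $ i $ j $ k $ l) = tact (\<gamma> n) c" by (intro ext) (simp add: x_def)
    then have "\<Lambda> (x n) = Poly_Mapping.lookup (act (\<gamma> n) (tens c))" by (simp only: \<Lambda>_def act_tens)
    then show ?thesis using assms(1)[of n] by (simp add: orbit_coeffs_def)
  qed
  then have O: "\<forall>n. \<Lambda> (x n) \<in> closure (orbit_coeffs (tens c))" using closure_subset by blast
  have "\<Lambda> (\<chi> i j k l. g i j k l) \<in> closure (orbit_coeffs (tens c))"
    by (rule Lim_in_closed_set[OF closed_closure always_eventually[OF O] sequentially_bot L])
  moreover have "(\<lambda>i j k l. (\<chi> i j k l. g i j k l) $ i $ j $ k $ l) = g" by (intro ext) simp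
  ultimately show ?thesis by (simp only: \<Lambda>_def)
qed

text \<open>Only finitely many monomials matter. Neighbourhoods controlling these give a sequence in
  the group, and the coefficients at all other monomials vanish on the orbit, hence in its
  closure.\<close>

lemma closure_orbitD:
  assumes "h \<in> closure (orbit_coeffs (tens c))" "tsym c"
  obtains \<gamma> g where "\<forall>n::nat. \<gamma> n \<in> SL \<times> SL" "\<forall>i j k l. (\<lambda>n. tact (\<gamma> n) c i j k l) \<longlonglongrightarrow> g i j k l"
    "h = Poly_Mapping.lookup (tens g)"
proof -
  have "\<exists>\<gamma>\<in>SL \<times> SL. \<forall>i j k l. dist (Poly_Mapping.lookup (act \<gamma> (tens c)) (mon i j k l)) (h (mon i j k l)) < inverse (Suc n)" for n
  proof -
    define U where "U = (\<Inter>(i,j,k,l)\<in>UNIV. (\<lambda>h :: (coord \<Rightarrow>\<^sub>0 nat) \<Rightarrow> complex. h (mon i j k l)) -` ball (h (mon i j k l)) (inverse (Suc n)))"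
    have "open ((\<lambda>h :: (coord \<Rightarrow>\<^sub>0 nat) \<Rightarrow> complex. h m) -` ball a e)" for m a e
      by (rule open_vimage[OF open_ball continuous_on_product_coordinates])
    then have "open U" unfolding U_def case_prod_unfold by (intro open_INT) simp_all
    moreover have "h \<in> U" by (auto simp: U_def)
    ultimately obtain y where "y \<in> orbit_coeffs (tens c)" "y \<in> U"
      using assms(1) unfolding closure_iff_nhds_not_empty by blast
    then show ?thesis unfolding orbit_coeffs_def U_def by (auto simp: dist_commute)
  qed
  then have "\<forall>n. \<exists>\<gamma>. \<gamma> \<in> SL \<times> SL \<and> (\<forall>i j k l. dist (Poly_Mapping.lookup (act \<gamma> (tens c)) (mon i j k l)) (h (mon i j k l)) < inverse (Suc n))"
    by blast
  from choice[OF this] obtain \<gamma> where \<gamma>: "\<And>n. \<gamma> n \<in> SL \<times> SL"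
    "\<And>n i j k l. dist (Poly_Mapping.lookup (act (\<gamma> n) (tens c)) (mon i j k l)) (h (mon i j k l)) < inverse (Suc n)" by blast
  define g where "g = (\<lambda>i j k l. h (mon i j k l) / of_nat (mon_mult (mon i j k l)))"
  have lim: "(\<lambda>n. tact (\<gamma> n) c i j k l) \<longlonglongrightarrow> g i j k l" for i j k l
  proof -
    have "(\<lambda>n. Poly_Mapping.lookup (act (\<gamma> n) (tens c)) (mon i j k l)) \<longlonglongrightarrow> h (mon i j k l)"
      by (rule tendsto_dist_iff[THEN iffD2], rule tendsto_sandwich[OF always_eventually always_eventually tendsto_const LIMSEQ_inverse_real_of_nat])
         (intro allI zero_le_dist less_imp_le[OF \<gamma>(2)])+
    then have "(\<lambda>n. Poly_Mapping.lookup (act (\<gamma> n) (tens c)) (mon i j k l) / of_nat (mon_mult (mon i j k l))) \<longlonglongrightarrow> g i j k l"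
      unfolding g_def by (intro tendsto_intros) (use mon_mult_pos[of i j k l] in auto)
    then show ?thesis
      unfolding act_tens lookup_tens_mon[OF tsym_tact[OF assms(2)]] using mon_mult_pos[of i j k l] by simp
  qed
  have "tsym g" unfolding tsym_def g_def by (metis mon_swap)
  have "h m = Poly_Mapping.lookup (tens g) m" for m
  proof (cases "\<exists>i j k l. m = mon i j k l")
    case True
    then obtain i j k l where m: "m = mon i j k l" by blast
    show ?thesis unfolding m lookup_tens_mon[OF \<open>tsym g\<close>] using mon_mult_pos[of i j k l] by (simp add: g_def)
  next
    case False
    have "h m = 0"
    proof (rule ccontr)
      assume "h m \<noteq> 0"
      have "open ((\<lambda>h :: (coord \<Rightarrow>\<^sub>0 nat) \<Rightarrow> complex. h m) -` (- {0}))"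
        by (intro open_vimage continuous_on_product_coordinates) auto
      moreover have "h \<in> (\<lambda>h. h m) -` (- {0})" using \<open>h m \<noteq> 0\<close> by simp
      ultimately obtain y where "y \<in> orbit_coeffs (tens c)" "y \<in> (\<lambda>h. h m) -` (- {0})"
        using assms(1) unfolding closure_iff_nhds_not_empty by blast
      then show False using False by (auto simp: orbit_coeffs_def act_tens lookup_tens_other)
    qed
    then show ?thesis using False by (simp add: lookup_tens_other)
  qed
  then have "h = Poly_Mapping.lookup (tens g)" by blast
  with \<gamma>(1) lim that show thesis by blast
qed

lemma diagm_row: "diagm d $ i = d i *s axis i 1"
  by (simp add: diagm_def axis_def vec_eq_iff)

lemma det_diagm: "det (diagm d) = (\<Prod>i\<in>UNIV. d i)"
  unfolding diagm_def by (subst det_diagonal) auto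

lemma tact_diagm: "tact (diagm d, diagm e) c i j k l = d i * d j * (e k * e l) * c i j k l"
  by (simp add: tact_def diagm_row Phi_linear Phi_axis ac_simps)

definition one_ps :: "(2 \<Rightarrow> real) \<Rightarrow> (3 \<Rightarrow> real) \<Rightarrow> real \<Rightarrow> (complex^2^2) \<times> (complex^3^3)" where
  "one_ps a b s = (diagm (\<lambda>i. of_real (exp (s * a i))), diagm (\<lambda>k. of_real (exp (s * b k))))"

lemma tact_one_ps: "tact (one_ps a b s) c i j k l = of_real (exp (s * (a i + a j + b k + b l))) * c i j k l"
  unfolding one_ps_def tact_diagm
  by (simp add: of_real_mult[symmetric] exp_add[symmetric] algebra_simps del: of_real_mult)

lemma one_ps_SL:
  assumes "(\<Sum>i\<in>UNIV. a i) = 0" "(\<Sum>k\<in>UNIV. b k) = 0"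
  shows "one_ps a b s \<in> SL \<times> SL"
  using assms
  by (simp add: one_ps_def SL_def det_diagm of_real_prod[symmetric] exp_sum[symmetric] sum_distrib_left[symmetric] del: of_real_prod)

definition gmult :: "(complex^2^2) \<times> (complex^3^3) \<Rightarrow> (complex^2^2) \<times> (complex^3^3) \<Rightarrow> (complex^2^2) \<times> (complex^3^3)" where
  "gmult \<gamma> \<delta> = (fst \<gamma> ** fst \<delta>, snd \<gamma> ** snd \<delta>)"

lemma tact_gmult: "tact (gmult \<gamma> \<delta>) c = tact \<gamma> (tact \<delta> c)"
  by (simp add: tact_mult gmult_def)

lemma gmult_SL: "\<gamma> \<in> SL \<times> SL \<Longrightarrow> \<delta> \<in> SL \<times> SL \<Longrightarrow> gmult \<gamma> \<delta> \<in> SL \<times> SL"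
  by (auto simp: gmult_def SL_mult)

lemma gmult_assoc: "gmult (gmult \<alpha> \<beta>) \<gamma> = gmult \<alpha> (gmult \<beta> \<gamma>)"
  by (simp add: gmult_def matrix_mul_assoc)

lemma gmult_one [simp]: "gmult (mat 1, mat 1) \<gamma> = \<gamma>" "gmult \<gamma> (mat 1, mat 1) = \<gamma>"
  by (simp_all add: gmult_def)

lemma group_inverse:
  assumes "\<gamma> \<in> SL \<times> SL"
  obtains \<gamma>' where "\<gamma>' \<in> SL \<times> SL" "gmult \<gamma> \<gamma>' = (mat 1, mat 1)" "gmult \<gamma>' \<gamma> = (mat 1, mat 1)"
proof -
  have "fst \<gamma> \<in> SL" "snd \<gamma> \<in> SL" using assms by auto
  obtain A' where "A' \<in> SL" "fst \<gamma> ** A' = mat 1" "A' ** fst \<gamma> = mat 1" by (rule SL_inverse[OF \<open>fst \<gamma> \<in> SL\<close>])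
  moreover obtain B' where "B' \<in> SL" "snd \<gamma> ** B' = mat 1" "B' ** snd \<gamma> = mat 1" by (rule SL_inverse[OF \<open>snd \<gamma> \<in> SL\<close>])
  ultimately show thesis using that[of "(A', B')"] by (simp add: gmult_def)
qed

text \<open>Rescaling one row normalizes the determinant of a basis. Multiplying rows by nonzero
  numbers does not change which entries of \<open>tact\<close> vanish, so bases need only be
  invertible in what follows.\<close>

lemma scale_to_SL:
  assumes "det (A :: complex^'n^'n) \<noteq> 0"
  shows "\<exists>d. (\<forall>i. d i \<noteq> 0) \<and> (\<chi> i. d i *s A $ i) \<in> SL"
proof -
  obtain i0 :: 'n where True by blast
  define d where "d = (\<lambda>i. if i = i0 then inverse (det A) else 1)"
  have "det (\<chi> i. d i *s A $ i) = prod d UNIV * det A" by (simp add: det_rows_mul)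
  also have "prod d UNIV = inverse (det A)" by (simp add: d_def)
  finally have "(\<chi> i. d i *s A $ i) \<in> SL" using assms by (simp add: SL_def)
  moreover have "\<forall>i. d i \<noteq> 0" using assms by (simp add: d_def)
  ultimately show ?thesis by blast
qed

text \<open>Along \<open>one_ps\<close> the tensor tends to its part \<open>c0\<close> of weight
  zero. A closed orbit contains \<open>c0\<close>, which the whole one-parameter group fixes;
  conjugating back makes the stabilizer of \<open>c\<close> infinite.\<close>

theorem weights_imp_not_stable:
  assumes c: "tsym c" and det: "det (fst \<gamma>) \<noteq> 0" "det (snd \<gamma>) \<noteq> 0" and w: "weights c \<gamma> a b"
    and nz: "(\<exists>i. a i \<noteq> 0) \<or> (\<exists>k. b k \<noteq> 0)"
  shows "\<not> stable (tens c)"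
proof
  assume stable: "stable (tens c)"
  obtain d where d: "\<forall>i. d i \<noteq> 0" "(\<chi> i. d i *s fst \<gamma> $ i) \<in> SL" using scale_to_SL[OF det(1)] by blast
  obtain e where e: "\<forall>i. e i \<noteq> 0" "(\<chi> i. e i *s snd \<gamma> $ i) \<in> SL" using scale_to_SL[OF det(2)] by blast
  define \<delta> where "\<delta> = ((\<chi> i. d i *s fst \<gamma> $ i), (\<chi> i. e i *s snd \<gamma> $ i))"
  have \<delta>: "\<delta> \<in> SL \<times> SL" using d e by (simp add: \<delta>_def)
  have "tact \<delta> c i j k l = d i * d j * e k * e l * tact \<gamma> c i j k l" for i j k l
    by (simp add: tact_def \<delta>_def Phi_linear)
  then have w': "a i + a j + b k + b l \<le> 0" if "tact \<delta> c i j k l \<noteq> 0" for i j k l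
    using w that by (auto simp: weights_def)
  have sums: "(\<Sum>i\<in>UNIV. a i) = 0" "(\<Sum>k\<in>UNIV. b k) = 0" using w by (auto simp: weights_def)
  define c0 where "c0 = (\<lambda>i j k l. if a i + a j + b k + b l = 0 then tact \<delta> c i j k l else 0)"
  have lim: "(\<lambda>n. tact (gmult (one_ps a b (real n)) \<delta>) c i j k l) \<longlonglongrightarrow> c0 i j k l" for i j k l
  proof -
    consider "tact \<delta> c i j k l = 0" | "a i + a j + b k + b l = 0" | "a i + a j + b k + b l < 0"
      using w'[of i j k l] by linarith
    then show ?thesis
    proof cases
      case 3
      have "(\<lambda>n. exp (a i + a j + b k + b l) ^ n) \<longlonglongrightarrow> 0"
        using 3 by (intro LIMSEQ_realpow_zero) auto
      then have "(\<lambda>n. of_real (exp (real n * (a i + a j + b k + b l))) :: complex) \<longlonglongrightarrow> of_real 0"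
        by (intro tendsto_of_real) (simp add: exp_of_nat_mult)
      from tendsto_mult[OF this tendsto_const[of "tact \<delta> c i j k l"]] show ?thesis
        using 3 by (simp add: tact_gmult tact_one_ps c0_def)
    qed (simp_all add: tact_gmult tact_one_ps c0_def)
  qed
  have "Poly_Mapping.lookup (tens c0) \<in> closure (orbit_coeffs (tens c))"
    by (rule closure_orbitI[OF _ lim]) (intro gmult_SL one_ps_SL sums \<delta>)
  then have "Poly_Mapping.lookup (tens c0) \<in> orbit_coeffs (tens c)"
    using stable by (simp add: stable_def closure_closed)
  then obtain \<theta> where \<theta>: "\<theta> \<in> SL \<times> SL" "Poly_Mapping.lookup (tens c0) = Poly_Mapping.lookup (act \<theta> (tens c))"
    by (auto simp: orbit_coeffs_def)
  have "tsym (tact \<delta> c)" by (rule tsym_tact[OF c])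
  then have t: "tact \<delta> c i j k l = tact \<delta> c j i k l" "tact \<delta> c i j k l = tact \<delta> c i j l k" for i j k l
    unfolding tsym_def by blast+
  have "c0 i j k l = c0 j i k l" for i j k l
    unfolding c0_def t(1)[of i j k l] by (simp add: add.commute[of "a i"])
  moreover have "c0 i j k l = c0 i j l k" for i j k l
    unfolding c0_def t(2)[of i j k l] by (simp add: add.assoc add.commute[of "b k"])
  ultimately have "tsym c0" unfolding tsym_def by blast
  have "tens c0 = tens (tact \<theta> c)" using \<theta>(2) by (simp add: act_tens lookup_inject)
  then have c0: "c0 = tact \<theta> c" using tens_inject[OF \<open>tsym c0\<close> tsym_tact[OF c]] by blast
  obtain \<theta>' where \<theta>': "\<theta>' \<in> SL \<times> SL" "gmult \<theta> \<theta>' = (mat 1, mat 1)" "gmult \<theta>' \<theta> = (mat 1, mat 1)"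
    by (rule group_inverse[OF \<theta>(1)])
  define S where "S = (\<lambda>s. gmult \<theta>' (gmult (one_ps a b s) \<theta>))"
  have fixed: "tact (S s) c = c" for s
  proof -
    have "tact (one_ps a b s) c0 = c0"
      by (intro ext) (auto simp: tact_one_ps c0_def)
    then have "tact (S s) c = tact \<theta>' (tact \<theta> c)" by (simp add: S_def tact_gmult c0)
    also have "\<dots> = c" using \<theta>'(3) tact_one by (simp add: tact_gmult[symmetric])
    finally show ?thesis .
  qed
  have "inj S"
  proof (rule injI)
    fix s t assume "S s = S t"
    then have "gmult \<theta> (gmult (S s) \<theta>') = gmult \<theta> (gmult (S t) \<theta>')" by simp
    moreover have "gmult \<theta> (gmult (S s) \<theta>') = one_ps a b s" for s
      using \<theta>' by (simp add: S_def gmult_assoc[symmetric]) (simp add: gmult_assoc)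
    ultimately have eq: "one_ps a b s = one_ps a b t" by simp
    have 1: "fst (one_ps a b s) $ i $ i = of_real (exp (s * a i))" for s i by (simp add: one_ps_def diagm_def)
    have 2: "snd (one_ps a b s) $ i $ i = of_real (exp (s * b i))" for s i by (simp add: one_ps_def diagm_def)
    have "s * a i = t * a i" for i using 1[of s i] 1[of t i] eq by auto
    moreover have "s * b i = t * b i" for i using 2[of s i] 2[of t i] eq by auto
    ultimately show "s = t" using nz by auto
  qed
  then have "infinite (range S)" by (simp add: finite_image_iff infinite_UNIV_char_0)
  moreover have "range S \<subseteq> {\<gamma> \<in> SL \<times> SL. act \<gamma> (tens c) = tens c}"
  proof
    fix \<gamma> assume "\<gamma> \<in> range S"
    then obtain s where s: "\<gamma> = S s" by blast
    have "S s \<in> SL \<times> SL" unfolding S_def by (intro gmult_SL one_ps_SL sums \<theta>(1) \<theta>'(1))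
    then show "\<gamma> \<in> {\<gamma> \<in> SL \<times> SL. act \<gamma> (tens c) = tens c}" by (simp only: s act_tens fixed mem_Collect_eq)
  qed
  ultimately show False using stable infinite_super unfolding stable_def by blast
qed

lemma negative_weights_imp_not_semistable:
  fixes a :: "2 \<Rightarrow> real" and b :: "3 \<Rightarrow> real"
  assumes det: "det (fst \<gamma>) \<noteq> 0" "det (snd \<gamma>) \<noteq> 0"
    and sums: "(\<Sum>i\<in>UNIV. a i) = 0" "(\<Sum>k\<in>UNIV. b k) = 0"
    and neg: "\<And>i j k l. tact \<gamma> c i j k l \<noteq> 0 \<Longrightarrow> a i + a j + b k + b l < 0"
  shows "\<not> semistable (tens c)"
proof -
  obtain d where d: "\<forall>i. d i \<noteq> 0" "(\<chi> i. d i *s fst \<gamma> $ i) \<in> SL" using scale_to_SL[OF det(1)] by blast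
  obtain e where e: "\<forall>i. e i \<noteq> 0" "(\<chi> i. e i *s snd \<gamma> $ i) \<in> SL" using scale_to_SL[OF det(2)] by blast
  define \<delta> where "\<delta> = ((\<chi> i. d i *s fst \<gamma> $ i), (\<chi> i. e i *s snd \<gamma> $ i))"
  have \<delta>: "\<delta> \<in> SL \<times> SL" using d e by (simp add: \<delta>_def)
  have "tact \<delta> c i j k l = d i * d j * e k * e l * tact \<gamma> c i j k l" for i j k l
    by (simp add: tact_def \<delta>_def Phi_linear)
  then have w': "a i + a j + b k + b l < 0" if "tact \<delta> c i j k l \<noteq> 0" for i j k l
    using neg that by auto
  have lim: "(\<lambda>n. tact (gmult (one_ps a b (real n)) \<delta>) c i j k l) \<longlonglongrightarrow> (\<lambda>i j k l. 0) i j k l" for i j k l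
  proof (cases "tact \<delta> c i j k l = 0")
    case False
    have "(\<lambda>n. exp (a i + a j + b k + b l) ^ n) \<longlonglongrightarrow> 0"
      using w'[OF False] by (intro LIMSEQ_realpow_zero) auto
    then have "(\<lambda>n. of_real (exp (real n * (a i + a j + b k + b l))) :: complex) \<longlonglongrightarrow> of_real 0"
      by (intro tendsto_of_real) (simp add: exp_of_nat_mult)
    from tendsto_mult[OF this tendsto_const[of "tact \<delta> c i j k l"]] show ?thesis
      by (simp add: tact_gmult tact_one_ps)
  qed (simp add: tact_gmult tact_one_ps)
  have "Poly_Mapping.lookup (tens (\<lambda>i j k l. 0)) \<in> closure (orbit_coeffs (tens c))"
    by (rule closure_orbitI[OF _ lim]) (intro gmult_SL one_ps_SL sums \<delta>)
  moreover have "tens (\<lambda>i j k l. 0) = 0" by (simp add: tens_single)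
  ultimately show ?thesis by (simp add: semistable_def)
qed

text \<open>Properness of the orbit map: preimages of bounded sets of tensors are bounded, hence
  relatively compact, and their limits stay in the group because \<open>SL\<close> is
  closed.\<close>

definition proper :: "tensor \<Rightarrow> bool" where
  "proper c \<longleftrightarrow> (\<forall>C. bounded {\<gamma> \<in> SL \<times> SL. \<forall>i j k l. norm (tact \<gamma> c i j k l) \<le> C})"

text \<open>A convergent sequence in the orbit is bounded, so its group elements have a convergent
  subsequence, whose limit carries \<open>c\<close> to the given limit.\<close>

lemma proper_imp_closed:
  assumes c: "tsym c" and "proper c"
  shows "closed (orbit_coeffs (tens c))"
proof -
  have "h \<in> orbit_coeffs (tens c)" if h_closure: "h \<in> closure (orbit_coeffs (tens c))" for h
  proof -
    obtain \<gamma> g where \<gamma>: "\<forall>n::nat. \<gamma> n \<in> SL \<times> SL" and "\<forall>i j k l. (\<lambda>n. tact (\<gamma> n) c i j k l) \<longlonglongrightarrow> g i j k l"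
      and h: "h = Poly_Mapping.lookup (tens g)"
      by (rule closure_orbitD[OF h_closure c])
    then have lim: "(\<lambda>n. tact (\<gamma> n) c i j k l) \<longlonglongrightarrow> g i j k l" for i j k l by blast
    have "\<exists>K. \<forall>n. norm (tact (\<gamma> n) c i j k l) \<le> K" for i j k l
      using convergent_imp_Bseq[OF convergentI[OF lim[of i j k l]]] by (auto simp: Bseq_def)
    then have "\<forall>t. \<exists>K. case t of (i,j,k,l) \<Rightarrow> \<forall>n. norm (tact (\<gamma> n) c i j k l) \<le> K" by auto
  from choice[OF this] obtain K' where K': "\<And>t. case t of (i,j,k,l) \<Rightarrow> \<forall>n. norm (tact (\<gamma> n) c i j k l) \<le> K' t" by blast
    define K where "K = (\<lambda>i j k l. K' (i,j,k,l))"
    have K: "norm (tact (\<gamma> n) c i j k l) \<le> K i j k l" for i j k l n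
      using K'[of "(i,j,k,l)"] by (simp add: K_def)
    define C where "C = Max (range (\<lambda>(i,j,k,l). K i j k l))"
    have "K i j k l \<le> C" for i j k l
      unfolding C_def by (intro Max_ge) (auto intro!: image_eqI[of _ _ "(i,j,k,l)"])
    then have "norm (tact (\<gamma> n) c i j k l) \<le> C" for n i j k l using K order_trans by blast
    then have "range \<gamma> \<subseteq> {\<gamma> \<in> SL \<times> SL. \<forall>i j k l. norm (tact \<gamma> c i j k l) \<le> C}" using \<gamma> by blast
    then have "bounded (range \<gamma>)" using assms(2) bounded_subset unfolding proper_def by blast
    then obtain l r where r: "strict_mono r" "(\<gamma> \<circ> r) \<longlonglongrightarrow> l" using bounded_imp_convergent_subsequence by blast
    have "closed (SL \<times> SL :: ((complex^2^2) \<times> (complex^3^3)) set)" by (intro closed_Times closed_SL)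
    then have l: "l \<in> SL \<times> SL"
      by (rule closed_sequentially[OF _ _ r(2)]) (use \<gamma> in auto)
    have "g = tact l c"
    proof (intro ext)
      fix i j k m
      have "(\<lambda>n. tact ((\<gamma> \<circ> r) n) c i j k m) \<longlonglongrightarrow> tact l c i j k m" by (rule tendsto_tact'[OF r(2)])
      moreover have "(\<lambda>n. tact ((\<gamma> \<circ> r) n) c i j k m) \<longlonglongrightarrow> g i j k m"
        using LIMSEQ_subseq_LIMSEQ[OF lim r(1)] by (simp add: o_def)
      ultimately show "g i j k m = tact l c i j k m" using LIMSEQ_unique by blast
    qed
    then show ?thesis using l by (auto simp: h orbit_coeffs_def act_tens)
  qed
  then show ?thesis by (metis closure_subset closure_eq subsetI subset_antisym)
qed

section \<open>Bounds for entries, determinants and values of the form\<close>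

lemma vec_compare_norm: "(\<And>i. norm (v $ i) \<le> K) \<Longrightarrow> norm (v :: 'a::real_normed_vector^'n) \<le> real CARD('n) * K"
  unfolding norm_vec_def using sum_bounded_above[of UNIV "\<lambda>i. norm (v $ i)" K]
  by (intro order_trans[OF L2_set_le_sum]) auto

lemma matrix_compare_norm: "(\<And>i j. norm (A $ i $ j) \<le> K) \<Longrightarrow> norm (A :: complex^'m^'n) \<le> real CARD('n) * (real CARD('m) * K)"
  by (intro vec_compare_norm)

lemma matrix_entry_norm: "norm (A $ i $ j) \<le> norm (A :: complex^'m^'n)"
  using Finite_Cartesian_Product.norm_nth_le[of "A $ i" j] Finite_Cartesian_Product.norm_nth_le[of A i] by linarith

lemma det_bound:
  assumes "\<And>i j. norm (A $ i $ j) \<le> K"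
  shows "norm (det (A :: complex^'n^'n)) \<le> fact (CARD('n)) * K ^ CARD('n)"
proof -
  have "norm (of_int (sign p) * (\<Prod>i\<in>UNIV. A $ i $ p i)) \<le> K ^ CARD('n)" for p
  proof -
    have "norm (\<Prod>i\<in>UNIV. A $ i $ p i) \<le> (\<Prod>i\<in>(UNIV :: 'n set). K)"
      unfolding prod_norm[symmetric] by (intro prod_mono) (use assms in auto)
    moreover have "norm (of_int (sign p) :: complex) = 1" by (simp add: sign_def)
    ultimately show ?thesis by (simp add: norm_mult)
  qed
  then have "norm (det A) \<le> of_nat (card {p. p permutes (UNIV :: 'n set)}) * K ^ CARD('n)"
    unfolding det_def by (intro sum_norm_bound)
  then show ?thesis by (simp add: card_permutations)
qed

text \<open>The constant 36 = 2 * 2 * 3 * 3 counts the terms of the sum.\<close>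

lemma Phi_bound:
  assumes "\<And>i j k l. norm (c i j k l) \<le> C" "\<And>i. norm (p $ i) \<le> M" "\<And>i. norm (p' $ i) \<le> M"
    "\<And>i. norm (q $ i) \<le> M" "\<And>i. norm (q' $ i) \<le> M"
  shows "norm (Phi c p p' q q') \<le> 36 * (C * M ^ 4)"
proof -
  have M: "0 \<le> M" using assms(2) norm_ge_zero order_trans by blast
  have b: "norm (c i j k l * (p $ i * p' $ j * (q $ k * q' $ l))) \<le> C * M ^ 4" for i j k l
  proof -
    have "norm (c i j k l * (p $ i * p' $ j * (q $ k * q' $ l))) \<le> C * (M * M * (M * M))"
      unfolding norm_mult using assms M order_trans[OF norm_ge_zero assms(1)]
      by (intro mult_mono mult_nonneg_nonneg) auto
    then show ?thesis by (simp add: power4_eq_xxxx ac_simps)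
  qed
  have 3: "norm (\<Sum>i\<in>UNIV. f i) \<le> 3 * K" if "\<And>i. norm (f i) \<le> K" for f :: "3 \<Rightarrow> complex" and K
    using sum_norm_bound[of UNIV f K] that by simp
  have 2: "norm (\<Sum>i\<in>UNIV. f i) \<le> 2 * K" if "\<And>i. norm (f i) \<le> K" for f :: "2 \<Rightarrow> complex" and K
    using sum_norm_bound[of UNIV f K] that by simp
  have "norm (Phi c p p' q q') \<le> 2 * (2 * (3 * (3 * (C * M ^ 4))))"
    unfolding Phi_def tform_def by (intro 2 3 b)
  then show ?thesis by simp
qed

lemma matrix_inv_entries_tact:
  assumes "\<gamma>' = (B', C')" "B' ** B = mat 1" "C' ** C = mat 1"
  shows "tact \<gamma>' (tact (B ** A, C ** D) c) = tact (A, D) c"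
  using assms by (simp add: tact_mult matrix_mul_assoc)

lemma bounded_inverses_entries:
  assumes "bounded_inverses K B B'" "K \<le> M"
  shows "norm (B $ i $ j) \<le> M" "norm (B' $ i $ j) \<le> M"
  using assms order_trans[of _ K M] unfolding bounded_inverses_def by blast+

text \<open>Let \<gamma> = B D E with B, E and their inverses bounded. Acting by D on the tensor in
  the basis E gives the bounded tensor of \<gamma> transformed by the inverse of B, so it stays
  bounded. Hence products of pivots are bounded at entries that stay away from 0, and their
  logarithms, divided by the total size, tend to weights for the limit of the bases E.\<close>

theorem not_proper_imp_weights:
  assumes c: "tsym c" and "\<not> proper c"
  obtains \<gamma> a b where "det (fst \<gamma>) \<noteq> 0" "det (snd \<gamma>) \<noteq> 0" "weights c \<gamma> a b" "(\<exists>i. a i \<noteq> 0) \<or> (\<exists>k. b k \<noteq> 0)"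
proof -
  obtain C where C: "\<not> bounded {\<gamma> \<in> SL \<times> SL. \<forall>i j k l. norm (tact \<gamma> c i j k l) \<le> C}"
    using assms(2) by (auto simp: proper_def)
  then have "\<forall>n. \<exists>\<gamma>. \<gamma> \<in> SL \<times> SL \<and> (\<forall>i j k l. norm (tact \<gamma> c i j k l) \<le> C) \<and> real n < norm \<gamma>"
    unfolding bounded_iff by (auto simp: not_le)
  from choice[OF this] obtain \<gamma> where \<gamma>: "\<And>n. \<gamma> n \<in> SL \<times> SL" "\<And>n i j k l. norm (tact (\<gamma> n) c i j k l) \<le> C"
    "\<And>n. real n < norm (\<gamma> n)" by blast
  obtain M1 where M1: "M1 \<ge> 0" "\<And>A :: complex^2^2. \<exists>B B' d E E'. A = B ** diagm d ** E \<and> bounded_inverses M1 B B' \<and> bounded_inverses M1 E E'"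
    using complete_pivoting by blast
  obtain M2 where M2: "M2 \<ge> 0" "\<And>A :: complex^3^3. \<exists>B B' d E E'. A = B ** diagm d ** E \<and> bounded_inverses M2 B B' \<and> bounded_inverses M2 E E'"
    using complete_pivoting by blast
  define M where "M = max 1 (max M1 M2)"
  have M: "M \<ge> 1" "M1 \<le> M" "M2 \<le> M" by (auto simp: M_def)
  have "\<forall>n. \<exists>B B' d E E'. fst (\<gamma> n) = B ** diagm d ** E \<and> bounded_inverses M1 B B' \<and> bounded_inverses M1 E E'"
    using M1(2) by blast
  then obtain B1 B1' d1 E1 E1' where D1: "\<And>n. fst (\<gamma> n) = B1 n ** diagm (d1 n) ** E1 n"
    "\<And>n. bounded_inverses M1 (B1 n) (B1' n)" "\<And>n. bounded_inverses M1 (E1 n) (E1' n)" by metis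
  have "\<forall>n. \<exists>B B' d E E'. snd (\<gamma> n) = B ** diagm d ** E \<and> bounded_inverses M2 B B' \<and> bounded_inverses M2 E E'"
    using M2(2) by blast
  then obtain B2 B2' d2 E2 E2' where D2: "\<And>n. snd (\<gamma> n) = B2 n ** diagm (d2 n) ** E2 n"
    "\<And>n. bounded_inverses M2 (B2 n) (B2' n)" "\<And>n. bounded_inverses M2 (E2 n) (E2' n)" by metis
  have ent1: "norm (B1 n $ i $ j) \<le> M" "norm (B1' n $ i $ j) \<le> M" "norm (E1 n $ i $ j) \<le> M" "norm (E1' n $ i $ j) \<le> M" for n i j
    using bounded_inverses_entries[OF D1(2) M(2)] bounded_inverses_entries[OF D1(3) M(2)] by auto
  have ent2: "norm (B2 n $ i $ j) \<le> M" "norm (B2' n $ i $ j) \<le> M" "norm (E2 n $ i $ j) \<le> M" "norm (E2' n $ i $ j) \<le> M" for n i j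
    using bounded_inverses_entries[OF D2(2) M(3)] bounded_inverses_entries[OF D2(3) M(3)] by auto

  \<comment> \<open>The Leibniz formula bounds determinants by 2! M^2 and 3! M^3; since M \<ge> 1,
    the second bound serves for both sizes.\<close>
  define F where "F = fact 3 * M ^ 3"
  have "M ^ 2 \<le> M ^ 3" using M(1) by (intro power_increasing) auto
  moreover have "1 \<le> M ^ 3" using M(1) by (rule one_le_power)
  ultimately have F: "fact 2 * M ^ 2 \<le> F" "1 \<le> F" by (auto simp: F_def fact_numeral)
  \<comment> \<open>The pivots need not multiply to 1. But the outer factors and their inverses have
    determinants of modulus at most \<open>F\<close>, so the logarithm of the product is bounded,
    and it disappears after division by \<open>R\<close>.\<close>
  have prod_bounds: "\<bar>ln (norm (\<Prod>i\<in>UNIV. d i))\<bar> \<le> 2 * ln F \<and> (\<Prod>i\<in>UNIV. d i) \<noteq> 0"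
    if "det (A :: complex^'n^'n) = 1" "A = B ** diagm d ** E" "norm (det B) \<le> F" "norm (det B') \<le> F" "norm (det E) \<le> F" "norm (det E') \<le> F"
      "B ** B' = mat 1" "E ** E' = mat 1" for A B B' E E' :: "complex^'n^'n" and d
  proof -
    have 1: "det B * (\<Prod>i\<in>UNIV. d i) * det E = 1" using that(1,2) by (simp add: det_mul det_diagm)
    have 2: "det B * det B' = 1" "det E * det E' = 1" using that(7,8) by (metis det_mul det_I)+
    have nz: "det B \<noteq> 0" "det E \<noteq> 0" "det B' \<noteq> 0" "det E' \<noteq> 0" "(\<Prod>i\<in>UNIV. d i) \<noteq> 0"
      using 1 2 mult_zero_left mult_zero_right zero_neq_one by metis+
    have l1: "ln (norm (det B)) + ln (norm (\<Prod>i\<in>UNIV. d i)) + ln (norm (det E)) = 0"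
      using arg_cong[OF 1, of "\<lambda>z. ln (norm z)"] nz by (simp add: norm_mult ln_mult)
    have l2: "ln (norm (det B)) + ln (norm (det B')) = 0" "ln (norm (det E)) + ln (norm (det E')) = 0"
      using arg_cong[OF 2(1), of "\<lambda>z. ln (norm z)"] arg_cong[OF 2(2), of "\<lambda>z. ln (norm z)"] nz by (simp_all add: norm_mult ln_mult)
    have "ln (norm (det B)) \<le> ln F" "ln (norm (det B')) \<le> ln F" "ln (norm (det E)) \<le> ln F" "ln (norm (det E')) \<le> ln F"
      using that(3-6) nz F(2) by (simp_all add: ln_le_cancel_iff)
    then show ?thesis using l1 l2 nz by linarith
  qed
  have P1: "\<bar>ln (norm (\<Prod>i\<in>UNIV. d1 n i))\<bar> \<le> 2 * ln F \<and> (\<Prod>i\<in>UNIV. d1 n i) \<noteq> 0" for n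
  proof (rule prod_bounds[OF _ D1(1)[of n]])
    show "det (fst (\<gamma> n)) = 1" using \<gamma>(1)[of n] by (auto simp: SL_def)
    show "B1 n ** B1' n = mat 1" "E1 n ** E1' n = mat 1" using D1(2,3)[of n] by (auto simp: bounded_inverses_def)
    have d: "norm (det A) \<le> F" if "\<And>i j. norm (A $ i $ j) \<le> M" for A :: "complex^2^2"
      using det_bound[of A M, OF that] F(1) by simp
    show "norm (det (B1 n)) \<le> F" "norm (det (B1' n)) \<le> F" "norm (det (E1 n)) \<le> F" "norm (det (E1' n)) \<le> F"
      by (intro d ent1)+
  qed
  have P2: "\<bar>ln (norm (\<Prod>i\<in>UNIV. d2 n i))\<bar> \<le> 2 * ln F \<and> (\<Prod>i\<in>UNIV. d2 n i) \<noteq> 0" for n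
  proof (rule prod_bounds[OF _ D2(1)[of n]])
    show "det (snd (\<gamma> n)) = 1" using \<gamma>(1)[of n] by (auto simp: SL_def)
    show "B2 n ** B2' n = mat 1" "E2 n ** E2' n = mat 1" using D2(2,3)[of n] by (auto simp: bounded_inverses_def)
    have d: "norm (det A) \<le> F" if "\<And>i j. norm (A $ i $ j) \<le> M" for A :: "complex^3^3"
      using det_bound[of A M, OF that] by (simp add: F_def)
    show "norm (det (B2 n)) \<le> F" "norm (det (B2' n)) \<le> F" "norm (det (E2 n)) \<le> F" "norm (det (E2' n)) \<le> F"
      by (intro d ent2)+
  qed
  have d1: "d1 n i \<noteq> 0" and d2: "d2 n k \<noteq> 0" for n i k using P1[of n] P2[of n] by auto
  define \<alpha> where "\<alpha> = (\<lambda>n i. ln (norm (d1 n i)))"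
  define \<beta> where "\<beta> = (\<lambda>n k. ln (norm (d2 n k)))"
  define R where "R = (\<lambda>n. (\<Sum>i\<in>UNIV. \<bar>\<alpha> n i\<bar>) + (\<Sum>k\<in>UNIV. \<bar>\<beta> n k\<bar>))"
  have R0: "R n \<ge> 0" for n by (simp add: R_def sum_nonneg)
  have R\<alpha>: "\<bar>\<alpha> n i\<bar> \<le> R n" for n i
  proof -
    have "\<bar>\<alpha> n i\<bar> \<le> (\<Sum>i\<in>UNIV. \<bar>\<alpha> n i\<bar>)" by (rule member_le_sum) auto
    moreover have "0 \<le> (\<Sum>k\<in>UNIV. \<bar>\<beta> n k\<bar>)" by (rule sum_nonneg) simp
    ultimately show ?thesis unfolding R_def by linarith
  qed
  have R\<beta>: "\<bar>\<beta> n i\<bar> \<le> R n" for n i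
  proof -
    have "\<bar>\<beta> n i\<bar> \<le> (\<Sum>i\<in>UNIV. \<bar>\<beta> n i\<bar>)" by (rule member_le_sum) auto
    moreover have "0 \<le> (\<Sum>k\<in>UNIV. \<bar>\<alpha> n k\<bar>)" by (rule sum_nonneg) simp
    ultimately show ?thesis unfolding R_def by linarith
  qed
  have n1: "norm (d1 n i) = exp (\<alpha> n i)" and n2: "norm (d2 n k) = exp (\<beta> n k)" for n i k
    using d1 d2 by (simp_all add: \<alpha>_def \<beta>_def)
  have s\<alpha>: "\<bar>\<Sum>i\<in>UNIV. \<alpha> n i\<bar> \<le> 2 * ln F" and s\<beta>: "\<bar>\<Sum>k\<in>UNIV. \<beta> n k\<bar> \<le> 2 * ln F" for n
    using P1[of n] P2[of n] d1 d2 by (simp_all add: \<alpha>_def \<beta>_def ln_prod[symmetric] prod_norm)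

  \<comment> \<open>The constant is generous: 2^3 + 3^3 = 35 would do.\<close>
  have grow: "norm (\<gamma> n) \<le> 1000 * M ^ 2 * exp (R n)" for n
  proof -
    have dd: "(diagm d ** E) $ i $ j = d i * E $ i $ j" for d and E :: "complex^'n^'n" and i j
      by (simp add: matrix_matrix_mult_def diagm_def if_distrib[where f = "\<lambda>a. a * _"] cong: if_cong)
    have e: "norm ((B ** diagm d ** E) $ i $ j) \<le> CARD('n) * (M * (exp (R n) * M))"
      if "\<And>i j. norm (B $ i $ j) \<le> M" "\<And>i j. norm (E $ i $ j) \<le> M" "\<And>i. norm (d i) \<le> exp (R n)"
      for B E :: "complex^'n^'n" and d i j
    proof -
      have "norm (B $ i $ k * (d k * E $ k $ j)) \<le> M * (exp (R n) * M)" for k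
        unfolding norm_mult using that M(1) by (intro mult_mono) auto
      then show ?thesis
        unfolding matrix_mul_assoc[symmetric] unfolding matrix_matrix_mult_def[of B] dd vec_lambda_beta
        using sum_norm_bound[of UNIV "\<lambda>k. B $ i $ k * (d k * E $ k $ j)" "M * (exp (R n) * M)"] by simp
    qed
    have "norm (fst (\<gamma> n)) \<le> real CARD(2) * (real CARD(2) * (CARD(2) * (M * (exp (R n) * M))))"
    proof -
      have "norm (d1 n i) \<le> exp (R n)" for i using R\<alpha>[of n i] by (simp add: n1)
      note a = this
      show ?thesis unfolding D1 by (rule matrix_compare_norm[OF e[OF ent1(1) ent1(3) a]])
    qed
    moreover have "norm (snd (\<gamma> n)) \<le> real CARD(3) * (real CARD(3) * (CARD(3) * (M * (exp (R n) * M))))"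
    proof -
      have "norm (d2 n i) \<le> exp (R n)" for i using R\<beta>[of n i] by (simp add: n2)
      note a = this
      show ?thesis unfolding D2 by (rule matrix_compare_norm[OF e[OF ent2(1) ent2(3) a]])
    qed
    moreover have "norm (\<gamma> n) \<le> norm (fst (\<gamma> n)) + norm (snd (\<gamma> n))"
      by (metis norm_Pair_le prod.collapse)
    moreover have "0 \<le> M * (exp (R n) * M)" using M by simp
    ultimately show ?thesis by (simp add: power2_eq_square ac_simps)
  qed
  have Rtop: "filterlim R at_top sequentially"
    unfolding filterlim_at_top
  proof
    fix Z
    have "\<forall>\<^sub>F n in sequentially. 1000 * M ^ 2 * exp Z \<le> real n"
      using filterlim_real_sequentially unfolding filterlim_at_top by blast
    then show "\<forall>\<^sub>F n in sequentially. Z \<le> R n"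
    proof (rule eventually_mono)
      fix n assume "1000 * M ^ 2 * exp Z \<le> real n"
      then have "1000 * M ^ 2 * exp Z \<le> 1000 * M ^ 2 * exp (R n)" using grow[of n] \<gamma>(3)[of n] by linarith
      then show "Z \<le> R n" using M by simp
    qed
  qed

  \<comment> \<open>Logarithms of the pivots on the scale of their total size \<open>R\<close>. The
    entries lie in [-1, 1], also where \<open>R n\<close> is 0.\<close>
  define v where "v = (\<lambda>n. (\<chi> i. \<alpha> n i / R n) :: real^2)"
  define w where "w = (\<lambda>n. (\<chi> i. \<beta> n i / R n) :: real^3)"
  \<comment> \<open>All data form one sequence, so that bases, inverses and weights converge along
    one common subsequence.\<close>
  define z where "z = (\<lambda>n. (E1 n, E1' n, E2 n, E2' n, v n, w n))"
  have "bounded (range z)"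
  proof (rule bounded_subset)
    have bm: "bounded {A :: complex^'n^'n. \<forall>i j. norm (A $ i $ j) \<le> M}"
      unfolding bounded_iff by (intro exI[of _ "real CARD('n) * (CARD('n) * M)"] ballI matrix_compare_norm) auto
    have bv: "bounded {x :: real^'n. \<forall>i. norm (x $ i) \<le> 1}"
      unfolding bounded_iff by (intro exI[of _ "real CARD('n) * 1"] ballI vec_compare_norm) auto
    let ?S = "{A :: complex^2^2. \<forall>i j. norm (A $ i $ j) \<le> M} \<times> {A :: complex^2^2. \<forall>i j. norm (A $ i $ j) \<le> M} \<times>
       {A :: complex^3^3. \<forall>i j. norm (A $ i $ j) \<le> M} \<times> {A :: complex^3^3. \<forall>i j. norm (A $ i $ j) \<le> M} \<times>
       {x :: real^2. \<forall>i. norm (x $ i) \<le> 1} \<times> {x :: real^3. \<forall>i. norm (x $ i) \<le> 1}"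
    show "bounded ?S"
      by (intro bounded_Times bm bv)
    have "\<bar>x / y\<bar> \<le> 1" if "\<bar>x\<bar> \<le> y" for x y :: real
    proof -
      have "0 \<le> y" using that by linarith
      then show ?thesis using that by (cases "y = 0") (auto simp: abs_divide divide_le_eq_1)
    qed
    note q = this
    have "\<bar>\<alpha> n i / R n\<bar> \<le> 1" "\<bar>\<beta> n k / R n\<bar> \<le> 1" for n i k using q[OF R\<alpha>] q[OF R\<beta>] by auto
    then have "norm (v n $ i) \<le> 1" "norm (w n $ k) \<le> 1" for n i k unfolding v_def w_def vec_lambda_beta real_norm_def by auto
    then show "range z \<subseteq> ?S"
      using ent1 ent2 unfolding z_def by (intro image_subsetI SigmaI CollectI allI)
  qed
  then obtain l r where r: "strict_mono r" "(z \<circ> r) \<longlonglongrightarrow> l" using bounded_imp_convergent_subsequence by blast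
  obtain e1 e1' e2 e2' a b where l: "l = (e1, e1', e2, e2', a, b)" by (cases l) auto
  note lims = tendsto_fst[OF r(2)] tendsto_fst[OF tendsto_snd[OF r(2)]] tendsto_fst[OF tendsto_snd[OF tendsto_snd[OF r(2)]]]
    tendsto_fst[OF tendsto_snd[OF tendsto_snd[OF tendsto_snd[OF r(2)]]]]
    tendsto_fst[OF tendsto_snd[OF tendsto_snd[OF tendsto_snd[OF tendsto_snd[OF r(2)]]]]]
    tendsto_snd[OF tendsto_snd[OF tendsto_snd[OF tendsto_snd[OF tendsto_snd[OF r(2)]]]]]
  have lim: "(\<lambda>n. E1 (r n)) \<longlonglongrightarrow> e1" "(\<lambda>n. E1' (r n)) \<longlonglongrightarrow> e1'" "(\<lambda>n. E2 (r n)) \<longlonglongrightarrow> e2" "(\<lambda>n. E2' (r n)) \<longlonglongrightarrow> e2'"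
    "(\<lambda>n. v (r n)) \<longlonglongrightarrow> a" "(\<lambda>n. w (r n)) \<longlonglongrightarrow> b"
    using lims by (simp_all add: l z_def o_def)
  have "(\<lambda>n. E1 (r n) ** E1' (r n)) \<longlonglongrightarrow> e1 ** e1'" "(\<lambda>n. E2 (r n) ** E2' (r n)) \<longlonglongrightarrow> e2 ** e2'"
    by (intro tendsto_matrix_mult lim)+
  then have "e1 ** e1' = mat 1" "e2 ** e2' = mat 1"
    using D1(3) D2(3) by (simp_all add: bounded_inverses_def LIMSEQ_const_iff)
  then have det: "det e1 \<noteq> 0" "det e2 \<noteq> 0"
    by (metis det_I det_mul mult_zero_left zero_neq_one)+
  have Rr: "filterlim (\<lambda>n. R (r n)) at_top sequentially"
    using filterlim_compose[OF Rtop filterlim_subseq[OF r(1)]] .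
  have small: "(\<lambda>n. K / R (r n)) \<longlonglongrightarrow> 0" for K
    using tendsto_mult[OF tendsto_const[of K] tendsto_inverse_0_at_top[OF Rr]] by (simp add: divide_inverse)
  have av: "(\<lambda>n. \<alpha> (r n) i / R (r n)) \<longlonglongrightarrow> a $ i" for i
    using tendsto_vec_nth[OF lim(5), of i] by (simp add: v_def)
  have bw: "(\<lambda>n. \<beta> (r n) i / R (r n)) \<longlonglongrightarrow> b $ i" for i
    using tendsto_vec_nth[OF lim(6), of i] by (simp add: w_def)
  have Rpos: "\<forall>\<^sub>F n in sequentially. R (r n) > 0"
    using Rr unfolding filterlim_at_top_dense by blast
  have sum0: "(\<Sum>i\<in>UNIV. a $ i) = 0"
  proof -
    have "(\<lambda>n. (\<Sum>i\<in>UNIV. \<alpha> (r n) i / R (r n))) \<longlonglongrightarrow> (\<Sum>i\<in>UNIV. a $ i)" by (intro tendsto_sum av)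
    moreover have "(\<lambda>n. (\<Sum>i\<in>UNIV. \<alpha> (r n) i / R (r n))) \<longlonglongrightarrow> 0"
    proof (rule Lim_null_comparison[OF always_eventually small[of "2 * ln F"]], rule allI)
      show "norm (\<Sum>i\<in>UNIV. \<alpha> (r n) i / R (r n)) \<le> 2 * ln F / R (r n)" for n
        unfolding sum_divide_distrib[symmetric] using s\<alpha>[of "r n"] R0[of "r n"] by (simp add: abs_divide divide_right_mono)
    qed
    ultimately show ?thesis using LIMSEQ_unique by blast
  qed
  have sum0': "(\<Sum>i\<in>UNIV. b $ i) = 0"
  proof -
    have "(\<lambda>n. (\<Sum>i\<in>UNIV. \<beta> (r n) i / R (r n))) \<longlonglongrightarrow> (\<Sum>i\<in>UNIV. b $ i)" by (intro tendsto_sum bw)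
    moreover have "(\<lambda>n. (\<Sum>i\<in>UNIV. \<beta> (r n) i / R (r n))) \<longlonglongrightarrow> 0"
    proof (rule Lim_null_comparison[OF always_eventually small[of "2 * ln F"]], rule allI)
      show "norm (\<Sum>i\<in>UNIV. \<beta> (r n) i / R (r n)) \<le> 2 * ln F / R (r n)" for n
        unfolding sum_divide_distrib[symmetric] using s\<beta>[of "r n"] R0[of "r n"] by (simp add: abs_divide divide_right_mono)
    qed
    ultimately show ?thesis using LIMSEQ_unique by blast
  qed
  \<comment> \<open>The normalization by \<open>R\<close> makes the absolute values sum to 1
    eventually, hence in the limit; so the weights cannot all vanish.\<close>
  have "(\<Sum>i\<in>UNIV. \<bar>a $ i\<bar>) + (\<Sum>i\<in>UNIV. \<bar>b $ i\<bar>) = 1"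
  proof -
    have "(\<lambda>n. (\<Sum>i\<in>UNIV. \<bar>\<alpha> (r n) i / R (r n)\<bar>) + (\<Sum>i\<in>UNIV. \<bar>\<beta> (r n) i / R (r n)\<bar>)) \<longlonglongrightarrow> (\<Sum>i\<in>UNIV. \<bar>a $ i\<bar>) + (\<Sum>i\<in>UNIV. \<bar>b $ i\<bar>)"
      by (intro tendsto_intros av bw)
    moreover have "\<forall>\<^sub>F n in sequentially. (\<Sum>i\<in>UNIV. \<bar>\<alpha> (r n) i / R (r n)\<bar>) + (\<Sum>i\<in>UNIV. \<bar>\<beta> (r n) i / R (r n)\<bar>) = 1"
    proof (rule eventually_mono[OF Rpos])
      fix n assume *: "R (r n) > 0"
      have "(\<Sum>i\<in>UNIV. \<bar>\<alpha> (r n) i / R (r n)\<bar>) + (\<Sum>i\<in>UNIV. \<bar>\<beta> (r n) i / R (r n)\<bar>) = R (r n) / R (r n)"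
        using * by (simp add: abs_divide sum_divide_distrib[symmetric] add_divide_distrib[symmetric]) (simp add: R_def)
      then show "(\<Sum>i\<in>UNIV. \<bar>\<alpha> (r n) i / R (r n)\<bar>) + (\<Sum>i\<in>UNIV. \<bar>\<beta> (r n) i / R (r n)\<bar>) = 1" using * by simp
    qed
    ultimately have "(\<lambda>n. 1) \<longlonglongrightarrow> (\<Sum>i\<in>UNIV. \<bar>a $ i\<bar>) + (\<Sum>i\<in>UNIV. \<bar>b $ i\<bar>)"
      using tendsto_cong by fast
    then show ?thesis by (simp add: LIMSEQ_const_iff)
  qed
  then have nz: "(\<exists>i. a $ i \<noteq> 0) \<or> (\<exists>i. b $ i \<noteq> 0)" by (intro disjCI) (rule ccontr, simp)
  have wt: "a $ i + a $ j + b $ k + b $ m \<le> 0" if nz: "tact (e1, e2) c i j k m \<noteq> 0" for i j k m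
  proof -
    define h where "h = tact (e1, e2) c i j k m"
    have hlim: "(\<lambda>n. norm (tact (E1 (r n), E2 (r n)) c i j k m)) \<longlonglongrightarrow> norm h"
      unfolding h_def by (intro tendsto_norm tendsto_tact' tendsto_Pair lim)
    \<comment> \<open>An entry that is nonzero in the limit basis is eventually at least half as
      large in the approximating bases; this turns the bound on the product of pivots into one on
      the sum of logarithms.\<close>
    have "norm h / 2 < norm h" using nz by (simp add: h_def)
    then have ev1: "\<forall>\<^sub>F n in sequentially. norm h / 2 < norm (tact (E1 (r n), E2 (r n)) c i j k m)"
      using order_tendstoD(1)[OF hlim] by blast
    define K where "K = 36 * (C * M ^ 4)"
    have bound: "exp (\<alpha> n i + \<alpha> n j + \<beta> n k + \<beta> n m) * norm (tact (E1 n, E2 n) c i j k m) \<le> K" for n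
    proof -
      have "tact (diagm (d1 n), diagm (d2 n)) (tact (E1 n, E2 n) c) = tact (B1' n, B2' n) (tact (\<gamma> n) c)"
        using matrix_inv_entries_tact[of "(B1' n, B2' n)" "B1' n" "B2' n" "B1 n" "B2 n" "diagm (d1 n) ** E1 n" "diagm (d2 n) ** E2 n" c]
          D1[of n] D2[of n] by (cases "\<gamma> n") (simp add: bounded_inverses_def tact_mult matrix_mul_assoc)
      moreover have "norm (tact (B1' n, B2' n) (tact (\<gamma> n) c) i j k m) \<le> K"
        unfolding tact_def[of "(B1' n, B2' n)"] K_def by (intro Phi_bound) (use \<gamma>(2) ent1 ent2 in auto)
      ultimately have "norm (d1 n i * d1 n j * (d2 n k * d2 n m) * tact (E1 n, E2 n) c i j k m) \<le> K"
        by (simp add: tact_diagm[symmetric])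
      then show ?thesis by (simp add: norm_mult n1 n2 exp_add ac_simps)
    qed
    have "\<forall>\<^sub>F n in sequentially. \<alpha> (r n) i / R (r n) + \<alpha> (r n) j / R (r n) + \<beta> (r n) k / R (r n) + \<beta> (r n) m / R (r n) \<le> ln (K / (norm h / 2)) / R (r n)"
      using ev1 Rpos
    proof eventually_elim
      case (elim n)
      let ?s = "\<alpha> (r n) i + \<alpha> (r n) j + \<beta> (r n) k + \<beta> (r n) m"
      have "exp ?s * (norm h / 2) \<le> exp ?s * norm (tact (E1 (r n), E2 (r n)) c i j k m)"
        using elim(1) by (intro mult_left_mono) auto
      then have "exp ?s * (norm h / 2) \<le> K" using bound[of "r n"] by linarith
      then have "exp ?s \<le> K / (norm h / 2)" using nz by (simp add: h_def field_simps)
      then have "?s \<le> ln (K / (norm h / 2))" by (metis exp_gt_zero ln_exp ln_le_cancel_iff order_less_le_trans)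
      then have "?s / R (r n) \<le> ln (K / (norm h / 2)) / R (r n)" using elim(2) by (intro divide_right_mono) auto
      then show ?case by (simp add: add_divide_distrib)
    qed
    moreover have "(\<lambda>n. \<alpha> (r n) i / R (r n) + \<alpha> (r n) j / R (r n) + \<beta> (r n) k / R (r n) + \<beta> (r n) m / R (r n)) \<longlonglongrightarrow> a $ i + a $ j + b $ k + b $ m"
      by (intro tendsto_intros av bw)
    ultimately show ?thesis using small tendsto_le[OF sequentially_bot] by blast
  qed
  show thesis
    by (rule that[of "(e1, e2)" "\<lambda>i. a $ i" "\<lambda>k. b $ k"]) (use det sum0 sum0' wt nz in \<open>auto simp: weights_def\<close>)
qed

section \<open>Jets of formal power series in three variables\<close>

text \<open>In the iterated series z is the outermost variable, which reverses the order of the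
  indices.\<close>

definition cf :: "fps3 \<Rightarrow> nat \<Rightarrow> nat \<Rightarrow> nat \<Rightarrow> complex" where
  "cf s i j k = fps_nth (fps_nth (fps_nth s k) j) i"

definition fconst :: "complex \<Rightarrow> fps3" where
  "fconst c = fps_const (fps_const (fps_const c))"

definition uvar :: "3 \<Rightarrow> fps3" where
  "uvar a = (if a = 1 then fps_const (fps_const fps_X) else if a = 2 then fps_const fps_X else fps_X)"

lemma uvar_simps: "uvar 1 = fps_const (fps_const fps_X)" "uvar 2 = fps_const fps_X" "uvar 3 = fps_X"
  by (simp_all add: uvar_def)

lemma cf_eqI: "(\<And>i j k. cf s i j k = cf t i j k) \<Longrightarrow> s = t"
  by (simp add: fps_eq_iff cf_def)

lemma cf_simps [simp]:
  "cf 0 i j k = 0" "cf (s + t) i j k = cf s i j k + cf t i j k" "cf (s - t) i j k = cf s i j k - cf t i j k"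
  "cf (- s) i j k = - cf s i j k"
  by (simp_all add: cf_def)

lemma cf_sum: "cf (sum f A) i j k = (\<Sum>a\<in>A. cf (f a) i j k)"
  by (induct A rule: infinite_finite_induct) simp_all

lemma cf_fconst: "cf (fconst c) i j k = (if i = 0 \<and> j = 0 \<and> k = 0 then c else 0)"
  by (simp add: cf_def fconst_def)

lemma cf_mult: "cf (s * t) i j k = (\<Sum>k'=0..k. \<Sum>j'=0..j. \<Sum>i'=0..i. cf s i' j' k' * cf t (i - i') (j - j') (k - k'))"
  by (simp add: cf_def fps_mult_nth fps_sum_nth)

lemma cf_fconst_mult: "cf (fconst c * s) i j k = c * cf s i j k"
  by (simp add: cf_def fconst_def)

lemma cf_uvar_mult:
  "cf (uvar 1 * s) i j k = (if i = 0 then 0 else cf s (i - 1) j k)"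
  "cf (uvar 2 * s) i j k = (if j = 0 then 0 else cf s i (j - 1) k)"
  "cf (uvar 3 * s) i j k = (if k = 0 then 0 else cf s i j (k - 1))"
  by (simp_all add: cf_def uvar_simps)

lemma cf_uvar: "cf (uvar a) i j k = (if (i, j, k) = (if a = 1 then (1,0,0) else if a = 2 then (0,1,0) else (0,0,1)) then 1 else 0)"
  by (simp add: cf_def uvar_def fps_X_def)

lemma ring_morph_fconst: "ring_morph fconst"
  by (simp add: ring_morph_def fconst_def)

text \<open>The power (x, y, z)^n of the maximal ideal, as the series of order at least
  \<open>n\<close>. All approximations are measured by these ideals.\<close>

definition jet :: "nat \<Rightarrow> fps3 set" where
  "jet n = {s. \<forall>i j k. i + j + k < n \<longrightarrow> cf s i j k = 0}"

lemma jet_0 [simp]: "s \<in> jet 0"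
  by (simp add: jet_def)

lemma jet_zero [simp]: "0 \<in> jet n"
  by (simp add: jet_def)

lemma jet_mono: "s \<in> jet m \<Longrightarrow> n \<le> m \<Longrightarrow> s \<in> jet n"
  by (auto simp: jet_def)

lemma jet_add: "s \<in> jet n \<Longrightarrow> t \<in> jet n \<Longrightarrow> s + t \<in> jet n"
  and jet_diff: "s \<in> jet n \<Longrightarrow> t \<in> jet n \<Longrightarrow> s - t \<in> jet n"
  and jet_uminus: "s \<in> jet n \<Longrightarrow> - s \<in> jet n"
  by (auto simp: jet_def)

lemma jet_sum: "(\<And>a. a \<in> A \<Longrightarrow> f a \<in> jet n) \<Longrightarrow> sum f A \<in> jet n"
  by (auto simp: jet_def cf_sum)

lemma jet_mult: "s \<in> jet m \<Longrightarrow> t \<in> jet n \<Longrightarrow> s * t \<in> jet (m + n)"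
  unfolding jet_def
proof (clarsimp simp: cf_mult)
  fix i j k :: nat
  assume *: "\<forall>i j k. i + j + k < m \<longrightarrow> cf s i j k = 0" "\<forall>i j k. i + j + k < n \<longrightarrow> cf t i j k = 0" "i + j + k < m + n"
  have "cf s i' j' k' * cf t (i - i') (j - j') (k - k') = 0" if "i' \<le> i" "j' \<le> j" "k' \<le> k" for i' j' k'
  proof (cases "i' + j' + k' < m")
    case False
    then have "(i - i') + (j - j') + (k - k') < n" using that *(3) by linarith
    then show ?thesis using *(2) by simp
  qed (use *(1) in simp)
  then show "(\<Sum>k'=0..k. \<Sum>j'=0..j. \<Sum>i'=0..i. cf s i' j' k' * cf t (i - i') (j - j') (k - k')) = 0"
    by (intro sum.neutral ballI) simp
qed

lemma jet_mult_left: "t \<in> jet n \<Longrightarrow> s * t \<in> jet n"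
  using jet_mult[of s 0 t n] by simp

lemma jet_mult_right: "t \<in> jet n \<Longrightarrow> t * s \<in> jet n"
  using jet_mult_left[of t n s] by (simp add: mult.commute)

lemma jet_power: "s \<in> jet m \<Longrightarrow> s ^ n \<in> jet (n * m)"
  by (induct n) (simp_all add: jet_mult)

lemma jet_all_zero: "(\<And>n. s \<in> jet n) \<Longrightarrow> s = 0"
proof (rule cf_eqI)
  fix i j k assume "\<And>n. s \<in> jet n"
  from this[of "i + j + k + 1"] show "cf s i j k = cf 0 i j k" by (simp add: jet_def)
qed

lemma uvar_jet: "uvar a \<in> jet 1"
  by (auto simp: jet_def cf_uvar)

lemma jet_1_iff: "s \<in> jet 1 \<longleftrightarrow> cf s 0 0 0 = 0"
  by (auto simp: jet_def)

text \<open>Each monomial is divided by one variable occurring in it: by z if possible, else by y,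
  else by x.\<close>

lemma jet_Suc_decomp:
  assumes "s \<in> jet (Suc n)"
  obtains g where "\<And>a. g a \<in> jet n" "s = (\<Sum>a\<in>UNIV. uvar a * g a)"
proof -
  define g1 :: fps3 where "g1 = fps_const (fps_const (fps_shift 1 (fps_nth (fps_nth s 0) 0)))"
  define g2 :: fps3 where "g2 = fps_const (fps_shift 1 (fps_nth s 0))"
  define g3 :: fps3 where "g3 = fps_shift 1 s"
  have c: "cf g1 i j k = (if j = 0 \<and> k = 0 then cf s (Suc i) 0 0 else 0)" "cf g2 i j k = (if k = 0 then cf s i (Suc j) 0 else 0)"
    "cf g3 i j k = cf s i j (Suc k)" for i j k
    by (simp_all add: cf_def g1_def g2_def g3_def)
  define g where "g = (\<lambda>a::3. if a = 1 then g1 else if a = 2 then g2 else g3)"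
  have s: "cf s i j k = 0" if "i + j + k \<le> n" for i j k using assms that by (simp add: jet_def)
  have "g1 \<in> jet n" "g2 \<in> jet n" "g3 \<in> jet n" by (auto simp: jet_def c s)
  then have "g a \<in> jet n" for a by (simp add: g_def)
  moreover have "s = (\<Sum>a\<in>UNIV. uvar a * g a)"
  proof (rule cf_eqI)
    fix i j k
    show "cf s i j k = cf (\<Sum>a\<in>UNIV. uvar a * g a) i j k"
      unfolding sum_3 using s[of 0 0 0] by (cases i; cases j; cases k) (simp_all add: g_def cf_uvar_mult c)
  qed
  ultimately show thesis by (rule that)
qed

text \<open>Completeness of the power series ring: a coefficient of total degree m is the same in
  all \<open>s n\<close> with n > m, and the limit takes it from the first of these.\<close>

lemma jet_limit:
  assumes "\<And>n. s (Suc n) - s n \<in> jet n"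
  obtains t where "\<And>n. t - s n \<in> jet n"
proof -
  have diff: "s (n + m) - s n \<in> jet n" for n m
  proof (induct m)
    case (Suc m)
    have "s (Suc (n + m)) - s (n + m) \<in> jet n" by (rule jet_mono[OF assms]) simp
    from jet_add[OF this Suc] show ?case by simp
  qed simp
  define t :: fps3 where "t = Abs_fps (\<lambda>k. Abs_fps (\<lambda>j. Abs_fps (\<lambda>i. cf (s (Suc (i + j + k))) i j k)))"
  have t: "cf t i j k = cf (s (Suc (i + j + k))) i j k" for i j k by (simp add: t_def cf_def)
  have "t - s n \<in> jet n" for n
    unfolding jet_def
  proof (clarsimp simp: t)
    fix i j k assume "i + j + k < n"
    then have "s (Suc (i + j + k) + (n - Suc (i + j + k))) - s (Suc (i + j + k)) \<in> jet (Suc (i + j + k))" by (intro diff)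
    moreover have "Suc (i + j + k) + (n - Suc (i + j + k)) = n" using \<open>i + j + k < n\<close> by simp
    ultimately have "s n - s (Suc (i + j + k)) \<in> jet (Suc (i + j + k))" by (simp only:)
    then show "cf (s (Suc (i + j + k))) i j k = cf (s n) i j k" by (simp add: jet_def)
  qed
  then show thesis by (rule that)
qed

lemma fps_unit:
  assumes "fps_nth f 0 * y = 1"
  obtains g where "f * g = (1 :: 'a::comm_ring_1 fps)"
  using fps_right_inverse[OF assms] by blast

lemma fps3_unit:
  assumes "s \<notin> jet 1"
  obtains t :: fps3 where "s * t = 1"
proof -
  have "fps_nth (fps_nth (fps_nth s 0) 0) 0 * inverse (fps_nth (fps_nth (fps_nth s 0) 0) 0) = 1"
    using assms unfolding jet_1_iff cf_def by simp
  then obtain a where "fps_nth (fps_nth s 0) 0 * a = 1" by (rule fps_unit)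
  then obtain b where "fps_nth s 0 * b = 1" by (rule fps_unit)
  then show thesis using that by (rule fps_unit)
qed

section \<open>The quadric and ideals modulo a power series\<close>

definition qform :: fps3 where
  "qform = (\<Sum>a\<in>UNIV. uvar a ^ 2)"

lemma qform_An: "qform = An_equation 1"
  by (simp only: qform_def sum_3 An_equation_def uvar_simps one_add_one)

text \<open>The term x^2 serves as leading term: the coefficient of the product at (i + 2, j, k) is
  that of \<open>g\<close> at (i, j, k) plus coefficients of \<open>g\<close> of the same total
  degree with smaller j + k.\<close>

lemma qform_cancel:
  assumes "qform * g \<in> jet (n + 2)"
  shows "g \<in> jet n"
proof -
  have q: "cf (qform * g) i j k = (if i < 2 then 0 else cf g (i - 2) j k) + (if j < 2 then 0 else cf g i (j - 2) k)
     + (if k < 2 then 0 else cf g i j (k - 2))" for i j k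
    by (auto simp: qform_def sum_3 distrib_right power2_eq_square mult.assoc cf_uvar_mult numeral_2_eq_2)
  have "cf g i j k = 0" if "i + j + k < n" for i j k
    using that
  proof (induct "j + k" arbitrary: i j k rule: less_induct)
    case less
    have "cf (qform * g) (i + 2) j k = 0" using assms less(2) by (simp add: jet_def)
    moreover have "cf g (i + 2) (j - 2) k = 0" if "\<not> j < 2" using less(1)[of "j - 2" k "i + 2"] less(2) that by simp
    moreover have "cf g (i + 2) j (k - 2) = 0" if "\<not> k < 2" using less(1)[of j "k - 2" "i + 2"] less(2) that by simp
    ultimately show ?case unfolding q by (auto split: if_splits)
  qed
  then show ?thesis by (simp add: jet_def)
qed

text \<open>The ideal (F) + (x, y, z)^n, which is the n-th power of the maximal ideal of the
  quotient by \<open>F\<close>, pulled back to power series.\<close>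

definition jetmod :: "fps3 \<Rightarrow> nat \<Rightarrow> fps3 set" where
  "jetmod F n = {s. \<exists>g. s - F * g \<in> jet n}"

lemma jetmod_jet: "s \<in> jet n \<Longrightarrow> s \<in> jetmod F n"
  unfolding jetmod_def by (auto intro: exI[of _ 0])

lemma jetmod_add: "s \<in> jetmod F n \<Longrightarrow> t \<in> jetmod F n \<Longrightarrow> s + t \<in> jetmod F n"
proof -
  assume "s \<in> jetmod F n" "t \<in> jetmod F n"
  then obtain g h where "s - F * g \<in> jet n" "t - F * h \<in> jet n" by (auto simp: jetmod_def)
  then have "(s - F * g) + (t - F * h) \<in> jet n" by (rule jet_add)
  then have "(s + t) - F * (g + h) \<in> jet n" by (simp add: algebra_simps)
  then show ?thesis by (auto simp: jetmod_def)
qed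

lemma jetmod_mult_left: "t \<in> jetmod F n \<Longrightarrow> s * t \<in> jetmod F n"
proof -
  assume "t \<in> jetmod F n"
  then obtain g where "t - F * g \<in> jet n" by (auto simp: jetmod_def)
  then have "s * (t - F * g) \<in> jet n" by (rule jet_mult_left)
  then have "s * t - F * (s * g) \<in> jet n" by (simp add: algebra_simps)
  then show ?thesis by (auto simp: jetmod_def)
qed

lemma jetmod_uminus: "s \<in> jetmod F n \<Longrightarrow> - s \<in> jetmod F n"
  using jetmod_mult_left[of s F n "- 1"] by simp

lemma jetmod_diff: "s \<in> jetmod F n \<Longrightarrow> t \<in> jetmod F n \<Longrightarrow> s - t \<in> jetmod F n"
  using jetmod_add[of s F n "- t"] jetmod_uminus by simp

lemma jetmod_multiple: "F * g \<in> jetmod F n"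
  by (auto simp: jetmod_def intro: exI[of _ g])

lemma jetmod_mult:
  assumes "s \<in> jetmod F m" "t \<in> jetmod F n"
  shows "s * t \<in> jetmod F (m + n)"
proof -
  obtain g h where gh: "s - F * g \<in> jet m" "t - F * h \<in> jet n" using assms by (auto simp: jetmod_def)
  have "(s - F * g) * (t - F * h) \<in> jet (m + n)" by (rule jet_mult[OF gh])
  moreover have "s * t - F * (g * t + h * (s - F * g)) = (s - F * g) * (t - F * h)" by (simp add: algebra_simps)
  ultimately have "s * t - F * (g * t + h * (s - F * g)) \<in> jet (m + n)" by (simp only:)
  then show ?thesis unfolding jetmod_def by blast
qed

lemma jetmod_mono: "s \<in> jetmod F m \<Longrightarrow> n \<le> m \<Longrightarrow> s \<in> jetmod F n"
  unfolding jetmod_def using jet_mono by blast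

lemma jetmod_0: "s \<in> jetmod F 0"
  by (simp add: jetmod_def)

text \<open>A series \<open>F\<close> that starts in degree 2 leaves no trace below that
  degree.\<close>

lemma jetmod_low:
  assumes "F \<in> jet 2" "n \<le> 2"
  shows "s \<in> jetmod F n \<longleftrightarrow> s \<in> jet n"
proof
  assume "s \<in> jetmod F n"
  then obtain g where "s - F * g \<in> jet n" by (auto simp: jetmod_def)
  moreover have "F * g \<in> jet n" using assms by (intro jet_mult_right) (rule jet_mono)
  ultimately have "(s - F * g) + F * g \<in> jet n" by (rule jet_add)
  then show "s \<in> jet n" by simp
qed (rule jetmod_jet)

text \<open>The ideal of the quadric is closed: the quotients found to increasing precision form a
  Cauchy sequence by \<open>qform_cancel\<close>, and their limit is an exact quotient.\<close>

lemma jetmod_qform_closed: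
  assumes "\<And>n. s \<in> jetmod qform n"
  obtains g where "s = qform * g"
proof -
  \<comment> \<open>Precision \<open>n + 2\<close> of the remainder gives precision \<open>n\<close>
    of the quotient.\<close>
  have "\<forall>n. \<exists>g. s - qform * g \<in> jet (n + 2)" using assms by (auto simp: jetmod_def)
  then obtain g where g: "\<And>n. s - qform * g n \<in> jet (n + 2)" by metis
  have "g (Suc n) - g n \<in> jet n" for n
  proof (rule qform_cancel)
    have "s - qform * g (Suc n) \<in> jet (n + 2)" by (rule jet_mono[OF g]) simp
    with g[of n] have "(s - qform * g n) - (s - qform * g (Suc n)) \<in> jet (n + 2)" by (rule jet_diff)
    then show "qform * (g (Suc n) - g n) \<in> jet (n + 2)" by (simp add: algebra_simps)
  qed
  then obtain h where h: "\<And>n. h - g n \<in> jet n" by (rule jet_limit) blast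
  have "s - qform * h \<in> jet n" for n
  proof -
    have "s - qform * g n \<in> jet n" by (rule jet_mono[OF g]) simp
    moreover have "qform * (h - g n) \<in> jet n" by (intro jet_mult_left h)
    ultimately have "(s - qform * g n) - qform * (h - g n) \<in> jet n" by (rule jet_diff)
    then show ?thesis by (simp add: algebra_simps)
  qed
  then have "s - qform * h = 0" by (rule jet_all_zero)
  then show thesis using that[of h] by simp
qed

text \<open>A formal Morse lemma by Newton iteration: each step divides the error by the coordinates and
  halves the quotients.\<close>

lemma formal_morse:
  fixes G :: "(3 \<Rightarrow> fps3) \<Rightarrow> fps3"
  assumes G3: "\<And>\<eta>. (\<And>a. \<eta> a \<in> jet 1) \<Longrightarrow> G \<eta> \<in> jet 3"
    and G: "\<And>n \<eta> \<eta>'. (\<And>a. \<eta> a \<in> jet 1) \<Longrightarrow> (\<And>a. \<eta>' a \<in> jet 1) \<Longrightarrow> (\<And>a. \<eta>' a - \<eta> a \<in> jet (n + 1)) \<Longrightarrow> G \<eta>' - G \<eta> \<in> jet (n + 3)"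
  obtains \<eta> where "\<And>a. \<eta> a - uvar a \<in> jet 2" "(\<Sum>a\<in>UNIV. \<eta> a ^ 2) + G \<eta> = qform"
proof -
  define E where "E = (\<lambda>\<eta>. (\<Sum>a\<in>UNIV. \<eta> a ^ 2) + G \<eta> - qform)"
  define P where "P = (\<lambda>n \<eta>. (\<forall>a. \<eta> a - uvar a \<in> jet 2) \<and> E \<eta> \<in> jet (n + 3))"
  have jet1: "\<eta> a \<in> jet 1" if "\<eta> a - uvar a \<in> jet 2" for \<eta> :: "3 \<Rightarrow> fps3" and a
    using jet_add[OF jet_mono[OF that] uvar_jet[of a]] by simp
  have step: "\<exists>\<eta>'. P (Suc n) \<eta>' \<and> (\<forall>a. \<eta>' a - \<eta> a \<in> jet (n + 2))" if P: "P n \<eta>" for n \<eta>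
  proof -
    have \<eta>: "\<eta> a - uvar a \<in> jet 2" for a using P by (simp add: P_def)
    have "E \<eta> \<in> jet (Suc (n + 2))" using P by (simp add: P_def numeral_3_eq_3)
    then obtain \<epsilon> where \<epsilon>: "\<And>a. \<epsilon> a \<in> jet (n + 2)" "E \<eta> = (\<Sum>a\<in>UNIV. uvar a * \<epsilon> a)" by (rule jet_Suc_decomp) blast
    define h where "h = fconst (1 / 2)"
    have h: "h + h = 1" by (simp add: h_def fconst_def)
    define \<eta>' where "\<eta>' = (\<lambda>a. \<eta> a - h * \<epsilon> a)"
    have d: "\<eta>' a - \<eta> a \<in> jet (n + 2)" for a
      using jet_uminus[OF jet_mult_left[OF \<epsilon>(1)[of a], of h]] by (simp add: \<eta>'_def)
    have \<eta>': "\<eta>' a - uvar a \<in> jet 2" for a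
      using jet_add[OF jet_mono[OF d[of a]] \<eta>[of a]] by simp
    have Gd: "G \<eta>' - G \<eta> \<in> jet (n + 4)"
      using G[of \<eta> \<eta>' "n + 1"] jet1[of \<eta>, OF \<eta>] jet1[of \<eta>', OF \<eta>'] d by (simp add: numeral_eq_Suc)
    have sq: "\<eta>' a ^ 2 = \<eta> a ^ 2 - (h + h) * (\<eta> a * \<epsilon> a) + (h * \<epsilon> a) ^ 2" for a
      by (simp add: \<eta>'_def power2_eq_square algebra_simps)
    have "E \<eta>' = E \<eta> - (\<Sum>a\<in>UNIV. \<eta> a * \<epsilon> a) + (\<Sum>a\<in>UNIV. (h * \<epsilon> a) ^ 2) + (G \<eta>' - G \<eta>)"
      unfolding E_def sq h by (simp add: sum.distrib sum_subtractf)
    also have "E \<eta> - (\<Sum>a\<in>UNIV. \<eta> a * \<epsilon> a) = - (\<Sum>a\<in>UNIV. (\<eta> a - uvar a) * \<epsilon> a)"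
      unfolding \<epsilon>(2) by (simp add: left_diff_distrib sum_subtractf)
    finally have E': "E \<eta>' = - (\<Sum>a\<in>UNIV. (\<eta> a - uvar a) * \<epsilon> a) + (\<Sum>a\<in>UNIV. (h * \<epsilon> a) ^ 2) + (G \<eta>' - G \<eta>)" .
    \<comment> \<open>Halving has cancelled the leading error. What is left is small because \<eta>
      agrees with the variables up to order 2 while \<epsilon> has order n + 2; the squares even
      have order 2 (n + 2).\<close>
    have "(\<eta> a - uvar a) * \<epsilon> a \<in> jet (n + 4)" for a
      using jet_mult[OF \<eta>[of a] \<epsilon>(1)[of a]] by (simp add: add.commute numeral_eq_Suc)
    moreover have "(h * \<epsilon> a) ^ 2 \<in> jet (n + 4)" for a
      by (rule jet_mono[OF jet_power[OF jet_mult_left[OF \<epsilon>(1)[of a]]]]) simp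
    ultimately have "E \<eta>' \<in> jet (n + 4)"
      unfolding E' by (intro jet_add Gd jet_uminus jet_sum)
    then have "P (Suc n) \<eta>'" using \<eta>' by (simp add: P_def numeral_eq_Suc)
    then show ?thesis using d by blast
  qed
  have "E uvar \<in> jet 3"
    using G3[of uvar, OF uvar_jet] by (simp add: E_def qform_def)
  then have "P 0 uvar" by (simp add: P_def)
  then obtain \<eta> where \<eta>: "\<And>n. P n (\<eta> n)" "\<And>n. \<forall>a. \<eta> (Suc n) a - \<eta> n a \<in> jet (n + 2)"
    using dependent_nat_choice[of P "\<lambda>n \<eta> \<eta>'. \<forall>a. \<eta>' a - \<eta> a \<in> jet (n + 2)"] step by metis
  have "\<exists>t. \<forall>n. t - \<eta> n a \<in> jet n" for a
  proof -
    have "\<eta> (Suc n) a - \<eta> n a \<in> jet n" for n using \<eta>(2)[of n] jet_mono[of _ "n + 2" n] by simp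
    then show ?thesis using jet_limit[of "\<lambda>n. \<eta> n a"] by metis
  qed
  then obtain \<theta> where \<theta>: "\<And>a n. \<theta> a - \<eta> n a \<in> jet n" by metis
  have \<theta>u: "\<theta> a - uvar a \<in> jet 2" for a
    using jet_add[OF \<theta>[of a 2], of "\<eta> 2 a - uvar a"] \<eta>(1)[of 2] by (simp add: P_def)
  have "E \<theta> \<in> jet n" for n
  proof -
    have d: "\<theta> a - \<eta> (Suc n) a \<in> jet (n + 1)" for a using \<theta>[of a "Suc n"] by simp
    have \<eta>u: "\<eta> (Suc n) a - uvar a \<in> jet 2" for a using \<eta>(1)[of "Suc n"] by (simp add: P_def)
    have "G \<theta> - G (\<eta> (Suc n)) \<in> jet (n + 3)"
      by (rule G) (use jet1[of \<theta>, OF \<theta>u] jet1[of "\<eta> (Suc n)", OF \<eta>u] d in auto)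
    then have 1: "G \<theta> - G (\<eta> (Suc n)) \<in> jet n" by (rule jet_mono) simp
    have "(\<theta> a - \<eta> (Suc n) a) * (\<theta> a + \<eta> (Suc n) a) \<in> jet n" for a
      by (rule jet_mult_right, rule jet_mono[OF d]) simp
    then have 2: "(\<Sum>a\<in>UNIV. (\<theta> a - \<eta> (Suc n) a) * (\<theta> a + \<eta> (Suc n) a)) \<in> jet n" by (intro jet_sum)
    have 3: "E (\<eta> (Suc n)) \<in> jet n" using \<eta>(1)[of "Suc n"] jet_mono[of _ "Suc n + 3" n] by (simp add: P_def)
    have "E \<theta> = E (\<eta> (Suc n)) + (\<Sum>a\<in>UNIV. (\<theta> a - \<eta> (Suc n) a) * (\<theta> a + \<eta> (Suc n) a)) + (G \<theta> - G (\<eta> (Suc n)))"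
      unfolding E_def by (simp add: sum_subtractf[symmetric] power2_eq_square algebra_simps)
        (simp add: sum_subtractf[symmetric] sum.distrib[symmetric] algebra_simps)
    then show ?thesis using jet_add[OF jet_add[OF 3 2] 1] by simp
  qed
  then have "E \<theta> = 0" by (rule jet_all_zero)
  then show thesis using that[of \<theta>] \<theta>u by (simp add: E_def)
qed

section \<open>Completions of quotients of local rings\<close>

lemma ring_on_simps [simp]:
  "carrier (ring_on C) = C" "mult (ring_on C) = (*)" "one (ring_on C) = 1" "zero (ring_on C) = 0" "add (ring_on C) = (+)"
  by (simp_all add: ring_on_def)

lemma ring_on_cring:
  assumes "0 \<in> C" "1 \<in> C" "\<And>a b. a \<in> C \<Longrightarrow> b \<in> C \<Longrightarrow> a + b \<in> C" "\<And>a b. a \<in> C \<Longrightarrow> b \<in> C \<Longrightarrow> a * b \<in> C"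
    "\<And>a. a \<in> C \<Longrightarrow> - a \<in> C"
  shows "cring (ring_on C)"
  by (intro cringI abelian_groupI comm_monoidI)
     (use assms in \<open>auto simp: algebra_simps intro: bexI[of _ "- _"]\<close>)

lemma ring_on_minus:
  assumes "cring (ring_on C)" "a \<in> C" "b \<in> C" "- b \<in> C"
  shows "a \<ominus>\<^bsub>ring_on C\<^esub> b = a - b"
proof -
  interpret cring "ring_on C" by fact
  have "\<ominus>\<^bsub>ring_on C\<^esub> b = - b" by (rule minus_equality) (use assms in auto)
  then show ?thesis by (simp add: a_minus_def)
qed

context ideal
begin

lemma quot_carrier: "carrier (R Quot I) = (\<lambda>a. I +> a) ` carrier R"
  by (auto simp: FactRing_def A_RCOSETS_def')

lemma quot_mult: "a \<in> carrier R \<Longrightarrow> b \<in> carrier R \<Longrightarrow> (I +> a) \<otimes>\<^bsub>R Quot I\<^esub> (I +> b) = I +> (a \<otimes> b)"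
  by (simp add: FactRing_def rcoset_mult_add)

lemma quot_add: "a \<in> carrier R \<Longrightarrow> b \<in> carrier R \<Longrightarrow> (I +> a) \<oplus>\<^bsub>R Quot I\<^esub> (I +> b) = I +> (a \<oplus> b)"
  by (simp add: FactRing_def a_rcos_sum)

lemma quot_one: "\<one>\<^bsub>R Quot I\<^esub> = I +> \<one>"
  by (simp add: FactRing_def)

lemma quot_eq: "a \<in> carrier R \<Longrightarrow> b \<in> carrier R \<Longrightarrow> I +> a = I +> b \<longleftrightarrow> a \<ominus> b \<in> I"
  using quotient_eq_iff_same_a_r_cos[OF is_ideal] by blast

lemma quot_mem: "a \<in> carrier R \<Longrightarrow> b \<in> carrier R \<Longrightarrow> b \<in> I +> a \<longleftrightarrow> b \<ominus> a \<in> I"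
  by (rule a_rcos_module_minus[OF ring_axioms])

lemma quot_subset: "a \<in> carrier R \<Longrightarrow> I +> a \<subseteq> carrier R"
  by (rule a_r_coset_subset_G[OF a_subset])

end

text \<open>The hypotheses express that \<open>C\<close> is local with maximal ideal generated by \<open>w 1, w 2, w 3\<close>, and that
  \<open>\<Theta>\<close> is the expansion in regular parameters.\<close>

locale expansion =
  fixes C :: "'a::comm_ring_1 set" and I :: "'a set" and \<Theta> :: "'a \<Rightarrow> fps3" and \<iota> :: "complex \<Rightarrow> 'a"
    and F :: fps3 and \<phi> :: 'a and w :: "3 \<Rightarrow> 'a"
  assumes C_0: "0 \<in> C" and C_1: "1 \<in> C" and C_add: "\<And>a b. a \<in> C \<Longrightarrow> b \<in> C \<Longrightarrow> a + b \<in> C"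
    and C_mult: "\<And>a b. a \<in> C \<Longrightarrow> b \<in> C \<Longrightarrow> a * b \<in> C" and C_uminus: "\<And>a. a \<in> C \<Longrightarrow> - a \<in> C"
    and C_const: "\<iota> c \<in> C"
    and T_1: "\<Theta> 1 = 1" and T_add: "\<And>a b. a \<in> C \<Longrightarrow> b \<in> C \<Longrightarrow> \<Theta> (a + b) = \<Theta> a + \<Theta> b"
    and T_mult: "\<And>a b. a \<in> C \<Longrightarrow> b \<in> C \<Longrightarrow> \<Theta> (a * b) = \<Theta> a * \<Theta> b"
    and T_const: "\<Theta> (\<iota> c) = fconst c"
    and I_sub: "I \<subseteq> C" and I_0: "0 \<in> I" and I_add: "\<And>a b. a \<in> I \<Longrightarrow> b \<in> I \<Longrightarrow> a + b \<in> I"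
    and I_mult: "\<And>a b. a \<in> C \<Longrightarrow> b \<in> I \<Longrightarrow> a * b \<in> I"
    and T_I: "\<And>a. a \<in> I \<Longrightarrow> \<exists>g. \<Theta> a = F * g"
    and \<phi>: "\<phi> \<in> I" "\<Theta> \<phi> = F" and F_jet: "F \<in> jet 2"
    and w_C: "w i \<in> C" and w_jet: "\<Theta> (w i) - uvar i \<in> jet 2"
    and generators: "\<And>a. a \<in> C \<Longrightarrow> \<Theta> a \<in> jet 1 \<Longrightarrow> \<exists>g. (\<forall>i. g i \<in> C) \<and> a = (\<Sum>i\<in>UNIV. w i * g i)"
    and units: "\<And>a. a \<in> C \<Longrightarrow> \<Theta> a \<notin> jet 1 \<Longrightarrow> \<exists>b\<in>C. a * b = 1"
begin

abbreviation "A \<equiv> ring_on C"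
abbreviation "R \<equiv> A Quot I"

lemma C_diff: "a \<in> C \<Longrightarrow> b \<in> C \<Longrightarrow> a - b \<in> C"
  using C_add[of a "- b"] C_uminus by simp

lemma C_sum: "(\<And>i. i \<in> S \<Longrightarrow> g i \<in> C) \<Longrightarrow> sum g S \<in> C"
  by (induct S rule: infinite_finite_induct) (simp_all add: C_0 C_add)

lemma C_power: "a \<in> C \<Longrightarrow> a ^ n \<in> C"
  by (induct n) (simp_all add: C_1 C_mult)

lemma T_0: "\<Theta> 0 = 0"
  using T_add[OF C_0 C_0] by simp

lemma T_uminus: "a \<in> C \<Longrightarrow> \<Theta> (- a) = - \<Theta> a"
  using T_add[of "- a" a] T_0 C_uminus by (simp add: eq_neg_iff_add_eq_0)

lemma T_diff: "a \<in> C \<Longrightarrow> b \<in> C \<Longrightarrow> \<Theta> (a - b) = \<Theta> a - \<Theta> b"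
  using T_add[of a "- b"] T_uminus[of b] C_uminus by simp

lemma T_sum: "(\<And>i. i \<in> S \<Longrightarrow> g i \<in> C) \<Longrightarrow> \<Theta> (sum g S) = (\<Sum>i\<in>S. \<Theta> (g i))"
  by (induct S rule: infinite_finite_induct) (simp_all add: T_0 T_add C_sum)

lemma T_power: "a \<in> C \<Longrightarrow> \<Theta> (a ^ n) = \<Theta> a ^ n"
  by (induct n) (simp_all add: T_1 T_mult C_power)

lemma w_jet_1: "\<Theta> (w i) \<in> jet 1"
proof -
  have "\<Theta> (w i) - uvar i \<in> jet 1" using w_jet by (rule jet_mono) simp
  from jet_add[OF this uvar_jet[of i]] show ?thesis by simp
qed

lemma A_cring: "cring A"
  by (rule ring_on_cring) (use C_0 C_1 C_add C_mult C_uminus in auto)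

lemma A_minus: "a \<in> C \<Longrightarrow> b \<in> C \<Longrightarrow> a \<ominus>\<^bsub>A\<^esub> b = a - b"
  by (rule ring_on_minus[OF A_cring]) (use C_uminus in auto)

lemma I_ideal: "ideal I A"
proof (rule idealI)
  interpret cring A by (rule A_cring)
  show "ring A" by (rule ring_axioms)
  have "\<ominus>\<^bsub>A\<^esub> b = - b" if "b \<in> C" for b by (rule minus_equality) (use that C_uminus in auto)
  moreover have "- b \<in> I" if "b \<in> I" for b
    using I_mult[OF C_uminus[OF C_1] that] by simp
  ultimately show "subgroup I (add_monoid A)"
    using I_sub I_0 I_add by (intro add.subgroupI) (auto simp: a_inv_def[symmetric])
  show "x \<otimes>\<^bsub>A\<^esub> a \<in> I" "a \<otimes>\<^bsub>A\<^esub> x \<in> I" if "a \<in> I" "x \<in> carrier A" for a x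
    using I_mult[of x a] that by (simp_all add: mult.commute)
qed

sublocale IA: ideal I A by (rule I_ideal)

definition cl :: "'a \<Rightarrow> 'a set" where
  "cl a = I +>\<^bsub>A\<^esub> a"

lemma R_carrier: "carrier R = cl ` C"
  by (simp add: IA.quot_carrier cl_def[abs_def])

lemma cl_mult: "a \<in> C \<Longrightarrow> b \<in> C \<Longrightarrow> cl a \<otimes>\<^bsub>R\<^esub> cl b = cl (a * b)"
  using IA.quot_mult[of a b] by (simp add: cl_def)

lemma cl_add: "a \<in> C \<Longrightarrow> b \<in> C \<Longrightarrow> cl a \<oplus>\<^bsub>R\<^esub> cl b = cl (a + b)"
  using IA.quot_add[of a b] by (simp add: cl_def)

lemma cl_one: "\<one>\<^bsub>R\<^esub> = cl 1"
  by (simp add: IA.quot_one cl_def)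

lemma cl_eq: "a \<in> C \<Longrightarrow> b \<in> C \<Longrightarrow> cl a = cl b \<longleftrightarrow> a - b \<in> I"
  using IA.quot_eq[of a b] by (simp add: cl_def A_minus)

lemma R_cring: "cring R"
  by (rule IA.quotient_is_cring[OF A_cring])

sublocale Rr: cring R by (rule R_cring)

lemma cl_zero: "\<zero>\<^bsub>R\<^esub> = cl 0"
proof -
  have "cl 0 \<oplus>\<^bsub>R\<^esub> cl 0 = cl 0" by (simp add: cl_add C_0)
  then show ?thesis using Rr.add.l_cancel_one[of "cl 0" "cl 0"] R_carrier C_0 by auto
qed

lemma cl_uminus: "a \<in> C \<Longrightarrow> \<ominus>\<^bsub>R\<^esub> cl a = cl (- a)"
  by (rule Rr.minus_equality) (use R_carrier C_uminus in \<open>auto simp: cl_add cl_zero\<close>)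

lemma cl_minus: "a \<in> C \<Longrightarrow> b \<in> C \<Longrightarrow> cl a \<ominus>\<^bsub>R\<^esub> cl b = cl (a - b)"
  by (simp add: a_minus_def cl_uminus cl_add C_uminus)

lemma jetmod_cl:
  assumes "a \<in> C" "b \<in> C" "cl a = cl b" "\<Theta> a \<in> jetmod F n"
  shows "\<Theta> b \<in> jetmod F n"
proof -
  have "a - b \<in> I" using assms cl_eq by blast
  then obtain g where "\<Theta> (a - b) = F * g" using T_I by blast
  then have "\<Theta> b = \<Theta> a - F * g" using assms T_diff by (simp add: algebra_simps)
  then show ?thesis using jetmod_diff[OF assms(4) jetmod_multiple] by simp
qed

text \<open>Classes whose expansion lies in (F) + (x, y, z)^n. They turn out to be the powers of the
  maximal ideal, and unlike the products defining \<open>max_power\<close> they can be tested on the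
  expansion.\<close>

definition W :: "nat \<Rightarrow> 'a set set" where
  "W n = {cl a | a. a \<in> C \<and> \<Theta> a \<in> jetmod F n}"

lemma cl_W: "a \<in> C \<Longrightarrow> cl a \<in> W n \<longleftrightarrow> \<Theta> a \<in> jetmod F n"
  unfolding W_def using jetmod_cl by blast

lemma nonunits: "carrier R - Units R = W 1"
proof -
  have "cl a \<in> Units R \<longleftrightarrow> \<Theta> a \<notin> jet 1" if a: "a \<in> C" for a
  proof
    assume "cl a \<in> Units R"
    then obtain b where b: "b \<in> C" "cl a \<otimes>\<^bsub>R\<^esub> cl b = \<one>\<^bsub>R\<^esub>" unfolding Units_def R_carrier by blast
    show "\<Theta> a \<notin> jet 1"
    proof
      assume "\<Theta> a \<in> jet 1"
      then have "\<Theta> (a * b) \<in> jet 1" using a b T_mult by (simp add: jet_mult_right)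
      then have "\<Theta> (a * b) \<in> jetmod F 1" by (rule jetmod_jet)
      moreover have "cl (a * b) = cl 1" using b a by (simp add: cl_mult cl_one)
      ultimately have "\<Theta> 1 \<in> jetmod F 1" using jetmod_cl[of "a * b" 1 1] a b C_mult C_1 by blast
      then have "\<Theta> 1 \<in> jet 1" using jetmod_low[OF F_jet, of 1] by simp
      then show False unfolding T_1 jet_1_iff by (simp add: cf_def)
    qed
  next
    assume "\<Theta> a \<notin> jet 1"
    then obtain b where "b \<in> C" "a * b = 1" using units a by blast
    then have "cl a \<otimes>\<^bsub>R\<^esub> cl b = \<one>\<^bsub>R\<^esub>" "cl b \<in> carrier R" using a R_carrier by (auto simp: cl_mult cl_one)
    then show "cl a \<in> Units R" using a R_carrier Rr.m_comm unfolding Units_def by (metis (mono_tags, lifting) imageI mem_Collect_eq)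
  qed
  then show ?thesis
    unfolding R_carrier W_def using jetmod_low[OF F_jet, of 1] by auto
qed

lemma max_power_subset: "max_power R n \<subseteq> W n"
proof (induct n)
  case 0
  show ?case by (auto simp: W_def R_carrier jetmod_0)
next
  case (Suc n)
  show ?case
  proof
    fix \<rho> assume "\<rho> \<in> max_power R (Suc n)"
    then have "\<rho> \<in> ideal_prod R (max_power R n) (W 1)" by (simp add: nonunits)
    then show "\<rho> \<in> W (Suc n)"
    proof induct
      case (prod i j)
      then obtain a b where "a \<in> C" "\<Theta> a \<in> jetmod F n" "i = cl a" "b \<in> C" "\<Theta> b \<in> jetmod F 1" "j = cl b"
        using Suc unfolding W_def by blast
      then show ?case using jetmod_mult[of "\<Theta> a" F n "\<Theta> b" 1] by (auto simp: cl_mult W_def C_mult T_mult)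
    next
      case (sum s1 s2)
      then obtain a b where "a \<in> C" "\<Theta> a \<in> jetmod F (Suc n)" "s1 = cl a" "b \<in> C" "\<Theta> b \<in> jetmod F (Suc n)" "s2 = cl b"
        unfolding W_def by blast
      then show ?case using jetmod_add[of "\<Theta> a" F "Suc n" "\<Theta> b"] by (auto simp: cl_add W_def C_add T_add)
    qed
  qed
qed

text \<open>Every leading form is attained in \<open>C\<close>: constants settle degree 0, and
  multiplication by \<open>w i\<close>, with leading term \<open>uvar i\<close>, raises the degree.
  So the image of \<open>C\<close> is dense.\<close>

lemma approximation: "s \<in> jet n \<Longrightarrow> \<exists>b\<in>C. \<Theta> b \<in> jet n \<and> \<Theta> b - s \<in> jet (Suc n)"
proof (induct n arbitrary: s)
  case 0
  have "fconst (cf s 0 0 0) - s \<in> jet (Suc 0)" by (auto simp: jet_def cf_fconst)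
  then show ?case using C_const T_const by (intro bexI[of _ "\<iota> (cf s 0 0 0)"]) auto
next
  case (Suc n)
  obtain g where g: "\<And>i. g i \<in> jet n" "s = (\<Sum>i\<in>UNIV. uvar i * g i)" using jet_Suc_decomp[OF Suc(2)] by blast
  have "\<forall>i. \<exists>b\<in>C. \<Theta> b \<in> jet n \<and> \<Theta> b - g i \<in> jet (Suc n)" using Suc(1) g(1) by blast
  then obtain b where b: "\<And>i. b i \<in> C" "\<And>i. \<Theta> (b i) \<in> jet n" "\<And>i. \<Theta> (b i) - g i \<in> jet (Suc n)" by metis
  have T: "\<Theta> (\<Sum>i\<in>UNIV. w i * b i) = (\<Sum>i\<in>UNIV. \<Theta> (w i) * \<Theta> (b i))"
    using w_C b(1) by (simp add: T_sum C_mult T_mult)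
  have "\<Theta> (w i) * \<Theta> (b i) \<in> jet (Suc n)" for i using jet_mult[OF w_jet_1[of i] b(2)[of i]] by simp
  then have 1: "\<Theta> (\<Sum>i\<in>UNIV. w i * b i) \<in> jet (Suc n)" unfolding T by (intro jet_sum)
  have "(\<Theta> (w i) - uvar i) * \<Theta> (b i) + uvar i * (\<Theta> (b i) - g i) \<in> jet (Suc (Suc n))" for i
    using jet_add[OF jet_mult[OF w_jet[of i] b(2)[of i]], of "uvar i * (\<Theta> (b i) - g i)"] jet_mult[OF uvar_jet[of i] b(3)[of i]]
    by (simp add: numeral_2_eq_2)
  then have "(\<Sum>i\<in>UNIV. (\<Theta> (w i) - uvar i) * \<Theta> (b i) + uvar i * (\<Theta> (b i) - g i)) \<in> jet (Suc (Suc n))" by (intro jet_sum)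
  also have "(\<Sum>i\<in>UNIV. (\<Theta> (w i) - uvar i) * \<Theta> (b i) + uvar i * (\<Theta> (b i) - g i)) = \<Theta> (\<Sum>i\<in>UNIV. w i * b i) - s"
    unfolding T g(2) sum_subtractf[symmetric] by (simp add: algebra_simps)
  finally show ?case using 1 w_C b(1) by (intro bexI[of _ "\<Sum>i\<in>UNIV. w i * b i"]) (auto intro: C_sum C_mult)
qed

lemma approximation_mod: "\<exists>b\<in>C. \<Theta> b - s \<in> jet n"
proof (induct n)
  case 0
  show ?case using C_0 by auto
next
  case (Suc n)
  then obtain b where b: "b \<in> C" "\<Theta> b - s \<in> jet n" by blast
  have "s - \<Theta> b \<in> jet n" using jet_uminus[OF b(2)] by simp
  then obtain b' where b': "b' \<in> C" "\<Theta> b' - (s - \<Theta> b) \<in> jet (Suc n)" using approximation by blast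
  then have "\<Theta> (b + b') - s \<in> jet (Suc n)" using b(1) by (simp add: T_add algebra_simps)
  then show ?case using b(1) b'(1) C_add by blast
qed

definition wm :: "nat \<times> nat \<times> nat \<Rightarrow> 'a" where
  "wm t = (case t of (i, j, k) \<Rightarrow> w 1 ^ i * (w 2 ^ j * w 3 ^ k))"

definition um :: "nat \<times> nat \<times> nat \<Rightarrow> fps3" where
  "um t = (case t of (i, j, k) \<Rightarrow> uvar 1 ^ i * (uvar 2 ^ j * uvar 3 ^ k))"

definition mons :: "nat \<Rightarrow> (nat \<times> nat \<times> nat) set" where
  "mons n = {(i, j, k). i + j + k = n}"

lemma finite_mons: "finite (mons n)"
  by (rule finite_subset[of _ "{..n} \<times> {..n} \<times> {..n}"]) (auto simp: mons_def)

lemma wm_C: "wm t \<in> C"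
  by (cases t) (simp add: wm_def C_mult C_power w_C)

lemma jet_prod_diff:
  assumes "s - s' \<in> jet (Suc i)" "t - t' \<in> jet (Suc j)" "s \<in> jet i" "t' \<in> jet j"
  shows "s * t - s' * t' \<in> jet (Suc (i + j))"
proof -
  have "s * (t - t') \<in> jet (Suc (i + j))" "(s - s') * t' \<in> jet (Suc (i + j))"
    using jet_mult[OF assms(3,2)] jet_mult[OF assms(1,4)] by simp_all
  from jet_add[OF this] show ?thesis by (simp add: algebra_simps)
qed

lemma T_wm: "t \<in> mons n \<Longrightarrow> \<Theta> (wm t) - um t \<in> jet (Suc n)"
proof -
  have pw: "\<Theta> (w a ^ i) - uvar a ^ i \<in> jet (Suc i)" for a i
  proof (induct i)
    case (Suc i)
    have u: "uvar a ^ i \<in> jet i" using jet_power[OF uvar_jet[of a], of i] by simp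
    have "\<Theta> (w a) * \<Theta> (w a ^ i) - uvar a * uvar a ^ i \<in> jet (Suc (1 + i))"
      by (rule jet_prod_diff[OF _ Suc w_jet_1[of a] u]) (use w_jet[of a] in \<open>simp add: numeral_2_eq_2\<close>)
    then show ?case by (simp add: T_mult w_C C_power)
  qed (simp add: T_1)
  have wp: "\<Theta> (w a ^ i) \<in> jet i" and up: "uvar a ^ i \<in> jet i" for a i
    using jet_power[OF w_jet_1[of a], of i] jet_power[OF uvar_jet[of a], of i] by (simp_all add: T_power w_C)
  assume "t \<in> mons n"
  then obtain i j k where t: "t = (i, j, k)" "n = i + (j + k)" by (auto simp: mons_def)
  have 23: "\<Theta> (w 2 ^ j * w 3 ^ k) - uvar 2 ^ j * uvar 3 ^ k \<in> jet (Suc (j + k))"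
    unfolding T_mult[OF C_power[OF w_C] C_power[OF w_C]] by (rule jet_prod_diff[OF pw pw wp up])
  have "uvar 2 ^ j * uvar 3 ^ k \<in> jet (j + k)" by (rule jet_mult[OF up up])
  from jet_prod_diff[OF pw 23 wp this]
  show ?thesis by (simp add: t wm_def um_def T_mult w_C C_power C_mult)
qed

lemma cf_uvar_power_mult:
  "cf (uvar 1 ^ m * s) i j k = (if i < m then 0 else cf s (i - m) j k)"
  "cf (uvar 2 ^ m * s) i j k = (if j < m then 0 else cf s i (j - m) k)"
  "cf (uvar 3 ^ m * s) i j k = (if k < m then 0 else cf s i j (k - m))"
proof -
  show "cf (uvar 1 ^ m * s) i j k = (if i < m then 0 else cf s (i - m) j k)"
    by (induct m arbitrary: i) (auto simp: mult.assoc cf_uvar_mult)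
  show "cf (uvar 2 ^ m * s) i j k = (if j < m then 0 else cf s i (j - m) k)"
    by (induct m arbitrary: j) (auto simp: mult.assoc cf_uvar_mult)
  show "cf (uvar 3 ^ m * s) i j k = (if k < m then 0 else cf s i j (k - m))"
    by (induct m arbitrary: k) (auto simp: mult.assoc cf_uvar_mult)
qed

lemma cf_um_mult:
  assumes "t \<in> mons n" "(i, j, k) \<in> mons n"
  shows "cf (um t * s) i j k = (if t = (i, j, k) then cf s 0 0 0 else 0)"
proof -
  obtain i' j' k' where t: "t = (i', j', k')" by (cases t)
  have n: "i' + j' + k' = n" "i + j + k = n" using assms by (auto simp: mons_def t)
  have "cf (um t * s) i j k = (if i < i' \<or> j < j' \<or> k < k' then 0 else cf s (i - i') (j - j') (k - k'))"
    by (auto simp: t um_def mult.assoc cf_uvar_power_mult)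
  also have "\<dots> = (if t = (i, j, k) then cf s 0 0 0 else 0)"
  proof (cases "i < i' \<or> j < j' \<or> k < k'")
    case False
    then have "i = i'" "j = j'" "k = k'" using n by linarith+
    then show ?thesis by (simp add: t)
  qed (auto simp: t)
  finally show ?thesis .
qed

text \<open>The n-th power of the maximal ideal of \<open>C\<close>, by explicit generators: the
  monomials of degree \<open>n\<close> in the parameters.\<close>

definition N :: "nat \<Rightarrow> 'a set" where
  "N n = {\<Sum>t\<in>mons n. wm t * g t | g. \<forall>t. g t \<in> C}"

lemma N_add: "a \<in> N n \<Longrightarrow> b \<in> N n \<Longrightarrow> a + b \<in> N n"
proof -
  assume "a \<in> N n" "b \<in> N n"
  then obtain g h where "\<forall>t. g t \<in> C" "a = (\<Sum>t\<in>mons n. wm t * g t)" "\<forall>t. h t \<in> C" "b = (\<Sum>t\<in>mons n. wm t * h t)"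
    unfolding N_def by blast
  then show ?thesis unfolding N_def
    by (intro CollectI exI[of _ "\<lambda>t. g t + h t"]) (simp add: C_add sum.distrib distrib_left)
qed

lemma N_wm: "t \<in> mons n \<Longrightarrow> b \<in> C \<Longrightarrow> wm t * b \<in> N n"
  unfolding N_def
  by (intro CollectI exI[of _ "\<lambda>t'. if t' = t then b else 0"])
     (auto simp: C_0 finite_mons if_distrib[where f = "\<lambda>a. _ * a"] cong: if_cong)

lemma N_0: "0 \<in> N n"
  unfolding N_def by (intro CollectI exI[of _ "\<lambda>_. 0"]) (simp add: C_0)

lemma N_sum: "(\<And>x. x \<in> S \<Longrightarrow> g x \<in> N n) \<Longrightarrow> sum g S \<in> N n"
  by (induct S rule: infinite_finite_induct) (simp_all add: N_0 N_add)

text \<open>This is regularity: monomials in the parameters have independent leading forms. If an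
  expression of degree \<open>n\<close> expands to order above \<open>n\<close>, its coefficients
  have no constant term, lie in the maximal ideal, and the degree can be raised.\<close>

lemma jet_N: "a \<in> C \<Longrightarrow> \<Theta> a \<in> jet n \<Longrightarrow> a \<in> N n"
proof (induct n)
  case 0
  have "mons 0 = {(0, 0, 0)}" by (auto simp: mons_def)
  then show ?case unfolding N_def using 0(1) by (intro CollectI exI[of _ "\<lambda>_. a"]) (simp add: wm_def)
next
  case (Suc n)
  then have "a \<in> N n" using jet_mono[of "\<Theta> a" "Suc n" n] by simp
  then obtain g where g: "\<And>t. g t \<in> C" "a = (\<Sum>t\<in>mons n. wm t * g t)" unfolding N_def by blast
  have g1: "\<Theta> (g (i, j, k)) \<in> jet 1" if ijk: "(i, j, k) \<in> mons n" for i j k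
  proof -
    have T: "\<Theta> a = (\<Sum>t\<in>mons n. um t * \<Theta> (g t)) + (\<Sum>t\<in>mons n. (\<Theta> (wm t) - um t) * \<Theta> (g t))"
      unfolding g(2) sum.distrib[symmetric] by (simp add: T_sum C_mult wm_C g(1) T_mult algebra_simps)
    have d: "(\<Sum>t\<in>mons n. (\<Theta> (wm t) - um t) * \<Theta> (g t)) \<in> jet (Suc n)"
      by (intro jet_sum jet_mult_right T_wm)
    have "\<Theta> a - (\<Sum>t\<in>mons n. (\<Theta> (wm t) - um t) * \<Theta> (g t)) = (\<Sum>t\<in>mons n. um t * \<Theta> (g t))"
      using T by simp
    then have "(\<Sum>t\<in>mons n. um t * \<Theta> (g t)) \<in> jet (Suc n)"
      using jet_diff[OF Suc(3) d] by (simp only:)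
    then have "0 = cf (\<Sum>t\<in>mons n. um t * \<Theta> (g t)) i j k" using ijk by (simp add: jet_def mons_def)
    also have "\<dots> = (\<Sum>t\<in>mons n. if t = (i, j, k) then cf (\<Theta> (g t)) 0 0 0 else 0)"
      unfolding cf_sum by (rule sum.cong[OF refl]) (rule cf_um_mult[OF _ ijk])
    also have "\<dots> = cf (\<Theta> (g (i, j, k))) 0 0 0" using ijk by (simp add: finite_mons)
    finally show ?thesis by (simp only: jet_1_iff)
  qed
  have "wm t * g t \<in> N (Suc n)" if t: "t \<in> mons n" for t
  proof -
    obtain i j k where ijk: "t = (i, j, k)" by (cases t)
    obtain h where h: "\<And>i. h i \<in> C" "g t = (\<Sum>i\<in>UNIV. w i * h i)"
      using generators[OF g(1)[of t]] g1 t ijk by blast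
    have "wm t * g t = wm (Suc i, j, k) * h 1 + wm (i, Suc j, k) * h 2 + wm (i, j, Suc k) * h 3"
      unfolding h(2) sum_3 by (simp add: ijk wm_def algebra_simps)
    moreover have "(Suc i, j, k) \<in> mons (Suc n)" "(i, Suc j, k) \<in> mons (Suc n)" "(i, j, Suc k) \<in> mons (Suc n)"
      using t by (auto simp: ijk mons_def)
    ultimately show ?thesis using h(1) by (simp add: N_add N_wm)
  qed
  then show ?case unfolding g(2) by (intro N_sum)
qed

lemma max_power_w: "a \<in> C \<Longrightarrow> cl a \<in> max_power R n \<Longrightarrow> cl (w i ^ m * a) \<in> max_power R (n + m)"
proof (induct m)
  case (Suc m)
  have "cl (w i) \<in> W 1" using w_jet_1 w_C by (simp add: cl_W jetmod_jet)
  then have "cl (w i ^ m * a) \<otimes>\<^bsub>R\<^esub> cl (w i) \<in> ideal_prod R (max_power R (n + m)) (W 1)"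
    using Suc by (intro ideal_prod.prod)
  then show ?case using Suc(2) by (simp add: cl_mult C_mult C_power w_C nonunits ac_simps)
qed simp

lemma N_max_power: "a \<in> N n \<Longrightarrow> cl a \<in> max_power R n"
proof -
  assume "a \<in> N n"
  then obtain g where g: "\<And>t. g t \<in> C" "a = (\<Sum>t\<in>mons n. wm t * g t)" unfolding N_def by blast
  have wm: "cl (wm t * b) \<in> max_power R n" if "t \<in> mons n" "b \<in> C" for t b
  proof -
    obtain i j k where t: "t = (i, j, k)" "n = 0 + k + j + i" using \<open>t \<in> mons n\<close> by (auto simp: mons_def)
    have "cl b \<in> max_power R 0" using \<open>b \<in> C\<close> by (simp add: R_carrier)
    from max_power_w[OF \<open>b \<in> C\<close> this, of 3 k] have 1: "cl (w 3 ^ k * b) \<in> max_power R (0 + k)" .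
    from max_power_w[OF _ this, of 2 j] have 2: "cl (w 2 ^ j * (w 3 ^ k * b)) \<in> max_power R (0 + k + j)"
      using \<open>b \<in> C\<close> by (simp add: C_mult C_power w_C)
    from max_power_w[OF _ this, of 1 i] have "cl (w 1 ^ i * (w 2 ^ j * (w 3 ^ k * b))) \<in> max_power R (0 + k + j + i)"
      using \<open>b \<in> C\<close> by (simp add: C_mult C_power w_C)
    then show ?thesis unfolding t(2) by (simp add: t(1) wm_def mult.assoc)
  qed
  have add: "cl (a + b) \<in> max_power R n" if "a \<in> C" "b \<in> C" "cl a \<in> max_power R n" "cl b \<in> max_power R n" for a b
  proof (cases n)
    case 0
    then show ?thesis using that by (simp add: R_carrier C_add)
  next
    case (Suc m)
    then show ?thesis using that ideal_prod.sum[of "cl a" R "max_power R m" "carrier R - Units R" "cl b"] by (simp add: cl_add)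
  qed
  have "cl (wm (n, 0, 0) * 0) \<in> max_power R n" by (rule wm) (simp_all add: mons_def C_0)
  then have zero: "cl 0 \<in> max_power R n" by simp
  have "S \<subseteq> mons n \<Longrightarrow> cl (\<Sum>t\<in>S. wm t * g t) \<in> max_power R n" if "finite S" for S
    using that
  proof induct
    case (insert t S)
    then show ?case using add[of "wm t * g t" "\<Sum>t\<in>S. wm t * g t"] wm[of t "g t"] g(1)
      by (simp add: C_mult wm_C C_sum)
  qed (simp add: zero)
  then show ?thesis using g(2) finite_mons by blast
qed

text \<open>If the expansion of \<open>a\<close> is F g up to order \<open>n\<close>, approximate
  \<open>g\<close> by the expansion of some \<open>b\<close> in \<open>C\<close>; then a - b \<phi>
  expands to order \<open>n\<close> and has the same class as \<open>a\<close>.\<close>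

lemma max_power_eq: "max_power R n = W n"
proof
  show "W n \<subseteq> max_power R n"
  proof
    fix \<rho> assume "\<rho> \<in> W n"
    then obtain a g where a: "a \<in> C" "\<rho> = cl a" "\<Theta> a - F * g \<in> jet n" by (auto simp: W_def jetmod_def)
    obtain b where b: "b \<in> C" "\<Theta> b - g \<in> jet n" using approximation_mod by blast
    have \<phi>C: "\<phi> \<in> C" using \<phi>(1) I_sub by blast
    have "(\<Theta> a - F * g) - F * (\<Theta> b - g) \<in> jet n" by (intro jet_diff jet_mult_left a b)
    then have "\<Theta> (a - b * \<phi>) \<in> jet n" using a(1) b(1) \<phi>C by (simp add: T_diff C_mult T_mult \<phi>(2) algebra_simps)
    then have "cl (a - b * \<phi>) \<in> max_power R n" by (intro N_max_power jet_N C_diff C_mult a b \<phi>C)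
    moreover have "cl (a - b * \<phi>) = cl a"
      using I_mult[OF C_uminus[OF b(1)] \<phi>(1)] a(1) b(1) \<phi>C by (subst cl_eq) (simp_all add: C_diff C_mult)
    ultimately show "\<rho> \<in> max_power R n" using a(2) by simp
  qed
qed (rule max_power_subset)

lemma max_power_ideal: "ideal (max_power R n) R"
  unfolding max_power_eq
proof (rule idealI)
  show "ring R" by (rule Rr.ring_axioms)
  show "subgroup (W n) (add_monoid R)"
  proof (rule Rr.add.subgroupI)
    show "W n \<subseteq> carrier R" by (auto simp: W_def R_carrier)
    show "W n \<noteq> {}" using cl_W[OF C_0, of n] T_0 jetmod_jet by fastforce
    show "\<ominus>\<^bsub>R\<^esub> a \<in> W n" if "a \<in> W n" for a
    proof -
      obtain b where "b \<in> C" "\<Theta> b \<in> jetmod F n" "a = cl b" using \<open>a \<in> W n\<close> by (auto simp: W_def)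
      then show ?thesis by (simp add: cl_uminus cl_W C_uminus T_uminus jetmod_uminus)
    qed
    show "a \<oplus>\<^bsub>R\<^esub> b \<in> W n" if "a \<in> W n" "b \<in> W n" for a b
    proof -
      obtain c where "c \<in> C" "\<Theta> c \<in> jetmod F n" "a = cl c" using \<open>a \<in> W n\<close> by (auto simp: W_def)
      moreover obtain d where "d \<in> C" "\<Theta> d \<in> jetmod F n" "b = cl d" using \<open>b \<in> W n\<close> by (auto simp: W_def)
      ultimately show ?thesis by (simp add: cl_add cl_W C_add T_add jetmod_add)
    qed
  qed
  show "x \<otimes>\<^bsub>R\<^esub> a \<in> W n" "a \<otimes>\<^bsub>R\<^esub> x \<in> W n" if ax: "a \<in> W n" "x \<in> carrier R" for a x
  proof -
    obtain b c where bc: "b \<in> C" "\<Theta> b \<in> jetmod F n" "a = cl b" "c \<in> C" "x = cl c" using ax by (auto simp: W_def R_carrier)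
    then have "x \<otimes>\<^bsub>R\<^esub> a = cl (c * b)" "a \<otimes>\<^bsub>R\<^esub> x = cl (c * b)" by (simp_all add: cl_mult mult.commute)
    moreover have "cl (c * b) \<in> W n" using bc by (simp add: cl_W C_mult T_mult jetmod_mult_left)
    ultimately show "x \<otimes>\<^bsub>R\<^esub> a \<in> W n" "a \<otimes>\<^bsub>R\<^esub> x \<in> W n" by simp_all
  qed
qed

end

section \<open>Row vectors times matrices\<close>

lemma vector_matrix_mult_assoc: "v v* (A ** B) = (v v* A) v* (B :: complex^'k^'m)" for A :: "complex^'m^'n"
proof -
  have "(\<Sum>i\<in>UNIV. v $ i * (\<Sum>k\<in>UNIV. A $ i $ k * B $ k $ j)) = (\<Sum>k\<in>UNIV. (\<Sum>i\<in>UNIV. v $ i * A $ i $ k) * B $ k $ j)" for j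
    unfolding sum_distrib_left sum_distrib_right by (subst sum.swap) (simp add: ac_simps)
  then show ?thesis by (simp add: vec_eq_iff vector_matrix_mult_def matrix_matrix_mult_def mult.commute)
qed

lemma vector_matrix_mult_one: "v v* mat 1 = (v :: complex^'n)"
  by (simp add: vec_eq_iff vector_matrix_mult_def mat_def if_distrib[where f = "\<lambda>a. _ * a"] if_distrib[where f = "\<lambda>a. a * _"] cong: if_cong)

lemma matrix_mult_row_vector: "(K ** A) $ i = K $ i v* (A :: complex^'m^'n)"
  by (simp add: vec_eq_iff vector_matrix_mult_def matrix_matrix_mult_def mult.commute)

section \<open>Singularities of type \<open>A\<^sub>1\<close>\<close>

definition qc :: "fps3 \<Rightarrow> fps3 set" where
  "qc \<sigma> = PIdl\<^bsub>ring_on UNIV\<^esub> qform +>\<^bsub>ring_on UNIV\<^esub> \<sigma>"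

lemma UNIV_cring: "cring (ring_on (UNIV :: 'a::comm_ring_1 set))"
  by (rule ring_on_cring) auto

lemma qform_ideal: "ideal (PIdl\<^bsub>ring_on UNIV\<^esub> qform) (ring_on UNIV)"
  by (rule cring.cgenideal_ideal[OF UNIV_cring]) simp

lemma An_ring_quot: "An_ring 1 = ring_on UNIV Quot (PIdl\<^bsub>ring_on UNIV\<^esub> qform)"
  by (simp add: An_ring_def qform_An)

lemma qc_carrier: "carrier (An_ring 1) = range qc"
  unfolding An_ring_quot ideal.quot_carrier[OF qform_ideal] by (simp add: qc_def[abs_def])

lemma qc_mult: "qc \<sigma> \<otimes>\<^bsub>An_ring 1\<^esub> qc \<tau> = qc (\<sigma> * \<tau>)"
  unfolding An_ring_quot qc_def by (subst ideal.quot_mult[OF qform_ideal]) simp_all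

lemma qc_add: "qc \<sigma> \<oplus>\<^bsub>An_ring 1\<^esub> qc \<tau> = qc (\<sigma> + \<tau>)"
  unfolding An_ring_quot qc_def by (subst ideal.quot_add[OF qform_ideal]) simp_all

lemma qc_one: "\<one>\<^bsub>An_ring 1\<^esub> = qc 1"
  unfolding An_ring_quot qc_def by (subst ideal.quot_one[OF qform_ideal]) simp

lemma qc_eq: "qc \<sigma> = qc \<tau> \<longleftrightarrow> (\<exists>g. \<sigma> - \<tau> = qform * g)"
  unfolding qc_def by (subst ideal.quot_eq[OF qform_ideal])
    (simp_all add: ring_on_minus[OF UNIV_cring] cgenideal_def mult.commute)

lemma An_const_qc: "An_const 1 c = qc (fconst c)"
  by (simp add: An_const_def qc_def qform_An fconst_def)

context expansion
begin

abbreviation "Rh \<equiv> completion R"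

definition cc :: "nat \<Rightarrow> 'a \<Rightarrow> 'a set set" where
  "cc n a = max_power R n +>\<^bsub>R\<^esub> cl a"

lemma cl_carrier: "a \<in> C \<Longrightarrow> cl a \<in> carrier R"
  by (simp add: R_carrier)

lemma cc_carrier: "carrier (R Quot max_power R n) = cc n ` C"
  unfolding ideal.quot_carrier[OF max_power_ideal] R_carrier cc_def[abs_def] by (simp add: image_image)

lemma cc_mult: "a \<in> C \<Longrightarrow> b \<in> C \<Longrightarrow> cc n a \<otimes>\<^bsub>R Quot max_power R n\<^esub> cc n b = cc n (a * b)"
  unfolding cc_def by (subst ideal.quot_mult[OF max_power_ideal]) (simp_all add: cl_carrier cl_mult)

lemma cc_add: "a \<in> C \<Longrightarrow> b \<in> C \<Longrightarrow> cc n a \<oplus>\<^bsub>R Quot max_power R n\<^esub> cc n b = cc n (a + b)"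
  unfolding cc_def by (subst ideal.quot_add[OF max_power_ideal]) (simp_all add: cl_carrier cl_add)

lemma cc_one: "\<one>\<^bsub>R Quot max_power R n\<^esub> = cc n 1"
  unfolding cc_def by (subst ideal.quot_one[OF max_power_ideal]) (simp add: cl_one)

lemma cc_eq: "a \<in> C \<Longrightarrow> b \<in> C \<Longrightarrow> cc n a = cc n b \<longleftrightarrow> \<Theta> a - \<Theta> b \<in> jetmod F n"
  unfolding cc_def by (subst ideal.quot_eq[OF max_power_ideal])
    (simp_all add: cl_carrier cl_minus max_power_eq cl_W C_diff T_diff)

lemma cc_mem: "a \<in> C \<Longrightarrow> b \<in> C \<Longrightarrow> cl b \<in> cc n a \<longleftrightarrow> \<Theta> b - \<Theta> a \<in> jetmod F n"
  unfolding cc_def by (subst ideal.quot_mem[OF max_power_ideal])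
    (simp_all add: cl_carrier cl_minus max_power_eq cl_W C_diff T_diff)

lemma cc_subset: "a \<in> C \<Longrightarrow> b \<in> C \<Longrightarrow> cc (Suc n) b \<subseteq> cc n a \<longleftrightarrow> \<Theta> b - \<Theta> a \<in> jetmod F n"
proof
  assume ab: "a \<in> C" "b \<in> C"
  assume "cc (Suc n) b \<subseteq> cc n a"
  moreover have "cl b \<in> cc (Suc n) b" using ab by (simp add: cc_mem jetmod_jet)
  ultimately show "\<Theta> b - \<Theta> a \<in> jetmod F n" using ab cc_mem by blast
next
  assume ab: "a \<in> C" "b \<in> C"
  assume *: "\<Theta> b - \<Theta> a \<in> jetmod F n"
  show "cc (Suc n) b \<subseteq> cc n a"
  proof
    fix \<rho> assume \<rho>: "\<rho> \<in> cc (Suc n) b"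
    then have "\<rho> \<in> carrier R"
      using ideal.quot_subset[OF max_power_ideal cl_carrier[OF ab(2)], of "Suc n"] by (auto simp: cc_def)
    then obtain d where d: "d \<in> C" "\<rho> = cl d" by (auto simp: R_carrier)
    then have "\<Theta> d - \<Theta> b \<in> jetmod F (Suc n)" using \<rho> ab cc_mem by blast
    then have "\<Theta> d - \<Theta> b \<in> jetmod F n" by (rule jetmod_mono) simp
    from jetmod_add[OF this *] show "\<rho> \<in> cc n a" using d ab by (simp add: cc_mem)
  qed
qed

text \<open>The map from power series to the completion: at level \<open>n\<close> it takes the
  class of any element of \<open>C\<close> approximating \<sigma> to order \<open>n\<close> modulo
  \<open>F\<close>. The class does not depend on the choice.\<close>

definition K :: "fps3 \<Rightarrow> nat \<Rightarrow> 'a set set" where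
  "K \<sigma> n = cc n (SOME b. b \<in> C \<and> \<Theta> b - \<sigma> \<in> jetmod F n)"

lemma K_rep: obtains b where "b \<in> C" "\<Theta> b - \<sigma> \<in> jetmod F n" "K \<sigma> n = cc n b"
proof -
  have "\<exists>b. b \<in> C \<and> \<Theta> b - \<sigma> \<in> jetmod F n" using approximation_mod[of \<sigma> n] jetmod_jet by blast
  from someI_ex[OF this] show thesis using that by (auto simp: K_def)
qed

lemma K_eq_cc: "b \<in> C \<Longrightarrow> K \<sigma> n = cc n b \<longleftrightarrow> \<Theta> b - \<sigma> \<in> jetmod F n"
proof -
  assume b: "b \<in> C"
  obtain d where d: "d \<in> C" "\<Theta> d - \<sigma> \<in> jetmod F n" "K \<sigma> n = cc n d" by (rule K_rep)
  have "\<Theta> d - \<Theta> b \<in> jetmod F n \<longleftrightarrow> \<Theta> b - \<sigma> \<in> jetmod F n"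
  proof
    assume "\<Theta> d - \<Theta> b \<in> jetmod F n"
    from jetmod_diff[OF d(2) this] show "\<Theta> b - \<sigma> \<in> jetmod F n" by simp
  next
    assume "\<Theta> b - \<sigma> \<in> jetmod F n"
    from jetmod_diff[OF d(2) this] show "\<Theta> d - \<Theta> b \<in> jetmod F n" by simp
  qed
  then show ?thesis using b d by (simp add: cc_eq)
qed

lemma K_carrier: "K \<sigma> \<in> carrier Rh"
proof -
  have "K \<sigma> n \<in> carrier (R Quot max_power R n)" for n
    by (rule K_rep[of \<sigma> n]) (simp add: cc_carrier)
  moreover have "K \<sigma> (Suc n) \<subseteq> K \<sigma> n" for n
  proof -
    obtain a where a: "a \<in> C" "\<Theta> a - \<sigma> \<in> jetmod F n" "K \<sigma> n = cc n a" by (rule K_rep)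
    obtain b where b: "b \<in> C" "\<Theta> b - \<sigma> \<in> jetmod F (Suc n)" "K \<sigma> (Suc n) = cc (Suc n) b" by (rule K_rep)
    have "\<Theta> b - \<sigma> \<in> jetmod F n" using b(2) by (rule jetmod_mono) simp
    from jetmod_diff[OF this a(2)] show ?thesis using a b by (simp add: cc_subset)
  qed
  ultimately show ?thesis by (simp add: completion_def)
qed

lemma K_mult: "K \<sigma> \<otimes>\<^bsub>Rh\<^esub> K \<tau> = K (\<sigma> * \<tau>)"
proof
  fix n
  obtain a where a: "a \<in> C" "\<Theta> a - \<sigma> \<in> jetmod F n" "K \<sigma> n = cc n a" by (rule K_rep)
  obtain b where b: "b \<in> C" "\<Theta> b - \<tau> \<in> jetmod F n" "K \<tau> n = cc n b" by (rule K_rep)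
  have "\<Theta> a * (\<Theta> b - \<tau>) + \<tau> * (\<Theta> a - \<sigma>) \<in> jetmod F n" by (intro jetmod_add jetmod_mult_left a b)
  then have "\<Theta> (a * b) - \<sigma> * \<tau> \<in> jetmod F n" using a b by (simp add: T_mult algebra_simps)
  then have "K (\<sigma> * \<tau>) n = cc n (a * b)" using a b by (simp add: K_eq_cc C_mult)
  then show "(K \<sigma> \<otimes>\<^bsub>Rh\<^esub> K \<tau>) n = K (\<sigma> * \<tau>) n" using a b by (simp add: completion_def cc_mult)
qed

lemma K_add: "K \<sigma> \<oplus>\<^bsub>Rh\<^esub> K \<tau> = K (\<sigma> + \<tau>)"
proof
  fix n
  obtain a where a: "a \<in> C" "\<Theta> a - \<sigma> \<in> jetmod F n" "K \<sigma> n = cc n a" by (rule K_rep)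
  obtain b where b: "b \<in> C" "\<Theta> b - \<tau> \<in> jetmod F n" "K \<tau> n = cc n b" by (rule K_rep)
  have "(\<Theta> a - \<sigma>) + (\<Theta> b - \<tau>) \<in> jetmod F n" by (intro jetmod_add a b)
  then have "\<Theta> (a + b) - (\<sigma> + \<tau>) \<in> jetmod F n" using a b by (simp add: T_add algebra_simps)
  then have "K (\<sigma> + \<tau>) n = cc n (a + b)" using a b by (simp add: K_eq_cc C_add)
  then show "(K \<sigma> \<oplus>\<^bsub>Rh\<^esub> K \<tau>) n = K (\<sigma> + \<tau>) n" using a b by (simp add: completion_def cc_add)
qed

lemma K_one: "\<one>\<^bsub>Rh\<^esub> = K 1"
proof
  fix n
  have "K 1 n = cc n 1" using C_1 by (simp add: K_eq_cc T_1 jetmod_jet)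
  then show "\<one>\<^bsub>Rh\<^esub> n = K 1 n" by (simp add: completion_def cc_one)
qed

lemma K_const: "completion_map R (cl (\<iota> c)) = K (fconst c)"
proof
  fix n
  have "K (fconst c) n = cc n (\<iota> c)" using C_const by (simp add: K_eq_cc T_const jetmod_jet)
  then show "completion_map R (cl (\<iota> c)) n = K (fconst c) n" by (simp add: completion_map_def cc_def)
qed

text \<open>The kernel of \<open>K\<close> is the intersection of the ideals (F) + (x, y, z)^n, that
  is, the closure of (F).\<close>

lemma K_eq: "K \<sigma> = K \<tau> \<longleftrightarrow> (\<forall>n. \<sigma> - \<tau> \<in> jetmod F n)"
proof -
  have "K \<sigma> n = K \<tau> n \<longleftrightarrow> \<sigma> - \<tau> \<in> jetmod F n" for n
  proof -
    obtain b where b: "b \<in> C" "\<Theta> b - \<tau> \<in> jetmod F n" "K \<tau> n = cc n b" by (rule K_rep)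
    have "\<Theta> b - \<sigma> \<in> jetmod F n \<longleftrightarrow> \<sigma> - \<tau> \<in> jetmod F n"
    proof
      assume "\<Theta> b - \<sigma> \<in> jetmod F n"
      from jetmod_diff[OF b(2) this] show "\<sigma> - \<tau> \<in> jetmod F n" by simp
    next
      assume "\<sigma> - \<tau> \<in> jetmod F n"
      from jetmod_diff[OF b(2) this] show "\<Theta> b - \<sigma> \<in> jetmod F n" by simp
    qed
    then show ?thesis unfolding b(3) using K_eq_cc[OF b(1), of \<sigma> n] by simp
  qed
  then show ?thesis by (auto simp: fun_eq_iff)
qed

text \<open>Representatives at successive levels differ by multiples of \<open>F\<close> up to order
  \<open>n\<close>. Subtracting the accumulated multiples makes their expansions a Cauchy sequence,
  whose limit represents the given element.\<close>

lemma K_surj: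
  assumes "s \<in> carrier Rh"
  obtains \<sigma> where "s = K \<sigma>"
proof -
  have s: "s n \<in> cc n ` C" "s (Suc n) \<subseteq> s n" for n using assms by (auto simp: completion_def cc_carrier)
  then have "\<forall>n. \<exists>a. a \<in> C \<and> s n = cc n a" by blast
  then obtain a where a: "\<And>n. a n \<in> C" "\<And>n. s n = cc n (a n)" by metis
  have "\<exists>g. (\<Theta> (a (Suc n)) - \<Theta> (a n)) - F * g \<in> jet n" for n
    using s(2)[of n] a by (simp add: cc_subset jetmod_def)
  then obtain g where g: "\<And>n. (\<Theta> (a (Suc n)) - \<Theta> (a n)) - F * g n \<in> jet n" by metis
  define \<sigma> where "\<sigma> = (\<lambda>n. \<Theta> (a n) - F * (\<Sum>m<n. g m))"
  have "\<sigma> (Suc n) - \<sigma> n \<in> jet n" for n using g[of n] by (simp add: \<sigma>_def algebra_simps)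
  then obtain t where t: "\<And>n. t - \<sigma> n \<in> jet n" by (rule jet_limit) blast
  have "s n = K t n" for n
  proof -
    have "(\<Theta> (a n) - t) - F * (\<Sum>m<n. g m) = - (t - \<sigma> n)" by (simp add: \<sigma>_def)
    then have "(\<Theta> (a n) - t) - F * (\<Sum>m<n. g m) \<in> jet n" using jet_uminus[OF t[of n]] by (simp only:)
    then have "\<Theta> (a n) - t \<in> jetmod F n" unfolding jetmod_def by blast
    then show ?thesis using a by (simp add: K_eq_cc[symmetric])
  qed
  then show thesis using that[of t] by blast
qed

text \<open>If the equation expands to the quadric itself, \<open>K\<close> and \<open>qc\<close>
  have the same kernel because the ideal of the quadric is closed; sending \<open>K \<sigma>\<close>
  to \<open>qc \<sigma>\<close> is then the isomorphism.\<close>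

lemma qform_imp_A1:
  assumes F: "F = qform"
  shows "\<exists>h \<in> ring_iso Rh (An_ring 1). \<forall>c. h (completion_map R (cl (\<iota> c))) = An_const 1 c"
proof -
  note One_nat_def [simp del]
  note assms = F
  have K_qc: "K \<sigma> = K \<tau> \<longleftrightarrow> qc \<sigma> = qc \<tau>" for \<sigma> \<tau>
  proof
    assume "K \<sigma> = K \<tau>"
    then have k: "\<forall>n. \<sigma> - \<tau> \<in> jetmod F n" unfolding K_eq .
    obtain g where "\<sigma> - \<tau> = qform * g" using jetmod_qform_closed[of "\<sigma> - \<tau>"] k[unfolded assms] by blast
    then show "qc \<sigma> = qc \<tau>" unfolding qc_eq by blast
  next
    assume "qc \<sigma> = qc \<tau>"
    then obtain g where "\<sigma> - \<tau> = qform * g" unfolding qc_eq by blast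
    then have "\<sigma> - \<tau> = F * g" by (simp only: assms)
    then show "K \<sigma> = K \<tau>" unfolding K_eq using jetmod_multiple[of F g] by simp
  qed
  define h where "h = (\<lambda>s. qc (SOME \<sigma>. s = K \<sigma>))"
  have hK: "h (K \<sigma>) = qc \<sigma>" for \<sigma>
  proof -
    have "K \<sigma> = K (SOME \<tau>. K \<sigma> = K \<tau>)" by (rule someI) simp
    then show ?thesis unfolding h_def using K_qc by metis
  qed
  have "h \<in> ring_iso Rh (An_ring 1)"
    unfolding ring_iso_def
  proof (intro CollectI conjI)
    show "h \<in> ring_hom Rh (An_ring 1)"
    proof (rule ring_hom_memI)
      show "h x \<in> carrier (An_ring 1)" if x: "x \<in> carrier Rh" for x
      proof -
        obtain \<sigma> where "x = K \<sigma>" using x by (rule K_surj)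
        then show ?thesis unfolding qc_carrier by (simp add: hK)
      qed
      show "h (x \<otimes>\<^bsub>Rh\<^esub> y) = h x \<otimes>\<^bsub>An_ring 1\<^esub> h y" "h (x \<oplus>\<^bsub>Rh\<^esub> y) = h x \<oplus>\<^bsub>An_ring 1\<^esub> h y" if xy: "x \<in> carrier Rh" "y \<in> carrier Rh" for x y
      proof -
        obtain \<sigma> where "x = K \<sigma>" using xy(1) by (rule K_surj)
        moreover obtain \<tau> where "y = K \<tau>" using xy(2) by (rule K_surj)
        ultimately show "h (x \<otimes>\<^bsub>Rh\<^esub> y) = h x \<otimes>\<^bsub>An_ring 1\<^esub> h y" "h (x \<oplus>\<^bsub>Rh\<^esub> y) = h x \<oplus>\<^bsub>An_ring 1\<^esub> h y"
          by (simp_all add: K_mult K_add hK qc_mult qc_add)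
      qed
      show "h \<one>\<^bsub>Rh\<^esub> = \<one>\<^bsub>An_ring 1\<^esub>" by (simp add: K_one hK qc_one)
    qed
    show "bij_betw h (carrier Rh) (carrier (An_ring 1))"
      unfolding bij_betw_def
    proof
      show "inj_on h (carrier Rh)"
      proof (rule inj_onI)
        fix x y assume xy: "x \<in> carrier Rh" "y \<in> carrier Rh" "h x = h y"
        obtain \<sigma> where "x = K \<sigma>" using xy(1) by (rule K_surj)
        moreover obtain \<tau> where "y = K \<tau>" using xy(2) by (rule K_surj)
        ultimately show "x = y" using xy(3) by (simp add: hK K_qc)
      qed
      show "h ` carrier Rh = carrier (An_ring 1)"
      proof
        show "h ` carrier Rh \<subseteq> carrier (An_ring 1)"
        proof
          fix z assume "z \<in> h ` carrier Rh"
          then obtain x where x: "x \<in> carrier Rh" "z = h x" by blast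
          obtain \<sigma> where "x = K \<sigma>" using x(1) by (rule K_surj)
          then show "z \<in> carrier (An_ring 1)" unfolding qc_carrier using x(2) by (simp add: hK)
        qed
        show "carrier (An_ring 1) \<subseteq> h ` carrier Rh"
        proof
          fix z assume "z \<in> carrier (An_ring 1)"
          then obtain \<sigma> where "z = qc \<sigma>" unfolding qc_carrier by blast
          then show "z \<in> h ` carrier Rh" using hK[of \<sigma>] K_carrier[of \<sigma>] by (metis imageI)
        qed
      qed
    qed
  qed
  then show ?thesis by (intro bexI[of _ h]) (simp_all add: K_const hK An_const_qc)
qed

text \<open>The symmetric matrix of the quadratic part of \<open>F\<close>: mixed coefficients are
  split evenly, so it is half the matrix of second derivatives.\<close>

definition hess :: "complex^3^3" where
  "hess = vector [vector [cf F 2 0 0, cf F 1 1 0 / 2, cf F 1 0 1 / 2],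
     vector [cf F 1 1 0 / 2, cf F 0 2 0, cf F 0 1 1 / 2],
     vector [cf F 1 0 1 / 2, cf F 0 1 1 / 2, cf F 0 0 2]]"

definition lin :: "fps3 \<Rightarrow> complex^3" where
  "lin s = vector [cf s 1 0 0, cf s 0 1 0, cf s 0 0 1]"

lemma lin_simps: "lin s $ 1 = cf s 1 0 0" "lin s $ 2 = cf s 0 1 0" "lin s $ 3 = cf s 0 0 1"
  by (simp_all add: lin_def)

text \<open>Transport the three coordinates through the inverse isomorphism to series \<xi>. Their
  linear parts form an invertible matrix, and their squares sum to a multiple of \<open>F\<close> up
  to order 3. Comparing quadratic parts gives \<open>transpose N ** N\<close> as a multiple of
  \<open>hess\<close>, so the determinant cannot vanish.\<close>

lemma A1_imp_hess:
  assumes h: "h \<in> ring_iso Rh (An_ring 1)" and hc: "\<And>c. h (completion_map R (cl (\<iota> c))) = An_const 1 c"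
  shows "det hess \<noteq> 0"
proof -
  note One_nat_def [simp del]
  have hom: "h \<in> ring_hom Rh (An_ring 1)" and bij: "bij_betw h (carrier Rh) (carrier (An_ring 1))"
    using h by (auto simp: ring_iso_def)
  define H where "H = (\<lambda>\<sigma>. h (K \<sigma>))"
  have H_mult: "H (\<sigma> * \<tau>) = H \<sigma> \<otimes>\<^bsub>An_ring 1\<^esub> H \<tau>" and H_add: "H (\<sigma> + \<tau>) = H \<sigma> \<oplus>\<^bsub>An_ring 1\<^esub> H \<tau>" for \<sigma> \<tau>
    unfolding H_def K_mult[symmetric] K_add[symmetric] using ring_hom_mult[OF hom] ring_hom_add[OF hom] K_carrier by auto
  have H_one: "H 1 = qc 1" using ring_hom_one[OF hom] unfolding H_def K_one qc_one .
  have H_const: "H (fconst c) = qc (fconst c)" for c using hc[of c] unfolding H_def K_const An_const_qc .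
  have H_eq: "H \<sigma> = H \<tau> \<longleftrightarrow> (\<forall>n. \<sigma> - \<tau> \<in> jetmod F n)" for \<sigma> \<tau>
    unfolding H_def K_eq[symmetric] using inj_on_eq_iff[OF bij_betw_imp_inj_on[OF bij] K_carrier K_carrier] .
  have H_qc: "\<exists>\<tau>. H \<sigma> = qc \<tau>" for \<sigma>
    using ring_hom_closed[OF hom K_carrier, of \<sigma>] unfolding H_def qc_carrier by blast
  have qc_H: "\<exists>\<sigma>. H \<sigma> = qc \<tau>" for \<tau>
  proof -
    have "qc \<tau> \<in> h ` carrier Rh" using bij by (simp add: bij_betw_def qc_carrier)
    then obtain x where x: "x \<in> carrier Rh" "qc \<tau> = h x" by blast
    obtain \<sigma> where "x = K \<sigma>" using x(1) by (rule K_surj)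
    then show ?thesis using x(2) by (auto simp: H_def)
  qed
  \<comment> \<open>Units go to units in both directions, so a series without constant term goes to
    one without constant term.\<close>
  have local: "\<tau> \<in> jet 1" if "\<sigma> \<in> jet 1" "H \<sigma> = qc \<tau>" for \<sigma> \<tau>
  proof (rule ccontr)
    assume "\<tau> \<notin> jet 1"
    then obtain \<tau>' where \<tau>': "\<tau> * \<tau>' = 1" by (rule fps3_unit)
    obtain \<upsilon> where \<upsilon>: "H \<upsilon> = qc \<tau>'" using qc_H by blast
    have "H (\<sigma> * \<upsilon>) = H 1" by (simp add: H_mult that(2) \<upsilon> qc_mult \<tau>' H_one)
    then have "\<sigma> * \<upsilon> - 1 \<in> jetmod F 1" by (simp add: H_eq)
    then have "\<sigma> * \<upsilon> - 1 \<in> jet 1" using jetmod_low[OF F_jet, of 1] by simp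
    from jet_diff[OF jet_mult_right[OF that(1), of \<upsilon>] this] have "1 \<in> jet 1" by simp
    then show False unfolding jet_1_iff by (simp add: cf_def)
  qed
  have "\<forall>i. \<exists>\<xi>. H \<xi> = qc (uvar i)" using qc_H by blast
  then obtain \<xi> where \<xi>: "\<And>i. H (\<xi> i) = qc (uvar i)" by metis
  have \<xi>1: "\<xi> i \<in> jet 1" for i
  proof -
    \<comment> \<open>Here the isomorphism has to respect the constants: after subtracting the
      constant term \<open>c\<close> on both sides, \<open>uvar i\<close> minus \<open>c\<close> has
      no constant term, so \<open>c\<close> is 0.\<close>
    define c where "c = cf (\<xi> i) 0 0 0"
    have "\<xi> i + fconst (- c) \<in> jet 1" unfolding jet_1_iff by (simp add: cf_fconst c_def)
    moreover have "H (\<xi> i + fconst (- c)) = qc (uvar i + fconst (- c))" by (simp only: H_add \<xi> H_const qc_add)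
    ultimately have "uvar i + fconst (- c) \<in> jet 1" by (rule local)
    then have "c = 0" using uvar_jet[of i] unfolding jet_1_iff by (simp add: cf_fconst)
    then show ?thesis by (simp only: jet_1_iff c_def)
  qed
  have H_sum: "H (\<Sum>i\<in>UNIV. f i) = qc (\<Sum>i\<in>UNIV. g i)" if "\<And>i. H (f i) = qc (g i)" for f g :: "3 \<Rightarrow> fps3"
    unfolding sum_3 by (simp add: H_add that qc_add)
  have zero: "H 0 = qc 0" using H_const[of 0] by (simp add: fconst_def)
  have "H (\<Sum>i\<in>UNIV. \<xi> i * \<xi> i) = qc (\<Sum>i\<in>UNIV. uvar i * uvar i)"
    by (rule H_sum) (simp add: H_mult \<xi> qc_mult)
  also have "\<dots> = H 0"
    unfolding zero qc_eq by (rule exI[of _ 1]) (simp add: qform_def power2_eq_square)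
  finally have "(\<Sum>i\<in>UNIV. \<xi> i * \<xi> i) \<in> jetmod F 3" by (simp add: H_eq)
  then obtain g where g: "(\<Sum>i\<in>UNIV. \<xi> i * \<xi> i) - F * g \<in> jet 3" by (auto simp: jetmod_def)
  \<comment> \<open>Every variable is a combination of the \<xi> up to order 2. Taking linear parts
    exhibits a left inverse of the matrix of linear parts.\<close>
  have "\<exists>b. uvar m - (\<Sum>i\<in>UNIV. \<xi> i * b i) \<in> jet 2" for m
  proof -
    obtain \<tau> where \<tau>: "H (uvar m) = qc \<tau>" using H_qc by blast
    then have "\<tau> \<in> jet (Suc 0)" using local[OF uvar_jet \<tau>] by (simp only: One_nat_def)
    then obtain t where t: "\<tau> = (\<Sum>i\<in>UNIV. uvar i * t i)" using jet_Suc_decomp by blast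
    have "\<forall>i. \<exists>b. H b = qc (t i)" using qc_H by blast
    then obtain b where b: "\<And>i. H (b i) = qc (t i)" by metis
    have "H (\<Sum>i\<in>UNIV. \<xi> i * b i) = qc (\<Sum>i\<in>UNIV. uvar i * t i)"
      by (rule H_sum) (simp add: H_mult \<xi> b qc_mult)
    then have "H (uvar m) = H (\<Sum>i\<in>UNIV. \<xi> i * b i)" using \<tau> t by simp
    then have "uvar m - (\<Sum>i\<in>UNIV. \<xi> i * b i) \<in> jetmod F 2" by (simp add: H_eq)
    then show ?thesis using jetmod_low[OF F_jet, of 2] by auto
  qed
  then obtain b where b: "\<And>m. uvar m - (\<Sum>i\<in>UNIV. \<xi> i * b m i) \<in> jet 2" by metis
  define N where "N = (\<chi> i. lin (\<xi> i))"
  define B where "B = (\<chi> m i. cf (b m i) 0 0 0)"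
  have \<xi>0: "cf (\<xi> i) 0 0 0 = 0" for i using \<xi>1[of i] by (simp only: jet_1_iff)
  have lin_mult: "lin (\<xi> i * s) = cf s 0 0 0 *s lin (\<xi> i)" for i s
    by (simp add: vec_eq_iff forall_3 lin_simps cf_mult \<xi>0 atLeast0_atMost_Suc One_nat_def)
  have lin_add: "lin (s + t) = lin s + lin t" for s t by (simp add: vec_eq_iff forall_3 lin_simps)
  have lin_jet: "lin s = lin t" if "s - t \<in> jet 2" for s t
    using that by (simp add: vec_eq_iff forall_3 lin_simps jet_def)
  have lin_uvar: "lin (uvar m) = axis m 1" for m
    using exhaust_3[of m] by (auto simp: vec_eq_iff forall_3 lin_simps cf_uvar axis_def)
  have "(B ** N) $ m = mat 1 $ m" for m
  proof -
    have "(B ** N) $ m = (\<Sum>i\<in>UNIV. cf (b m i) 0 0 0 *s lin (\<xi> i))"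
      by (simp add: matrix_mult_row B_def N_def)
    also have "\<dots> = lin (\<Sum>i\<in>UNIV. \<xi> i * b m i)" by (simp add: sum_3 lin_add lin_mult)
    also have "\<dots> = lin (uvar m)" using lin_jet[OF b[of m]] by simp
    finally show ?thesis by (simp add: lin_uvar mat_row)
  qed
  then have "B ** N = mat 1" by (simp add: vec_eq_iff)
  then have detN: "det N \<noteq> 0" by (metis det_I det_mul mult_zero_right zero_neq_one)
  have F0: "cf F i j k = 0" if "i + j + k < 2" for i j k using F_jet that by (simp add: jet_def)
  have two: "{0..2::nat} = {0, 1, 2}" "{0..1::nat} = {0, 1}" by auto
  define c where "c = cf g 0 0 0"
  have quad: "(\<Sum>i\<in>UNIV. cf (\<xi> i * \<xi> i) p q r) = cf (F * g) p q r" if "p + q + r < 3" for p q r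
    using g that by (simp add: jet_def cf_sum)
  \<comment> \<open>\<open>F\<close> has order 2, so in degree 2 the product sees only the constant
    term \<open>c\<close> of \<open>g\<close>.\<close>
  have Fg: "cf (F * g) 2 0 0 = cf F 2 0 0 * c" "cf (F * g) 1 1 0 = cf F 1 1 0 * c" "cf (F * g) 1 0 1 = cf F 1 0 1 * c"
    "cf (F * g) 0 2 0 = cf F 0 2 0 * c" "cf (F * g) 0 1 1 = cf F 0 1 1 * c" "cf (F * g) 0 0 2 = cf F 0 0 2 * c"
    by (simp_all add: cf_mult two F0 c_def)
  have sq: "cf (\<xi> i * \<xi> i) 2 0 0 = N$i$1 * N$i$1" "cf (\<xi> i * \<xi> i) 1 1 0 = 2 * (N$i$1 * N$i$2)" "cf (\<xi> i * \<xi> i) 1 0 1 = 2 * (N$i$1 * N$i$3)"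
    "cf (\<xi> i * \<xi> i) 0 2 0 = N$i$2 * N$i$2" "cf (\<xi> i * \<xi> i) 0 1 1 = 2 * (N$i$2 * N$i$3)" "cf (\<xi> i * \<xi> i) 0 0 2 = N$i$3 * N$i$3" for i
    by (simp_all add: cf_mult two \<xi>0 N_def lin_simps One_nat_def)
  have S: "(\<Sum>i\<in>UNIV. N$i$1 * N$i$1) = cf F 2 0 0 * c" "2 * (\<Sum>i\<in>UNIV. N$i$1 * N$i$2) = cf F 1 1 0 * c"
    "2 * (\<Sum>i\<in>UNIV. N$i$1 * N$i$3) = cf F 1 0 1 * c" "(\<Sum>i\<in>UNIV. N$i$2 * N$i$2) = cf F 0 2 0 * c"
    "2 * (\<Sum>i\<in>UNIV. N$i$2 * N$i$3) = cf F 0 1 1 * c" "(\<Sum>i\<in>UNIV. N$i$3 * N$i$3) = cf F 0 0 2 * c"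
    using quad[of 2 0 0] quad[of 1 1 0] quad[of 1 0 1] quad[of 0 2 0] quad[of 0 1 1] quad[of 0 0 2]
    unfolding sq Fg by (simp_all add: sum_distrib_left)
  have "transpose N ** N = (\<chi> i. c *s hess $ i)"
    using S by (simp add: vec_eq_iff forall_3 matrix_matrix_mult_def transpose_def hess_def mult.commute)
  then have "det (transpose N ** N) = det (\<chi> i. c *s hess $ i)" by simp
  also have "\<dots> = c ^ 3 * det hess" using det_rows_mul[of "\<lambda>_. c" "\<lambda>i. hess $ i"] by simp
  finally have "det N * det N = c ^ 3 * det hess" by (simp add: det_mul det_transpose)
  then show ?thesis using detN by auto
qed

end

section \<open>Power-bounded matrices and infinite stabilizers\<close>

lemma norm_vec_scale: "norm (a *s (v :: complex^'n)) = norm a * norm v"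
  unfolding norm_vec_def by (simp add: norm_mult L2_set_right_distrib)

text \<open>Boundedness of the powers of \<open>A\<close> and of its inverse forces |a| = 1. On a
  Jordan chain of length two, v A^n = a^n v + n a^(n - 1) w, which grows linearly unless w =
  0.\<close>

lemma power_bounded_imp_semisimple:
  fixes A A' :: "complex^'n^'n" and P P' :: "nat \<Rightarrow> complex^'n^'n"
  assumes P: "P 0 = mat 1" "\<And>n. P (Suc n) = P n ** A" "\<And>n. norm (P n) \<le> K"
    and P': "P' 0 = mat 1" "\<And>n. P' (Suc n) = P' n ** A'" "\<And>n. norm (P' n) \<le> K"
    and inv: "A ** A' = mat 1"
    and w: "w = v v* A - a *s v" "w v* A = a *s w"
  shows "w = 0"
proof (rule ccontr)
  assume nz: "w \<noteq> 0"
  define L where "L = real CARD('n) * CARD('n) * K"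
  have L: "norm (x v* P n) \<le> norm x * L" "norm (x v* P' n) \<le> norm x * L" for x n
  proof -
    have "norm (x v* B) \<le> norm x * L" if "norm B \<le> K" for B :: "complex^'n^'n"
    proof -
      have "real CARD('n) * CARD('n) * (norm x * norm B) \<le> real CARD('n) * CARD('n) * (norm x * K)"
        using that by (intro mult_left_mono) auto
      then show ?thesis using norm_vector_matrix_mult_le[of x B] by (simp add: L_def ac_simps)
    qed
    then show "norm (x v* P n) \<le> norm x * L" "norm (x v* P' n) \<le> norm x * L" using P(3) P'(3) by auto
  qed
  have pw: "w v* P n = a ^ n *s w" for n
    by (induct n) (simp_all add: P vector_matrix_mult_one vector_matrix_mult_assoc vector_matrix_simps w(2) vector_smult_assoc mult.commute)
  have "a \<noteq> 0"
  proof
    assume "a = 0"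
    then have "w v* (A ** A') = 0" using w(2) by (simp add: vector_matrix_mult_assoc vector_matrix_simps)
    then show False using nz by (simp add: inv vector_matrix_mult_one)
  qed
  have "a *s (w v* A') = w"
    using arg_cong[OF w(2), of "\<lambda>x. x v* A'"] by (simp add: vector_matrix_mult_assoc[symmetric] inv vector_matrix_mult_one vector_matrix_simps)
  then have "inverse a *s (a *s (w v* A')) = inverse a *s w" by simp
  then have wA': "w v* A' = inverse a *s w" using \<open>a \<noteq> 0\<close> by (simp add: vector_smult_assoc)
  have pw': "w v* P' n = inverse a ^ n *s w" for n
    by (induct n) (simp_all add: P' vector_matrix_mult_one vector_matrix_mult_assoc vector_matrix_simps wA' vector_smult_assoc mult.commute)
  have le1: "norm b \<le> 1" if "\<And>n. norm (b ^ n *s w) \<le> norm w * L" for b :: complex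
  proof (rule ccontr)
    assume "\<not> norm b \<le> 1"
    then obtain n where "L < norm b ^ n" using real_arch_pow[of "norm b" L] by auto
    moreover have "norm b ^ n \<le> L" using that[of n] nz by (simp add: norm_vec_scale norm_power mult.commute)
    ultimately show False by simp
  qed
  have "norm a \<le> 1" by (rule le1) (metis pw L(1))
  moreover have "norm (inverse a) \<le> 1" by (rule le1) (metis pw' L(2))
  ultimately have "norm a = 1" using \<open>a \<noteq> 0\<close> by (simp add: norm_inverse inverse_le_1_iff)
  have vA: "v v* A = a *s v + w" using w(1) by simp
  \<comment> \<open>For n = 0 the truncated exponent \<open>n - 1\<close> is harmless because of the
    factor \<open>of_nat n\<close>.\<close>
  have "v v* P n = a ^ n *s v + (of_nat n * a ^ (n - 1)) *s w" for n
  proof (induct n)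
    case (Suc n)
    have "v v* P (Suc n) = a ^ n *s (a *s v + w) + (of_nat n * a ^ (n - 1)) *s (a *s w)"
      by (simp add: P vector_matrix_mult_assoc Suc vector_matrix_simps vA w(2))
    also have "\<dots> = a ^ Suc n *s v + (a ^ n + of_nat n * a ^ (n - 1) * a) *s w"
      by (simp add: vec.scale_right_distrib vector_smult_assoc vector_sadd_rdistrib mult.commute)
    also have "a ^ n + of_nat n * a ^ (n - 1) * a = of_nat (Suc n) * a ^ n"
      by (cases n) (simp_all add: algebra_simps)
    finally show ?case by simp
  qed (simp add: P vector_matrix_mult_one)
  then have "norm ((of_nat n * a ^ (n - 1)) *s w) \<le> norm v * L + norm v" for n
    using norm_triangle_ineq4[of "v v* P n" "a ^ n *s v"] L(1)[of v n] \<open>norm a = 1\<close>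
    by (simp add: norm_vec_scale norm_power)
  then have b: "real n * norm w \<le> norm v * L + norm v" for n
    using \<open>norm a = 1\<close> by (simp add: norm_vec_scale norm_mult norm_power)
  obtain n where "norm v * L + norm v < real n * norm w"
    using reals_Archimedean3[of "norm w"] nz by auto
  then show False using b[of n] by simp
qed

text \<open>At a coordinate of \<open>x\<close> of largest modulus, the eigenvalue equation bounds
  \<mu> - 1 by the entries of \<open>A - mat 1\<close>.\<close>

lemma eigenvalue_near_one:
  fixes A :: "complex^'n^'n" and e :: real
  assumes "x \<noteq> 0" "x v* A = \<mu> *s x" "norm (A - mat 1) < e"
  shows "norm (\<mu> - 1) < real CARD('n) * e"
proof -
  define m where "m = Max (range (\<lambda>i. norm (x $ i)))"
  have "m \<in> range (\<lambda>i. norm (x $ i))" unfolding m_def by (intro Max_in) auto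
  then obtain i where i: "m = norm (x $ i)" by blast
  have le: "norm (x $ j) \<le> norm (x $ i)" for j unfolding i[symmetric] m_def by (intro Max_ge) auto
  have pos: "norm (x $ i) > 0"
  proof (rule ccontr)
    assume "\<not> norm (x $ i) > 0"
    then have "x $ j = 0" for j using le[of j] by simp
    then show False using assms(1) by (simp add: vec_eq_iff)
  qed
  have "x v* (A - mat 1) = x v* A - x v* mat 1"
    by (simp add: vec_eq_iff vector_matrix_mult_def sum_subtractf right_diff_distrib left_diff_distrib)
  then have e: "(\<mu> - 1) *s x = x v* (A - mat 1)"
    using assms(2) by (simp add: vector_matrix_mult_one vec.scale_left_diff_distrib)
  have "((\<mu> - 1) *s x) $ i = (x v* (A - mat 1)) $ i" by (simp only: e)
  then have "(\<mu> - 1) * x $ i = (\<Sum>j\<in>UNIV. x $ j * (A - mat 1) $ j $ i)"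
    by (simp only: vector_matrix_mult_def vec_lambda_beta vector_smult_component)
  moreover have "norm (x $ j * (A - mat 1) $ j $ i) \<le> norm (x $ i) * norm (A - mat 1)" for j
    unfolding norm_mult by (intro mult_mono le matrix_entry_norm) auto
  ultimately have "norm (\<mu> - 1) * norm (x $ i) \<le> CARD('n) * (norm (x $ i) * norm (A - mat 1))"
    using sum_norm_bound[of UNIV "\<lambda>j. x $ j * (A - mat 1) $ j $ i" "norm (x $ i) * norm (A - mat 1)"]
    by (metis norm_mult)
  also have "\<dots> < CARD('n) * (norm (x $ i) * e)"
    using assms(3) pos by (intro mult_strict_left_mono) auto
  finally have "norm (\<mu> - 1) * norm (x $ i) < (CARD('n) * e) * norm (x $ i)" by (simp add: ac_simps)
  then show ?thesis using pos by simp
qed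

text \<open>Nonzero periods of the exponential have modulus at least 2 pi > 6. The bound 5 is chosen
  to exceed every sum of up to four logarithms of modulus below 1.\<close>

lemma small_exp_eq_1:
  assumes "exp z = 1" "norm z < 5"
  shows "z = (0::complex)"
proof -
  obtain n :: int where n: "Re z = 0" "Im z = of_int (2 * n) * pi" using assms(1) exp_eq_1 by auto
  have "\<bar>Im z\<bar> < 5" using abs_Im_le_cmod[of z] assms(2) by linarith
  moreover have "\<bar>Im z\<bar> = \<bar>of_int n\<bar> * (2 * pi)" using n(2) by (simp add: abs_mult)
  moreover have "\<bar>real_of_int n\<bar> * (2 * pi) \<ge> 6" if "n \<noteq> 0"
  proof -
    have "\<bar>real_of_int n\<bar> \<ge> 1" using that by linarith
    then have "\<bar>real_of_int n\<bar> * (2 * pi) \<ge> 1 * (2 * 3)" using pi_gt3 by (intro mult_mono) auto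
    then show ?thesis by simp
  qed
  ultimately have "n = 0" by linarith
  then show ?thesis using n by (simp add: complex_eq_iff)
qed

lemma Ln_near_one:
  obtains \<delta> where "\<delta> > 0" "\<And>z. norm (z - 1) < \<delta> \<Longrightarrow> z \<noteq> 0 \<and> norm (Ln z) < 1"
proof -
  have "isCont Ln 1" by (rule continuous_at_Ln) (simp add: complex_nonpos_Reals_iff)
  then obtain d where d: "d > 0" "\<And>z. dist z 1 < d \<Longrightarrow> dist (Ln z) (Ln 1) < 1"
    unfolding continuous_at_eps_delta by (metis zero_less_one)
  show thesis
  proof (rule that[of "min d 1"])
    show "z \<noteq> 0 \<and> norm (Ln z) < 1" if "norm (z - 1) < min d 1" for z
      using that d(2)[of z] by (auto simp: dist_norm)
  qed (use d in auto)
qed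

theorem infinite_stabilizer_imp_weights:
  assumes c: "tsym c" and proper: "proper c" and inf: "infinite {\<gamma> \<in> SL \<times> SL. act \<gamma> (tens c) = tens c}"
  obtains \<gamma> a b where "det (fst \<gamma>) \<noteq> 0" "det (snd \<gamma>) \<noteq> 0" "weights c \<gamma> a b" "(\<exists>i. a i \<noteq> 0) \<or> (\<exists>k. b k \<noteq> 0)"
proof -
  define H where "H = {\<gamma> \<in> SL \<times> SL. tact \<gamma> c = c}"
  have "infinite H" using inf tens_inject[OF tsym_tact[OF c] c] by (simp add: H_def act_tens)
  have H_mult: "gmult \<gamma> \<delta> \<in> H" if "\<gamma> \<in> H" "\<delta> \<in> H" for \<gamma> \<delta>
    using that gmult_SL[of \<gamma> \<delta>] by (simp add: H_def tact_gmult)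
  have H_one: "(mat 1, mat 1) \<in> H" by (simp add: H_def SL_one tact_one)
  have H_inv: "\<exists>\<gamma>'\<in>H. gmult \<gamma> \<gamma>' = (mat 1, mat 1) \<and> gmult \<gamma>' \<gamma> = (mat 1, mat 1)" if "\<gamma> \<in> H" for \<gamma>
  proof -
    have "\<gamma> \<in> SL \<times> SL" "tact \<gamma> c = c" using that by (auto simp: H_def)
    obtain \<gamma>' where \<gamma>': "\<gamma>' \<in> SL \<times> SL" "gmult \<gamma> \<gamma>' = (mat 1, mat 1)" "gmult \<gamma>' \<gamma> = (mat 1, mat 1)"
      by (rule group_inverse[OF \<open>\<gamma> \<in> SL \<times> SL\<close>])
    have "tact \<gamma>' c = tact (gmult \<gamma>' \<gamma>) c" using \<open>tact \<gamma> c = c\<close> by (simp only: tact_gmult)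
    also have "\<dots> = c" by (simp only: \<gamma>'(3) tact_one)
    finally show ?thesis using \<gamma>' by (auto simp: H_def)
  qed
  define C where "C = (\<Sum>t\<in>UNIV. norm (case t of (i,j,k,l) \<Rightarrow> c i j k l))"
  have "norm (c i j k l) \<le> C" for i j k l
    unfolding C_def using member_le_sum[of "(i,j,k,l)" UNIV "\<lambda>t. norm (case t of (i,j,k,l) \<Rightarrow> c i j k l)"] by simp
  then have "H \<subseteq> {\<gamma> \<in> SL \<times> SL. \<forall>i j k l. norm (tact \<gamma> c i j k l) \<le> C}" by (auto simp: H_def)
  then have "bounded H" by (rule bounded_subset[OF proper[unfolded proper_def, THEN spec, of C]])
  then obtain K where K: "\<And>\<gamma>. \<gamma> \<in> H \<Longrightarrow> norm \<gamma> \<le> K" unfolding bounded_iff by blast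
  have "closed H"
    unfolding closed_sequential_limits
  proof (intro allI impI, elim conjE)
    fix x l assume x: "\<forall>n. x n \<in> H" "x \<longlonglongrightarrow> l"
    have "closed (SL \<times> SL :: ((complex^2^2) \<times> (complex^3^3)) set)" by (intro closed_Times closed_SL)
    then have l: "l \<in> SL \<times> SL"
      by (rule closed_sequentially[OF _ _ x(2)]) (use x(1) in \<open>auto simp: H_def\<close>)
    have "tact l c i j k m = c i j k m" for i j k m
    proof -
      have "(\<lambda>n. tact (x n) c i j k m) \<longlonglongrightarrow> tact l c i j k m" by (rule tendsto_tact'[OF x(2)])
      moreover have "tact (x n) c = c" for n using x(1) by (simp add: H_def)
      ultimately show ?thesis by (simp add: LIMSEQ_const_iff)
    qed
    then have "tact l c = c" by blast
    then show "l \<in> H" using l by (simp add: H_def)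
  qed
  then have "compact H" using \<open>bounded H\<close> by (simp add: compact_eq_bounded_closed)
  then obtain x where x: "x \<in> H" "x islimpt H"
    using \<open>infinite H\<close> unfolding compact_eq_Bolzano_Weierstrass by blast
  then obtain f where f: "\<And>n::nat. f n \<in> H - {x}" "f \<longlonglongrightarrow> x" unfolding islimpt_sequential by blast
  obtain x' where x': "x' \<in> H" "gmult x x' = (mat 1, mat 1)" "gmult x' x = (mat 1, mat 1)" using H_inv[OF x(1)] by blast
  \<comment> \<open>Translating by the inverse of the accumulation point \<open>x\<close> moves the
    accumulation to the identity.\<close>
  define h where "h = (\<lambda>n. gmult (f n) x')"
  have hH: "h n \<in> H" for n using f(1)[of n] x'(1) H_mult by (simp add: h_def)
  have h1: "h n \<noteq> (mat 1, mat 1)" for n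
  proof
    assume "h n = (mat 1, mat 1)"
    then have "gmult (gmult (f n) x') x = x" by (simp add: h_def)
    then have "f n = x" by (simp add: gmult_assoc x'(3))
    then show False using f(1)[of n] by blast
  qed
  have "(\<lambda>n. fst (h n)) \<longlonglongrightarrow> fst x ** fst x'" "(\<lambda>n. snd (h n)) \<longlonglongrightarrow> snd x ** snd x'"
    unfolding h_def gmult_def fst_conv snd_conv
    by (intro tendsto_matrix_mult tendsto_fst[OF f(2)] tendsto_snd[OF f(2)] tendsto_const)+
  then have lim: "(\<lambda>n. fst (h n)) \<longlonglongrightarrow> mat 1" "(\<lambda>n. snd (h n)) \<longlonglongrightarrow> mat 1"
    using x'(2) by (simp_all add: gmult_def)
  obtain \<delta> where \<delta>0: "\<delta> > 0" "\<forall>z. norm (z - 1) < \<delta> \<longrightarrow> z \<noteq> 0 \<and> norm (Ln z) < 1" by (rule Ln_near_one) blast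
  have \<delta>: "\<delta> > 0" "\<And>z. norm (z - 1) < \<delta> \<Longrightarrow> z \<noteq> 0 \<and> norm (Ln z) < 1" using \<delta>0 by blast+
  have "\<forall>\<^sub>F n in sequentially. dist (fst (h n)) (mat 1) < \<delta> / 3 \<and> dist (snd (h n)) (mat 1) < \<delta> / 3"
    using \<delta>(1) by (intro eventually_conj tendstoD lim) auto
  \<comment> \<open>The division by 3 makes up for the matrix size, 2 or 3, that
    \<open>eigenvalue_near_one\<close> costs.\<close>
  then obtain n where n: "dist (fst (h n)) (mat 1) < \<delta> / 3" "dist (snd (h n)) (mat 1) < \<delta> / 3"
    using eventually_happens'[OF sequentially_bot] by blast
  define \<gamma> where "\<gamma> = h n"
  have \<gamma>: "\<gamma> \<in> H" "\<gamma> \<noteq> (mat 1, mat 1)" "norm (fst \<gamma> - mat 1) < \<delta> / 3" "norm (snd \<gamma> - mat 1) < \<delta> / 3"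
    using hH h1 n by (simp_all add: \<gamma>_def dist_norm)
  obtain \<gamma>' where \<gamma>': "\<gamma>' \<in> H" "gmult \<gamma> \<gamma>' = (mat 1, mat 1)" using H_inv[OF \<gamma>(1)] by blast
  define P where "P = rec_nat (mat 1, mat 1) (\<lambda>_ \<eta>. gmult \<eta> \<gamma>)"
  define P' where "P' = rec_nat (mat 1, mat 1) (\<lambda>_ \<eta>. gmult \<eta> \<gamma>')"
  have P: "P 0 = (mat 1, mat 1)" "P (Suc n) = gmult (P n) \<gamma>" and P': "P' 0 = (mat 1, mat 1)" "P' (Suc n) = gmult (P' n) \<gamma>'" for n
    by (simp_all add: P_def P'_def)
  have "P n \<in> H" "P' n \<in> H" for n
    by (induct n) (simp_all add: P P' H_one H_mult \<gamma>(1) \<gamma>'(1))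
  then have bnd: "norm (P n) \<le> K" "norm (P' n) \<le> K" for n using K by blast+
  have bf: "norm (fst (P n)) \<le> K" "norm (fst (P' n)) \<le> K" "norm (snd (P n)) \<le> K" "norm (snd (P' n)) \<le> K" for n
    using bnd[of n] norm_fst_le[of "fst (P n)" "snd (P n)"] norm_fst_le[of "fst (P' n)" "snd (P' n)"]
      norm_snd_le[of "snd (P n)" "fst (P n)"] norm_snd_le[of "snd (P' n)" "fst (P' n)"] by auto
  have inv: "fst \<gamma> ** fst \<gamma>' = mat 1" "snd \<gamma> ** snd \<gamma>' = mat 1" using \<gamma>'(2) by (auto simp: gmult_def)
  have ss1: "w = 0" if "w = v v* fst \<gamma> - a *s v" "w v* fst \<gamma> = a *s w" for v w a
    by (rule power_bounded_imp_semisimple[where P = "\<lambda>n. fst (P n)" and P' = "\<lambda>n. fst (P' n)", OF _ _ bf(1) _ _ bf(2) inv(1) that]) (simp_all add: P P' gmult_def)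
  have ss2: "w = 0" if "w = v v* snd \<gamma> - a *s v" "w v* snd \<gamma> = a *s w" for v w a
    by (rule power_bounded_imp_semisimple[where P = "\<lambda>n. snd (P n)" and P' = "\<lambda>n. snd (P' n)", OF _ _ bf(3) _ _ bf(4) inv(2) that]) (simp_all add: P P' gmult_def)
  obtain K1 \<mu>1 where K1': "det K1 \<noteq> 0 \<and> (\<forall>i. K1 $ i v* fst \<gamma> = \<mu>1 i *s K1 $ i)" by (rule diagonalization[OF ss1]) blast+
  obtain K2 \<mu>2 where K2': "det K2 \<noteq> 0 \<and> (\<forall>i. K2 $ i v* snd \<gamma> = \<mu>2 i *s K2 $ i)" by (rule diagonalization[OF ss2]) blast+
  have K1: "det K1 \<noteq> 0" "\<And>i. K1 $ i v* fst \<gamma> = \<mu>1 i *s K1 $ i" and K2: "det K2 \<noteq> 0" "\<And>i. K2 $ i v* snd \<gamma> = \<mu>2 i *s K2 $ i"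
    using K1' K2' by blast+
  have row_nz: "A $ i \<noteq> 0" if "det A \<noteq> 0" for A :: "complex^'n^'n" and i
    using that det_zero_row(1)[of i A] by (auto simp: row_def vec_eq_iff)
  have m1: "norm (\<mu>1 i - 1) < \<delta>" for i
    using eigenvalue_near_one[OF row_nz[OF K1(1)] K1(2) \<gamma>(3), of i] \<delta>(1) by simp
  have m2: "norm (\<mu>2 i - 1) < \<delta>" for i
    using eigenvalue_near_one[OF row_nz[OF K2(1)] K2(2) \<gamma>(4), of i] by simp
  define l1 where "l1 = (\<lambda>i. Ln (\<mu>1 i))"
  define l2 where "l2 = (\<lambda>i. Ln (\<mu>2 i))"
  have l1: "exp (l1 i) = \<mu>1 i" "norm (l1 i) < 1" and l2: "exp (l2 k) = \<mu>2 k" "norm (l2 k) < 1" for i k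
    using \<delta>(2)[OF m1[of i]] \<delta>(2)[OF m2[of k]] by (auto simp: l1_def l2_def)
  \<comment> \<open>The first part makes the logarithms sum to zero; the second makes them
    nontrivial, as a diagonalizable matrix with all eigenvalues 1 is the identity.\<close>
  have prod1: "(\<Prod>i\<in>UNIV. \<mu> i) = 1 \<and> ((\<forall>i. \<mu> i = 1) \<longrightarrow> A = mat 1)"
    if "det A = 1" "det K \<noteq> 0" "\<And>i. K $ i v* A = \<mu> i *s K $ i" for A K :: "complex^'n^'n" and \<mu>
  proof -
    have "K ** A = diagm \<mu> ** K"
    proof -
      have "(diagm \<mu> ** K) $ i = \<mu> i *s K $ i" for i
        by (simp add: vec_eq_iff matrix_matrix_mult_def diagm_def if_distrib[where f = "\<lambda>a. a * _"] cong: if_cong)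
      then show ?thesis by (simp add: vec_eq_iff[of "K ** A"] matrix_mult_row_vector that(3))
    qed
    then have "det (K ** A) = det (diagm \<mu> ** K)" by (rule arg_cong)
    then have "det K * det A = (\<Prod>i\<in>UNIV. \<mu> i) * det K" by (simp add: det_mul det_diagm)
    moreover have "A = mat 1" if "\<forall>i. \<mu> i = 1"
    proof -
      have "diagm \<mu> = mat 1" using that by (simp add: diagm_def mat_def vec_eq_iff)
      then have "K ** A = K" using \<open>K ** A = diagm \<mu> ** K\<close> by simp
      obtain K' where K': "K' ** K = mat 1" using \<open>det K \<noteq> 0\<close> by (auto simp: invertible_det_nz[symmetric] invertible_def)
      have "(K' ** K) ** A = K' ** K" using \<open>K ** A = K\<close> by (simp only: matrix_mul_assoc[symmetric])
      then show ?thesis unfolding \<open>K' ** K = mat 1\<close> by (simp only: matrix_mul_lid)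
    qed
    ultimately show ?thesis using that(1,2) by auto
  qed
  have dets: "det (fst \<gamma>) = 1" "det (snd \<gamma>) = 1" using \<gamma>(1) by (auto simp: H_def SL_def)
  have "exp (\<Sum>i\<in>UNIV. l1 i) = 1" "exp (\<Sum>i\<in>UNIV. l2 i) = 1"
    using prod1[OF dets(1) K1] prod1[OF dets(2) K2] by (simp_all add: exp_sum l1 l2)
  moreover have "norm (\<Sum>i\<in>UNIV. l1 i) < 5"
    unfolding sum_2 using norm_triangle_ineq[of "l1 1" "l1 2"] l1(2)[of 1] l1(2)[of 2] by linarith
  moreover have "norm (\<Sum>i\<in>UNIV. l2 i) < 5"
    unfolding sum_3 using norm_triangle_ineq[of "l2 1" "l2 2"] norm_triangle_ineq[of "l2 1 + l2 2" "l2 3"] l2(2)[of 1] l2(2)[of 2] l2(2)[of 3] by linarith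
  ultimately have sums: "(\<Sum>i\<in>UNIV. l1 i) = 0" "(\<Sum>i\<in>UNIV. l2 i) = 0" using small_exp_eq_1 by blast+
  \<comment> \<open>As \<gamma> fixes \<open>c\<close>, the product of the eigenvalues belonging to
    a nonzero entry is 1. Since the logarithms are small, their sum is 0 and not merely a
    period.\<close>
  have wt: "l1 i + l1 j + l2 k + l2 m = 0" if "tact (K1, K2) c i j k m \<noteq> 0" for i j k m
  proof -
    have "Phi c (K1 $ i) (K1 $ j) (K2 $ k) (K2 $ m) = Phi (tact \<gamma> c) (K1 $ i) (K1 $ j) (K2 $ k) (K2 $ m)"
      using \<gamma>(1) by (simp add: H_def)
    also have "\<dots> = \<mu>1 i * \<mu>1 j * \<mu>2 k * \<mu>2 m * Phi c (K1 $ i) (K1 $ j) (K2 $ k) (K2 $ m)"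
      by (simp add: Phi_tact K1(2) K2(2) Phi_linear)
    finally have "\<mu>1 i * \<mu>1 j * \<mu>2 k * \<mu>2 m = 1" using that by (simp add: tact_def)
    then have "exp (l1 i + l1 j + l2 k + l2 m) = 1" by (simp add: exp_add l1 l2)
    moreover have "norm (l1 i + l1 j + l2 k + l2 m) < 5"
      using l1(2)[of i] l1(2)[of j] l2(2)[of k] l2(2)[of m] norm_triangle_ineq[of "l1 i + l1 j + l2 k" "l2 m"]
        norm_triangle_ineq[of "l1 i + l1 j" "l2 k"] norm_triangle_ineq[of "l1 i" "l1 j"] by linarith
    ultimately show ?thesis by (rule small_exp_eq_1)
  qed
  have "\<not> ((\<forall>i. l1 i = 0) \<and> (\<forall>i. l2 i = 0))"
  proof
    assume "(\<forall>i. l1 i = 0) \<and> (\<forall>i. l2 i = 0)"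
    then have "\<forall>i. \<mu>1 i = 1" "\<forall>i. \<mu>2 i = 1" using l1(1) l2(1) by (metis exp_zero)+
    then have "fst \<gamma> = mat 1" "snd \<gamma> = mat 1" using prod1[OF dets(1) K1] prod1[OF dets(2) K2] by blast+
    then show False using \<gamma>(2) by (simp add: prod_eq_iff)
  qed
  \<comment> \<open>All relations between the logarithms are real linear, so real and imaginary
    parts are weights separately, and one of the two systems is nonzero.\<close>
  then have "((\<exists>i. Re (l1 i) \<noteq> 0) \<or> (\<exists>i. Re (l2 i) \<noteq> 0)) \<or> ((\<exists>i. Im (l1 i) \<noteq> 0) \<or> (\<exists>i. Im (l2 i) \<noteq> 0))"
    by (auto simp: complex_eq_iff)
  then show thesis
  proof
    assume *: "(\<exists>i. Re (l1 i) \<noteq> 0) \<or> (\<exists>i. Re (l2 i) \<noteq> 0)"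
    have "weights c (K1, K2) (\<lambda>i. Re (l1 i)) (\<lambda>i. Re (l2 i))"
      unfolding weights_def Re_sum[symmetric] sums using arg_cong[OF wt, of _ _ _ _ Re] by auto
    then show thesis using * K1(1) K2(1) by (intro that[of "(K1, K2)"]) auto
  next
    assume *: "(\<exists>i. Im (l1 i) \<noteq> 0) \<or> (\<exists>i. Im (l2 i) \<noteq> 0)"
    have "weights c (K1, K2) (\<lambda>i. Im (l1 i)) (\<lambda>i. Im (l2 i))"
      unfolding weights_def Im_sum[symmetric] sums using arg_cong[OF wt, of _ _ _ _ Im] by auto
    then show thesis using * K1(1) K2(1) by (intro that[of "(K1, K2)"]) auto
  qed
qed

theorem not_stable_iff_weights:
  assumes c: "tsym c"
  shows "\<not> stable (tens c) \<longleftrightarrow> (\<exists>\<gamma> a b. det (fst \<gamma>) \<noteq> 0 \<and> det (snd \<gamma>) \<noteq> 0 \<and> weights c \<gamma> a b \<and>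
    ((\<exists>i. a i \<noteq> 0) \<or> (\<exists>k. b k \<noteq> 0)))"
proof
  assume "\<not> stable (tens c)"
  then have "\<not> proper c \<or> proper c \<and> infinite {\<gamma> \<in> SL \<times> SL. act \<gamma> (tens c) = tens c}"
    using proper_imp_closed[OF c] unfolding stable_def by blast
  then show "\<exists>\<gamma> a b. det (fst \<gamma>) \<noteq> 0 \<and> det (snd \<gamma>) \<noteq> 0 \<and> weights c \<gamma> a b \<and> ((\<exists>i. a i \<noteq> 0) \<or> (\<exists>k. b k \<noteq> 0))"
  proof
    assume "\<not> proper c"
    obtain \<gamma> a b where "det (fst \<gamma>) \<noteq> 0" "det (snd \<gamma>) \<noteq> 0" "weights c \<gamma> a b" "(\<exists>i. a i \<noteq> 0) \<or> (\<exists>k. b k \<noteq> 0)" by (rule not_proper_imp_weights[OF c \<open>\<not> proper c\<close>])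
    then show ?thesis by (intro exI[of _ \<gamma>] exI[of _ a] exI[of _ b] conjI)
  next
    assume *: "proper c \<and> infinite {\<gamma> \<in> SL \<times> SL. act \<gamma> (tens c) = tens c}"
    obtain \<gamma> a b where "det (fst \<gamma>) \<noteq> 0" "det (snd \<gamma>) \<noteq> 0" "weights c \<gamma> a b" "(\<exists>i. a i \<noteq> 0) \<or> (\<exists>k. b k \<noteq> 0)" by (rule infinite_stabilizer_imp_weights[OF c conjunct1[OF *] conjunct2[OF *]])
    then show ?thesis by (intro exI[of _ \<gamma>] exI[of _ a] exI[of _ b] conjI)
  qed
next
  assume "\<exists>\<gamma> a b. det (fst \<gamma>) \<noteq> 0 \<and> det (snd \<gamma>) \<noteq> 0 \<and> weights c \<gamma> a b \<and> ((\<exists>i. a i \<noteq> 0) \<or> (\<exists>k. b k \<noteq> 0))"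
  then obtain \<gamma> a b where "det (fst \<gamma>) \<noteq> 0" "det (snd \<gamma>) \<noteq> 0" "weights c \<gamma> a b" "(\<exists>i. a i \<noteq> 0) \<or> (\<exists>k. b k \<noteq> 0)" by (elim exE conjE)
  then show "\<not> stable (tens c)" by (rule weights_imp_not_stable[OF c])
qed

section \<open>Local coordinates at a point of the surface\<close>

lemma jet_lip_mult:
  assumes "s - s' \<in> jet (n + p)" "t - t' \<in> jet (n + q)" "s \<in> jet p" "t' \<in> jet q"
  shows "s * t - s' * t' \<in> jet (n + (p + q))"
proof -
  have "s * (t - t') \<in> jet (n + (p + q))" "(s - s') * t' \<in> jet (n + (p + q))"
    using jet_mult[OF assms(3,2)] jet_mult[OF assms(1,4)] by (simp_all add: ac_simps)
  from jet_add[OF this] show ?thesis by (simp add: algebra_simps)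
qed

text \<open>Terms of degree at least three of a form of bidegree \<open>(2,2)\<close> with coefficients \<open>d\<close> in the
  affine chart where the first coordinates are \<open>1\<close>.\<close>

definition cubic :: "tensor \<Rightarrow> (3 \<Rightarrow> fps3) \<Rightarrow> fps3" where
  "cubic d \<xi> = \<xi> 1 * \<xi> 1 * (fconst (2 * d 2 2 1 2) * \<xi> 2 + fconst (2 * d 2 2 1 3) * \<xi> 3)
    + \<xi> 1 * (fconst (2 * d 1 2 2 2) * (\<xi> 2 * \<xi> 2) + fconst (4 * d 1 2 2 3) * (\<xi> 2 * \<xi> 3) + fconst (2 * d 1 2 3 3) * (\<xi> 3 * \<xi> 3))
    + \<xi> 1 * \<xi> 1 * (fconst (d 2 2 2 2) * (\<xi> 2 * \<xi> 2) + fconst (2 * d 2 2 2 3) * (\<xi> 2 * \<xi> 3) + fconst (d 2 2 3 3) * (\<xi> 3 * \<xi> 3))"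

text \<open>The matrix of the quadratic part in the chart. A product of the line coordinate with a
  plane coordinate arises from four orderings of the indices, split over two symmetric places; hence
  the factor 2.\<close>

definition hess :: "tensor \<Rightarrow> complex^3^3" where
  "hess d = vector [vector [d 2 2 1 1, 2 * d 1 2 1 2, 2 * d 1 2 1 3],
     vector [2 * d 1 2 1 2, d 1 1 2 2, d 1 1 2 3], vector [2 * d 1 2 1 3, d 1 1 2 3, d 1 1 3 3]]"

text \<open>\<open>\<xi> 1\<close> stands for the affine coordinate on the line,
  \<open>\<xi> 2\<close> and \<open>\<xi> 3\<close> for those on the plane.\<close>

definition chart_x :: "(3 \<Rightarrow> fps3) \<Rightarrow> 2 \<Rightarrow> fps3" where
  "chart_x \<xi> a = (if a = 1 then 1 else \<xi> 1)"

definition chart_y :: "(3 \<Rightarrow> fps3) \<Rightarrow> 3 \<Rightarrow> fps3" where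
  "chart_y \<xi> b = (if b = 1 then 1 else \<xi> b)"

lemma cubic_jet: "(\<And>a. \<xi> a \<in> jet 1) \<Longrightarrow> cubic d \<xi> \<in> jet 3"
proof -
  assume \<xi>: "\<And>a. \<xi> a \<in> jet 1"
  have 2: "\<xi> a * \<xi> b \<in> jet 2" for a b using jet_mult[OF \<xi>[of a] \<xi>[of b]] by (simp add: numeral_2_eq_2)
  have 21: "s * t \<in> jet 3" if "s \<in> jet 2" "t \<in> jet 1" for s t using jet_mult[OF that] by (simp add: numeral_3_eq_3)
  have 12: "s * t \<in> jet 3" if "s \<in> jet 1" "t \<in> jet 2" for s t using jet_mult[OF that] by (simp add: numeral_3_eq_3)
  have 22: "s * t \<in> jet 3" if "s \<in> jet 2" "t \<in> jet 2" for s t by (rule jet_mono[OF jet_mult[OF that]]) simp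
  have A: "\<xi> 1 * \<xi> 1 * (fconst x * \<xi> 2 + fconst y * \<xi> 3) \<in> jet 3" for x y
    by (intro 21 2 jet_add jet_mult_left \<xi>)
  have B: "\<xi> 1 * (fconst x * (\<xi> 2 * \<xi> 2) + fconst y * (\<xi> 2 * \<xi> 3) + fconst z * (\<xi> 3 * \<xi> 3)) \<in> jet 3" for x y z
    by (rule 12[OF \<xi>]) (intro jet_add jet_mult_left 2)
  have D: "\<xi> 1 * \<xi> 1 * (fconst x * (\<xi> 2 * \<xi> 2) + fconst y * (\<xi> 2 * \<xi> 3) + fconst z * (\<xi> 3 * \<xi> 3)) \<in> jet 3" for x y z
    by (rule 22[OF 2]) (intro jet_add jet_mult_left 2)
  show ?thesis unfolding cubic_def by (intro jet_add A B D)
qed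

lemma cubic_lip:
  assumes \<xi>: "\<And>a. \<xi> a \<in> jet 1" and \<xi>': "\<And>a. \<xi>' a \<in> jet 1" and d: "\<And>a. \<xi>' a - \<xi> a \<in> jet (n + 1)"
  shows "cubic d \<xi>' - cubic d \<xi> \<in> jet (n + 3)"
proof -
  have 2: "\<xi> a * \<xi> b \<in> jet 2" "\<xi>' a * \<xi>' b \<in> jet 2" for a b
    using jet_mult[OF \<xi>[of a] \<xi>[of b]] jet_mult[OF \<xi>'[of a] \<xi>'[of b]] by (simp_all add: numeral_2_eq_2)
  have d2: "\<xi>' a * \<xi>' b - \<xi> a * \<xi> b \<in> jet (n + 2)" for a b
    using jet_lip_mult[OF d[of a] d[of b] \<xi>'[of a] \<xi>[of b]] by (simp add: numeral_2_eq_2)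
  have lc: "(fconst x * s' + t') - (fconst x * s + t) \<in> jet m" if "s' - s \<in> jet m" "t' - t \<in> jet m" for x s s' t t' m
    using jet_add[OF jet_mult_left[OF that(1), of "fconst x"] that(2)] by (simp add: algebra_simps)
  have lc1: "fconst x * s' - fconst x * s \<in> jet m" if "s' - s \<in> jet m" for x s s' m
    using jet_mult_left[OF that(1), of "fconst x"] by (simp add: algebra_simps)
  have la: "(s' + t') - (s + t) \<in> jet m" if "s' - s \<in> jet m" "t' - t \<in> jet m" for s s' t t' m
    using jet_add[OF that] by (simp add: algebra_simps)
  have A: "\<xi>' 1 * \<xi>' 1 * (fconst x * \<xi>' 2 + fconst y * \<xi>' 3) - \<xi> 1 * \<xi> 1 * (fconst x * \<xi> 2 + fconst y * \<xi> 3) \<in> jet (n + 3)" for x y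
    using jet_lip_mult[OF d2[of 1 1] la[OF lc1[OF d[of 2]] lc1[OF d[of 3]]] 2(2) jet_add[OF jet_mult_left[OF \<xi>[of 2]] jet_mult_left[OF \<xi>[of 3]]]]
    by simp
  let ?q = "\<lambda>\<xi>. \<lambda>x y z. fconst x * (\<xi> 2 * \<xi> 2) + fconst y * (\<xi> 2 * \<xi> 3) + fconst z * (\<xi> 3 * (\<xi> (3::3) :: fps3))"
  have q2: "?q \<xi> x y z \<in> jet 2" for x y z by (intro jet_add jet_mult_left 2)
  have dq: "?q \<xi>' x y z - ?q \<xi> x y z \<in> jet (n + 2)" for x y z by (intro la lc1 d2)
  have B: "\<xi>' 1 * ?q \<xi>' x y z - \<xi> 1 * ?q \<xi> x y z \<in> jet (n + 3)" for x y z
    using jet_lip_mult[OF d[of 1] dq[of x y z] \<xi>'[of 1] q2] by (simp add: numeral_3_eq_3)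
  have D: "\<xi>' 1 * \<xi>' 1 * ?q \<xi>' x y z - \<xi> 1 * \<xi> 1 * ?q \<xi> x y z \<in> jet (n + 3)" for x y z
    by (rule jet_mono[OF jet_lip_mult[OF d2[of 1 1] dq[of x y z] 2(2) q2]]) simp
  show ?thesis unfolding cubic_def by (intro la A B D)
qed

text \<open>The four vanishing entries are the value and the first derivatives at the point, so the
  expansion starts with a quadratic form.\<close>

lemma tform_chart:
  assumes d: "tsym d" and z: "d 1 1 1 1 = 0" "d 1 2 1 1 = 0" "d 1 1 1 2 = 0" "d 1 1 1 3 = 0"
  shows "tform fconst d (chart_x \<xi>) (chart_x \<xi>) (chart_y \<xi>) (chart_y \<xi>) =
    (\<Sum>j\<in>UNIV. \<Sum>k\<in>UNIV. fconst (hess d $ j $ k) * (\<xi> j * \<xi> k)) + cubic d \<xi>"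
proof -
  have s: "d 2 1 k l = d 1 2 k l" "d i j 2 1 = d i j 1 2" "d i j 3 1 = d i j 1 3" "d i j 3 2 = d i j 2 3" for i j k l
    using d unfolding tsym_def by blast+
  have c: "chart_x \<xi> 1 = 1" "chart_x \<xi> 2 = \<xi> 1" "chart_y \<xi> 1 = 1" "chart_y \<xi> 2 = \<xi> 2" "chart_y \<xi> 3 = \<xi> 3"
    by (simp_all add: chart_x_def chart_y_def)
  have h: "hess d $ 1 $ 1 = d 2 2 1 1" "hess d $ 1 $ 2 = 2 * d 1 2 1 2" "hess d $ 1 $ 3 = 2 * d 1 2 1 3"
    "hess d $ 2 $ 1 = 2 * d 1 2 1 2" "hess d $ 2 $ 2 = d 1 1 2 2" "hess d $ 2 $ 3 = d 1 1 2 3"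
    "hess d $ 3 $ 1 = 2 * d 1 2 1 3" "hess d $ 3 $ 2 = d 1 1 2 3" "hess d $ 3 $ 3 = d 1 1 3 3"
    by (simp_all add: hess_def)
  have f: "fconst (2 * x) = fconst x + fconst x" "fconst (4 * x) = fconst x + fconst x + (fconst x + fconst x)" "fconst 0 = 0" for x
    unfolding ring_morphD(2)[OF ring_morph_fconst, symmetric] by (simp_all add: fconst_def)
  show ?thesis
    unfolding tform_def sum_2 sum_3 c s z h cubic_def f by (simp add: algebra_simps)
qed

text \<open>Gram-Schmidt for a complex symmetric form, where isotropic vectors are the danger. If
  all vectors orthogonal to \<open>V\<close> were isotropic, the form would vanish on that
  complement by polarization, nondegeneracy would make the complement 0, and \<open>V\<close> would
  span although it is too small.\<close>

lemma orthonormal_basis_symmetric: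
  fixes H :: "complex^'n^'n"
  assumes sym: "transpose H = H" and det: "det H \<noteq> 0"
  obtains L :: "complex^'n^'n" where "transpose L ** H ** L = mat 1"
proof -
  define b where "b = (\<lambda>v w :: complex^'n. \<Sum>i\<in>UNIV. \<Sum>j\<in>UNIV. v $ i * H $ i $ j * w $ j)"
  have b_add: "b (u + v) w = b u w + b v w" "b w (u + v) = b w u + b w v" for u v w
    by (simp_all add: b_def distrib_right distrib_left sum.distrib)
  have b_scale: "b (a *s v) w = a * b v w" "b v (a *s w) = a * b v w" for a v w
    by (simp_all add: b_def sum_distrib_left ac_simps)
  have b_sum: "b w (\<Sum>x\<in>S. f x) = (\<Sum>x\<in>S. b w (f x))" for S :: "(complex^'n) set" and f w
  proof -
    have "b w 0 = 0" using b_scale(2)[of w 0 0] by (simp add: vector_smult_lzero)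
    then show ?thesis by (induct S rule: infinite_finite_induct) (simp_all add: b_add)
  qed
  have b_sym: "b v w = b w v" for v w
  proof -
    have "H $ i $ j = H $ j $ i" for i j using arg_cong[OF sym, of "\<lambda>A. A $ j $ i"] by (simp add: transpose_def)
    then have "b v w = (\<Sum>i\<in>UNIV. \<Sum>j\<in>UNIV. w $ j * H $ j $ i * v $ i)" by (simp add: b_def ac_simps)
    then show ?thesis unfolding b_def by (subst (asm) sum.swap)
  qed
  have nondeg: "v = 0" if "\<And>w. b v w = 0" for v
  proof -
    have "b v (axis j 1) = (v v* H) $ j" for j
      by (simp add: b_def vector_matrix_mult_def axis_def if_distrib[where f = "\<lambda>a. _ * a"] cong: if_cong)
    then have "v v* H = 0" using that by (simp add: vec_eq_iff)
    moreover obtain H' where "H ** H' = mat 1" using det by (auto simp: invertible_det_nz[symmetric] invertible_def)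
    ultimately show ?thesis
      using vector_matrix_mult_assoc[of v H H'] by (simp add: vector_matrix_mult_one vector_matrix_simps)
  qed
  have "\<exists>V. finite V \<and> card V = k \<and> (\<forall>v\<in>V. \<forall>w\<in>V. b v w = (if v = w then 1 else 0))" if "k \<le> CARD('n)" for k
    using that
  proof (induct k)
    case 0
    show ?case by (intro exI[of _ "{}"]) simp
  next
    case (Suc k)
    then obtain V where V: "finite V" "card V = k" "\<And>v w. v \<in> V \<Longrightarrow> w \<in> V \<Longrightarrow> b v w = (if v = w then 1 else 0)" by auto
    \<comment> \<open>Projection to the orthogonal complement of \<open>V\<close>.\<close>
    define r where "r = (\<lambda>x. x + (-1) *s (\<Sum>v\<in>V. b v x *s v))"
    have r: "b u (r x) = 0" if u: "u \<in> V" for u x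
    proof -
      have "b u (\<Sum>v\<in>V. b v x *s v) = (\<Sum>v\<in>V. if v = u then b u x else 0)"
        unfolding b_sum b_scale by (intro sum.cong refl) (use V(3) u in auto)
      also have "\<dots> = b u x" using V(1) u by simp
      finally show ?thesis unfolding r_def b_add b_scale by simp
    qed
    have "\<exists>w. (\<forall>v\<in>V. b v w = 0) \<and> b w w \<noteq> 0"
    proof (rule ccontr)
      assume "\<not> ?thesis"
      then have iso: "b w w = 0" if "\<forall>v\<in>V. b v w = 0" for w using that by blast
      have pol: "b w w' = 0" if "\<forall>v\<in>V. b v w = 0" "\<forall>v\<in>V. b v w' = 0" for w w'
      proof -
        have "b (w + w') (w + w') = 0" using that by (intro iso) (simp add: b_add)
        then have "2 * b w w' = 0" using iso[OF that(1)] iso[OF that(2)] b_sym[of w' w] by (simp add: b_add)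
        then show ?thesis by simp
      qed
      have "w = 0" if w: "\<forall>v\<in>V. b v w = 0" for w
      proof (rule nondeg)
        fix x
        have "b w (r x) = 0" using pol[OF w] r by blast
        moreover have "b w (\<Sum>v\<in>V. b v x *s v) = 0"
          unfolding b_sum b_scale using w b_sym by (intro sum.neutral) (metis mult_zero_right)
        ultimately show "b w x = 0" unfolding r_def b_add b_scale by simp
      qed
      then have "r x = 0" for x using r by blast
      then have "x = (\<Sum>v\<in>V. b v x *s v)" for x by (simp add: r_def)
      moreover have "(\<Sum>v\<in>V. b v x *s v) \<in> vec.span V" for x
        by (intro vec.span_sum vec.span_scale vec.span_base)
      ultimately have "(UNIV :: (complex^'n) set) \<subseteq> vec.span V" by (metis subsetI)
      then have "vec.dim (UNIV :: (complex^'n) set) \<le> card V" using V(1) by (rule vec.dim_le_card)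
      then show False using V(2) Suc(2) vec_dim_card[where 'a = complex and 'n = 'n] by simp
    qed
    then obtain w where w: "\<forall>v\<in>V. b v w = 0" "b w w \<noteq> 0" by blast
    define u where "u = inverse (csqrt (b w w)) *s w"
    have u1: "b u u = 1"
    proof -
      have "csqrt (b w w) * csqrt (b w w) = b w w" by (metis power2_csqrt power2_eq_square)
      then show ?thesis using w(2) unfolding u_def b_scale by (simp add: field_simps)
    qed
    have u0: "b v u = 0" "b u v = 0" if "v \<in> V" for v
      using w(1) that b_sym[of u v] by (simp_all add: u_def b_scale)
    have "u \<notin> V" using u0(1)[of u] u1 by auto
    then show ?case using V u1 u0
      by (intro exI[of _ "insert u V"]) auto
  qed
  from this[of "CARD('n)"] obtain V where V: "finite V" "card V = CARD('n)"
    "\<And>v w. v \<in> V \<Longrightarrow> w \<in> V \<Longrightarrow> b v w = (if v = w then 1 else 0)" by auto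
  then obtain e where e: "bij_betw e (UNIV :: 'n set) V" by (metis finite finite_same_card_bij)
  define L where "L = (\<chi> j i. e i $ j)"
  have "(transpose L ** H ** L) $ i $ m = b (e i) (e m)" for i m
    by (simp add: matrix_matrix_mult_def transpose_def L_def b_def sum_distrib_right) (rule sum.swap)
  moreover have "b (e i) (e m) = (if i = m then 1 else 0)" for i m
    using V(3)[of "e i" "e m"] e by (auto simp: bij_betw_def inj_eq)
  ultimately have "transpose L ** H ** L = mat 1" by (simp add: vec_eq_iff mat_def)
  then show thesis by (rule that)
qed

lemma quadratic_substitution:
  fixes H L :: "complex^3^3"
  assumes "transpose L ** H ** L = mat 1" "\<And>j. \<xi> j = (\<Sum>i\<in>UNIV. fconst (L $ j $ i) * \<eta> i)"
  shows "(\<Sum>j\<in>UNIV. \<Sum>k\<in>UNIV. fconst (H $ j $ k) * (\<xi> j * \<xi> k)) = (\<Sum>i\<in>UNIV. \<eta> i ^ 2)"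
proof -
  note f = ring_morphD[OF ring_morph_fconst] ring_morph_sum[OF ring_morph_fconst]
  have "(\<Sum>j\<in>UNIV. \<Sum>k\<in>UNIV. fconst (H $ j $ k) * (\<xi> j * \<xi> k)) =
    (\<Sum>j\<in>UNIV. \<Sum>k\<in>UNIV. \<Sum>i\<in>UNIV. \<Sum>m\<in>UNIV. fconst (L $ j $ i * H $ j $ k * L $ k $ m) * (\<eta> i * \<eta> m))"
    unfolding assms(2) sum_product unfolding sum_distrib_left by (simp add: f ac_simps)
  also have "\<dots> = (\<Sum>(j,k)\<in>UNIV. \<Sum>(i,m)\<in>UNIV. fconst (L $ j $ i * H $ j $ k * L $ k $ m) * (\<eta> i * \<eta> m))"
    unfolding UNIV_Times_UNIV[symmetric] sum.cartesian_product[symmetric] by simp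
  also have "\<dots> = (\<Sum>(i,m)\<in>UNIV. \<Sum>(j,k)\<in>UNIV. fconst (L $ j $ i * H $ j $ k * L $ k $ m) * (\<eta> i * \<eta> m))"
    unfolding case_prod_unfold by (rule sum.swap)
  also have "\<dots> = (\<Sum>i\<in>UNIV. \<Sum>m\<in>UNIV. fconst ((transpose L ** H ** L) $ i $ m) * (\<eta> i * \<eta> m))"
  proof -
    have "(transpose L ** H ** L) $ i $ m = (\<Sum>j\<in>UNIV. \<Sum>k\<in>UNIV. L $ j $ i * H $ j $ k * L $ k $ m)" for i m
      by (simp add: matrix_matrix_mult_def transpose_def sum_distrib_right) (rule sum.swap)
    then show ?thesis
      unfolding UNIV_Times_UNIV[symmetric] sum.cartesian_product[symmetric] by (simp add: f sum_distrib_right)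
  qed
  also have "\<dots> = (\<Sum>i\<in>UNIV. \<Sum>m\<in>UNIV. if i = m then \<eta> i * \<eta> m else 0)"
    unfolding assms(1) by (intro sum.cong refl) (simp add: mat_def f)
  also have "\<dots> = (\<Sum>i\<in>UNIV. \<eta> i ^ 2)" by (simp add: power2_eq_square)
  finally show ?thesis .
qed

section \<open>The local ring of the ambient space in a chart\<close>

lemma ring_morph_Fract: "ring_morph (\<lambda>f. Fract f 1 :: 'a::idom fract)"
  by (simp add: ring_morph_def One_fract_def)

text \<open>The point is given by the first rows of \<open>A\<close> and \<open>B\<close>; \<eta>
  are formal coordinates equal to the variables up to order 2, and \<open>L\<close> relates them
  linearly to the expansions \<xi> of the affine coordinates. Instances are the variables themselves
  and Morse coordinates.\<close>

locale chart =
  fixes c :: tensor and A A' :: "complex^2^2" and B B' :: "complex^3^3" and \<xi> \<eta> :: "3 \<Rightarrow> fps3" and L M :: "complex^3^3"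
  assumes sym: "tsym c"
    and A: "A ** A' = mat 1" "A' ** A = mat 1" and B: "B ** B' = mat 1" "B' ** B = mat 1"
    and singular: "tact (A, B) c 1 1 1 1 = 0" "tact (A, B) c 1 2 1 1 = 0" "tact (A, B) c 1 1 1 2 = 0" "tact (A, B) c 1 1 1 3 = 0"
    and \<eta>: "\<And>i. \<eta> i - uvar i \<in> jet 2" and L: "L ** M = mat 1" "M ** L = mat 1"
    and \<xi>: "\<And>j. \<xi> j = (\<Sum>i\<in>UNIV. fconst (L $ j $ i) * \<eta> i)"
begin

definition d :: tensor where "d = tact (A, B) c"

text \<open>The linear coordinates dual to the rows of \<open>A\<close>, as \<open>mu\<close> for
  \<open>B\<close>; \<open>lam 1\<close> and \<open>mu 1\<close> do not vanish at the point and
  serve as denominators.\<close>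

definition lam :: "2 \<Rightarrow> coord mpol" where
  "lam a = (\<Sum>i\<in>UNIV. Const (A' $ i $ a) * Var (X i))"

definition mu :: "3 \<Rightarrow> coord mpol" where
  "mu b = (\<Sum>k\<in>UNIV. Const (B' $ k $ b) * Var (Y k))"

text \<open>The expansion of a polynomial at the point in the chart where \<open>lam 1\<close> and
  \<open>mu 1\<close> are 1.\<close>

definition T0 :: "coord mpol \<Rightarrow> fps3" where
  "T0 = peval fconst (case_coord (\<lambda>i. \<Sum>a\<in>UNIV. fconst (A $ a $ i) * chart_x \<xi> a) (\<lambda>k. \<Sum>b\<in>UNIV. fconst (B $ b $ k) * chart_y \<xi> b))"

definition val :: "coord mpol \<Rightarrow> complex" where
  "val g = ev g (A $ 1) (B $ 1)"

sublocale fc: coeff_morph fconst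
  by standard (rule ring_morph_fconst)

lemma f: "fconst 1 = 1" "fconst 0 = 0" "fconst (x + y) = fconst x + fconst y" "fconst (x * y) = fconst x * fconst y"
  "fconst (sum h S) = (\<Sum>a\<in>S. fconst (h a))"
  using ring_morphD[OF ring_morph_fconst] ring_morph_sum[OF ring_morph_fconst] by auto

lemma T0_morph: "ring_morph T0"
  unfolding T0_def by (rule fc.peval_morph)

lemmas T0_simps = ring_morphD[OF T0_morph]

lemma T0_Const: "T0 (Const x) = fconst x"
  by (simp add: T0_def)

lemma mat_entry: "(\<Sum>i\<in>UNIV. P $ a $ i * Q $ i $ b) = (if a = b then 1 else 0)" if "P ** Q = mat 1" for P Q :: "complex^'n^'n"
  using arg_cong[OF that, of "\<lambda>A. A $ a $ b"] by (simp add: matrix_matrix_mult_def mat_def)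

lemma T0_lam: "T0 (lam a) = chart_x \<xi> a"
proof -
  have "T0 (lam a) = (\<Sum>i\<in>UNIV. \<Sum>b\<in>UNIV. fconst (A $ b $ i * A' $ i $ a) * chart_x \<xi> b)"
    by (simp add: lam_def T0_def fc.peval_simps f sum_distrib_left ac_simps)
  also have "\<dots> = (\<Sum>b\<in>UNIV. fconst (\<Sum>i\<in>UNIV. A $ b $ i * A' $ i $ a) * chart_x \<xi> b)"
    by (subst sum.swap) (simp add: f sum_distrib_right)
  also have "\<dots> = (\<Sum>b\<in>UNIV. if b = a then chart_x \<xi> b else 0)"
    unfolding mat_entry[OF A(1)] by (intro sum.cong refl) (simp add: f)
  finally show ?thesis by simp
qed

lemma T0_mu: "T0 (mu a) = chart_y \<xi> a"
proof -
  have "T0 (mu a) = (\<Sum>i\<in>UNIV. \<Sum>b\<in>UNIV. fconst (B $ b $ i * B' $ i $ a) * chart_y \<xi> b)"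
    by (simp add: mu_def T0_def fc.peval_simps f sum_distrib_left ac_simps)
  also have "\<dots> = (\<Sum>b\<in>UNIV. fconst (\<Sum>i\<in>UNIV. B $ b $ i * B' $ i $ a) * chart_y \<xi> b)"
    by (subst sum.swap) (simp add: f sum_distrib_right)
  also have "\<dots> = (\<Sum>b\<in>UNIV. if b = a then chart_y \<xi> b else 0)"
    unfolding mat_entry[OF B(1)] by (intro sum.cong refl) (simp add: f)
  finally show ?thesis by simp
qed

lemma Var_lam: "Var (X i) = (\<Sum>a\<in>UNIV. Const (A $ a $ i) * lam a)"
proof -
  have "(\<Sum>a\<in>UNIV. Const (A $ a $ i) * lam a) = (\<Sum>a\<in>UNIV. \<Sum>j\<in>UNIV. Const (A' $ j $ a * A $ a $ i) * Var (X j))"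
    by (simp add: lam_def Const_simps sum_distrib_left ac_simps)
  also have "\<dots> = (\<Sum>j\<in>UNIV. Const (\<Sum>a\<in>UNIV. A' $ j $ a * A $ a $ i) * Var (X j))"
    by (subst sum.swap) (simp add: Const_simps sum_distrib_right)
  also have "\<dots> = (\<Sum>j\<in>UNIV. if j = i then Var (X j) else 0)"
    unfolding mat_entry[OF A(2)] by (intro sum.cong refl) (simp add: Const_simps)
  finally show ?thesis by simp
qed

lemma Var_mu: "Var (Y i) = (\<Sum>a\<in>UNIV. Const (B $ a $ i) * mu a)"
proof -
  have "(\<Sum>a\<in>UNIV. Const (B $ a $ i) * mu a) = (\<Sum>a\<in>UNIV. \<Sum>j\<in>UNIV. Const (B' $ j $ a * B $ a $ i) * Var (Y j))"
    by (simp add: mu_def Const_simps sum_distrib_left ac_simps)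
  also have "\<dots> = (\<Sum>j\<in>UNIV. Const (\<Sum>a\<in>UNIV. B' $ j $ a * B $ a $ i) * Var (Y j))"
    by (subst sum.swap) (simp add: Const_simps sum_distrib_right)
  also have "\<dots> = (\<Sum>j\<in>UNIV. if j = i then Var (Y j) else 0)"
    unfolding mat_entry[OF B(2)] by (intro sum.cong refl) (simp add: Const_simps)
  finally show ?thesis by simp
qed

lemma lam_bihomogeneous: "bihomogeneous 1 0 (lam a)"
  unfolding lam_def using bihomogeneous_mult[OF bihomogeneous_Const bihomogeneous_VarX] by (intro bihomogeneous_sum) simp

lemma mu_bihomogeneous: "bihomogeneous 0 1 (mu a)"
  unfolding mu_def using bihomogeneous_mult[OF bihomogeneous_Const bihomogeneous_VarY] by (intro bihomogeneous_sum) simp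

lemma \<xi>_jet: "\<xi> j \<in> jet 1"
proof -
  have "\<eta> i \<in> jet 1" for i
  proof -
    have "\<eta> i - uvar i \<in> jet 1" using \<eta> by (rule jet_mono) simp
    from jet_add[OF this uvar_jet[of i]] show ?thesis by simp
  qed
  then show ?thesis unfolding \<xi> by (intro jet_sum jet_mult_left)
qed

lemma ct_morph: "ring_morph (\<lambda>s. cf s 0 0 0)"
  by (simp add: ring_morph_def cf_mult cf_fconst[of 1, unfolded f])

lemma ct_T0: "cf (T0 g) 0 0 0 = val g"
proof -
  have x: "cf (chart_x \<xi> a) 0 0 0 = (if a = 1 then 1 else 0)" and y: "cf (chart_y \<xi> b) 0 0 0 = (if b = 1 then 1 else 0)" for a b
    using \<xi>_jet ring_morphD(1)[OF ct_morph] unfolding jet_1_iff by (auto simp: chart_x_def chart_y_def)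
  have "cf (T0 g) 0 0 0 = peval (\<lambda>c. cf (fconst c) 0 0 0) (\<lambda>v. cf (case_coord (\<lambda>i. \<Sum>a\<in>UNIV. fconst (A $ a $ i) * chart_x \<xi> a) (\<lambda>k. \<Sum>b\<in>UNIV. fconst (B $ b $ k) * chart_y \<xi> b) v) 0 0 0) g"
    unfolding T0_def by (rule morph_peval[OF ct_morph]) (rule fc.coeff_morph_axioms)
  also have "\<dots> = val g"
    unfolding val_def ev_def
  proof (rule peval_cong[THEN trans])
    fix v
    show "cf (case_coord (\<lambda>i. \<Sum>a\<in>UNIV. fconst (A $ a $ i) * chart_x \<xi> a) (\<lambda>k. \<Sum>b\<in>UNIV. fconst (B $ b $ k) * chart_y \<xi> b) v) 0 0 0 = case_coord (($) (A $ 1)) (($) (B $ 1)) v"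
      by (cases v) (simp_all add: cf_sum cf_fconst_mult x y if_distrib[where f = "\<lambda>a. _ * a"] cong: if_cong)
  qed (simp add: cf_fconst)
  finally show ?thesis .
qed

definition good :: "coord mpol \<Rightarrow> coord mpol \<Rightarrow> bool" where
  "good g h \<longleftrightarrow> (\<exists>d e. bihomogeneous d e g \<and> bihomogeneous d e h) \<and> val h \<noteq> 0"

definition C :: "coord mpol fract set" where
  "C = {Fract g h | g h. good g h}"

definition I :: "coord mpol fract set" where
  "I = {Fract g h | g h. good g h \<and> tens c dvd g}"

lemma A_row_nz: "A $ 1 \<noteq> 0" "B $ 1 \<noteq> 0"
proof -
  show "A $ 1 \<noteq> 0" using mat_entry[OF A(1), of 1 1] by auto
  show "B $ 1 \<noteq> 0" using mat_entry[OF B(1), of 1 1] by auto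
qed

lemma nonvanishing_iff:
  assumes "bihomogeneous m n h"
  shows "(\<forall>p\<in>hcoords (fst (pt (A $ 1), pt (B $ 1))). \<forall>q\<in>hcoords (snd (pt (A $ 1), pt (B $ 1))). ev h p q \<noteq> 0) \<longleftrightarrow> val h \<noteq> 0"
proof
  assume "\<forall>p\<in>hcoords (fst (pt (A $ 1), pt (B $ 1))). \<forall>q\<in>hcoords (snd (pt (A $ 1), pt (B $ 1))). ev h p q \<noteq> 0"
  then show "val h \<noteq> 0" using pt_mem[OF A_row_nz(1)] pt_mem[OF A_row_nz(2)] by (simp add: val_def)
next
  assume "val h \<noteq> 0"
  then show "\<forall>p\<in>hcoords (fst (pt (A $ 1), pt (B $ 1))). \<forall>q\<in>hcoords (snd (pt (A $ 1), pt (B $ 1))). ev h p q \<noteq> 0"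
    using A_row_nz by (auto simp: hcoords_pt ev_scale[OF assms] val_def)
qed

lemma ambient_eq: "ambient_local_ring (pt (A $ 1), pt (B $ 1)) = ring_on C"
  unfolding ambient_local_ring_def C_def good_def using nonvanishing_iff by (intro arg_cong[of _ _ ring_on]) blast

lemma local_ideal_eq: "local_ideal (tens c) (pt (A $ 1), pt (B $ 1)) = I"
  unfolding local_ideal_def I_def good_def using nonvanishing_iff by blast

lemma good_nz: "good g h \<Longrightarrow> h \<noteq> 0"
  by (auto simp: good_def val_def ev_simps)

lemma goodI: "bihomogeneous m n g \<Longrightarrow> bihomogeneous m n h \<Longrightarrow> val h \<noteq> 0 \<Longrightarrow> good g h"
  by (auto simp: good_def)

lemma val_simps: "val (g * h) = val g * val h" "val 1 = 1" "val (Const x) = x" "val (g ^ n) = val g ^ n"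
proof -
  show *: "val (g * h) = val g * val h" "val 1 = 1" "val (Const x) = x" for g h by (simp_all add: val_def ev_simps)
  show "val (g ^ n) = val g ^ n" by (induct n) (simp_all add: *)
qed

lemma val_lam: "val (lam 1) = 1" "val (mu 1) = 1"
  using ct_T0[of "lam 1"] ct_T0[of "mu 1"] ring_morphD(1)[OF ct_morph] by (simp_all add: T0_lam T0_mu chart_x_def chart_y_def)

lemma good_add: "good g h \<Longrightarrow> good g' h' \<Longrightarrow> good (g * h' + g' * h) (h * h')"
proof -
  assume "good g h" "good g' h'"
  then obtain m n m' n' where b: "bihomogeneous m n g" "bihomogeneous m n h" "val h \<noteq> 0" "bihomogeneous m' n' g'" "bihomogeneous m' n' h'" "val h' \<noteq> 0"
    unfolding good_def by blast
  have "bihomogeneous (m + m') (n + n') (g * h' + g' * h)"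
    using bihomogeneous_mult[OF b(1) b(5)] bihomogeneous_mult[OF b(4) b(2)] by (intro bihomogeneous_add) (simp_all add: add.commute)
  moreover have "bihomogeneous (m + m') (n + n') (h * h')" by (rule bihomogeneous_mult[OF b(2) b(5)])
  ultimately show ?thesis using b(3,6) by (intro goodI) (simp_all add: val_simps)
qed

lemma good_mult: "good g h \<Longrightarrow> good g' h' \<Longrightarrow> good (g * g') (h * h')"
  unfolding good_def using bihomogeneous_mult by (auto simp: val_simps) metis

lemma good_uminus: "good g h \<Longrightarrow> good (- g) h"
  unfolding good_def using bihomogeneous_uminus by blast

lemma good_Const: "good (Const x) 1"
  by (intro goodI[of 0 0] bihomogeneous_Const bihomogeneous_1) (simp add: val_simps)

lemma I_I: "good g h \<Longrightarrow> tens c dvd g \<Longrightarrow> Fract g h \<in> I"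
  unfolding I_def by blast

lemma C_I: "good g h \<Longrightarrow> Fract g h \<in> C"
  by (auto simp: C_def)

text \<open>A fraction does not determine its numerator and denominator, hence the definite
  description; the series is unique since \<open>T0 h\<close> is a unit whenever \<open>h\<close>
  does not vanish at the point.\<close>

definition T :: "coord mpol fract \<Rightarrow> fps3" where
  "T a = (THE s. \<exists>g h. good g h \<and> a = Fract g h \<and> s * T0 h = T0 g)"

lemma T0_unit:
  assumes "val h \<noteq> 0"
  obtains s where "T0 h * s = 1"
proof -
  have "T0 h \<notin> jet 1" using assms by (simp only: jet_1_iff ct_T0) simp
  then show thesis using that by (rule fps3_unit)
qed

lemma T_eq:
  assumes "good g h"
  shows "T (Fract g h) * T0 h = T0 g"
proof -
  obtain u where u: "T0 h * u = 1" using assms by (auto simp: good_def intro: T0_unit)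
  have "\<exists>g' h'. good g' h' \<and> Fract g h = Fract g' h' \<and> (T0 g * u) * T0 h' = T0 g'"
    using assms u by (intro exI[of _ g] exI[of _ h]) (simp add: ac_simps)
  moreover have "s = T0 g * u" if ex: "\<exists>g' h'. good g' h' \<and> Fract g h = Fract g' h' \<and> s * T0 h' = T0 g'" for s
  proof -
    obtain g' h' where gh: "good g' h'" "Fract g h = Fract g' h'" "s * T0 h' = T0 g'" using ex by blast
    have "g * h' = g' * h" using gh(2) good_nz[OF assms] good_nz[OF gh(1)] by (simp add: eq_fract)
    then have "T0 g * T0 h' = T0 g' * T0 h" by (metis T0_simps(3))
    then have "(T0 g * u) * T0 h' = (T0 h * u) * T0 g'" by (simp add: ac_simps)
    then have e: "(T0 g * u) * T0 h' = s * T0 h'" using u gh(3) by simp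
    obtain u' where "T0 h' * u' = 1" using gh(1) by (auto simp: good_def intro: T0_unit)
    then show ?thesis using arg_cong[OF e, of "\<lambda>x. x * u'"] by (simp add: mult.assoc)
  qed
  ultimately have "T (Fract g h) = T0 g * u" unfolding T_def by (intro the_equality)
  then show ?thesis using u by (simp add: ac_simps)
qed

lemma T_unique:
  assumes "good g h" "s * T0 h = T0 g"
  shows "T (Fract g h) = s"
proof -
  obtain u where u: "T0 h * u = 1" using assms by (auto simp: good_def intro: T0_unit)
  have "T (Fract g h) * T0 h * u = s * T0 h * u" using T_eq[OF assms(1)] assms(2) by simp
  then show ?thesis using u by (simp add: mult.assoc)
qed

definition cst :: "complex \<Rightarrow> coord mpol fract" where
  "cst x = Fract (Const x) 1"

definition loc :: "3 \<Rightarrow> coord mpol fract" where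
  "loc j = (if j = 1 then Fract (lam 2) (lam 1) else Fract (mu j) (mu 1))"

lemma cst_C: "cst x \<in> C"
  unfolding cst_def by (rule C_I[OF good_Const])

lemma T_cst: "T (cst x) = fconst x"
  unfolding cst_def by (rule T_unique[OF good_Const]) (simp add: T0_Const T0_simps)

lemma cst_morph: "ring_morph cst"
  unfolding cst_def using ring_morph_comp[OF ring_morph_Fract ring_morph_Const] by simp

lemma good_loc: "good (lam a) (lam 1)" "good (mu b) (mu 1)"
  by (rule goodI[OF lam_bihomogeneous lam_bihomogeneous], simp add: val_lam)
    (rule goodI[OF mu_bihomogeneous mu_bihomogeneous], simp add: val_lam)

lemma loc_C: "loc j \<in> C"
  using good_loc by (auto simp: loc_def intro: C_I)

lemma T_loc: "T (loc j) = \<xi> j"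
proof (cases "j = 1")
  case True
  have "T (Fract (lam 2) (lam 1)) = \<xi> j"
    by (rule T_unique[OF good_loc(1)]) (simp add: T0_lam chart_x_def True)
  then show ?thesis by (simp add: loc_def True)
next
  case False
  have "T (Fract (mu j) (mu 1)) = \<xi> j"
    by (rule T_unique[OF good_loc(2)]) (simp add: T0_mu chart_y_def False)
  then show ?thesis by (simp add: loc_def False)
qed

lemma C_closed: "0 \<in> C" "1 \<in> C" "a \<in> C \<Longrightarrow> b \<in> C \<Longrightarrow> a + b \<in> C" "a \<in> C \<Longrightarrow> b \<in> C \<Longrightarrow> a * b \<in> C" "a \<in> C \<Longrightarrow> - a \<in> C"
proof -
  show "0 \<in> C" "1 \<in> C" using cst_C[of 0] cst_C[of 1] ring_morphD[OF cst_morph] by simp_all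
  show "a + b \<in> C" if ab: "a \<in> C" "b \<in> C"
  proof -
    obtain g h g' h' where *: "good g h" "a = Fract g h" "good g' h'" "b = Fract g' h'" using ab unfolding C_def by blast
    then show ?thesis using C_I[OF good_add[OF *(1,3)]] good_nz by simp
  qed
  show "a * b \<in> C" if ab: "a \<in> C" "b \<in> C"
  proof -
    obtain g h g' h' where *: "good g h" "a = Fract g h" "good g' h'" "b = Fract g' h'" using ab unfolding C_def by blast
    then show ?thesis using C_I[OF good_mult[OF *(1,3)]] by simp
  qed
  show "- a \<in> C" if a: "a \<in> C"
  proof -
    obtain g h where *: "good g h" "a = Fract g h" using a unfolding C_def by blast
    then show ?thesis using C_I[OF good_uminus[OF *(1)]] by simp
  qed
qed

lemma T_hom: "a \<in> C \<Longrightarrow> b \<in> C \<Longrightarrow> T (a + b) = T a + T b" "a \<in> C \<Longrightarrow> b \<in> C \<Longrightarrow> T (a * b) = T a * T b"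
proof -
  assume ab: "a \<in> C" "b \<in> C"
  obtain g h g' h' where *: "good g h" "a = Fract g h" "good g' h'" "b = Fract g' h'" using ab unfolding C_def by blast
  note e = T_eq[OF *(1)] T_eq[OF *(3)]
  have "a + b = Fract (g * h' + g' * h) (h * h')" using * good_nz by simp
  moreover have "T (Fract (g * h' + g' * h) (h * h')) = T a + T b"
    by (rule T_unique[OF good_add[OF *(1,3)]]) (simp add: T0_simps e[symmetric] * algebra_simps)
  ultimately show "T (a + b) = T a + T b" by simp
  have "a * b = Fract (g * g') (h * h')" using * by simp
  moreover have "T (Fract (g * g') (h * h')) = T a * T b"
    by (rule T_unique[OF good_mult[OF *(1,3)]]) (simp add: T0_simps e[symmetric] * algebra_simps)
  ultimately show "T (a * b) = T a * T b" by simp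
qed

definition F :: fps3 where
  "F = T0 (tens c)"

lemma F_eq: "F = (\<Sum>j\<in>UNIV. \<Sum>k\<in>UNIV. fconst (hess d $ j $ k) * (\<xi> j * \<xi> k)) + cubic d \<xi>"
proof -
  have "F = tform fconst (tact (A, B) c) (chart_x \<xi>) (chart_x \<xi>) (chart_y \<xi>) (chart_y \<xi>)"
    unfolding F_def T0_def fc.peval_tens by (rule fc.tform_basis) simp_all
  also have "\<dots> = (\<Sum>j\<in>UNIV. \<Sum>k\<in>UNIV. fconst (hess d $ j $ k) * (\<xi> j * \<xi> k)) + cubic d \<xi>"
    unfolding d_def by (rule tform_chart[OF tsym_tact[OF sym] singular])
  finally show ?thesis .
qed

lemma F_jet: "F \<in> jet 2"
proof -
  have "\<xi> j * \<xi> k \<in> jet 2" for j k using jet_mult[OF \<xi>_jet[of j] \<xi>_jet[of k]] by (simp add: numeral_2_eq_2)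
  then have "fconst x * (\<xi> j * \<xi> k) \<in> jet 2" for x j k by (rule jet_mult_left)
  moreover have "cubic d \<xi> \<in> jet 2" by (rule jet_mono[OF cubic_jet[OF \<xi>_jet]]) simp
  ultimately show ?thesis unfolding F_eq by (intro jet_add jet_sum)
qed

text \<open>Elements that are a constant plus a combination of the affine coordinates over
  \<open>C\<close> are closed under sums and products, and the dehomogenized variables are of this
  kind.\<close>

lemma affine_expansion:
  "\<exists>x b. (\<forall>j. b j \<in> C) \<and> peval cst (case_coord (\<lambda>i. Fract (Var (X i)) (lam 1)) (\<lambda>k. Fract (Var (Y k)) (mu 1))) g = cst x + (\<Sum>j\<in>UNIV. loc j * b j)"
    (is "\<exists>x b. _ \<and> peval cst ?s g = _")
proof -
  interpret cm: coeff_morph cst by standard (rule cst_morph)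
  note cs = ring_morphD[OF cst_morph]
  define P where "P = (\<lambda>a. \<exists>x b. (\<forall>j. b j \<in> C) \<and> a = cst x + (\<Sum>j\<in>UNIV. loc j * b j))"
  have C_sum: "(\<And>j. b j \<in> C) \<Longrightarrow> (\<Sum>j\<in>UNIV. b j) \<in> C" for b :: "3 \<Rightarrow> coord mpol fract" by (simp add: sum_3 C_closed)
  have P_cst: "P (cst x)" for x unfolding P_def by (intro exI[of _ x] exI[of _ "\<lambda>_. 0"]) (simp add: C_closed)
  have P_loc: "P (loc j)" for j unfolding P_def
    by (intro exI[of _ 0] exI[of _ "\<lambda>i. if i = j then 1 else 0"]) (simp add: C_closed cs if_distrib[where f = "\<lambda>a. _ * a"] cong: if_cong)
  have P_C: "a \<in> C" if "P a" for a using that unfolding P_def by (auto intro!: C_closed C_sum cst_C loc_C)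
  have P_add: "P (a + a')" if "P a" "P a'" for a a'
  proof -
    obtain x b x' b' where *: "\<And>j. b j \<in> C" "a = cst x + (\<Sum>j\<in>UNIV. loc j * b j)" "\<And>j. b' j \<in> C" "a' = cst x' + (\<Sum>j\<in>UNIV. loc j * b' j)"
      using \<open>P a\<close> \<open>P a'\<close> unfolding P_def by blast
    show ?thesis unfolding P_def
      by (intro exI[of _ "x + x'"] exI[of _ "\<lambda>j. b j + b' j"]) (simp add: * C_closed cs distrib_left sum.distrib)
  qed
  have P_mult: "P (a * a')" if "P a" "P a'" for a a'
  proof -
    obtain x b x' b' where *: "\<And>j. b j \<in> C" "a = cst x + (\<Sum>j\<in>UNIV. loc j * b j)" "\<And>j. b' j \<in> C" "a' = cst x' + (\<Sum>j\<in>UNIV. loc j * b' j)"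
      using \<open>P a\<close> \<open>P a'\<close> unfolding P_def by blast
    have "a * a' = cst x * cst x' + (cst x * (\<Sum>j\<in>UNIV. loc j * b' j) + (\<Sum>j\<in>UNIV. loc j * b j) * a')"
      unfolding *(2) by (subst *(4)) (simp add: *(4) algebra_simps)
    also have "\<dots> = cst (x * x') + (\<Sum>j\<in>UNIV. loc j * (cst x * b' j + b j * a'))"
      by (simp add: cs distrib_left sum.distrib sum_distrib_left sum_distrib_right ac_simps)
    finally show ?thesis unfolding P_def
      using *(1,3) P_C[OF \<open>P a'\<close>] cst_C by (intro exI[of _ "x * x'"] exI[of _ "\<lambda>j. cst x * b' j + b j * a'"]) (simp add: C_closed)
  qed
  have nz: "lam 1 \<noteq> 0" "mu 1 \<noteq> 0" using good_nz[OF good_loc(1)] good_nz[OF good_loc(2)] by auto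
  have P_sum2: "P (\<Sum>i\<in>UNIV. h i)" if "\<And>i. P (h i)" for h :: "2 \<Rightarrow> _" unfolding sum_2 by (intro P_add that)
  have P_sum3: "P (\<Sum>i\<in>UNIV. h i)" if "\<And>i. P (h i)" for h :: "3 \<Rightarrow> _" unfolding sum_3 by (intro P_add that)
  have one: "P 1" using P_cst[of 1] by (simp add: cs)
  have Fsum: "Fract (\<Sum>a\<in>S. g a) m = (\<Sum>a\<in>S. Fract (g a) m)" if "m \<noteq> 0" for S :: "'z set" and g and m :: "coord mpol"
  proof -
    have "Fract (a + b) m = Fract a m + Fract b m" for a b using that by (simp add: eq_fract algebra_simps)
    then show ?thesis using that by (induct S rule: infinite_finite_induct) (simp_all add: Zero_fract_def eq_fract del: add_fract)
  qed
  have FC: "Fract (Const x * p) m = cst x * Fract p m" for x p m by (simp add: cst_def)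
  have PX: "P (Fract (lam a) (lam 1))" for a
  proof -
    have "a = 1 \<or> a = 2" using exhaust_2 by blast
    moreover have "Fract (lam 1) (lam 1) = 1" using nz by (simp add: One_fract_def eq_fract)
    ultimately show ?thesis using P_loc[of 1] one by (auto simp: loc_def)
  qed
  have PY: "P (Fract (mu b) (mu 1))" for b
  proof (cases "b = 1")
    case True
    moreover have "Fract (mu 1) (mu 1) = 1" using nz by (simp add: One_fract_def eq_fract)
    ultimately show ?thesis using one by simp
  next
    case False
    then show ?thesis using P_loc[of b] by (simp add: loc_def)
  qed
  have "P (?s v)" for v
  proof (cases v)
    case (X i)
    show ?thesis unfolding X coord.case Var_lam[of i] Fsum[OF nz(1)] FC by (intro P_sum2 P_mult P_cst PX)
  next
    case (Y i)
    show ?thesis unfolding Y coord.case Var_mu[of i] Fsum[OF nz(2)] FC by (intro P_sum3 P_mult P_cst PY)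
  qed
  then have "P (peval cst ?s g)"
    by (induct g rule: mpol_induct) (simp_all add: cm.peval_simps P_cst P_add P_mult)
  then show ?thesis unfolding P_def .
qed

text \<open>Every form is a power product of \<open>lam 1\<close> and \<open>mu 1\<close> times a
  polynomial in affine quotients, to which \<open>affine_expansion\<close> applies.\<close>

lemma dehomogenize:
  assumes "bihomogeneous m n g"
  shows "Fract g 1 = Fract (lam 1 ^ m * mu 1 ^ n) 1 *
    peval cst (case_coord (\<lambda>i. Fract (Var (X i)) (lam 1)) (\<lambda>k. Fract (Var (Y k)) (mu 1))) g"
proof -
  interpret cm: coeff_morph cst by standard (rule cst_morph)
  have nz: "lam 1 \<noteq> 0" "mu 1 \<noteq> 0" using good_nz[OF good_loc(1)] good_nz[OF good_loc(2)] by auto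
  have "Fract g 1 = Fract (peval Const Var g) 1" by (simp add: peval_self)
  also have "\<dots> = peval cst (\<lambda>v. Fract (Var v) 1) g"
    unfolding cst_def by (rule morph_peval[OF ring_morph_Fract]) (rule coeff_morph.intro[OF ring_morph_Const])
  also have "\<dots> = peval cst (case_coord (\<lambda>i. Fract (lam 1) 1 * Fract (Var (X i)) (lam 1)) (\<lambda>k. Fract (mu 1) 1 * Fract (Var (Y k)) (mu 1))) g"
    by (rule peval_cong) (use nz in \<open>simp add: eq_fract split: coord.split\<close>)
  also have "\<dots> = Fract (lam 1) 1 ^ m * Fract (mu 1) 1 ^ n * peval cst (case_coord (\<lambda>i. Fract (Var (X i)) (lam 1)) (\<lambda>k. Fract (Var (Y k)) (mu 1))) g"
    by (rule cm.peval_bihomogeneous[OF assms])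
  also have "Fract (lam 1) 1 ^ m * Fract (mu 1) 1 ^ n = Fract (lam 1 ^ m * mu 1 ^ n) 1"
    using ring_morphD[OF ring_morph_Fract[where 'a = "coord mpol"]] by (simp del: mult_fract)
  finally show ?thesis .
qed

text \<open>Write \<open>a\<close> as a constant plus a combination of the coordinates, all times a
  fraction \<open>v\<close> that does not vanish at the point. As the expansion of \<open>a\<close>
  has no constant term, the constant is 0.\<close>

lemma local_generators:
  assumes "a \<in> C" "T a \<in> jet 1"
  obtains b where "\<And>j. b j \<in> C" "a = (\<Sum>j\<in>UNIV. loc j * b j)"
proof -
  obtain g h where gh: "good g h" "a = Fract g h" using assms(1) unfolding C_def by blast
  then obtain m n where mn: "bihomogeneous m n g" "bihomogeneous m n h" "val h \<noteq> 0" unfolding good_def by blast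
  obtain x b where b: "\<And>j. b j \<in> C" "peval cst (case_coord (\<lambda>i. Fract (Var (X i)) (lam 1)) (\<lambda>k. Fract (Var (Y k)) (mu 1))) g = cst x + (\<Sum>j\<in>UNIV. loc j * b j)"
    using affine_expansion by blast
  define v where "v = Fract (lam 1 ^ m * mu 1 ^ n) h"
  have "bihomogeneous (m * 1 + n * 0) (m * 0 + n * 1) (lam 1 ^ m * mu 1 ^ n)"
    by (intro bihomogeneous_mult bihomogeneous_power lam_bihomogeneous mu_bihomogeneous)
  then have good: "good (lam 1 ^ m * mu 1 ^ n) h" using mn by (intro goodI) auto
  then have vC: "v \<in> C" unfolding v_def by (rule C_I)
  have "a = Fract g 1 * Fract 1 h" using gh(2) by simp
  also have "\<dots> = (cst x + (\<Sum>j\<in>UNIV. loc j * b j)) * v"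
    unfolding dehomogenize[OF mn(1)] b(2) v_def by (simp add: mult.commute[of "Fract _ 1"] mult.assoc)
  finally have a: "a = (cst x + (\<Sum>j\<in>UNIV. loc j * b j)) * v" .
  have S: "(\<Sum>j\<in>UNIV. loc j * b j) \<in> C" by (simp add: sum_3 C_closed loc_C b(1))
  have TS: "T (\<Sum>j\<in>UNIV. loc j * b j) = (\<Sum>j\<in>UNIV. \<xi> j * T (b j))"
    by (simp add: sum_3 T_hom C_closed loc_C b(1) T_loc)
  have "T a = (fconst x + (\<Sum>j\<in>UNIV. \<xi> j * T (b j))) * T v"
    unfolding a by (simp add: T_hom C_closed S vC cst_C T_cst TS)
  moreover have "(\<Sum>j\<in>UNIV. \<xi> j * T (b j)) \<in> jet 1" by (intro jet_sum jet_mult_right \<xi>_jet)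
  ultimately have "0 = x * cf (T v) 0 0 0"
    using assms(2) unfolding jet_1_iff by (simp add: ring_morphD[OF ct_morph] cf_fconst)
  moreover have "cf (T v) 0 0 0 \<noteq> 0"
  proof -
    have "cf (T v) 0 0 0 * cf (T0 h) 0 0 0 = cf (T0 (lam 1 ^ m * mu 1 ^ n)) 0 0 0"
      using arg_cong[OF T_eq[OF good], of "\<lambda>s. cf s 0 0 0"] unfolding v_def ring_morphD(3)[OF ct_morph] .
    then show ?thesis by (auto simp: ct_T0 val_simps val_lam)
  qed
  ultimately have "x = 0" by simp
  then have "a = (\<Sum>j\<in>UNIV. loc j * (b j * v))"
    unfolding a by (simp add: ring_morphD[OF cst_morph] sum_distrib_right mult.assoc)
  then show thesis using that[of "\<lambda>j. b j * v"] b(1) vC C_closed(4) by blast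
qed

text \<open>The parameters whose expansions are \<eta>; unlike \<open>loc\<close> they start with
  the variables, as \<open>expansion\<close> demands of its generators.\<close>

definition wloc :: "3 \<Rightarrow> coord mpol fract" where
  "wloc i = (\<Sum>j\<in>UNIV. cst (M $ i $ j) * loc j)"

lemma loc_wloc: "loc j = (\<Sum>i\<in>UNIV. cst (L $ j $ i) * wloc i)"
proof -
  note cs = ring_morphD[OF cst_morph] ring_morph_sum[OF cst_morph]
  have "(\<Sum>i\<in>UNIV. cst (L $ j $ i) * wloc i) = (\<Sum>i\<in>UNIV. \<Sum>k\<in>UNIV. cst (L $ j $ i * M $ i $ k) * loc k)"
    by (simp add: wloc_def cs sum_distrib_left ac_simps)
  also have "\<dots> = (\<Sum>k\<in>UNIV. cst (\<Sum>i\<in>UNIV. L $ j $ i * M $ i $ k) * loc k)"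
    by (subst sum.swap) (simp add: cs sum_distrib_right)
  also have "\<dots> = (\<Sum>k\<in>UNIV. if k = j then loc k else 0)"
    unfolding mat_entry[OF L(1)] by (intro sum.cong refl) (simp add: cs)
  finally show ?thesis by simp
qed

lemma wloc_C: "wloc i \<in> C"
  by (simp add: wloc_def sum_3 C_closed cst_C loc_C)

lemma T_wloc: "T (wloc i) = \<eta> i"
proof -
  have "T (wloc i) = (\<Sum>j\<in>UNIV. fconst (M $ i $ j) * \<xi> j)"
    by (simp add: wloc_def sum_3 T_hom C_closed cst_C loc_C T_cst T_loc)
  also have "\<dots> = (\<Sum>j\<in>UNIV. \<Sum>k\<in>UNIV. fconst (M $ i $ j * L $ j $ k) * \<eta> k)"
    by (simp add: \<xi> f sum_distrib_left ac_simps)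
  also have "\<dots> = (\<Sum>k\<in>UNIV. fconst (\<Sum>j\<in>UNIV. M $ i $ j * L $ j $ k) * \<eta> k)"
    by (subst sum.swap) (simp add: f sum_distrib_right)
  also have "\<dots> = (\<Sum>k\<in>UNIV. if k = i then \<eta> k else 0)"
    unfolding mat_entry[OF L(2)] by (intro sum.cong refl) (simp add: f)
  finally show ?thesis by simp
qed

text \<open>The equation enters as its dehomogenization, the quotient of \<open>tens c\<close> by
  \<open>lam 1 ^ 2 * mu 1 ^ 2\<close>.\<close>

sublocale ex: expansion C I T cst F "Fract (tens c) (lam 1 ^ 2 * mu 1 ^ 2)" wloc
proof
  have bh_eq: "2 * 1 + 2 * 0 = (2::nat)" "2 * 0 + 2 * 1 = (2::nat)" by simp_all
  have bh: "bihomogeneous 2 2 (tens c)" using tens_forms22 by (simp add: forms22_def)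
  have "bihomogeneous 2 2 (lam 1 ^ 2 * mu 1 ^ 2)"
    using bihomogeneous_mult[OF bihomogeneous_power[OF lam_bihomogeneous, of 2] bihomogeneous_power[OF mu_bihomogeneous, of 2]]
    by (simp only: bh_eq)
  then have good: "good (tens c) (lam 1 ^ 2 * mu 1 ^ 2)"
    using bh by (intro goodI) (auto simp: val_simps val_lam)
  show "Fract (tens c) (lam 1 ^ 2 * mu 1 ^ 2) \<in> I" by (rule I_I[OF good dvd_refl])
  show "T (Fract (tens c) (lam 1 ^ 2 * mu 1 ^ 2)) = F"
    by (rule T_unique[OF good]) (simp add: F_def T0_simps T0_lam T0_mu chart_x_def chart_y_def)
  show "I \<subseteq> C" by (auto simp: I_def C_def)
  have "good 0 1" using good_Const[of 0] by (simp add: Const_simps)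
  then show "0 \<in> I" using I_I[of 0 1] by (simp add: Zero_fract_def)
  show "a + b \<in> I" if ab: "a \<in> I" "b \<in> I" for a b
  proof -
    obtain g h g' h' where *: "good g h" "a = Fract g h" "tens c dvd g" "good g' h'" "b = Fract g' h'" "tens c dvd g'" using ab unfolding I_def by blast
    have ab': "a + b = Fract (g * h' + g' * h) (h * h')" using * good_nz by simp
    show ?thesis unfolding ab' by (rule I_I[OF good_add[OF *(1,4)]]) (intro dvd_add dvd_mult2 *(3,6))
  qed
  show "a * b \<in> I" if ab: "a \<in> C" "b \<in> I" for a b
  proof -
    obtain g h g' h' where *: "good g h" "a = Fract g h" "good g' h'" "b = Fract g' h'" "tens c dvd g'" using ab unfolding I_def C_def by blast
    have ab': "a * b = Fract (g * g') (h * h')" using * by simp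
    show ?thesis unfolding ab' by (rule I_I[OF good_mult[OF *(1,3)]]) (intro dvd_mult *(5))
  qed
  show "\<exists>s. T a = F * s" if aI: "a \<in> I" for a
  proof -
    obtain g h where gh: "good g h" "a = Fract g h" "tens c dvd g" using aI unfolding I_def by blast
    then obtain k where k: "g = tens c * k" by (auto elim: dvdE)
    obtain u where u: "T0 h * u = 1" using gh(1) by (auto simp: good_def intro: T0_unit)
    have "T a = F * (T0 k * u)" unfolding gh(2)
      by (rule T_unique[OF gh(1)]) (use u in \<open>simp add: k F_def T0_simps ac_simps\<close>)
    then show ?thesis by blast
  qed
  show "\<exists>g. (\<forall>i. g i \<in> C) \<and> a = (\<Sum>i\<in>UNIV. wloc i * g i)" if a: "a \<in> C" "T a \<in> jet 1" for a
  proof -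
    obtain b where b: "\<And>j. b j \<in> C" "a = (\<Sum>j\<in>UNIV. loc j * b j)" using local_generators[OF a] by blast
    have "a = (\<Sum>j\<in>UNIV. \<Sum>i\<in>UNIV. wloc i * (cst (L $ j $ i) * b j))"
      unfolding b(2) by (subst loc_wloc) (simp add: sum_distrib_left sum_distrib_right ac_simps)
    also have "\<dots> = (\<Sum>i\<in>UNIV. wloc i * (\<Sum>j\<in>UNIV. cst (L $ j $ i) * b j))"
      by (subst sum.swap) (simp add: sum_distrib_left)
    finally show ?thesis by (intro exI[of _ "\<lambda>i. \<Sum>j\<in>UNIV. cst (L $ j $ i) * b j"]) (simp add: sum_3 C_closed cst_C b(1))
  qed
  show "\<exists>b\<in>C. a * b = 1" if a: "a \<in> C" "T a \<notin> jet 1" for a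
  proof -
    obtain g h where gh: "good g h" "a = Fract g h" using a(1) unfolding C_def by blast
    have "cf (T a) 0 0 0 * cf (T0 h) 0 0 0 = cf (T0 g) 0 0 0"
      using arg_cong[OF T_eq[OF gh(1)], of "\<lambda>s. cf s 0 0 0"] unfolding gh(2) ring_morphD(3)[OF ct_morph] .
    moreover have "cf (T a) 0 0 0 \<noteq> 0" using a(2) unfolding jet_1_iff .
    ultimately have "val g \<noteq> 0" using gh(1) by (auto simp: ct_T0 good_def)
    then have "good h g" using gh(1) by (auto simp: good_def)
    moreover have "a * Fract h g = 1" using good_nz[OF gh(1)] good_nz[OF \<open>good h g\<close>] by (simp add: gh(2) One_fract_def eq_fract mult.commute)
    ultimately show ?thesis using C_I by blast
  qed
  show "T 1 = 1" using T_cst[of 1] by (simp add: ring_morphD[OF cst_morph] f)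
qed (simp_all add: C_closed cst_C T_hom T_cst F_jet wloc_C T_wloc \<eta>)

lemma local_ring_eq: "local_ring (tens c) (pt (A $ 1), pt (B $ 1)) = ring_on C Quot I"
  by (simp add: local_ring_def ambient_eq local_ideal_eq)

lemma local_const_eq: "local_const (tens c) (pt (A $ 1), pt (B $ 1)) x = ex.cl (cst x)"
  by (simp add: local_const_def ambient_eq local_ideal_eq ex.cl_def cst_def)

lemma in_surface: "(pt (A $ 1), pt (B $ 1)) \<in> surface (tens c)"
  using singular(1) A_row_nz by (simp add: surface_tens tact_def)

lemma An_type_iff: "An_type 1 (tens c) (pt (A $ 1), pt (B $ 1)) \<longleftrightarrow>
  (\<exists>h \<in> ring_iso (completion (ring_on C Quot I)) (An_ring 1). \<forall>x. h (completion_map (ring_on C Quot I) (ex.cl (cst x))) = An_const 1 x)"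
  unfolding An_type_def local_ring_eq local_const_eq using in_surface by blast

end

text \<open>The type does not depend on the formal coordinates, so each direction picks its own: the
  affine ones, in which the quadratic part of the equation can be read off, and Morse coordinates,
  in which the equation is the quadric.\<close>

theorem A1_iff_hess:
  assumes sym: "tsym c" and det: "det A \<noteq> 0" "det B \<noteq> 0" and sing: "(pt (A $ 1), pt (B $ 1)) \<in> sing (tens c)"
  shows "An_type 1 (tens c) (pt (A $ 1), pt (B $ 1)) \<longleftrightarrow> det (hess (tact (A, B) c)) \<noteq> 0"
proof -
  obtain A' where A': "A ** A' = mat 1" "A' ** A = mat 1" using det(1) by (auto simp: invertible_det_nz[symmetric] invertible_def)
  obtain B' where B': "B ** B' = mat 1" "B' ** B = mat 1" using det(2) by (auto simp: invertible_det_nz[symmetric] invertible_def)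
  have nz: "A $ 1 \<noteq> 0" "B $ 1 \<noteq> 0"
    using det det_zero_row(1)[of 1 A] det_zero_row(1)[of 1 B] by (auto simp: row_def vec_eq_iff)
  have s: "Phi c p' (A $ 1) (B $ 1) (B $ 1) = 0" "Phi c (A $ 1) (A $ 1) q' (B $ 1) = 0" for p' q'
    using sing sing_tens[OF sym nz] by blast+
  define d where "d = tact (A, B) c"
  have z: "tact (A, B) c 1 1 1 1 = 0" "tact (A, B) c 1 2 1 1 = 0" "tact (A, B) c 1 1 1 2 = 0" "tact (A, B) c 1 1 1 3 = 0"
    using s Phi_swap(1)[OF sym, of "A $ 1" "A $ 2" "B $ 1" "B $ 1"] Phi_swap(2)[OF sym, of "A $ 1" "A $ 1" "B $ 1" "B $ 2"]
      Phi_swap(2)[OF sym, of "A $ 1" "A $ 1" "B $ 1" "B $ 3"] unfolding tact_def fst_conv snd_conv by simp_all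
  show ?thesis
  proof
    assume A1: "An_type 1 (tens c) (pt (A $ 1), pt (B $ 1))"
    have \<xi>: "uvar j = (\<Sum>i\<in>UNIV. fconst (mat 1 $ j $ i) * uvar i)" for j
      using ring_morphD[OF ring_morph_fconst] by (simp add: mat_def if_distrib[where f = fconst] if_distrib[where f = "\<lambda>a. a * _"] cong: if_cong)
    interpret ch: chart c A A' B B' uvar uvar "mat 1" "mat 1"
      by (intro chart.intro sym A' B' z matrix_mul_lid \<xi>) (simp add: jet_def cf_def)
    obtain h where h: "h \<in> ring_iso (completion (ring_on ch.C Quot ch.I)) (An_ring 1)"
      "\<forall>x. h (completion_map (ring_on ch.C Quot ch.I) (ch.ex.cl (ch.cst x))) = An_const 1 x"
      using A1 unfolding ch.An_type_iff by (elim bexE)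
    have nz: "det ch.ex.hess \<noteq> 0" by (rule ch.ex.A1_imp_hess[OF h(1) spec[OF h(2)]])
    have cub: "cf (cubic ch.d uvar) i j k = 0" if "i + j + k < 3" for i j k
      using cubic_jet[of uvar ch.d, OF uvar_jet] that by (simp add: jet_def)
    have cfF: "cf ch.F i j k = (\<Sum>a\<in>UNIV. \<Sum>b\<in>UNIV. hess ch.d $ a $ b * cf (uvar a * uvar b) i j k)"
      if "i + j + k < 3" for i j k
      unfolding ch.F_eq using cub[OF that] by (simp add: cf_sum cf_fconst_mult)
    have "ch.ex.hess = hess ch.d"
      unfolding ch.ex.hess_def by (simp add: cfF sum_3 vec_eq_iff forall_3 cf_uvar_mult cf_uvar hess_def)
    then show "det (hess (tact (A, B) c)) \<noteq> 0" using nz by (simp add: ch.d_def)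
  next
    assume H: "det (hess (tact (A, B) c)) \<noteq> 0"
    have "transpose (hess d) = hess d" by (simp add: vec_eq_iff forall_3 transpose_def hess_def)
    moreover have "det (hess d) \<noteq> 0" using H by (simp add: d_def)
    ultimately obtain L :: "complex^3^3" where L: "transpose L ** hess d ** L = mat 1" by (rule orthonormal_basis_symmetric)
    define M where "M = transpose L ** hess d"
    have LM: "M ** L = mat 1" "L ** M = mat 1" using L matrix_left_right_inverse[of M L] by (simp_all add: M_def)
    \<comment> \<open>The linear change \<open>L\<close> normalizes the quadratic part. The higher
      terms are then functions of \<eta>, and the Morse lemma corrects \<eta> beyond the first
      order.\<close>
    define lift where "lift = (\<lambda>\<eta> :: 3 \<Rightarrow> fps3. \<lambda>j. \<Sum>i\<in>UNIV. fconst (L $ j $ i) * \<eta> i)"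
    have lift1: "lift \<eta> a \<in> jet n" if "\<And>a. \<eta> a \<in> jet n" for \<eta> a n
      unfolding lift_def using that by (intro jet_sum jet_mult_left)
    have lift2: "lift \<eta>' a - lift \<eta> a = lift (\<lambda>a. \<eta>' a - \<eta> a) a" for \<eta> \<eta>' a
      by (simp add: lift_def sum_subtractf[symmetric] right_diff_distrib)
    obtain \<eta> where \<eta>: "\<And>a. \<eta> a - uvar a \<in> jet 2" "(\<Sum>a\<in>UNIV. \<eta> a ^ 2) + cubic d (lift \<eta>) = qform"
    proof (rule formal_morse[of "\<lambda>\<eta>. cubic d (lift \<eta>)"])
      show "cubic d (lift \<eta>) \<in> jet 3" if "\<And>a. \<eta> a \<in> jet 1" for \<eta>
        by (rule cubic_jet[OF lift1[OF that]])
      show "cubic d (lift \<eta>') - cubic d (lift \<eta>) \<in> jet (n + 3)"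
        if "\<And>a. \<eta> a \<in> jet 1" "\<And>a. \<eta>' a \<in> jet 1" "\<And>a. \<eta>' a - \<eta> a \<in> jet (n + 1)" for n \<eta> \<eta>'
      proof (rule cubic_lip[OF lift1[OF that(1)] lift1[OF that(2)]])
        show "lift \<eta>' a - lift \<eta> a \<in> jet (n + 1)" for a unfolding lift2 by (rule lift1[OF that(3)])
      qed
    qed blast
    interpret ch: chart c A A' B B' "lift \<eta>" \<eta> L M
      by (intro chart.intro sym A' B' z \<eta>(1) LM) (simp add: lift_def)
    have "ch.F = qform"
      unfolding ch.F_eq ch.d_def d_def[symmetric]
      using quadratic_substitution[OF L, of "lift \<eta>" \<eta>] \<eta>(2) by (simp add: lift_def)
    then show "An_type 1 (tens c) (pt (A $ 1), pt (B $ 1))"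
      unfolding ch.An_type_iff by (rule ch.ex.qform_imp_A1)
  qed
qed

section \<open>Adapted bases\<close>

lemma row_nonzero: "A $ i \<noteq> 0" if "det A \<noteq> 0" for A :: "complex^'n^'n"
  using that det_zero_row(1)[of i A] by (auto simp: row_def vec_eq_iff)

lemma matrix_inverse:
  fixes A :: "complex^'n^'n"
  assumes "det A \<noteq> 0"
  obtains A' where "A ** A' = mat 1" "A' ** A = mat 1"
  using assms by (auto simp: invertible_det_nz[symmetric] invertible_def)

lemma row_expansion:
  fixes A :: "complex^'n^'n"
  assumes "det A \<noteq> 0"
  obtains x where "v = (\<Sum>k\<in>UNIV. x k *s A $ k)"
proof -
  obtain A' where A': "A' ** A = mat 1" using matrix_inverse[OF assms] by blast
  have "v = (v v* A') v* A" by (simp only: vector_matrix_mult_assoc[symmetric] A' vector_matrix_mult_one)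
  then have "v = (\<Sum>k\<in>UNIV. (v v* A') $ k *s A $ k)" by (rule trans) (rule vector_matrix_mult_rows)
  then show thesis by (rule that[of "\<lambda>k. (v v* A') $ k"])
qed

lemma extend_basis_2:
  fixes v :: "complex^2"
  assumes "v \<noteq> 0"
  obtains A :: "complex^2^2" where "det A \<noteq> 0" "A $ 1 = v"
proof -
  have "v $ 1 \<noteq> 0 \<or> v $ 2 \<noteq> 0" using assms by (auto simp: vec_eq_iff forall_2)
  then show thesis
  proof
    assume "v $ 1 \<noteq> 0"
    then show thesis by (intro that[of "vector [v, vector [0, 1]]"]) (simp_all add: det_2)
  next
    assume "v $ 2 \<noteq> 0"
    then show thesis by (intro that[of "vector [v, vector [1, 0]]"]) (simp_all add: det_2)
  qed
qed

lemma extend_basis_3: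
  fixes v :: "complex^3"
  assumes "v \<noteq> 0"
  obtains B :: "complex^3^3" where "det B \<noteq> 0" "B $ 1 = v"
proof -
  have "v $ 1 \<noteq> 0 \<or> v $ 2 \<noteq> 0 \<or> v $ 3 \<noteq> 0" using assms by (auto simp: vec_eq_iff forall_3)
  then show thesis
  proof (elim disjE)
    assume "v $ 1 \<noteq> 0"
    then show thesis by (intro that[of "vector [v, vector [0, 1, 0], vector [0, 0, 1]]"]) (simp_all add: det_3)
  next
    assume "v $ 2 \<noteq> 0"
    then show thesis by (intro that[of "vector [v, vector [1, 0, 0], vector [0, 0, 1]]"]) (simp_all add: det_3)
  next
    assume "v $ 3 \<noteq> 0"
    then show thesis by (intro that[of "vector [v, vector [1, 0, 0], vector [0, 1, 0]]"]) (simp_all add: det_3)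
  qed
qed

text \<open>The span of the second and third row meets the kernel of \<open>l\<close>. This freedom
  in the second row provides an additional zero coefficient later.\<close>

lemma adapted_basis:
  fixes l :: "complex^3 \<Rightarrow> complex" and q :: "complex^3"
  assumes add: "\<And>u v. l (u + v) = l u + l v" and scale: "\<And>s v. l (s *s v) = s * l v" and q: "q \<noteq> 0"
  obtains B :: "complex^3^3" where "det B \<noteq> 0" "B $ 1 = q" "l (B $ 2) = 0"
proof -
  obtain B :: "complex^3^3" where B: "det B \<noteq> 0" "B $ 1 = q" using extend_basis_3[OF q] by blast
  show thesis
  proof (cases "l (B $ 2) = 0")
    case True
    then show thesis using that B by blast
  next
    case False
    \<comment> \<open>The combination of both rows killed by \<open>l\<close>, followed by the old
      second row; the determinant is multiplied by \<open>l (B $ 2)\<close>.\<close>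
    let ?B = "vector [q, l (B $ 3) *s B $ 2 + (- l (B $ 2)) *s B $ 3, B $ 2] :: complex^3^3"
    have "det ?B = l (B $ 2) * det B" unfolding det_3 by (simp add: B(2)[symmetric] algebra_simps)
    then have d: "det ?B \<noteq> 0" using False B(1) by simp
    have q1: "?B $ 1 = q" by (simp only: vector_3)
    have "l (?B $ 2) = l (B $ 3) * l (B $ 2) + (- l (B $ 2)) * l (B $ 3)" by (simp only: vector_3 add scale)
    then have "l (?B $ 2) = 0" by (simp only: mult_minus_left mult.commute[of "l (B $ 3)"] add.right_inverse)
    then show thesis by (rule that[OF d q1])
  qed
qed

context
  fixes c :: tensor and A :: "complex^2^2" and B :: "complex^3^3"
  assumes c: "tsym c" and det: "det A \<noteq> 0" "det B \<noteq> 0"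
begin

lemma tact_swap:
  "tact (A, B) c 2 1 k l = tact (A, B) c 1 2 k l" "tact (A, B) c i j 2 1 = tact (A, B) c i j 1 2"
  "tact (A, B) c i j 3 1 = tact (A, B) c i j 1 3" "tact (A, B) c i j 3 2 = tact (A, B) c i j 2 3"
  using tsym_tact[OF c, of "(A, B)"] unfolding tsym_def by blast+

lemma sing_iff:
  "(pt (A $ 1), pt (B $ 1)) \<in> sing (tens c) \<longleftrightarrow> tact (A, B) c 1 1 1 1 = 0 \<and> tact (A, B) c 1 2 1 1 = 0 \<and>
     tact (A, B) c 1 1 1 2 = 0 \<and> tact (A, B) c 1 1 1 3 = 0"
proof -
  have "Phi c p' (A $ 1) (B $ 1) (B $ 1) = 0" if *: "tact (A, B) c 1 1 1 1 = 0" "tact (A, B) c 2 1 1 1 = 0" for p'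
  proof -
    obtain x where "p' = (\<Sum>k\<in>UNIV. x k *s A $ k)" by (rule row_expansion[OF det(1)])
    then show ?thesis using * by (simp add: Phi_sum Phi_linear sum_2 tact_def)
  qed
  moreover have "Phi c (A $ 1) (A $ 1) q' (B $ 1) = 0"
    if *: "tact (A, B) c 1 1 1 1 = 0" "tact (A, B) c 1 1 2 1 = 0" "tact (A, B) c 1 1 3 1 = 0" for q'
  proof -
    obtain x where "q' = (\<Sum>k\<in>UNIV. x k *s B $ k)" by (rule row_expansion[OF det(2)])
    then show ?thesis using * by (simp add: Phi_sum Phi_linear sum_3 tact_def)
  qed
  moreover have "(\<forall>p'. Phi c p' (A $ 1) (B $ 1) (B $ 1) = 0) \<and> (\<forall>q'. Phi c (A $ 1) (A $ 1) q' (B $ 1) = 0) \<Longrightarrow>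
    tact (A, B) c 1 1 1 1 = 0 \<and> tact (A, B) c 2 1 1 1 = 0 \<and> tact (A, B) c 1 1 2 1 = 0 \<and> tact (A, B) c 1 1 3 1 = 0"
    by (simp add: tact_def)
  ultimately show ?thesis
    unfolding sing_tens[OF c row_nonzero[OF det(1)] row_nonzero[OF det(2)]] tact_swap[symmetric] by blast
qed

lemma nonfinite_iff:
  "(pt (A $ 1), pt (B $ 1)) \<in> p2_nonfinite (tens c) \<longleftrightarrow> (\<forall>i j. tact (A, B) c i j 1 1 = 0)"
proof -
  have "Phi c p p' (B $ 1) (B $ 1) = 0" if *: "\<forall>i j. tact (A, B) c i j 1 1 = 0" for p p'
  proof -
    obtain x where x: "p = (\<Sum>k\<in>UNIV. x k *s A $ k)" by (rule row_expansion[OF det(1)])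
    obtain y where y: "p' = (\<Sum>k\<in>UNIV. y k *s A $ k)" by (rule row_expansion[OF det(1)])
    show ?thesis unfolding x y using * by (simp add: Phi_sum Phi_linear tact_def)
  qed
  then show ?thesis
    unfolding nonfinite_tens[OF c row_nonzero[OF det(1)] row_nonzero[OF det(2)]] by (auto simp: tact_def)
qed

lemma not_A1_iff:
  assumes "(pt (A $ 1), pt (B $ 1)) \<in> sing (tens c)"
  shows "\<not> An_type 1 (tens c) (pt (A $ 1), pt (B $ 1)) \<longleftrightarrow> det (hess (tact (A, B) c)) = 0"
  using A1_iff_hess[OF c det assms] by blast

lemma not_stable_by_weights:
  fixes x y z :: real and a :: real
  assumes "\<And>i j k l. tact (A, B) c i j k l \<noteq> 0 \<Longrightarrow>
      (if i = 1 then a else - a) + (if j = 1 then a else - a) +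
      (if k = 1 then x else if k = 2 then y else z) + (if l = 1 then x else if l = 2 then y else z) \<le> 0"
    and "x + y + z = 0" "x \<noteq> 0"
  shows "\<not> stable (tens c)"
proof (rule weights_imp_not_stable[OF c])
  show "weights c (A, B) (\<lambda>i. if i = 1 then a else - a) (\<lambda>k. if k = 1 then x else if k = 2 then y else z)"
    unfolding weights_def using assms by (simp add: sum_2 sum_3)
  show "(\<exists>i. (if i = (1::2) then a else - a) \<noteq> 0) \<or> (\<exists>k. (if k = (1::3) then x else if k = 2 then y else z) \<noteq> 0)"
    using assms(3) by (intro disjI2 exI[of _ 1]) simp
qed (use det in simp_all)

end

lemma det_hess: "det (hess d) = d 2 2 1 1 * (d 1 1 2 2 * d 1 1 3 3 - d 1 1 2 3 * d 1 1 2 3)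
    - 4 * d 1 2 1 2 * (d 1 2 1 2 * d 1 1 3 3 - d 1 1 2 3 * d 1 2 1 3)
    + 4 * d 1 2 1 3 * (d 1 2 1 2 * d 1 1 2 3 - d 1 1 2 2 * d 1 2 1 3)"
  by (simp add: det_3 hess_def algebra_simps)

lemma ev_act: "ev (act \<gamma> f) p q = ev f (p v* fst \<gamma>) (q v* snd \<gamma>)"
proof (induct f rule: mpol_induct)
  case (Var v)
  show ?case by (cases v) (simp_all add: act_def ev_simps vector_matrix_mult_def mult.commute)
qed (simp_all add: act_def cst.peval_simps ev_simps)

text \<open>If the conic over the point were the whole plane, the equation would be divisible by the
  linear form vanishing there. Neither factor is a unit, as both vanish at the origin.\<close>

lemma irreducible_imp_fibre_nonzero:
  fixes A :: "complex^2^2"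
  assumes irr: "irreducible (tens c)" and det: "det A \<noteq> 0"
  shows "\<exists>q q'. Phi c (A $ 1) (A $ 1) q q' \<noteq> 0"
proof (rule ccontr)
  assume "\<not> ?thesis"
  then have z: "Phi c (A $ 1) (A $ 1) q q' = 0" for q q' by blast
  obtain A' where A': "A' ** A = mat 1" using matrix_inverse[OF det] by blast
  define d where "d = tact (A, mat 1) c"
  have d0: "d 1 1 k l = 0" for k l by (simp add: d_def tact_def z)
  define g where "g = (\<Sum>k\<in>UNIV. \<Sum>l\<in>UNIV. ((Const (d 1 2 k l) + Const (d 2 1 k l)) * Var (X 1) +
    Const (d 2 2 k l) * Var (X 2)) * (Var (Y k) * Var (Y l)))"
  have eq: "tens d = Var (X 2) * g"
    by (simp add: tens_def g_def sum_2 d0 Const_simps sum_distrib_left sum.distrib algebra_simps)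
  have "tens c = act (A', mat 1) (tens d)" by (simp add: d_def act_tens tact_mult A' tact_one)
  also have "\<dots> = act (A', mat 1) (Var (X 2)) * act (A', mat 1) g" unfolding eq act_def cst.peval_simps ..
  finally have "act (A', mat 1) (Var (X 2)) dvd 1 \<or> act (A', mat 1) g dvd 1" by (rule irreducibleD[OF irr])
  moreover have "\<not> u dvd 1" if u: "ev u 0 0 = 0" for u
  proof
    assume "u dvd 1"
    then obtain v where "1 = u * v" by (auto elim: dvdE)
    from arg_cong[OF this, of "\<lambda>f. ev f 0 0"] show False by (simp add: ev_simps u)
  qed
  moreover have "0 v* C = (0 :: complex^'m)" for C :: "complex^'m^'n" by (simp add: vec_eq_iff vector_matrix_mult_def)
  ultimately show False by (simp add: ev_act ev_simps g_def)
qed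

section \<open>Contracted sections\<close>

lemma gradY_dot:
  assumes "tsym c"
  shows "(\<Sum>j\<in>UNIV. gradY (tens c) p q $ j * q' $ j) = 2 * Phi c p p q' q"
  by (simp add: gradY_def ev_partialY[OF assms] Phi_expand_axis(2)[of c p q' q] sum_distrib_left ac_simps)

text \<open>In \<open>p\<close> this is a nonzero binary quadratic form; its zeros are roots of the
  dehomogenized polynomial and possibly the point at infinity \<open>e 2\<close>.\<close>

lemma finite_zeros:
  assumes c: "tsym c" and nz: "Phi c p p' q q' \<noteq> 0"
  shows "finite {Q. \<exists>p\<in>hcoords Q. Phi c p p q q' = 0}"
proof -
  define e :: "2 \<Rightarrow> complex^2" where "e i = axis i 1" for i
  define P where "P = [:Phi c (e 1) (e 1) q q', 2 * Phi c (e 1) (e 2) q q', Phi c (e 2) (e 2) q q':]"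
  have e: "p = p $ 1 *s e 1 + p $ 2 *s e 2" for p by (simp add: vec_eq_iff forall_2 e_def axis_def)
  have sw: "Phi c (e 2) (e 1) q q' = Phi c (e 1) (e 2) q q'" by (rule Phi_swap(1)[OF c])
  have val: "Phi c (s *s (e 1 + t *s e 2)) (s *s (e 1 + t *s e 2)) q q' = s * s * poly P t" for s t
    by (simp add: Phi_linear sw P_def algebra_simps)
  have "Phi c p p' q q' = Phi c (p $ 1 *s e 1 + p $ 2 *s e 2) (p' $ 1 *s e 1 + p' $ 2 *s e 2) q q'"
    by (simp only: e[symmetric])
  then have "P \<noteq> 0" using nz by (auto simp: P_def Phi_linear sw)
  then have fin: "finite (insert (pt (e 2)) ((\<lambda>t. pt (e 1 + t *s e 2)) ` {t. poly P t = 0}))"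
    by (intro finite.insertI finite_imageI poly_roots_finite)
  have "{Q. \<exists>p\<in>hcoords Q. Phi c p p q q' = 0} \<subseteq> insert (pt (e 2)) ((\<lambda>t. pt (e 1 + t *s e 2)) ` {t. poly P t = 0})"
  proof
    fix Q assume "Q \<in> {Q. \<exists>p\<in>hcoords Q. Phi c p p q q' = 0}"
    then obtain p where p: "p \<in> hcoords Q" "Phi c p p q q' = 0" by blast
    then have pQ: "p \<noteq> 0" "Q = pt p" by (simp_all add: hcoords_iff)
    show "Q \<in> insert (pt (e 2)) ((\<lambda>t. pt (e 1 + t *s e 2)) ` {t. poly P t = 0})"
    proof (cases "p $ 1 = 0")
      case True
      then have "p $ 2 \<noteq> 0" using pQ(1) by (auto simp: vec_eq_iff forall_2)
      moreover have "p = p $ 2 *s e 2" using True by (simp add: vec_eq_iff forall_2 e_def axis_def)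
      ultimately have "Q = pt (e 2)" using pQ(2) pt_scale[of "p $ 2" "e 2"] by metis
      then show ?thesis by simp
    next
      case False
      define t where "t = p $ 2 / p $ 1"
      have pt: "p = p $ 1 *s (e 1 + t *s e 2)"
        using False by (simp add: vec_eq_iff forall_2 e_def axis_def t_def)
      then have "Q = pt (e 1 + t *s e 2)" using pQ(2) pt_scale[OF False, of "e 1 + t *s e 2"] by metis
      moreover have "p $ 1 * p $ 1 * poly P t = 0" using p(2) val[of "p $ 1" t] unfolding pt[symmetric] by simp
      ultimately show ?thesis using False by auto
    qed
  qed
  then show ?thesis using fin by (rule finite_subset)
qed

lemma infinite_line: "infinite (UNIV :: 2 proj set)"
proof
  assume fin: "finite (UNIV :: 2 proj set)"
  have "inj (\<lambda>t. pt (vector [1, t] :: complex^2))"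
  proof (rule injI)
    fix s t :: complex
    have nz: "(vector [1, u] :: complex^2) \<noteq> 0" for u by (simp add: vec_eq_iff forall_2)
    assume "pt (vector [1, s] :: complex^2) = pt (vector [1, t])"
    then have "vector [1, s] \<in> hcoords (pt (vector [1, t] :: complex^2))" using pt_mem[OF nz, of s] by simp
    then obtain x where "vector [1, s] = x *s (vector [1, t] :: complex^2)" by (auto simp: hcoords_pt[OF nz])
    then show "s = t" by (auto simp: vec_eq_iff forall_2)
  qed
  moreover have "finite (range (\<lambda>t. pt (vector [1, t] :: complex^2)))" by (rule finite_subset[OF subset_UNIV fin])
  ultimately have "finite (UNIV :: complex set)" by (metis finite_imageD)
  then show False by (simp add: infinite_UNIV_char_0)
qed

lemma proj_morphism_id: "proj_morphism (id :: 'n::finite proj \<Rightarrow> 'n proj)"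
proof -
  have "homogeneous 1 (Var i :: 'n mpol)" for i
    by (simp add: homogeneous_def Var_def lookup_single when_def)
  then show ?thesis unfolding proj_morphism_def
    by (intro exI[of _ 1] exI[of _ Var]) simp
qed

lemma proj_morphism_const: "proj_morphism (\<lambda>_ :: 'n::finite proj. P :: 'm::finite proj)"
proof -
  obtain q where q: "q \<noteq> 0" "P = pt q" by (rule proj_cases)
  have "homogeneous 0 (Const x :: 'n mpol)" for x
    by (simp add: homogeneous_def Const_def)
  then show ?thesis unfolding proj_morphism_def
    using pt_mem[OF q(1)] q(2) by (intro exI[of _ 0] exI[of _ "\<lambda>i. Const (q $ i)"]) simp
qed

text \<open>Take \<open>B $ 2\<close> on the common tangent line. The derivative of the conics in
  this direction vanishes at all but finitely many points of the projective line, hence identically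
  by \<open>finite_zeros\<close>.\<close>

lemma constant_phi_imp:
  assumes c: "tsym c" and sec: "is_section (tens c) \<sigma>" "(snd \<circ> \<sigma>) ` UNIV = {P\<^sub>2}" and phi: "is_phi (tens c) P\<^sub>2 \<phi>" "\<And>Q. \<phi> Q = L"
  obtains B :: "complex^3^3" where "det B \<noteq> 0" "\<forall>p p'. Phi c p p' (B $ 1) (B $ 1) = 0" "\<forall>p p'. Phi c p p' (B $ 1) (B $ 2) = 0"
proof -
  obtain q where q: "q \<noteq> 0" "P\<^sub>2 = pt q" by (rule proj_cases)
  obtain l where l: "l \<noteq> 0" "L = pt l" by (rule proj_cases)
  define e :: "complex^2" where "e = axis 1 1"
  have e: "e \<noteq> 0" by (simp add: e_def axis_eq_0_iff)
  have surf: "(Q, P\<^sub>2) \<in> surface (tens c)" for Q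
  proof -
    have "fst (\<sigma> Q) = Q" using sec(1) by (auto simp: is_section_def fun_eq_iff)
    moreover have "snd (\<sigma> Q) = P\<^sub>2" using sec(2) by auto
    moreover have "\<sigma> Q \<in> surface (tens c)" using sec(1) by (auto simp: is_section_def)
    ultimately show ?thesis by (metis prod.collapse)
  qed
  then have "(pt e, pt q) \<in> p2_nonfinite (tens c)" by (auto simp: p2_nonfinite_def q(2))
  then have z: "Phi c p p' q q = 0" for p p' unfolding nonfinite_tens[OF c e q(1)] by blast
  define m where "m v = (\<Sum>i\<in>UNIV. l $ i * v $ i)" for v :: "complex^3"
  obtain B :: "complex^3^3" where B: "det B \<noteq> 0" "B $ 1 = q" "m (B $ 2) = 0"
    by (rule adapted_basis[of m q])
       (use q in \<open>auto simp: m_def distrib_left sum.distrib sum_distrib_left ac_simps\<close>)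
  have "Phi c p p' (B $ 2) q = 0" for p p'
  proof (rule ccontr)
    assume "Phi c p p' (B $ 2) q \<noteq> 0"
    from finite_zeros[OF c this] have f1: "finite {Q. \<exists>p\<in>hcoords Q. Phi c p p (B $ 2) q = 0}" .
    have f2: "finite {Q. \<not> tangent_line (tens c) Q P\<^sub>2 L}" using phi by (simp add: is_phi_def)
    have "Q \<in> {Q. \<exists>p\<in>hcoords Q. Phi c p p (B $ 2) q = 0}" if t: "tangent_line (tens c) Q P\<^sub>2 L" for Q
    proof -
      obtain p where p: "p \<noteq> 0" "Q = pt p" by (rule proj_cases)
      have "gradY (tens c) p q \<in> hcoords L"
        using t pt_mem[OF p(1)] pt_mem[OF q(1)] by (simp add: tangent_line_def p(2) q(2))
      then obtain s where "gradY (tens c) p q = s *s l" by (auto simp: l(2) hcoords_pt[OF l(1)])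
      then have "2 * Phi c p p (B $ 2) q = s * m (B $ 2)"
        by (simp add: gradY_dot[OF c, symmetric] m_def sum_distrib_left ac_simps)
      then show ?thesis using B(3) pt_mem[OF p(1)] p(2) by auto
    qed
    then have "(UNIV :: 2 proj set) \<subseteq> {Q. \<exists>p\<in>hcoords Q. Phi c p p (B $ 2) q = 0} \<union> {Q. \<not> tangent_line (tens c) Q P\<^sub>2 L}"
      by blast
    then show False using f1 f2 infinite_line finite_subset by blast
  qed
  then have "Phi c p p' (B $ 1) (B $ 2) = 0" for p p' using Phi_swap(2)[OF c, of p p' q "B $ 2"] by (simp add: B(2))
  then show thesis using that B(1,2) z by blast
qed

text \<open>Along the section the gradient of each conic is a multiple of the covector dual to
  \<open>B $ 3\<close>. By \<open>nz\<close> the multiple is nonzero at all but finitely many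
  points, so this covector is the constant tangent line.\<close>

lemma constant_phi:
  assumes c: "tsym c" and det: "det B \<noteq> 0" and z: "\<And>p p'. Phi c p p' (B $ 1) (B $ 1) = 0" "\<And>p p'. Phi c p p' (B $ 1) (B $ 2) = 0"
    and nz: "Phi c p p' (B $ 1) (B $ 3) \<noteq> 0"
  shows "\<exists>\<sigma> P\<^sub>2 \<phi>. is_section (tens c) \<sigma> \<and> (snd \<circ> \<sigma>) ` UNIV = {P\<^sub>2} \<and> is_phi (tens c) P\<^sub>2 \<phi> \<and> (\<exists>L. \<forall>Q. \<phi> Q = L)"
proof -
  have B1: "B $ 1 \<noteq> 0" by (rule row_nonzero[OF det])
  obtain B' where B': "B ** B' = mat 1" "B' ** B = mat 1" using matrix_inverse[OF det] by blast
  \<comment> \<open>The third column of the inverse: the linear form that is 1 on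
    \<open>B $ 3\<close> and 0 on the other rows.\<close>
  define l where "l = (\<chi> j. B' $ j $ 3)"
  have lB: "(\<Sum>j\<in>UNIV. l $ j * B $ k $ j) = (if k = 3 then 1 else 0)" for k
    using arg_cong[OF B'(1), of "\<lambda>C. C $ k $ 3"] by (simp add: l_def matrix_matrix_mult_def mat_def mult.commute)
  have l: "l \<noteq> 0" using lB[of 3] by auto
  have surf: "(Q, pt (B $ 1)) \<in> surface (tens c)" for Q
    using z(1) B1 by (cases Q rule: proj_cases) (simp add: surface_tens)
  have grad: "gradY (tens c) p (B $ 1) = (2 * Phi c p p (B $ 1) (B $ 3)) *s l" for p
  proof -
    have "Phi c p p (axis j 1) (B $ 1) = l $ j * Phi c p p (B $ 1) (B $ 3)" for j
    proof -
      have "axis j 1 = (\<Sum>k\<in>UNIV. B' $ j $ k *s B $ k)" using matrix_mult_row[of B' B j] by (simp add: B'(2) mat_row)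
      then have "Phi c p p (axis j 1) (B $ 1) = (\<Sum>k\<in>UNIV. B' $ j $ k * Phi c p p (B $ k) (B $ 1))"
        by (simp only: Phi_sum Phi_linear)
      also have "\<dots> = (\<Sum>k\<in>UNIV. B' $ j $ k * Phi c p p (B $ 1) (B $ k))" by (simp only: Phi_swap(2)[OF c, of p p _ "B $ 1"])
      finally show ?thesis by (simp add: sum_3 z l_def)
    qed
    then show ?thesis by (simp add: vec_eq_iff gradY_def ev_partialY[OF c])
  qed
  have tan: "tangent_line (tens c) Q (pt (B $ 1)) (pt l)" if nzQ: "\<forall>p\<in>hcoords Q. Phi c p p (B $ 1) (B $ 3) \<noteq> 0" for Q
  proof -
    have "gradY (tens c) p q \<in> hcoords (pt l)" if pq: "p \<in> hcoords Q" "q \<in> hcoords (pt (B $ 1))" for p q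
    proof -
      obtain s where s: "s \<noteq> 0" "q = s *s B $ 1" using pq(2) by (auto simp: hcoords_pt[OF B1])
      have "gradY (tens c) p q = s *s gradY (tens c) p (B $ 1)"
        by (simp add: vec_eq_iff gradY_def ev_partialY[OF c] s(2) Phi_linear)
      then have "gradY (tens c) p q = (s * (2 * Phi c p p (B $ 1) (B $ 3))) *s l"
        unfolding grad by (simp only: vector_smult_assoc)
      then show ?thesis
        using s(1) nzQ pq(1) unfolding hcoords_pt[OF l]
          by (intro CollectI exI[of _ "s * (2 * Phi c p p (B $ 1) (B $ 3))"] conjI) simp_all
    qed
    then show ?thesis using surf by (simp add: tangent_line_def)
  qed
  have "is_section (tens c) (\<lambda>Q. (Q, pt (B $ 1)))"
    unfolding is_section_def using surf proj_morphism_id proj_morphism_const by (auto simp: comp_def id_def)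
  moreover have "(snd \<circ> (\<lambda>Q :: 2 proj. (Q, pt (B $ 1)))) ` UNIV = {pt (B $ 1)}" by auto
  moreover have "is_phi (tens c) (pt (B $ 1)) (\<lambda>_. pt l)"
    unfolding is_phi_def
  proof (intro conjI)
    show "proj_morphism (\<lambda>_ :: 2 proj. pt l)" by (rule proj_morphism_const)
    have "(\<Sum>i\<in>UNIV. (s *s l) $ i * (t *s B $ 1) $ i) = 0" for s t
    proof -
      have "(\<Sum>i\<in>UNIV. (s *s l) $ i * (t *s B $ 1) $ i) = (s * t) * (\<Sum>i\<in>UNIV. l $ i * B $ 1 $ i)"
        by (simp add: sum_distrib_left ac_simps)
      then show ?thesis by (simp add: lB)
    qed
    then show "range (\<lambda>_ :: 2 proj. pt l) \<subseteq> pencil (pt (B $ 1))"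
      by (auto simp: pencil_def hcoords_pt[OF l] hcoords_pt[OF B1])
    have "{Q. \<not> tangent_line (tens c) Q (pt (B $ 1)) (pt l)} \<subseteq> {Q. \<exists>p\<in>hcoords Q. Phi c p p (B $ 1) (B $ 3) = 0}"
      using tan by blast
    then show "finite {Q. \<not> tangent_line (tens c) Q (pt (B $ 1)) (pt l)}"
      using finite_zeros[OF c nz] by (rule finite_subset)
  qed
  ultimately show ?thesis by blast
qed

section \<open>Non-reduced fibres\<close>

text \<open>Kronecker substitution: three variables become sufficiently spread powers of one.\<close>

lemma peval_zero_imp_zero:
  fixes f :: "3 mpol"
  assumes zero: "\<And>s. peval (\<lambda>c. c) s f = 0"
  shows "f = 0"
proof -
  \<comment> \<open>A base exceeding every exponent, so that \<open>w\<close> reads a monomial as a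
    number with three digits.\<close>
  define N where "N = Suc (\<Sum>m\<in>Poly_Mapping.keys f. \<Sum>v\<in>UNIV. Poly_Mapping.lookup m v)"
  have N0: "N > 0" by (simp add: N_def)
  have N: "Poly_Mapping.lookup m v < N" if "m \<in> Poly_Mapping.keys f" for m v
  proof -
    have "Poly_Mapping.lookup m v \<le> (\<Sum>v\<in>UNIV. Poly_Mapping.lookup m v)" by (rule member_le_sum) auto
    also have "\<dots> \<le> (\<Sum>m\<in>Poly_Mapping.keys f. \<Sum>v\<in>UNIV. Poly_Mapping.lookup m v)"
      by (rule member_le_sum[OF that]) auto
    finally show ?thesis by (simp add: N_def)
  qed
  define w where "w m = Poly_Mapping.lookup m 1 + N * (Poly_Mapping.lookup m 2 + N * Poly_Mapping.lookup m 3)"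
    for m :: "3 \<Rightarrow>\<^sub>0 nat"
  have digit: "a = a' \<and> b = b'" if "a + N * b = a' + N * b'" "a < N" "a' < N" for a a' b b'
  proof -
    have "(a + N * b) mod N = a" "(a + N * b) div N = b" "(a' + N * b') mod N = a'" "(a' + N * b') div N = b'"
      using that(2,3) N0 by simp_all
    then show ?thesis by (metis that(1))
  qed
  have inj: "m = m'" if m: "m \<in> Poly_Mapping.keys f" "m' \<in> Poly_Mapping.keys f" "w m = w m'" for m m'
  proof -
    have 1: "Poly_Mapping.lookup m 1 = Poly_Mapping.lookup m' 1 \<and>
        Poly_Mapping.lookup m 2 + N * Poly_Mapping.lookup m 3 = Poly_Mapping.lookup m' 2 + N * Poly_Mapping.lookup m' 3"
      using m(3) unfolding w_def by (rule digit[OF _ N[OF m(1)] N[OF m(2)]])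
    have 2: "Poly_Mapping.lookup m 2 = Poly_Mapping.lookup m' 2 \<and> Poly_Mapping.lookup m 3 = Poly_Mapping.lookup m' 3"
      by (rule digit[OF conjunct2[OF 1] N[OF m(1)] N[OF m(2)]])
    show ?thesis
    proof (rule poly_mapping_eqI)
      fix v
      show "Poly_Mapping.lookup m v = Poly_Mapping.lookup m' v" using 1 2 exhaust_3[of v] by auto
    qed
  qed
  define P where "P = (\<Sum>m\<in>Poly_Mapping.keys f. monom (Poly_Mapping.lookup f m) (w m))"
  have "poly P t = 0" for t
  proof -
    define s where "s v = t ^ (if v = 1 then 1 else if v = 2 then N else N * N)" for v :: 3
    have s: "s 1 = t" "s 2 = t ^ N" "s 3 = t ^ (N * N)" by (simp_all add: s_def)
    have "mval s m = t ^ w m" for m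
      by (subst mval_superset[of UNIV]) (simp_all add: prod_UNIV_3 s w_def power_add power_mult[symmetric] algebra_simps)
    then have "poly P t = peval (\<lambda>c. c) s f"
      unfolding peval_def mval_def[symmetric] by (simp add: P_def poly_sum poly_monom)
    then show ?thesis using zero by simp
  qed
  then have P0: "P = 0" using poly_all_0_iff_0 by blast
  have "Poly_Mapping.lookup f m = 0" if m: "m \<in> Poly_Mapping.keys f" for m
  proof -
    have "coeff P (w m) = (\<Sum>m'\<in>Poly_Mapping.keys f. if m' = m then Poly_Mapping.lookup f m' else 0)"
      unfolding P_def coeff_sum coeff_monom by (intro sum.cong refl) (use inj m in auto)
    then show ?thesis using P0 m by simp
  qed
  then show ?thesis by (intro poly_mapping_eqI) (metis in_keys_iff lookup_zero)
qed

lemma fibre_form_eval: "peval (\<lambda>c. c) (($) q) (fibre_form f p) = ev f p q"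
proof -
  have "peval (\<lambda>c. c) (($) q) (fibre_form f p) =
      peval (\<lambda>c. peval (\<lambda>c. c) (($) q) (Const c)) (\<lambda>v. peval (\<lambda>c. c) (($) q) (case_coord (\<lambda>i. Const (p $ i)) Var v)) f"
    unfolding fibre_form_def by (rule morph_peval[OF ev.peval_morph coeff_morph.intro[OF ring_morph_Const]])
  also have "\<dots> = peval (\<lambda>c. c) (case_coord (($) p) (($) q)) f"
    unfolding ev.peval_Const by (rule peval_cong) (simp split: coord.split)
  finally show ?thesis by (simp add: ev_def)
qed

text \<open>Let \<open>F\<close> be the equation of the fibre, \<open>b\<close> its bilinear form and \<open>b r r = 1\<close>. Completing the square,
  \<open>F = \<mu>\<^sup>2 - D\<close> with \<open>\<mu> = b r\<close> and \<open>D\<close> constant along \<open>r\<close>. Division by \<open>F\<close>, which is monic in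
  \<open>\<mu>\<close>, leaves a remainder \<open>r\<^sub>1 \<mu> + r\<^sub>0\<close>; if it vanishes where \<open>F\<close> does, that is for \<open>\<mu> = \<plusminus> \<surd> D\<close>, then
  \<open>r\<^sub>0 = r\<^sub>1 D = 0\<close>.\<close>

lemma nonreduced_imp_rank_one:
  assumes c: "tsym c" and nz: "Phi c p p q q' \<noteq> 0" and p: "p \<noteq> 0" and nr: "fibre_nonreduced (tens c) (pt p)"
  obtains r where "\<forall>u v. Phi c p p u v = Phi c p p u r * Phi c p p v r" "Phi c p p r r = 1"
proof -
  define b where "b u v = Phi c p p u v" for u v
  have b_lin: "b (u + v) w = b u w + b v w" "b u (v + w) = b u v + b u w" "b (s *s u) v = s * b u v" "b u (s *s v) = s * b u v" for u v w s
    by (simp_all add: b_def Phi_linear)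
  have b_sym: "b u v = b v u" for u v unfolding b_def by (rule Phi_swap(2)[OF c])
  have pol: "b (u + v) (u + v) = b u u + 2 * b u v + b v v" for u v using b_sym[of v u] by (simp add: b_lin)
  \<comment> \<open>A form vanishing on the diagonal is zero by polarization, against
    \<open>nz\<close>.\<close>
  have "\<exists>r0. b r0 r0 \<noteq> 0"
  proof (rule ccontr)
    assume "\<not> ?thesis"
    then have "b u u = 0" for u by blast
    then have "b q q' = 0" using pol[of q q'] by simp
    then show False using nz by (simp add: b_def)
  qed
  then obtain r0 where r0: "b r0 r0 \<noteq> 0" by blast
  define r where "r = inverse (csqrt (b r0 r0)) *s r0"
  have rr: "b r r = 1"
  proof -
    have "csqrt (b r0 r0) * csqrt (b r0 r0) = b r0 r0" by (metis power2_csqrt power2_eq_square)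
    then show ?thesis using r0 unfolding r_def b_lin by (simp add: field_simps)
  qed
  obtain g n where g: "fibre_form (tens c) p dvd g ^ n" "\<not> fibre_form (tens c) p dvd g"
    using nr pt_mem[OF p] unfolding fibre_nonreduced_def by blast
  define F where "F = fibre_form (tens c) p"
  define E where "E f u = peval (\<lambda>c. c) (($) u) f" for f :: "3 mpol" and u :: "complex^3"
  have E: "E (f + h) u = E f u + E h u" "E (f * h) u = E f u * E h u" "E (Const x) u = x" "E (Var v) u = u $ v"
    "E (f - h) u = E f u - E h u" "E (f ^ k) u = E f u ^ k" "E 0 u = 0" for f h u x v k
    by (simp_all add: E_def ev.peval_simps)
  have EF: "E F u = b u u" for u by (simp add: E_def F_def fibre_form_eval ev_tens b_def)
  define \<mu> where "\<mu> = (\<Sum>k\<in>UNIV. Const (b (axis k 1) r) * Var k)"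
  have E\<mu>: "E \<mu> u = b u r" for u
  proof -
    have "E \<mu> u = (\<Sum>k\<in>UNIV. u $ k * b (axis k 1) r)" by (simp add: \<mu>_def sum_3 E mult.commute)
    also have "\<dots> = b u r" unfolding b_def by (rule Phi_expand_axis(2)[symmetric])
    finally show ?thesis .
  qed
  define D where "D = \<mu> * \<mu> - F"
  have ED: "E D u = b u r * b u r - b u u" for u by (simp add: D_def E E\<mu> EF)
  define stat where "stat h \<longleftrightarrow> (\<forall>u t. E h (u + t *s r) = E h u)" for h
  have shift: "b (u + t *s r) r = b u r + t" "b (u + t *s r) (u + t *s r) = b u u + t * b u r + t * b u r + t * t" for u t
    by (simp_all add: b_lin rr b_sym[of r u] algebra_simps)
  have stat_D: "stat D" by (simp add: stat_def ED shift algebra_simps)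
  have stat_closed: "stat (f + h)" "stat (f * h)" if "stat f" "stat h" for f h using that by (simp_all add: stat_def E)
  have division: "\<exists>h r1 r0. f = F * h + r1 * \<mu> + r0 \<and> stat r1 \<and> stat r0" for f
  proof (induct f rule: mpol_induct)
    case (Const x)
    show ?case by (intro exI[of _ 0] exI[of _ "Const x"]) (simp add: stat_def E)
  next
    case (Var v)
    show ?case
      by (intro exI[of _ 0] exI[of _ "Const (r $ v)"] exI[of _ "Var v - Const (r $ v) * \<mu>"])
         (simp add: stat_def E E\<mu> shift algebra_simps)
  next
    case (add f g)
    then obtain h r1 r0 h' s1 s0 where *: "f = F * h + r1 * \<mu> + r0" "stat r1" "stat r0"
      "g = F * h' + s1 * \<mu> + s0" "stat s1" "stat s0" by blast
    have "f + g = F * (h + h') + (r1 + s1) * \<mu> + (r0 + s0)" by (simp add: *(1,4) algebra_simps)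
    moreover have "stat (r1 + s1)" "stat (r0 + s0)" by (intro stat_closed *)+
    ultimately show ?case by blast
  next
    case (mult f g)
    then obtain h r1 r0 h' s1 s0 where *: "f = F * h + r1 * \<mu> + r0" "stat r1" "stat r0"
      "g = F * h' + s1 * \<mu> + s0" "stat s1" "stat s0" by blast
    have "f * g = F * (h * g + (r1 * \<mu> + r0) * h' + r1 * s1) + (r1 * s0 + r0 * s1) * \<mu> + (r0 * s0 + r1 * s1 * D)"
      by (simp add: *(1,4) D_def algebra_simps)
    moreover have "stat (r1 * s0 + r0 * s1)" "stat (r0 * s0 + r1 * s1 * D)" by (intro stat_closed stat_D *)+
    ultimately show ?case by blast
  qed
  obtain h r1 r2 where d: "g = F * h + r1 * \<mu> + r2" "stat r1" "stat r2" using division[of g] by blast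
  have van: "E g u = 0" if "E F u = 0" for u
  proof -
    obtain k where "g ^ n = F * k" using g(1) unfolding F_def by (auto elim: dvdE)
    then have "E (g ^ n) u = E (F * k) u" by simp
    then show ?thesis using that by (simp add: E)
  qed
  have vanish: "E r2 u = 0 \<and> E r1 u * E D u = 0" for u
  proof -
    define s where "s = csqrt (E D u)"
    have s: "s * s = E D u" unfolding s_def by (metis power2_csqrt power2_eq_square)
    have *: "E r1 u * t + E r2 u = 0" if t: "t * t = E D u" for t
    proof -
      \<comment> \<open>The point on the line through \<open>u\<close> in direction \<open>r\<close>
        at which \<mu> takes the value \<open>t\<close>; since t^2 is the value of \<open>D\<close>,
        the conic vanishes there.\<close>
      define x where "x = u + (t - b u r) *s r"
      have t': "t * t = b u r * b u r - b u u" using t by (simp only: ED)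
      have "E F x = b u u + (t - b u r) * b u r + (t - b u r) * b u r + (t - b u r) * (t - b u r)" unfolding x_def EF shift ..
      also have "\<dots> = t * t - (b u r * b u r - b u u)" by (simp add: algebra_simps)
      also have "\<dots> = 0" using t' by simp
      finally have "E r1 x * E \<mu> x + E r2 x = 0" using van[of x] by (simp add: d(1) E)
      moreover have "E r1 x = E r1 u" "E r2 x = E r2 u" using d(2,3) unfolding stat_def x_def by blast+
      moreover have "E \<mu> x = t" unfolding x_def E\<mu> shift by simp
      ultimately show ?thesis by simp
    qed
    have e: "E r1 u * s + E r2 u = 0" "E r1 u * (- s) + E r2 u = 0" by (rule *, simp add: s)+
    have "2 * E r2 u = (E r1 u * s + E r2 u) + (E r1 u * (- s) + E r2 u)" by simp
    then have "E r2 u = 0" unfolding e by simp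
    moreover from this have "E r1 u * s = 0" using e(1) by simp
    ultimately show ?thesis unfolding s[symmetric] by simp
  qed
  have idz: "f = 0" if "\<And>u. E f u = 0" for f
  proof (rule peval_zero_imp_zero)
    fix s :: "3 \<Rightarrow> complex"
    have "($) (\<chi> v. s v) = s" by (simp add: fun_eq_iff)
    then show "peval (\<lambda>c. c) s f = 0" using that[of "\<chi> v. s v"] unfolding E_def by simp
  qed
  have "r2 = 0" by (rule idz) (use vanish in blast)
  have "r1 * D = 0" by (rule idz) (use vanish in \<open>simp add: E\<close>)
  \<comment> \<open>If both remainders were zero, \<open>F\<close> would divide \<open>g\<close>. As
    the polynomial ring is a domain, \<open>D\<close> is 0 and \<open>F\<close> is the square of
    \<mu>.\<close>
  moreover have "r1 \<noteq> 0" using g(2) d(1) \<open>r2 = 0\<close> by (auto simp: F_def)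
  ultimately have "D = 0" by simp
  then have sq: "b u u = b u r * b u r" for u using ED[of u] by (simp add: E)
  have rank: "b u v = b u r * b v r" for u v
  proof -
    have e: "b (u + v) (u + v) = (b u r + b v r) * (b u r + b v r)" unfolding sq[of "u + v"] by (simp only: b_lin(1))
    have "2 * b u v = b (u + v) (u + v) - b u u - b v v" by (simp add: pol)
    also have "\<dots> = (b u r + b v r) * (b u r + b v r) - b u r * b u r - b v r * b v r" by (simp only: e sq[of u] sq[of v])
    also have "\<dots> = b u r * b v r + b u r * b v r" by (simp add: algebra_simps)
    finally show ?thesis by (simp add: mult_2[symmetric])
  qed
  show thesis
  proof (rule that[of r])
    show "\<forall>u v. Phi c p p u v = Phi c p p u r * Phi c p p v r" using rank unfolding b_def by blast
    show "Phi c p p r r = 1" using rr unfolding b_def .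
  qed
qed

text \<open>The equation of the fibre is a nonzero multiple of the square of the linear form
  \<open>\<mu> 3\<close>, which is therefore nilpotent but nonzero in the coordinate ring.\<close>

lemma double_line_nonreduced:
  fixes A :: "complex^2^2" and B :: "complex^3^3"
  assumes det: "det A \<noteq> 0" "det B \<noteq> 0" and d: "\<And>k l. (k, l) \<noteq> (3, 3) \<Longrightarrow> tact (A, B) c 1 1 k l = 0"
    and nz: "tact (A, B) c 1 1 3 3 \<noteq> 0"
  shows "fibre_nonreduced (tens c) (pt (A $ 1))"
  unfolding fibre_nonreduced_def
proof
  fix p assume "p \<in> hcoords (pt (A $ 1))"
  then obtain s where s: "s \<noteq> 0" "p = s *s A $ 1" by (auto simp: hcoords_pt[OF row_nonzero[OF det(1)]])
  obtain B' where B': "B ** B' = mat 1" "B' ** B = mat 1" using matrix_inverse[OF det(2)] by blast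
  define \<mu> :: "3 \<Rightarrow> 3 mpol" where "\<mu> b = (\<Sum>k\<in>UNIV. Const (B' $ k $ b) * Var k)" for b
  have Var: "Var k = (\<Sum>b\<in>UNIV. Const (B $ b $ k) * \<mu> b)" for k
  proof -
    have "(\<Sum>b\<in>UNIV. Const (B $ b $ k) * \<mu> b) = (\<Sum>b\<in>UNIV. \<Sum>j\<in>UNIV. Const (B' $ j $ b * B $ b $ k) * Var j)"
      by (simp add: \<mu>_def Const_simps sum_distrib_left ac_simps)
    also have "\<dots> = (\<Sum>j\<in>UNIV. Const (\<Sum>b\<in>UNIV. B' $ j $ b * B $ b $ k) * Var j)"
      by (subst sum.swap) (simp add: Const_simps sum_distrib_right)
    also have "\<dots> = (\<Sum>j\<in>UNIV. if j = k then Var j else 0)"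
    proof (rule sum.cong[OF refl])
      fix j
      have "(\<Sum>b\<in>UNIV. B' $ j $ b * B $ b $ k) = (if j = k then 1 else 0)"
        using arg_cong[OF B'(2), of "\<lambda>C. C $ j $ k"] by (simp add: matrix_matrix_mult_def mat_def)
      then show "Const (\<Sum>b\<in>UNIV. B' $ j $ b * B $ b $ k) * Var j = (if j = k then Var j else 0)"
        by (simp add: Const_simps(1-2) ring_morphD[OF ring_morph_Const])
    qed
    finally show ?thesis by simp
  qed
  define \<kappa> where "\<kappa> = tact (A, B) c 1 1 3 3 * (s * s)"
  have \<kappa>: "\<kappa> \<noteq> 0" using nz s(1) by (simp add: \<kappa>_def)
  have F: "fibre_form (tens c) p = Const \<kappa> * (\<mu> 3 * \<mu> 3)"
  proof -
    have "fibre_form (tens c) p = tform Const c (\<lambda>i. Const (p $ i)) (\<lambda>i. Const (p $ i)) Var Var"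
      unfolding fibre_form_def cst.peval_tens by simp
    also have "\<dots> = tform Const (tact (A, B) c) (\<lambda>a. if a = 1 then Const s else 0) (\<lambda>a. if a = 1 then Const s else 0) \<mu> \<mu>"
    proof (rule cst.tform_basis)
      show "Const (p $ j) = (\<Sum>a\<in>UNIV. Const (fst (A, B) $ a $ j) * (if a = 1 then Const s else 0))" for j
        by (simp add: s(2) sum_2 Const_simps mult.commute)
      show "Var k = (\<Sum>b\<in>UNIV. Const (snd (A, B) $ b $ k) * \<mu> b)" for k unfolding snd_conv by (rule Var)
    qed
    also have "\<dots> = Const \<kappa> * (\<mu> 3 * \<mu> 3)"
      by (simp add: tform_def sum_2 sum_3 d Const_simps \<kappa>_def ac_simps)
    finally show ?thesis .
  qed
  have "Const \<kappa> * Const (1 / \<kappa>) = (1 :: 3 mpol)"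
  proof -
    have "Const \<kappa> * Const (1 / \<kappa>) = (Const (\<kappa> * (1 / \<kappa>)) :: 3 mpol)" by (simp only: Const_simps)
    also have "\<kappa> * (1 / \<kappa>) = 1" using \<kappa> by simp
    finally show ?thesis by (simp only: Const_simps)
  qed
  then have "\<mu> 3 ^ 2 = (Const \<kappa> * Const (1 / \<kappa>)) * (\<mu> 3 * \<mu> 3)" by (simp add: power2_eq_square)
  then have "\<mu> 3 ^ 2 = fibre_form (tens c) p * Const (1 / \<kappa>)" unfolding F by (simp only: ac_simps)
  then have "fibre_form (tens c) p dvd \<mu> 3 ^ 2" by (rule dvdI)
  moreover have "\<not> fibre_form (tens c) p dvd \<mu> 3"
  proof
    assume "fibre_form (tens c) p dvd \<mu> 3"
    then obtain h where h: "\<mu> 3 = Const \<kappa> * (\<mu> 3 * \<mu> 3) * h" unfolding F by (elim dvdE)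
    interpret pc: coeff_morph "\<lambda>c. [:c:]" by standard (simp add: ring_morph_def one_pCons)
    \<comment> \<open>Restriction to the multiples of \<open>B $ 3\<close>, on which
      \<open>\<mu> 3\<close> becomes the variable; a comparison of the linear coefficients then
      excludes divisibility.\<close>
    define T where "T = peval (\<lambda>c. [:c:]) (\<lambda>v. [:0, B $ 3 $ v:])"
    have "(\<Sum>k\<in>UNIV. B $ 3 $ k * B' $ k $ 3) = 1"
      using arg_cong[OF B'(1), of "\<lambda>C. C $ 3 $ 3"] by (simp add: matrix_matrix_mult_def mat_def)
    then have T\<mu>: "T (\<mu> 3) = [:0, 1:]" by (simp add: T_def \<mu>_def pc.peval_simps sum_3 ac_simps)
    have T: "T (a * b) = T a * T b" "T (Const x) = [:x:]" for a b x by (simp_all add: T_def pc.peval_simps)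
    have "T (\<mu> 3) = T (Const \<kappa>) * (T (\<mu> 3) * T (\<mu> 3)) * T h" using arg_cong[OF h, of T] by (simp only: T(1))
    then have "[:0, 1:] = [:\<kappa>:] * ([:0, 1:] * [:0, 1:]) * T h" unfolding T\<mu> T(2) .
    from arg_cong[OF this, of "\<lambda>P. coeff P 1"] show False by simp
  qed
  ultimately show "\<exists>g n. fibre_form (tens c) p dvd g ^ n \<and> \<not> fibre_form (tens c) p dvd g" by blast
qed

section \<open>Strictly semi-stable surfaces\<close>

lemma det_permuted_rows:
  fixes B :: "complex^'n^'n"
  assumes "det B \<noteq> 0" "inj \<pi>"
  shows "det (\<chi> k. B $ \<pi> k) \<noteq> 0"
proof -
  have "surj \<pi>" by (rule finite_UNIV_inj_surj[OF _ assms(2)]) simp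
  then have "bij \<pi>" using assms(2) by (simp add: bij_def)
  then have "\<pi> permutes UNIV" by (intro bij_imp_permutes) auto
  then show ?thesis using assms(1) by (simp add: det_permute_rows sign_def)
qed

text \<open>Permuting the rows of the bases sorts the weights. With x \<ge> y \<ge> z and sum zero,
  x = 0 forces y = z = 0, so \<alpha> \<noteq> 0 or x \<noteq> 0 expresses that the weights are
  nontrivial.\<close>

lemma sorted_weights:
  assumes c: "tsym c" and ns: "\<not> stable (tens c)"
  obtains A :: "complex^2^2" and B :: "complex^3^3" and \<alpha> x y z :: real
  where "det A \<noteq> 0" "det B \<noteq> 0" "\<alpha> \<ge> 0" "x \<ge> y" "y \<ge> z" "x + y + z = 0" "\<alpha> \<noteq> 0 \<or> x \<noteq> 0"
    "\<forall>i j k l. tact (A, B) c i j k l \<noteq> 0 \<longrightarrow> (if i = 1 then \<alpha> else - \<alpha>) + (if j = 1 then \<alpha> else - \<alpha>) +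
      (if k = 1 then x else if k = 2 then y else z) + (if l = 1 then x else if l = 2 then y else z) \<le> 0"
proof -
  obtain \<gamma> a b where w: "det (fst \<gamma>) \<noteq> 0" "det (snd \<gamma>) \<noteq> 0" "weights c \<gamma> a b" "(\<exists>i. a i \<noteq> 0) \<or> (\<exists>k. b k \<noteq> 0)"
    using ns unfolding not_stable_iff_weights[OF c] by (elim exE conjE)
  have sums: "(\<Sum>i\<in>UNIV. a i) = 0" "(\<Sum>k\<in>UNIV. b k) = 0"
    and le: "\<And>i j k l. tact \<gamma> c i j k l \<noteq> 0 \<Longrightarrow> a i + a j + b k + b l \<le> 0"
    using w(3) unfolding weights_def by blast+
  have "\<exists>i1 i2 :: 2. i1 \<noteq> i2 \<and> a i1 \<ge> a i2"
  proof (cases "a 1 \<ge> a 2")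
    case True
    then show ?thesis by (intro exI[of _ 1] exI[of _ 2]) simp
  next
    case False
    then show ?thesis by (intro exI[of _ 2] exI[of _ 1]) simp
  qed
  then obtain i1 i2 :: 2 where i: "i1 \<noteq> i2" "a i1 \<ge> a i2" by blast
  have "(b 1 \<ge> b 2 \<and> b 2 \<ge> b 3) \<or> (b 1 \<ge> b 3 \<and> b 3 \<ge> b 2) \<or> (b 2 \<ge> b 1 \<and> b 1 \<ge> b 3) \<or>
    (b 2 \<ge> b 3 \<and> b 3 \<ge> b 1) \<or> (b 3 \<ge> b 1 \<and> b 1 \<ge> b 2) \<or> (b 3 \<ge> b 2 \<and> b 2 \<ge> b 1)" by linarith
  moreover have "(1::3) \<noteq> 2" "(1::3) \<noteq> 3" "(2::3) \<noteq> 3" by simp_all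
  ultimately have "\<exists>k1 k2 k3 :: 3. k1 \<noteq> k2 \<and> k1 \<noteq> k3 \<and> k2 \<noteq> k3 \<and> b k1 \<ge> b k2 \<and> b k2 \<ge> b k3" by metis
  then obtain k1 k2 k3 :: 3 where k: "k1 \<noteq> k2" "k1 \<noteq> k3" "k2 \<noteq> k3" "b k1 \<ge> b k2" "b k2 \<ge> b k3" by blast
  define \<rho> where "\<rho> i = (if i = 1 then i1 else i2)" for i :: 2
  define \<pi> where "\<pi> m = (if m = 1 then k1 else if m = 2 then k2 else k3)" for m :: 3
  have \<rho>: "inj \<rho>"
  proof (rule injI)
    fix m n assume "\<rho> m = \<rho> n"
    then show "m = n" using i(1) exhaust_2[of m] exhaust_2[of n] by (auto simp: \<rho>_def split: if_splits)
  qed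
  have \<pi>: "inj \<pi>"
  proof (rule injI)
    fix m n assume "\<pi> m = \<pi> n"
    then show "m = n" using k(1-3) exhaust_3[of m] exhaust_3[of n] by (auto simp: \<pi>_def split: if_splits)
  qed
  have surj: "surj \<rho>" "surj \<pi>"
    by (rule finite_UNIV_inj_surj[OF _ \<rho>], simp) (rule finite_UNIV_inj_surj[OF _ \<pi>], simp)
  have "(\<Sum>m\<in>UNIV. b (\<pi> m)) = (\<Sum>m\<in>UNIV. b m)" using sum.reindex_bij_betw[of \<pi> UNIV UNIV b] \<pi> surj by (simp add: bij_def)
  then have sb: "b k1 + b k2 + b k3 = 0" using sums by (simp add: sum_3 \<pi>_def)
  have "(\<Sum>m\<in>UNIV. a (\<rho> m)) = (\<Sum>m\<in>UNIV. a m)" using sum.reindex_bij_betw[of \<rho> UNIV UNIV a] \<rho> surj by (simp add: bij_def)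
  then have sa: "a i2 = - a i1" using sums by (simp add: sum_2 \<rho>_def)
  have a\<rho>: "a (\<rho> i) = (if i = 1 then a i1 else - a i1)" for i by (simp add: \<rho>_def sa)
  have b\<pi>: "b (\<pi> m) = (if m = 1 then b k1 else if m = 2 then b k2 else b k3)" for m by (simp add: \<pi>_def)
  show thesis
  proof (rule that[of "\<chi> i. fst \<gamma> $ \<rho> i" "\<chi> m. snd \<gamma> $ \<pi> m" "a i1" "b k2" "b k1" "b k3"])
    show "det (\<chi> i. fst \<gamma> $ \<rho> i) \<noteq> 0" by (rule det_permuted_rows[OF w(1) \<rho>])
    show "det (\<chi> m. snd \<gamma> $ \<pi> m) \<noteq> 0" by (rule det_permuted_rows[OF w(2) \<pi>])
    show "a i1 \<ge> 0" using i(2) sa by simp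
    show "b k1 \<ge> b k2" "b k2 \<ge> b k3" by (rule k)+
    show "b k1 + b k2 + b k3 = 0" by (rule sb)
    show "a i1 \<noteq> 0 \<or> b k1 \<noteq> 0"
    proof (rule ccontr)
      assume z: "\<not> ?thesis"
      have "a i = 0" for i
      proof -
        obtain i' where "i = \<rho> i'" using surjD[OF surj(1)] by blast
        then show ?thesis using z by (simp add: a\<rho>)
      qed
      moreover have "b m = 0" for m
      proof -
        obtain m' where "m = \<pi> m'" using surjD[OF surj(2)] by blast
        moreover have "b k2 = 0" "b k3 = 0" using z k(4,5) sb by linarith+
        ultimately show ?thesis using z by (simp add: b\<pi>)
      qed
      ultimately show False using w(4) by blast
    qed
    show "\<forall>i j k l. tact (\<chi> i. fst \<gamma> $ \<rho> i, \<chi> m. snd \<gamma> $ \<pi> m) c i j k l \<noteq> 0 \<longrightarrow>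
      (if i = 1 then a i1 else - a i1) + (if j = 1 then a i1 else - a i1) +
      (if k = 1 then b k1 else if k = 2 then b k2 else b k3) + (if l = 1 then b k1 else if l = 2 then b k2 else b k3) \<le> 0"
    proof (intro allI impI)
      fix i j k l
      assume "tact (\<chi> i. fst \<gamma> $ \<rho> i, \<chi> m. snd \<gamma> $ \<pi> m) c i j k l \<noteq> 0"
      then have "tact \<gamma> c (\<rho> i) (\<rho> j) (\<pi> k) (\<pi> l) \<noteq> 0" by (simp add: tact_def)
      from le[OF this] show "(if i = 1 then a i1 else - a i1) + (if j = 1 then a i1 else - a i1) +
        (if k = 1 then b k1 else if k = 2 then b k2 else b k3) + (if l = 1 then b k1 else if l = 2 then b k2 else b k3) \<le> 0"
        unfolding a\<rho> b\<pi> .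
    qed
  qed
qed

lemma Phi_rows_zero:
  fixes A :: "complex^2^2" and B :: "complex^3^3"
  assumes det: "det A \<noteq> 0" and z: "\<And>i j. tact (A, B) c i j k l = 0"
  shows "Phi c p p' (B $ k) (B $ l) = 0"
proof -
  obtain x where x: "p = (\<Sum>k\<in>UNIV. x k *s A $ k)" by (rule row_expansion[OF det])
  obtain y where y: "p' = (\<Sum>k\<in>UNIV. y k *s A $ k)" by (rule row_expansion[OF det])
  show ?thesis unfolding x y using z by (simp add: Phi_sum Phi_linear tact_def)
qed

lemma fibre_entry_nonzero:
  fixes A :: "complex^2^2" and B :: "complex^3^3"
  assumes irr: "irreducible (tens c)" and det: "det A \<noteq> 0" "det B \<noteq> 0"
  obtains k l where "tact (A, B) c 1 1 k l \<noteq> 0"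
proof -
  obtain q q' where nz: "Phi c (A $ 1) (A $ 1) q q' \<noteq> 0" using irreducible_imp_fibre_nonzero[OF irr det(1)] by blast
  obtain x where x: "q = (\<Sum>k\<in>UNIV. x k *s B $ k)" by (rule row_expansion[OF det(2)])
  obtain y where y: "q' = (\<Sum>k\<in>UNIV. y k *s B $ k)" by (rule row_expansion[OF det(2)])
  have "\<exists>k l. tact (A, B) c 1 1 k l \<noteq> 0"
  proof (rule ccontr)
    assume "\<not> ?thesis"
    then have "Phi c (A $ 1) (A $ 1) (B $ k) (B $ l) = 0" for k l by (simp add: tact_def)
    then show False using nz unfolding x y by (simp add: Phi_sum Phi_linear)
  qed
  then show thesis using that by blast
qed

lemma not_stable_imp:
  assumes c: "tsym c" and irr: "irreducible (tens c)" and ss: "semistable (tens c)" and ns: "\<not> stable (tens c)"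
  shows "(\<exists>\<sigma> P\<^sub>2 \<phi>. is_section (tens c) \<sigma> \<and> (snd \<circ> \<sigma>) ` UNIV = {P\<^sub>2} \<and>
         is_phi (tens c) P\<^sub>2 \<phi> \<and> (\<exists>L. \<forall>Q. \<phi> Q = L))
    \<or> (\<exists>P \<in> sing (tens c). P \<in> p2_nonfinite (tens c) \<and> \<not> An_type 1 (tens c) P)
    \<or> (\<exists>P \<in> sing (tens c). \<not> An_type 1 (tens c) P \<and> fibre_nonreduced (tens c) (fst P))"
proof -
  obtain A :: "complex^2^2" and B :: "complex^3^3" and \<alpha> x y z :: real
    where det: "det A \<noteq> 0" "det B \<noteq> 0" and ord: "\<alpha> \<ge> 0" "x \<ge> y" "y \<ge> z" "x + y + z = 0" "\<alpha> \<noteq> 0 \<or> x \<noteq> 0"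
    and w: "\<forall>i j k l. tact (A, B) c i j k l \<noteq> 0 \<longrightarrow> (if i = 1 then \<alpha> else - \<alpha>) + (if j = 1 then \<alpha> else - \<alpha>) +
      (if k = 1 then x else if k = 2 then y else z) + (if l = 1 then x else if l = 2 then y else z) \<le> 0"
    by (rule sorted_weights[OF c ns])
  define d where "d = tact (A, B) c"
  note sw = tact_swap[OF c det, folded d_def]
  define a where "a i = (if i = 1 then \<alpha> else - \<alpha>)" for i :: 2
  define b where "b k = (if k = 1 then x else if k = 2 then y else z)" for k :: 3
  have W: "a 1 = \<alpha>" "a 2 = - \<alpha>" "b 1 = x" "b 2 = y" "b 3 = z" by (simp_all add: a_def b_def)
  have V: "d i j k l = 0" if "0 < a i + a j + b k + b l" for i j k l
  proof (rule ccontr)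
    assume "d i j k l \<noteq> 0"
    then have "a i + a j + b k + b l \<le> 0" using w unfolding d_def a_def b_def by blast
    then show False using that by linarith
  qed
  have aa: "- 2 * \<alpha> \<le> a i + a j" for i j using exhaust_2[of i] exhaust_2[of j] ord(1) by (auto simp: W)
  let ?P = "(pt (A $ 1), pt (B $ 1))"
  show ?thesis
  proof (cases "\<alpha> = 0 \<or> z < - 2 * \<alpha>")
    case True
    \<comment> \<open>Since x + y = -z, this is the second alternative; if \<alpha> = 0, it follows
      from z < 0, as the weights are not all zero. It makes the weights of all entries
      \<open>d i j 1 1\<close> and \<open>d i j 1 2\<close> positive.\<close>
    have pos: "2 * \<alpha> < x + y" using True ord by linarith
    have d11: "d i j 1 1 = 0" for i j by (rule V) (unfold W, insert aa[of i j] pos ord(2), linarith)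
    have d12: "d i j 1 2 = 0" for i j by (rule V) (unfold W, insert aa[of i j] pos, linarith)
    \<comment> \<open>Otherwise every conic is singular at the common point, and the weights 2, -1,
      -1 on the plane contradict semi-stability.\<close>
    have "\<exists>i j. d i j 1 3 \<noteq> 0"
    proof (rule ccontr)
      assume "\<not> ?thesis"
      then have "d i j 1 l = 0" for i j l using d11 d12 exhaust_3[of l] by auto
      moreover from this have "d i j k 1 = 0" for i j k using tsym_tact[OF c, of "(A, B)"] unfolding d_def tsym_def by metis
      ultimately have ne: "k \<noteq> 1 \<and> l \<noteq> 1" if "d i j k l \<noteq> 0" for i j k l using that by blast
      have "\<not> semistable (tens c)"
      proof (rule negative_weights_imp_not_semistable[of "(A, B)" "\<lambda>_. 0" "\<lambda>k. if k = 1 then 2 else - 1"])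
        show "(0::real) + 0 + (if k = 1 then 2 else - 1) + (if l = 1 then 2 else - 1) < 0" if "tact (A, B) c i j k l \<noteq> 0" for i j k l
          using ne[of i j k l] that by (simp add: d_def)
      qed (use det in \<open>simp_all add: sum_3\<close>)
      then show False using ss by blast
    qed
    then obtain i j where "Phi c (A $ i) (A $ j) (B $ 1) (B $ 3) \<noteq> 0" by (auto simp: d_def tact_def)
    from constant_phi[OF c det(2) Phi_rows_zero[OF det(1) d11[unfolded d_def]] Phi_rows_zero[OF det(1) d12[unfolded d_def]] this]
    show ?thesis by (rule disjI1)
  next
    case False
    then have fin: "\<alpha> > 0" "z \<ge> - 2 * \<alpha>" using ord(1) by auto
    \<comment> \<open>By irreducibility the conic over the first basis vector is not the whole
      plane; this rules out weights that live on the line factor alone.\<close>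
    obtain k l where kl: "d 1 1 k l \<noteq> 0" unfolding d_def by (rule fibre_entry_nonzero[OF irr det])
    have xz: "x > 0" "z < 0"
    proof -
      have "x \<noteq> 0"
      proof
        assume "x = 0"
        then have "y = 0" "z = 0" using ord by linarith+
        then have "b m = 0" for m using \<open>x = 0\<close> by (simp add: b_def)
        then have "d 1 1 k l = 0" using fin(1) by (intro V) (simp add: W)
        then show False using kl by blast
      qed
      then show "x > 0" "z < 0" using ord by linarith+
    qed
    have d1211: "d 1 2 1 1 = 0" by (rule V) (unfold W, insert xz, linarith)
    have d1212: "d 1 2 1 2 = 0" by (rule V) (unfold W, insert xz ord(4), linarith)
    have d1111: "d 1 1 1 1 = 0" by (rule V) (unfold W, insert xz fin, linarith)
    have d1112: "d 1 1 1 2 = 0" by (rule V) (unfold W, insert xz fin ord(4), linarith)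
    show ?thesis
    proof (cases "x \<le> \<alpha>")
      case True
      \<comment> \<open>Apart from (3, 3) the smallest weight is 2\<alpha> + y + z = 2\<alpha> - x >
        0, so the conic over the point is a double line.\<close>
      have d0: "d 1 1 k l = 0" if "(k, l) \<noteq> (3, 3)" for k l
      proof (rule V)
        have "y + z \<le> b k + b l" using exhaust_3[of k] exhaust_3[of l] that ord(2,3) by (auto simp: W)
        then show "0 < a 1 + a 1 + b k + b l" unfolding W using True fin(1) ord(4) by linarith
      qed
      have d33: "d 1 1 3 3 \<noteq> 0" using kl d0[of k l] by (cases "(k, l) = (3, 3)") auto
      have s: "?P \<in> sing (tens c)" unfolding sing_iff[OF c det, folded d_def] using d1111 d1211 d1112 d0[of 1 3] by simp
      have "det (hess d) = 0" unfolding det_hess using d0[of 2 2] d0[of 2 3] d1212 by simp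
      then have "\<not> An_type 1 (tens c) ?P" unfolding not_A1_iff[OF c det s, folded d_def] .
      moreover have "fibre_nonreduced (tens c) (fst ?P)"
        unfolding fst_conv by (rule double_line_nonreduced[OF det d0[unfolded d_def] d33[unfolded d_def]])
      ultimately show ?thesis using s by blast
    next
      case False
      have d1113: "d 1 1 1 3 = 0" by (rule V) (unfold W, insert xz fin False, linarith)
      have d11: "d i j 1 1 = 0" for i j by (rule V) (unfold W, insert aa[of i j] False, linarith)
      \<comment> \<open>The two weights are x + z = -y and 2\<alpha> + 2y, which cannot both be
        nonpositive. Since \<open>d 2 2 1 1\<close> and \<open>d 1 2 1 2\<close> vanish, the
        determinant is -4 \<open>d 1 1 2 2\<close> times the square of
        \<open>d 1 2 1 3\<close>.\<close>
      have "d 1 2 1 3 = 0 \<or> d 1 1 2 2 = 0"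
      proof (rule ccontr)
        assume "\<not> ?thesis"
        then have "\<not> 0 < a 1 + a 2 + b 1 + b 3" "\<not> 0 < a 1 + a 1 + b 2 + b 2" using V by blast+
        then show False unfolding W using fin(1) ord(4) by linarith
      qed
      then have "det (hess d) = 0" unfolding det_hess using d11[of 2 2] d1212 by auto
      moreover have s: "?P \<in> sing (tens c)" unfolding sing_iff[OF c det, folded d_def] using d1111 d1211 d1112 d1113 by simp
      ultimately have "\<not> An_type 1 (tens c) ?P" unfolding not_A1_iff[OF c det s, folded d_def] by simp
      moreover have "?P \<in> p2_nonfinite (tens c)" unfolding nonfinite_iff[OF c det, folded d_def] using d11 by blast
      ultimately show ?thesis using s by blast
    qed
  qed
qed

lemma constant_phi_imp_not_stable:
  assumes c: "tsym c" and "is_section (tens c) \<sigma>" "(snd \<circ> \<sigma>) ` UNIV = {P\<^sub>2}" "is_phi (tens c) P\<^sub>2 \<phi>" "\<And>Q. \<phi> Q = L"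
  shows "\<not> stable (tens c)"
proof -
  obtain B :: "complex^3^3" where B: "det B \<noteq> 0" "\<forall>p p'. Phi c p p' (B $ 1) (B $ 1) = 0" "\<forall>p p'. Phi c p p' (B $ 1) (B $ 2) = 0"
    by (rule constant_phi_imp[OF assms])
  have det: "det (mat 1 :: complex^2^2) \<noteq> 0" by simp
  have z: "tact (mat 1, B) c i j 1 1 = 0" "tact (mat 1, B) c i j 1 2 = 0" "tact (mat 1, B) c i j 2 1 = 0" for i j
    using B(2,3) tact_swap(2)[OF c det B(1)] by (simp_all add: tact_def)
  \<comment> \<open>With weights 1, 0, -1 on the plane only the index pairs (1, 1), (1, 2) and (2,
    1) have positive weight.\<close>
  show ?thesis
  proof (rule not_stable_by_weights[OF c det B(1), of 0 1 0 "- 1"])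
    fix i j k l
    assume "tact (mat 1, B) c i j k l \<noteq> 0"
    then show "(if i = 1 then 0 else - 0) + (if j = 1 then 0 else - 0) + (if k = 1 then 1 else if k = 2 then 0 else - 1) +
      (if l = 1 then 1 else if l = 2 then 0 else - 1) \<le> (0::real)"
      using exhaust_3[of k] exhaust_3[of l] z[of i j] by auto
  qed simp_all
qed

lemma nonfinite_imp_not_stable:
  assumes c: "tsym c" and P: "P \<in> sing (tens c)" "P \<in> p2_nonfinite (tens c)" "\<not> An_type 1 (tens c) P"
  shows "\<not> stable (tens c)"
proof -
  obtain p where p: "p \<noteq> 0" "fst P = pt p" by (rule proj_cases)
  obtain q where q: "q \<noteq> 0" "snd P = pt q" by (rule proj_cases)
  obtain A :: "complex^2^2" where A: "det A \<noteq> 0" "A $ 1 = p" by (rule extend_basis_2[OF p(1)])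
  \<comment> \<open>The second basis vector is chosen to make \<open>d 1 2 1 2\<close> vanish, which
    reduces the determinant of the quadratic part to one monomial.\<close>
  obtain B :: "complex^3^3" where B: "det B \<noteq> 0" "B $ 1 = q" "Phi c (A $ 1) (A $ 2) q (B $ 2) = 0"
    by (rule adapted_basis[of "Phi c (A $ 1) (A $ 2) q" q]) (simp_all add: Phi_linear q)
  have PP: "P = (pt (A $ 1), pt (B $ 1))" using p(2) q(2) by (simp add: A(2) B(2) prod_eq_iff)
  define d where "d = tact (A, B) c"
  note sw = tact_swap[OF c A(1) B(1), folded d_def]
  have s: "d 1 1 1 1 = 0" "d 1 2 1 1 = 0" "d 1 1 1 2 = 0" "d 1 1 1 3 = 0"
    using P(1) unfolding PP sing_iff[OF c A(1) B(1)] d_def by blast+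
  have f: "d i j 1 1 = 0" for i j using P(2) unfolding PP nonfinite_iff[OF c A(1) B(1)] d_def by blast
  have d1212: "d 1 2 1 2 = 0" using B(2,3) by (simp add: d_def tact_def)
  have "det (hess d) = 0" using P not_A1_iff[OF c A(1) B(1)] unfolding PP d_def by blast
  then have "d 1 2 1 3 = 0 \<or> d 1 1 2 2 = 0" unfolding det_hess using d1212 f[of 2 2] by auto
  then show ?thesis
  proof
    assume e: "d 1 2 1 3 = 0"
    \<comment> \<open>In the plane the index 1 survives only in \<open>d 2 2 1 k\<close> with k > 1,
      of weight -1; the conic \<open>d 1 1 k l\<close> on the indices 2 and 3 has weight 0.\<close>
    show ?thesis
    proof (rule not_stable_by_weights[OF c A(1) B(1), of 1 2 "- 1" "- 1"])
      fix i j k l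
      assume nz: "tact (A, B) c i j k l \<noteq> 0"
      show "(if i = 1 then 1 else - 1) + (if j = 1 then 1 else - 1) + (if k = 1 then 2 else if k = 2 then - 1 else - 1) +
        (if l = 1 then 2 else if l = 2 then - 1 else - 1) \<le> (0::real)"
        using exhaust_2[of i] exhaust_2[of j] exhaust_3[of k] exhaust_3[of l] nz[folded d_def] s f d1212 e
        by (elim disjE) (simp_all add: sw)
    qed simp_all
  next
    assume e: "d 1 1 2 2 = 0"
    \<comment> \<open>Now \<open>d 1 2 1 3\<close> may be nonzero and needs nonpositive weight; the
      weights 2, 0, -2 give weight 0 to it and also to \<open>d 2 2 1 2\<close> and
      \<open>d 1 1 2 3\<close>.\<close>
    show ?thesis
    proof (rule not_stable_by_weights[OF c A(1) B(1), of 1 2 0 "- 2"])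
      fix i j k l
      assume nz: "tact (A, B) c i j k l \<noteq> 0"
      show "(if i = 1 then 1 else - 1) + (if j = 1 then 1 else - 1) + (if k = 1 then 2 else if k = 2 then 0 else - 2) +
        (if l = 1 then 2 else if l = 2 then 0 else - 2) \<le> (0::real)"
        using exhaust_2[of i] exhaust_2[of j] exhaust_3[of k] exhaust_3[of l] nz[folded d_def] s f d1212 e
        by (elim disjE) (simp_all add: sw)
    qed simp_all
  qed
qed

lemma nonreduced_imp_not_stable:
  assumes c: "tsym c" and irr: "irreducible (tens c)" and P: "P \<in> sing (tens c)" "\<not> An_type 1 (tens c) P" "fibre_nonreduced (tens c) (fst P)"
  shows "\<not> stable (tens c)"
proof -
  obtain p where p: "p \<noteq> 0" "fst P = pt p" by (rule proj_cases)
  obtain q where q: "q \<noteq> 0" "snd P = pt q" by (rule proj_cases)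
  obtain A :: "complex^2^2" where A: "det A \<noteq> 0" "A $ 1 = p" by (rule extend_basis_2[OF p(1)])
  obtain u u' where nz: "Phi c p p u u' \<noteq> 0" using irreducible_imp_fibre_nonzero[OF irr A(1)] unfolding A(2) by blast
  obtain r where r: "\<forall>u v. Phi c p p u v = Phi c p p u r * Phi c p p v r" "Phi c p p r r = 1"
    by (rule nonreduced_imp_rank_one[OF c nz p(1) P(3)[unfolded p(2)]])
  define m where "m v = Phi c p p v r" for v
  \<comment> \<open>The conic is the square of \<open>m\<close>, and the singular point lies on the
    line m = 0. With the second basis vector on this line too, \<open>d 1 1 3 3\<close> is the only
    nonzero entry of the conic.\<close>
  obtain B :: "complex^3^3" where B: "det B \<noteq> 0" "B $ 1 = q" "m (B $ 2) = 0"
    by (rule adapted_basis[of m q]) (simp_all add: Phi_linear q m_def)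
  have PP: "P = (pt (A $ 1), pt (B $ 1))" using p(2) q(2) by (simp add: A(2) B(2) prod_eq_iff)
  define d where "d = tact (A, B) c"
  note sw = tact_swap[OF c A(1) B(1), folded d_def]
  have s: "d 1 1 1 1 = 0" "d 1 2 1 1 = 0" "d 1 1 1 2 = 0" "d 1 1 1 3 = 0"
    using P(1) unfolding PP sing_iff[OF c A(1) B(1)] d_def by blast+
  have dm: "d 1 1 k l = m (B $ k) * m (B $ l)" for k l
    unfolding d_def tact_def fst_conv snd_conv A(2) m_def using r(1) by blast
  have "m (B $ 3) \<noteq> 0"
  proof
    assume "m (B $ 3) = 0"
    moreover have "m (B $ 1) = 0" using dm[of 1 1] s(1) by simp
    moreover obtain y where "r = (\<Sum>k\<in>UNIV. y k *s B $ k)" by (rule row_expansion[OF B(1)])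
    then have "m r = (\<Sum>k\<in>UNIV. y k * m (B $ k))" unfolding m_def by (metis (no_types, lifting) Phi_linear(7) Phi_sum(3) sum.cong)
    ultimately have "m r = 0" using B(3) by (simp add: sum_3)
    then show False using r(2) by (simp add: m_def)
  qed
  then have d33: "d 1 1 3 3 \<noteq> 0" unfolding dm by simp
  have d2: "d 1 1 2 2 = 0" "d 1 1 2 3 = 0" unfolding dm using B(3) by simp_all
  have "det (hess d) = 0" using P not_A1_iff[OF c A(1) B(1)] unfolding PP d_def by blast
  \<comment> \<open>Here the determinant is -4 \<open>d 1 1 3 3\<close> times the square of
    \<open>d 1 2 1 2\<close>.\<close>
  then have d1212: "d 1 2 1 2 = 0" unfolding det_hess using d2 d33 by simp
  \<comment> \<open>The weights 1, -1 and 1, 0, -1 give weight 0 to \<open>d 1 1 3 3\<close>,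
    \<open>d 1 2 1 3\<close>, \<open>d 1 2 2 2\<close> and \<open>d 2 2 1 1\<close>, and negative
    weight to the other surviving entries.\<close>
  show ?thesis
  proof (rule not_stable_by_weights[OF c A(1) B(1), of 1 1 0 "- 1"])
    fix i j k l
    assume nz: "tact (A, B) c i j k l \<noteq> 0"
    show "(if i = 1 then 1 else - 1) + (if j = 1 then 1 else - 1) + (if k = 1 then 1 else if k = 2 then 0 else - 1) +
      (if l = 1 then 1 else if l = 2 then 0 else - 1) \<le> (0::real)"
      using exhaust_2[of i] exhaust_2[of j] exhaust_3[of k] exhaust_3[of l] nz[folded d_def] s d2 d1212
      by (elim disjE) (simp_all add: sw)
  qed simp_all
qed

theorem theorem5p1:
  fixes f :: "coord mpol"
  assumes "f \<in> forms22" and "f \<noteq> 0" and "irreducible f" and "semistable f"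
  shows "strictly_semistable f \<longleftrightarrow>
      (\<exists>\<sigma> P\<^sub>2 \<phi>. is_section f \<sigma> \<and> (snd \<circ> \<sigma>) ` UNIV = {P\<^sub>2} \<and>
         is_phi f P\<^sub>2 \<phi> \<and> (\<exists>L. \<forall>Q. \<phi> Q = L))
    \<or> (\<exists>P \<in> sing f. P \<in> p2_nonfinite f \<and> \<not> An_type 1 f P)
    \<or> (\<exists>P \<in> sing f. \<not> An_type 1 f P \<and> fibre_nonreduced f (fst P))"
    (is "_ \<longleftrightarrow> ?I \<or> ?II \<or> ?III")
proof -
  obtain c where c: "tsym c" "f = tens c" by (rule forms22_tens[OF assms(1)])
  have "\<not> stable f \<longleftrightarrow> ?I \<or> ?II \<or> ?III"
  proof
    show "\<not> stable f \<Longrightarrow> ?I \<or> ?II \<or> ?III"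
      using not_stable_imp[OF c(1)] assms(3,4) unfolding c(2) by blast
    assume "?I \<or> ?II \<or> ?III"
    then show "\<not> stable f"
    proof (elim disjE)
      assume ?I
      then show ?thesis using constant_phi_imp_not_stable[OF c(1)] unfolding c(2) by blast
    next
      assume ?II
      then show ?thesis using nonfinite_imp_not_stable[OF c(1)] unfolding c(2) by blast
    next
      assume ?III
      then show ?thesis using nonreduced_imp_not_stable[OF c(1)] assms(3) unfolding c(2) by blast
    qed
  qed
  then show ?thesis using assms(4) by (simp add: strictly_semistable_def)
qed

end
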